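(* Let $1\le p\le\infty$ and $1/p+1/p'=1$. Suppose $(\Omega_i,\mu_i)_{i\in I}$ is a collection of measure spaces. Then the $p$-multinormed space $\big(\sum_{i\in I}\max_p(L^{p'}(\mu_i))\big)_\infty$ is $1$-injective.
   Context: All spaces are over the real field; $\mathbb{N}=\{1,2,\dots\}$. For $1\le p\le\infty$, a $p$-multinormed space is a Banach space $X$ together with, for each $n\in\mathbb{N}$, a norm $\|\cdot\|_n$ (written $\|\cdot\|$) on $\ell^p_n\otimes X$ such that: (1) $\|a\otimes x\|_n=\|a\|\,\|x\|$ for $a\in\ell^p_n$, $x\in X$; (2) $\|w\|_n\ge|\langle a^*\otimes x^*,w\rangle|$ for all $w\in\ell^p_n\otimes X$ and all $a^*\in(\ell^p_n)^*$, $x^*\in X^*$ of norm at most $1$; (3) $\|(T\otimes I_X)w\|_m\le\|T\|\,\|w\|_n$ for all $m,n$, all $T\in B(\ell^p_n,\ell^p_m)$ and all $w\in\ell^p_n\otimes X$. (This is equivalent to giving a left tensorial cross-norm on $\ell^p\otimes X$, or on $c_0\otimes X$ if $p=\infty$.) For a linear map $u:X\to Y$ between $p$-multinormed spaces, $\|u\|_p=\sup_n\|I_{\ell^p_n}\otimes u:\ell^p_n\otimes X\to\ell^p_n\otimes Y\|$; $u$ is $p$-multibounded if $\|u\|_p<\infty$. A subspace $X$ of a $p$-multinormed space $Y$ is a closed linear subspace, where $\ell^p_n\otimes X$ carries the norm inherited from $\ell^p_n\otimes Y$. For a Banach space $E$, $\max_p(E)$ is the $p$-multinormed space in which $\ell^p_n\otimes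 E$ carries the Banach space projective tensor norm. The $\ell^\infty$ sum $(\sum_{i}X_i)_\infty$ of $p$-multinormed spaces has the Banach space $\ell^\infty$ sum as its underlying Banach space; an element of its tensor product with $\ell^p_n$ is written as a family $x=(x_i)_{i\in I}$ with $x_i\in\ell^p_n\otimes X_i$, and $\|x\|_n=\sup_i\|x_i\|_{\ell^p_n\otimes X_i}$. A $p$-multinormed space $Z$ is $c$-injective if for any $p$-multinormed spaces $X\subset Y$ ($X$ a subspace of $Y$), every $p$-multibounded $u:X\to Z$ has an extension $\tilde u:Y\to Z$ (that is, $\tilde u|_X=u$) with $\|\tilde u\|_p\le c\|u\|_p$.
   Formalization: For p = 1 (so p' = ∞) each measure is also assumed to have essential suprema of arbitrary families of measurable sets, i.e. L^∞(μ_i) is Dedekind complete; without this the claim fails, e.g. for counting measure on the countable-cocountable σ-algebra of an uncountable set. *)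

theory Defs
  imports "HOL-Analysis.Analysis" "HOL-Algebra.Module" "HOL-Algebra.Algebraic_Closure_Type"
begin

text \<open>
  The spaces \<open>L\<^sup>q(\<mu>)\<close> depend on a measure and the summands of a direct sum vary with the index,
  so they are not types. Banach spaces are therefore modelled with explicit carriers, as normed
  modules over the ring of real numbers. The fields \<open>mult\<close> and \<open>one\<close> that
  \<^typ>\<open>('a, 'b) module\<close> inherits from rings play no role and are left undefined.
\<close>

section \<open>Normed and Banach spaces with explicit carriers\<close>

abbreviation real_ring :: "real ring" where
  "real_ring \<equiv> ring_of_type_algebra"

record 'a nspace = "(real, 'a) module" +
  nrm :: "'a \<Rightarrow> real"

locale normed_space = module real_ring E for E :: "('a, 'm) nspace_scheme" (structure) +
  assumes nrm_nonneg: "x \<in> carrier E \<Longrightarrow> 0 \<le> nrm E x"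
    and nrm_eq_0: "x \<in> carrier E \<Longrightarrow> nrm E x = 0 \<longleftrightarrow> x = \<zero>"
    and nrm_smult: "x \<in> carrier E \<Longrightarrow> nrm E (c \<odot> x) = \<bar>c\<bar> * nrm E x"
    and nrm_triangle: "x \<in> carrier E \<Longrightarrow> y \<in> carrier E \<Longrightarrow> nrm E (x \<oplus> y) \<le> nrm E x + nrm E y"

text \<open>The value off the carrier is irrelevant; it is set to 0 because the locale
  \<^locale>\<open>Metric_space\<close> requires nonnegativity and symmetry on the whole type.\<close>

definition ndist :: "('a, 'm) nspace_scheme \<Rightarrow> 'a \<Rightarrow> 'a \<Rightarrow> real" where
  "ndist E x y = (if x \<in> carrier E \<and> y \<in> carrier E then nrm E (x \<ominus>\<^bsub>E\<^esub> y) else 0)"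

locale banach_space = normed_space +
  assumes complete: "Metric_space.mcomplete (carrier E) (ndist E)"

definition closed_subspace :: "'a set \<Rightarrow> ('a, 'm) nspace_scheme \<Rightarrow> bool" where
  "closed_subspace S Y \<longleftrightarrow>
     submodule S real_ring Y \<and> closedin (Metric_space.mtopology (carrier Y) (ndist Y)) S"

definition linear_map ::
    "('a, 'm) nspace_scheme \<Rightarrow> ('b, 'k) nspace_scheme \<Rightarrow> ('a \<Rightarrow> 'b) \<Rightarrow> bool" where
  "linear_map E Y u \<longleftrightarrow>
     u \<in> carrier E \<rightarrow> carrier Y \<and>
     (\<forall>x\<in>carrier E. \<forall>y\<in>carrier E. u (x \<oplus>\<^bsub>E\<^esub> y) = u x \<oplus>\<^bsub>Y\<^esub> u y) \<and>
     (\<forall>c. \<forall>x\<in>carrier E. u (c \<odot>\<^bsub>E\<^esub> x) = c \<odot>\<^bsub>Y\<^esub> u x)"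

definition op_norm ::
    "('a, 'm) nspace_scheme \<Rightarrow> ('b, 'k) nspace_scheme \<Rightarrow> ('a \<Rightarrow> 'b) \<Rightarrow> ennreal" where
  "op_norm E Y u = (SUP x\<in>{x \<in> carrier E. nrm E x \<le> 1}. ennreal (nrm Y (u x)))"

definition bounded_ops ::
    "('a, 'm) nspace_scheme \<Rightarrow> ('b, 'k) nspace_scheme \<Rightarrow> ('a \<Rightarrow> 'b) set" where
  "bounded_ops E Y = {u. linear_map E Y u \<and> op_norm E Y u < \<infinity>}"

definition real_line :: "real nspace" where
  "real_line = \<lparr>carrier = UNIV, mult = undefined, one = undefined, zero = 0, add = (+),
     smult = (*), nrm = abs\<rparr>"

definition dual_ball :: "('a, 'm) nspace_scheme \<Rightarrow> ('a \<Rightarrow> real) set" where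
  "dual_ball E = {f \<in> bounded_ops E real_line. op_norm E real_line f \<le> 1}"

section \<open>Tensor products with \<open>\<ell>\<^sup>p\<^sub>n\<close>\<close>

definition lp :: "ennreal \<Rightarrow> nat \<Rightarrow> (nat \<Rightarrow> real) nspace" where
  "lp p n = \<lparr>carrier = {..<n} \<rightarrow>\<^sub>E UNIV, mult = undefined, one = undefined,
     zero = (\<lambda>j\<in>{..<n}. 0), add = (\<lambda>a b. \<lambda>j\<in>{..<n}. a j + b j), smult = (\<lambda>c a. \<lambda>j\<in>{..<n}. c * a j),
     nrm = (\<lambda>a. if p = \<infinity> then Max ((\<lambda>j. \<bar>a j\<bar>) ` {..<n})
                else (\<Sum>j<n. \<bar>a j\<bar> powr enn2real p) powr (1 / enn2real p))\<rparr>"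

definition unit_vec :: "nat \<Rightarrow> nat \<Rightarrow> nat \<Rightarrow> real" where
  "unit_vec n j = (\<lambda>i\<in>{..<n}. if i = j then 1 else 0)"

text \<open>The algebraic tensor product of \<open>\<real>\<^sup>n\<close> with \<open>E\<close> is realised as \<open>E\<^sup>n\<close>: the tuple \<open>w\<close> stands for
  the sum over \<open>j < n\<close> of \<open>e\<^sub>j \<otimes> w\<^sub>j\<close>, where \<open>e\<^sub>j\<close> is the \<open>j\<close>-th unit vector.\<close>

definition tensor_module :: "nat \<Rightarrow> ('a, 'm) nspace_scheme \<Rightarrow> (real, nat \<Rightarrow> 'a) module" where
  "tensor_module n E = \<lparr>carrier = {..<n} \<rightarrow>\<^sub>E carrier E, mult = undefined, one = undefined,
     zero = (\<lambda>j\<in>{..<n}. \<zero>\<^bsub>E\<^esub>), add = (\<lambda>v w. \<lambda>j\<in>{..<n}. v j \<oplus>\<^bsub>E\<^esub> w j),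
     smult = (\<lambda>c w. \<lambda>j\<in>{..<n}. c \<odot>\<^bsub>E\<^esub> w j)\<rparr>"

definition elem_tensor ::
    "nat \<Rightarrow> ('a, 'm) nspace_scheme \<Rightarrow> (nat \<Rightarrow> real) \<Rightarrow> 'a \<Rightarrow> nat \<Rightarrow> 'a" where
  "elem_tensor n E a x = (\<lambda>j\<in>{..<n}. a j \<odot>\<^bsub>E\<^esub> x)"

text \<open>\<open>\<langle>f \<otimes> g, w\<rangle>\<close> for linear functionals \<open>f\<close> on \<open>\<real>\<^sup>n\<close> and \<open>g\<close> on \<open>E\<close>.\<close>

definition tensor_pair ::
    "nat \<Rightarrow> ((nat \<Rightarrow> real) \<Rightarrow> real) \<Rightarrow> ('a \<Rightarrow> real) \<Rightarrow> (nat \<Rightarrow> 'a) \<Rightarrow> real" where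
  "tensor_pair n f g w = (\<Sum>j<n. f (unit_vec n j) * g (w j))"

text \<open>\<open>T \<otimes> I\<^sub>E\<close> for a linear map \<open>T\<close> from \<open>\<real>\<^sup>n\<close> to \<open>\<real>\<^sup>m\<close>.\<close>

definition tensor_left ::
    "nat \<Rightarrow> nat \<Rightarrow> ('a, 'm) nspace_scheme \<Rightarrow> ((nat \<Rightarrow> real) \<Rightarrow> nat \<Rightarrow> real) \<Rightarrow> (nat \<Rightarrow> 'a) \<Rightarrow> nat \<Rightarrow> 'a"
  where
  "tensor_left n m E T w =
     (\<lambda>i\<in>{..<m}. \<Oplus>\<^bsub>E\<^esub>j\<in>{..<n}. T (unit_vec n j) i \<odot>\<^bsub>E\<^esub> w j)"

text \<open>\<open>I \<otimes> u\<close> for a linear map \<open>u\<close> on \<open>E\<close>.\<close>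

definition tensor_right :: "nat \<Rightarrow> ('a \<Rightarrow> 'b) \<Rightarrow> (nat \<Rightarrow> 'a) \<Rightarrow> nat \<Rightarrow> 'b" where
  "tensor_right n u w = (\<lambda>j\<in>{..<n}. u (w j))"

section \<open>\<open>p\<close>-multinormed spaces\<close>

record 'a mnspace = "'a nspace" +
  mnrm :: "nat \<Rightarrow> (nat \<Rightarrow> 'a) \<Rightarrow> real"

definition tensor_space :: "nat \<Rightarrow> ('a, 'm) mnspace_scheme \<Rightarrow> (nat \<Rightarrow> 'a) nspace" where
  "tensor_space n E = module.extend (tensor_module n E) (nspace.fields (mnrm E n))"

locale p_multinormed_space = banach_space E
  for p :: ennreal and E :: "('a, 'm) mnspace_scheme" (structure) +
  assumes mnrm_norm: "n \<ge> 1 \<Longrightarrow> normed_space (tensor_space n E)"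
    and mnrm_elem_tensor:
      "n \<ge> 1 \<Longrightarrow> a \<in> carrier (lp p n) \<Longrightarrow> x \<in> carrier E \<Longrightarrow>
       mnrm E n (elem_tensor n E a x) = nrm (lp p n) a * nrm E x"
    and mnrm_ge_pair:
      "n \<ge> 1 \<Longrightarrow> w \<in> carrier (tensor_space n E) \<Longrightarrow> f \<in> dual_ball (lp p n) \<Longrightarrow> g \<in> dual_ball E \<Longrightarrow>
       \<bar>tensor_pair n f g w\<bar> \<le> mnrm E n w"
    and mnrm_tensor_left:
      "n \<ge> 1 \<Longrightarrow> m \<ge> 1 \<Longrightarrow> T \<in> bounded_ops (lp p n) (lp p m) \<Longrightarrow> w \<in> carrier (tensor_space n E) \<Longrightarrow>
       ennreal (mnrm E m (tensor_left n m E T w)) \<le> op_norm (lp p n) (lp p m) T * ennreal (mnrm E n w)"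

text \<open>\<open>\<parallel>u\<parallel>\<^sub>p\<close>. The exponent enters only through the multinorms of the two spaces.\<close>

definition multi_norm ::
    "('a, 'm) mnspace_scheme \<Rightarrow> ('b, 'k) mnspace_scheme \<Rightarrow> ('a \<Rightarrow> 'b) \<Rightarrow> ennreal" where
  "multi_norm E Y u = (SUP n\<in>{1..}. op_norm (tensor_space n E) (tensor_space n Y) (tensor_right n u))"

definition multibounded ::
    "('a, 'm) mnspace_scheme \<Rightarrow> ('b, 'k) mnspace_scheme \<Rightarrow> ('a \<Rightarrow> 'b) \<Rightarrow> bool" where
  "multibounded E Y u \<longleftrightarrow> linear_map E Y u \<and> multi_norm E Y u < \<infinity>"

text \<open>HOL cannot quantify over types inside a formula, so the type of the elements of the ambient
  spaces \<open>Y\<close> is a parameter; a theorem that leaves \<open>'y\<close> free covers all \<open>Y\<close>. Replacing the carrier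
  of \<open>Y\<close> by \<open>S\<close> gives the subspace with the norms inherited from \<open>Y\<close>.\<close>

definition c_injective ::
    "'y itself \<Rightarrow> ennreal \<Rightarrow> real \<Rightarrow> ('z, 'k) mnspace_scheme \<Rightarrow> bool" where
  "c_injective (_ :: 'y itself) p c Z \<longleftrightarrow>
     p_multinormed_space p Z \<and>
     (\<forall>(Y :: 'y mnspace) S u.
        p_multinormed_space p Y \<longrightarrow> closed_subspace S Y \<longrightarrow>
        multibounded (Y\<lparr>carrier := S\<rparr>) Z u \<longrightarrow>
        (\<exists>v. linear_map Y Z v \<and> (\<forall>x\<in>S. v x = u x) \<and>
             multi_norm Y Z v \<le> ennreal c * multi_norm (Y\<lparr>carrier := S\<rparr>) Z u))"

definition proj_norm ::
    "ennreal \<Rightarrow> nat \<Rightarrow> ('a, 'm) nspace_scheme \<Rightarrow> (nat \<Rightarrow> 'a) \<Rightarrow> real" where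
  "proj_norm p n E w =
     Inf {(\<Sum>k<K. nrm (lp p n) (a k) * nrm E (x k)) | (K :: nat) a x.
            (\<forall>k<K. a k \<in> carrier (lp p n) \<and> x k \<in> carrier E) \<and>
            w = (\<Oplus>\<^bsub>tensor_module n E\<^esub>k\<in>{..<K}. elem_tensor n E (a k) (x k))}"

definition max_mn :: "ennreal \<Rightarrow> 'a nspace \<Rightarrow> 'a mnspace" where
  "max_mn p E = nspace.extend E (mnspace.fields (\<lambda>n. proj_norm p n E))"

text \<open>The element 0 is inserted because the supremum of the empty set of reals is unspecified.\<close>

definition linf_sum :: "'i set \<Rightarrow> ('i \<Rightarrow> 'a mnspace) \<Rightarrow> ('i \<Rightarrow> 'a) mnspace" where
  "linf_sum I E = \<lparr>
     carrier = {x \<in> \<Pi>\<^sub>E i\<in>I. carrier (E i). bdd_above ((\<lambda>i. nrm (E i) (x i)) ` I)},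
     mult = undefined, one = undefined,
     zero = (\<lambda>i\<in>I. \<zero>\<^bsub>E i\<^esub>), add = (\<lambda>x y. \<lambda>i\<in>I. x i \<oplus>\<^bsub>E i\<^esub> y i),
     smult = (\<lambda>c x. \<lambda>i\<in>I. c \<odot>\<^bsub>E i\<^esub> x i),
     nrm = (\<lambda>x. Sup (insert 0 ((\<lambda>i. nrm (E i) (x i)) ` I))),
     mnrm = (\<lambda>n w. Sup (insert 0 ((\<lambda>i. mnrm (E i) n (\<lambda>j\<in>{..<n}. w j i)) ` I)))\<rparr>"

section \<open>The spaces \<open>L\<^sup>q(\<mu>)\<close>\<close>

definition Lq_norm :: "ennreal \<Rightarrow> 'a measure \<Rightarrow> ('a \<Rightarrow> real) \<Rightarrow> real" where
  "Lq_norm q M f =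
     (if q = \<infinity> then Inf {c. 0 \<le> c \<and> (AE x in M. \<bar>f x\<bar> \<le> c)}
      else (\<integral>x. \<bar>f x\<bar> powr enn2real q \<partial>M) powr (1 / enn2real q))"

definition Lq_fun :: "ennreal \<Rightarrow> 'a measure \<Rightarrow> ('a \<Rightarrow> real) set" where
  "Lq_fun q M = {f \<in> borel_measurable M.
     if q = \<infinity> then \<exists>c. AE x in M. \<bar>f x\<bar> \<le> c else integrable M (\<lambda>x. \<bar>f x\<bar> powr enn2real q)}"

definition Lq_rel :: "ennreal \<Rightarrow> 'a measure \<Rightarrow> (('a \<Rightarrow> real) \<times> ('a \<Rightarrow> real)) set" where
  "Lq_rel q M = {(f, g). f \<in> Lq_fun q M \<and> g \<in> Lq_fun q M \<and> (AE x in M. f x = g x)}"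

definition Lq :: "ennreal \<Rightarrow> 'a measure \<Rightarrow> ('a \<Rightarrow> real) set nspace" where
  "Lq q M = \<lparr>
     carrier = Lq_fun q M // Lq_rel q M, mult = undefined, one = undefined,
     zero = Lq_rel q M `` {\<lambda>_. 0},
     add = (\<lambda>F G. \<Union>f\<in>F. \<Union>g\<in>G. Lq_rel q M `` {\<lambda>x. f x + g x}),
     smult = (\<lambda>c F. \<Union>f\<in>F. Lq_rel q M `` {\<lambda>x. c * f x}),
     nrm = (\<lambda>F. Lq_norm q M (SOME f. f \<in> F))\<rparr>"

text \<open>Dedekind completeness of the measure algebra: every family of measurable sets has an essential
  supremum. Together with semifiniteness this is localizability, so all sigma-finite measures have
  the property. It holds if and only if \<open>L\<^sup>\<infinity>\<close> is Dedekind complete as a vector lattice,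
  that is, if and only if \<open>L\<^sup>\<infinity>\<close> is a 1-injective Banach space. Counting measure on the
  countable-cocountable sigma-algebra of an uncountable set does not have the property.\<close>

definition dedekind_complete_measure :: "'a measure \<Rightarrow> bool" where
  "dedekind_complete_measure M \<longleftrightarrow>
     (\<forall>\<A> \<subseteq> sets M. \<exists>U\<in>sets M.
        (\<forall>A\<in>\<A>. A - U \<in> null_sets M) \<and>
        (\<forall>V\<in>sets M. (\<forall>A\<in>\<A>. A - V \<in> null_sets M) \<longrightarrow> U - V \<in> null_sets M))"

end

theory Submission
  imports Defs
begin

text \<open>
  It suffices to extend each component of \<open>u\<close> with values in \<open>L\<^sup>p\<^sup>'(\<mu>)\<close> without increasing the
  multinorm. A tuple in \<open>L\<^sup>p\<^sup>'(\<mu>)\<close> is paired with a tuple of step functions, that is, \<open>u\<close> is turned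
  into a functional on \<open>S\<close>-valued simple functions. The hypothesis on \<open>u\<close> says that this functional
  is dominated by the norm that the weights \<open>\<mu>(A\<^sub>k)\<^sup>1\<^sup>/\<^sup>p\<close> and the multinorm of \<open>Y\<close> induce, so the
  Hahn--Banach theorem extends it to \<open>Y\<close>-valued simple functions. If \<open>p' < \<infinity>\<close>, the extension is a
  finitely additive set function for every \<open>y\<close>, and the density of its absolutely continuous part
  is the value of the extended operator at \<open>y\<close>. The projective norm of the extended operator is
  controlled because the projective norm of a tuple in \<open>L\<^sup>p\<^sup>'(\<mu>)\<close> is attained, up to \<open>\<epsilon>\<close>, by
  pairing with a contraction from \<open>\<ell>\<^sup>p\<^sub>n\<close> into step functions. If \<open>p = 1\<close>, the projective norm is the
  sum of the norms of the coordinates; the argument with counting measure gives a dominating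
  seminorm on \<open>Y\<close>, and the Hahn--Banach theorem with values in the Dedekind complete lattice
  \<open>L\<^sup>\<infinity>(\<mu>)\<close> applies.
\<close>

section \<open>Real modules\<close>

text \<open>The obstacle: the Hahn--Banach theorem extends functionals, and the extension lands in
  the dual of the step functions. For p' = 1 this dual is larger than \<open>L\<^sup>1\<close>,
  since it contains charges that are only finitely additive. Passing to the absolutely continuous
  part is a linear contraction back to \<open>L\<^sup>p\<^sup>'\<close>, and it respects multinorms:
  a finite partition can be shrunk so that charge and density nearly agree on it, and restricting
  step functions to smaller sets is a contraction between \<open>\<ell>\<^sup>p\<close> spaces, to
  which the third multinorm axiom applies. The measures need not be sigma-finite. All estimates take
  place inside sets of finite measure, and a function in \<open>L\<^sup>q\<close> with finite q
  lives on countably many of these. This breaks down for \<open>L\<^sup>\<infinity>\<close>: an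
  essentially bounded function can live on a set without subsets of positive finite measure, so step
  functions do not norm it. For p = 1 an order-theoretic argument therefore replaces the
  pairing.\<close>

lemma real_ring_simps [simp]:
  "carrier real_ring = UNIV" "x \<oplus>\<^bsub>real_ring\<^esub> y = x + y" "x \<otimes>\<^bsub>real_ring\<^esub> y = x * y"
  "\<one>\<^bsub>real_ring\<^esub> = 1" "\<zero>\<^bsub>real_ring\<^esub> = 0"
  by (simp_all add: ring_of_type_algebra_def)

text \<open>Additive inverses come from scaling by -1 through \<open>ldist\<close> and
  \<open>null\<close>, so none has to be exhibited when a module is built.\<close>

lemma real_moduleI:
  fixes E (structure)
  assumes zero: "\<zero> \<in> carrier E"
    and add: "\<And>x y. x \<in> carrier E \<Longrightarrow> y \<in> carrier E \<Longrightarrow> x \<oplus> y \<in> carrier E"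
    and assoc: "\<And>x y z. x \<in> carrier E \<Longrightarrow> y \<in> carrier E \<Longrightarrow> z \<in> carrier E \<Longrightarrow> (x \<oplus> y) \<oplus> z = x \<oplus> (y \<oplus> z)"
    and comm: "\<And>x y. x \<in> carrier E \<Longrightarrow> y \<in> carrier E \<Longrightarrow> x \<oplus> y = y \<oplus> x"
    and l_zero: "\<And>x. x \<in> carrier E \<Longrightarrow> \<zero> \<oplus> x = x"
    and smult: "\<And>c x. x \<in> carrier E \<Longrightarrow> c \<odot> x \<in> carrier E"
    and ldist: "\<And>a b x. x \<in> carrier E \<Longrightarrow> (a + b) \<odot> x = a \<odot> x \<oplus> b \<odot> x"
    and rdist: "\<And>a x y. x \<in> carrier E \<Longrightarrow> y \<in> carrier E \<Longrightarrow> a \<odot> (x \<oplus> y) = a \<odot> x \<oplus> a \<odot> y"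
    and sassoc: "\<And>a b x. x \<in> carrier E \<Longrightarrow> (a * b) \<odot> x = a \<odot> (b \<odot> x)"
    and one: "\<And>x. x \<in> carrier E \<Longrightarrow> 1 \<odot> x = x"
    and null: "\<And>x. x \<in> carrier E \<Longrightarrow> 0 \<odot> x = \<zero>"
  shows "module real_ring E"
proof (rule moduleI)
  show "cring real_ring" by (rule cring_from_type_algebra)
  show "abelian_group E"
  proof (rule abelian_groupI)
    fix x assume x: "x \<in> carrier E"
    have "(-1) \<odot> x \<oplus> x = (-1 + 1) \<odot> x" using x by (simp only: ldist one)
    then show "\<exists>y\<in>carrier E. y \<oplus> x = \<zero>" using x null smult by auto
  qed (use assms in auto)
qed (use assms in auto)

lemma real_submodule:
  assumes E: "module real_ring E" and S: "S \<subseteq> carrier E" "\<zero>\<^bsub>E\<^esub> \<in> S"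
    and add: "\<And>x y. x \<in> S \<Longrightarrow> y \<in> S \<Longrightarrow> x \<oplus>\<^bsub>E\<^esub> y \<in> S"
    and smult: "\<And>c x. x \<in> S \<Longrightarrow> c \<odot>\<^bsub>E\<^esub> x \<in> S"
  shows "module real_ring (E\<lparr>carrier := S\<rparr>)"
proof -
  interpret module real_ring E by (rule E)
  show ?thesis
    apply (rule real_moduleI)
    using S add smult smult_l_distr smult_r_distr smult_assoc1 smult_one smult_l_null
    by (auto simp: subset_iff a_ac)
qed

locale real_module = module real_ring E for E (structure)
begin

lemma sm_closed [simp, intro]: "x \<in> carrier E \<Longrightarrow> c \<odot> x \<in> carrier E"
  by (rule smult_closed) simp_all

lemma sm_simps:
  "x \<in> carrier E \<Longrightarrow> (a + b) \<odot> x = a \<odot> x \<oplus> b \<odot> x"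
  "x \<in> carrier E \<Longrightarrow> y \<in> carrier E \<Longrightarrow> a \<odot> (x \<oplus> y) = a \<odot> x \<oplus> a \<odot> y"
  "x \<in> carrier E \<Longrightarrow> a \<odot> (b \<odot> x) = (a * b) \<odot> x"
  "x \<in> carrier E \<Longrightarrow> 1 \<odot> x = x"
  "x \<in> carrier E \<Longrightarrow> 0 \<odot> x = \<zero>"
  "a \<odot> \<zero> = \<zero>"
  using smult_l_distr[of a b x] smult_r_distr[of a x y] smult_assoc1[of a b x] smult_one[of x]
    smult_l_null[of x] smult_r_null[of a] by auto

lemma minus_eq_sm: "x \<in> carrier E \<Longrightarrow> y \<in> carrier E \<Longrightarrow> x \<ominus> y = x \<oplus> (-1) \<odot> y"
proof -
  assume xy: "x \<in> carrier E" "y \<in> carrier E"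
  have "(-1) \<odot> y \<oplus> y = (-1 + 1) \<odot> y" using xy by (simp only: sm_simps)
  then have "(-1) \<odot> y \<oplus> y = \<zero>" using xy by (simp add: sm_simps)
  then have "(-1) \<odot> y = \<ominus> y" using xy by (metis minus_equality sm_closed)
  then show ?thesis using xy by (simp add: a_minus_def)
qed

lemma sm_cancel: "x \<in> carrier E \<Longrightarrow> x \<oplus> (-1) \<odot> x = \<zero>"
proof -
  assume x: "x \<in> carrier E"
  then have "x \<oplus> (-1) \<odot> x = (1 + (-1)) \<odot> x" by (simp only: sm_simps)
  then show ?thesis using x by (simp add: sm_simps)
qed

lemma finsum_sm:
  "finite A \<Longrightarrow> f \<in> A \<rightarrow> carrier E \<Longrightarrow> c \<odot> (\<Oplus>k\<in>A. f k) = (\<Oplus>k\<in>A. c \<odot> f k)"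
  by (rule finsum_smult_ldistr) auto

end

lemma real_module_iff: "real_module E \<longleftrightarrow> module real_ring E"
  by (simp add: real_module_def)

section \<open>The Hahn--Banach theorem with values in functions modulo null sets\<close>

text \<open>The only null set is empty, so the union itself is the essential supremum. Counting
  measure on one point will turn the Hahn--Banach theorem for functions into the scalar one.\<close>

lemma dedekind_complete_count_space: "dedekind_complete_measure (count_space A)"
  unfolding dedekind_complete_measure_def
proof (intro allI impI)
  fix \<A> assume "\<A> \<subseteq> sets (count_space A)"
  then have "\<Union>\<A> \<in> sets (count_space A)" by auto
  moreover have "\<forall>V\<in>sets (count_space A). (\<forall>B\<in>\<A>. B - V \<in> null_sets (count_space A)) \<longrightarrow>
      \<Union>\<A> - V \<in> null_sets (count_space A)"
    by (auto simp: null_sets_count_space)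
  moreover have "\<forall>B\<in>\<A>. B - \<Union>\<A> \<in> null_sets (count_space A)"
    by (auto simp: null_sets_count_space)
  ultimately show "\<exists>U\<in>sets (count_space A). (\<forall>B\<in>\<A>. B - U \<in> null_sets (count_space A)) \<and>
      (\<forall>V\<in>sets (count_space A). (\<forall>B\<in>\<A>. B - V \<in> null_sets (count_space A)) \<longrightarrow>
        U - V \<in> null_sets (count_space A))"
    by blast
qed

text \<open>The families may be uncountable, so pointwise suprema are neither measurable nor
  compatible with null sets. The essential supremum \<open>U r\<close> of the sets where a member of
  \<open>F\<close> exceeds the rational r replaces the superlevel set of a supremum. There are
  countably many r, so the exceptional null sets can be united.\<close>

lemma AE_interpolant:
  fixes F G :: "('a \<Rightarrow> real) set"
  assumes M: "dedekind_complete_measure M"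
    and F: "F \<subseteq> borel_measurable M" "F \<noteq> {}" and G: "G \<subseteq> borel_measurable M" "G \<noteq> {}"
    and le: "\<And>f g. f \<in> F \<Longrightarrow> g \<in> G \<Longrightarrow> AE t in M. f t \<le> g t"
  obtains h where "h \<in> borel_measurable M"
    "\<And>f. f \<in> F \<Longrightarrow> AE t in M. f t \<le> h t" "\<And>g. g \<in> G \<Longrightarrow> AE t in M. h t \<le> g t"
proof -
  define L where "L r f = {t \<in> space M. real_of_rat r < f t}" for r and f :: "'a \<Rightarrow> real"
  have Lm: "L r f \<in> sets M" if "f \<in> F \<union> G" for r f
  proof -
    have [measurable]: "f \<in> borel_measurable M" using that F G by auto
    show ?thesis unfolding L_def by measurable
  qed
  have "\<exists>U. \<forall>r::rat. U r \<in> sets M \<and> (\<forall>f\<in>F. L r f - U r \<in> null_sets M) \<and>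
        (\<forall>V\<in>sets M. (\<forall>f\<in>F. L r f - V \<in> null_sets M) \<longrightarrow> U r - V \<in> null_sets M)"
  proof (intro choice allI)
    fix r
    have "L r ` F \<subseteq> sets M" using Lm by auto
    with M show "\<exists>U. U \<in> sets M \<and> (\<forall>f\<in>F. L r f - U \<in> null_sets M) \<and>
        (\<forall>V\<in>sets M. (\<forall>f\<in>F. L r f - V \<in> null_sets M) \<longrightarrow> U - V \<in> null_sets M)"
      unfolding dedekind_complete_measure_def by (elim allE[of _ "L r ` F"]) auto
  qed
  then obtain U where U: "\<And>r. U r \<in> sets M" "\<And>r f. f \<in> F \<Longrightarrow> L r f - U r \<in> null_sets M"
    "\<And>r V. V \<in> sets M \<Longrightarrow> (\<And>f. f \<in> F \<Longrightarrow> L r f - V \<in> null_sets M) \<Longrightarrow> U r - V \<in> null_sets M"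
    by metis
  \<comment> \<open>Extended reals keep the supremum meaningful at points that lie in no
    \<open>U r\<close>, or in \<open>U r\<close> for arbitrarily large r. Comparison with one member
    of each family makes \<open>H\<close> finite almost everywhere.\<close>
  define H where "H t = (SUP r. if t \<in> U r then ereal (real_of_rat r) else -\<infinity>)" for t
  have [measurable]: "U r \<in> sets M" for r by (rule U)
  have Hm: "H \<in> borel_measurable M" unfolding H_def by measurable
  have FH: "AE t in M. ereal (f t) \<le> H t" if f: "f \<in> F" for f
  proof -
    have "AE t in M. \<forall>r. t \<notin> L r f - U r"
      unfolding AE_all_countable using U(2)[OF f] AE_not_in by blast
    with AE_space show ?thesis
    proof eventually_elim
      case (elim t)
      show ?case
      proof (rule ereal_le_epsilon2)
        fix e :: real assume "0 < e"
        then obtain r where r: "f t - e < of_rat r" "of_rat r < f t"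
          using of_rat_dense[of "f t - e" "f t"] by auto
        then have "t \<in> U r" using elim unfolding L_def by auto
        then have "ereal (of_rat r) \<le> H t" unfolding H_def by (intro SUP_upper2[of r]) auto
        moreover have "ereal (f t) \<le> ereal (of_rat r) + ereal e" using r by simp
        ultimately show "ereal (f t) \<le> H t + ereal e"
          by (meson add_right_mono order_trans)
      qed
    qed
  qed
  have HG: "AE t in M. H t \<le> ereal (g t)" if g: "g \<in> G" for g
  proof -
    \<comment> \<open>The superlevel set of g is an essential upper bound for the superlevel sets of
      all members of \<open>F\<close>, so minimality of \<open>U r\<close> applies.\<close>
    have "U r - L r g \<in> null_sets M" for r
    proof (rule U(3))
      show "L r g \<in> sets M" using g Lm by auto
      fix f assume f: "f \<in> F"
      have "L r f - L r g \<in> sets M" using f g Lm by auto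
      moreover have "AE t in M. t \<notin> L r f - L r g"
        using le[OF f g] by eventually_elim (auto simp: L_def)
      ultimately show "L r f - L r g \<in> null_sets M" by (simp add: AE_iff_null_sets)
    qed
    then have "AE t in M. \<forall>r. t \<notin> U r - L r g"
      unfolding AE_all_countable using AE_not_in by blast
    then show ?thesis
    proof eventually_elim
      case (elim t)
      then show ?case unfolding H_def L_def by (intro SUP_least) (auto simp: less_imp_le)
    qed
  qed
  obtain f0 g0 where fg: "f0 \<in> F" "g0 \<in> G" using F G by auto
  have fin: "AE t in M. \<bar>H t\<bar> \<noteq> \<infinity>"
    using FH[OF fg(1)] HG[OF fg(2)] by eventually_elim auto
  show thesis
  proof
    show "(\<lambda>t. real_of_ereal (H t)) \<in> borel_measurable M" using Hm by measurable
    show "AE t in M. f t \<le> real_of_ereal (H t)" if "f \<in> F" for f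
      using FH[OF that] fin by eventually_elim (auto simp: ereal_le_real_iff)
    show "AE t in M. real_of_ereal (H t) \<le> g t" if "g \<in> G" for g
      using HG[OF that] fin by eventually_elim (auto simp: real_le_ereal_iff)
  qed
qed

definition sublinear :: "('e, 'm) nspace_scheme \<Rightarrow> ('e \<Rightarrow> real) \<Rightarrow> bool" where
  "sublinear E q \<longleftrightarrow> (\<forall>x\<in>carrier E. \<forall>y\<in>carrier E. q (x \<oplus>\<^bsub>E\<^esub> y) \<le> q x + q y) \<and>
     (\<forall>c>0. \<forall>x\<in>carrier E. q (c \<odot>\<^bsub>E\<^esub> x) = c * q x)"

text \<open>A partial linear map is stored as a linear relation between vectors and functions, not
  classes of functions. That it is single-valued up to null sets is a consequence of domination: two
  values at one vector differ by a value at 0, where \<open>q\<close> vanishes.\<close>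

definition dominated_graph ::
    "('e, 'm) nspace_scheme \<Rightarrow> 'a measure \<Rightarrow> ('e \<Rightarrow> real) \<Rightarrow> ('e \<times> ('a \<Rightarrow> real)) set \<Rightarrow> bool" where
  "dominated_graph E M q G \<longleftrightarrow> G \<noteq> {} \<and> G \<subseteq> carrier E \<times> borel_measurable M \<and>
     (\<forall>x f y g. (x, f) \<in> G \<longrightarrow> (y, g) \<in> G \<longrightarrow> (x \<oplus>\<^bsub>E\<^esub> y, \<lambda>t. f t + g t) \<in> G) \<and>
     (\<forall>c x f. (x, f) \<in> G \<longrightarrow> (c \<odot>\<^bsub>E\<^esub> x, \<lambda>t. c * f t) \<in> G) \<and>
     (\<forall>x f. (x, f) \<in> G \<longrightarrow> (AE t in M. f t \<le> q x))"

lemma dominated_graphD: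
  assumes "dominated_graph E M q G"
  shows "(x, f) \<in> G \<Longrightarrow> x \<in> carrier E" "(x, f) \<in> G \<Longrightarrow> f \<in> borel_measurable M"
    "(x, f) \<in> G \<Longrightarrow> AE t in M. f t \<le> q x"
    "(x, f) \<in> G \<Longrightarrow> (y, g) \<in> G \<Longrightarrow> (x \<oplus>\<^bsub>E\<^esub> y, \<lambda>t. f t + g t) \<in> G"
    "(x, f) \<in> G \<Longrightarrow> (c \<odot>\<^bsub>E\<^esub> x, \<lambda>t. c * f t) \<in> G"
  using assms unfolding dominated_graph_def by auto

text \<open>The one-dimensional step of the Hahn--Banach theorem. A value h at y is admissible when
  f - q (x - y) \<le> h \<le> q (x' + y) - f' for all pairs (x, f) and (x', f') of the graph.
  Subadditivity orders these bounds, and Dedekind completeness provides an interpolant.\<close>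

lemma dominated_graph_extend:
  assumes E: "module real_ring E" and M: "dedekind_complete_measure M" and q: "sublinear E q"
    and G: "dominated_graph E M q G" and y: "y \<in> carrier E"
  obtains h G' where "dominated_graph E M q G'" "G \<subseteq> G'" "(y, h) \<in> G'"
proof -
  interpret real_module E using E by (simp add: real_module_iff)
  have q_add: "q (a \<oplus>\<^bsub>E\<^esub> b) \<le> q a + q b" if "a \<in> carrier E" "b \<in> carrier E" for a b
    using q that by (auto simp: sublinear_def)
  have q_sm: "q (c \<odot>\<^bsub>E\<^esub> a) = c * q a" if "a \<in> carrier E" "c > 0" for a c
    using q that by (auto simp: sublinear_def)
  note Gc = dominated_graphD(1)[OF G] and Gm = dominated_graphD(2)[OF G]
    and Gq = dominated_graphD(3)[OF G] and Gadd = dominated_graphD(4)[OF G]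
    and Gsm = dominated_graphD(5)[OF G]
  define my where "my = (-1) \<odot>\<^bsub>E\<^esub> y"
  have my: "my \<in> carrier E" "y \<oplus>\<^bsub>E\<^esub> my = \<zero>\<^bsub>E\<^esub>" using y sm_cancel[of y] by (auto simp: my_def)
  obtain h where h: "h \<in> borel_measurable M"
    "\<And>x f. (x, f) \<in> G \<Longrightarrow> AE t in M. f t - q (x \<oplus>\<^bsub>E\<^esub> my) \<le> h t"
    "\<And>x f. (x, f) \<in> G \<Longrightarrow> AE t in M. h t \<le> q (x \<oplus>\<^bsub>E\<^esub> y) - f t"
  proof (rule AE_interpolant[OF M])
    let ?F = "(\<lambda>(x, f) t. f t - q (x \<oplus>\<^bsub>E\<^esub> my)) ` G"
    let ?H = "(\<lambda>(x, f) t. q (x \<oplus>\<^bsub>E\<^esub> y) - f t) ` G"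
    show "?F \<subseteq> borel_measurable M" "?H \<subseteq> borel_measurable M" using Gm by auto
    show "?F \<noteq> {}" "?H \<noteq> {}" using G by (auto simp: dominated_graph_def)
    show "AE t in M. a t \<le> b t" if ab: "a \<in> ?F" "b \<in> ?H" for a b
    proof -
      obtain x f x' f' where xf: "(x, f) \<in> G" "(x', f') \<in> G"
        and a: "a = (\<lambda>t. f t - q (x \<oplus>\<^bsub>E\<^esub> my))" and b: "b = (\<lambda>t. q (x' \<oplus>\<^bsub>E\<^esub> y) - f' t)"
        using ab by auto
      note c = Gc[OF xf(1)] Gc[OF xf(2)]
      have "x \<oplus>\<^bsub>E\<^esub> x' = (x \<oplus>\<^bsub>E\<^esub> my) \<oplus>\<^bsub>E\<^esub> (x' \<oplus>\<^bsub>E\<^esub> y)"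
      proof -
        have "(x \<oplus>\<^bsub>E\<^esub> my) \<oplus>\<^bsub>E\<^esub> (x' \<oplus>\<^bsub>E\<^esub> y) = (x \<oplus>\<^bsub>E\<^esub> x') \<oplus>\<^bsub>E\<^esub> (y \<oplus>\<^bsub>E\<^esub> my)"
          using c my(1) y by (simp add: a_ac)
        then show ?thesis using c my(2) by simp
      qed
      then have "q (x \<oplus>\<^bsub>E\<^esub> x') \<le> q (x \<oplus>\<^bsub>E\<^esub> my) + q (x' \<oplus>\<^bsub>E\<^esub> y)"
        using q_add c my(1) y by auto
      with Gq[OF Gadd[OF xf]] show ?thesis unfolding a b by (auto elim!: eventually_mono)
    qed
    fix h assume "h \<in> borel_measurable M" "\<And>f. f \<in> ?F \<Longrightarrow> AE t in M. f t \<le> h t"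
      "\<And>g. g \<in> ?H \<Longrightarrow> AE t in M. h t \<le> g t"
    then show thesis by (intro that) force+
  qed
  define G' where "G' = {(x \<oplus>\<^bsub>E\<^esub> s \<odot>\<^bsub>E\<^esub> y, \<lambda>t. f t + s * h t) | x f s. (x, f) \<in> G}"
  have I: "(x \<oplus>\<^bsub>E\<^esub> s \<odot>\<^bsub>E\<^esub> y, g) \<in> G'" if "(x, f) \<in> G" "g = (\<lambda>t. f t + s * h t)" for x f s g
    using that by (auto simp: G'_def)
  have "G \<subseteq> G'"
  proof clarify
    fix x f assume xf: "(x, f) \<in> G"
    have "x \<oplus>\<^bsub>E\<^esub> 0 \<odot>\<^bsub>E\<^esub> y = x" using Gc[OF xf] y by (simp add: sm_simps)
    then show "(x, f) \<in> G'" using I[OF xf, of f 0] by simp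
  qed
  moreover have "(y, h) \<in> G'"
  proof -
    obtain x f where xf: "(x, f) \<in> G" using G by (auto simp: dominated_graph_def)
    have "0 \<odot>\<^bsub>E\<^esub> x \<oplus>\<^bsub>E\<^esub> 1 \<odot>\<^bsub>E\<^esub> y = y" using Gc[OF xf] y by (simp add: sm_simps)
    then show ?thesis using I[OF Gsm[OF xf, of 0], of h 1] by simp
  qed
  moreover have "dominated_graph E M q G'"
    unfolding dominated_graph_def
  proof (intro conjI allI impI)
    show "G' \<noteq> {}" using \<open>(y, h) \<in> G'\<close> by auto
    show "G' \<subseteq> carrier E \<times> borel_measurable M" using Gc Gm y h(1) by (auto simp: G'_def)
    fix x f assume "(x, f) \<in> G'"
    then obtain a k s where a: "(a, k) \<in> G" and x: "x = a \<oplus>\<^bsub>E\<^esub> s \<odot>\<^bsub>E\<^esub> y" "f = (\<lambda>t. k t + s * h t)"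
      by (auto simp: G'_def)
    note ac = Gc[OF a]
    show "(c \<odot>\<^bsub>E\<^esub> x, \<lambda>t. c * f t) \<in> G'" for c
    proof -
      have "c \<odot>\<^bsub>E\<^esub> x = c \<odot>\<^bsub>E\<^esub> a \<oplus>\<^bsub>E\<^esub> (c * s) \<odot>\<^bsub>E\<^esub> y" using ac y by (simp add: x sm_simps)
      then show ?thesis using I[OF Gsm[OF a, of c], of "\<lambda>t. c * f t" "c * s"]
        by (simp add: x algebra_simps)
    qed
    show "(x \<oplus>\<^bsub>E\<^esub> x', \<lambda>t. f t + f' t) \<in> G'" if xf': "(x', f') \<in> G'" for x' f'
    proof -
      obtain b l r where b: "(b, l) \<in> G" and x': "x' = b \<oplus>\<^bsub>E\<^esub> r \<odot>\<^bsub>E\<^esub> y" "f' = (\<lambda>t. l t + r * h t)"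
        using xf' by (auto simp: G'_def)
      have "x \<oplus>\<^bsub>E\<^esub> x' = (a \<oplus>\<^bsub>E\<^esub> b) \<oplus>\<^bsub>E\<^esub> (s + r) \<odot>\<^bsub>E\<^esub> y"
        using ac Gc[OF b] y by (simp add: x x' sm_simps a_ac)
      then show ?thesis using I[OF Gadd[OF a b], of "\<lambda>t. f t + f' t" "s + r"]
        by (simp add: x x' algebra_simps)
    qed
    \<comment> \<open>For s \<noteq> 0, domination at a + s y becomes one of the two defining bounds
      of h after division by the modulus of s; the sign of s decides which one.\<close>
    consider "s = 0" | "s > 0" | "s < 0" by linarith
    then show "AE t in M. f t \<le> q x"
    proof cases
      case 1 then show ?thesis using Gq[OF a] ac y by (simp add: x sm_simps)
    next
      case 2
      have "x = s \<odot>\<^bsub>E\<^esub> ((1/s) \<odot>\<^bsub>E\<^esub> a \<oplus>\<^bsub>E\<^esub> y)" using 2 ac y by (simp add: x sm_simps)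
      then have "q x = s * q ((1/s) \<odot>\<^bsub>E\<^esub> a \<oplus>\<^bsub>E\<^esub> y)" using 2 ac y by (simp add: q_sm)
      with h(3)[OF Gsm[OF a, of "1/s"]] show ?thesis
        using 2 unfolding x(2) by (auto elim!: eventually_mono simp: field_simps)
    next
      case 3
      have "x = (-s) \<odot>\<^bsub>E\<^esub> ((-1/s) \<odot>\<^bsub>E\<^esub> a \<oplus>\<^bsub>E\<^esub> my)" using 3 ac y by (simp add: x my_def sm_simps)
      then have "q x = (-s) * q ((-1/s) \<odot>\<^bsub>E\<^esub> a \<oplus>\<^bsub>E\<^esub> my)"
        using 3 ac my q_sm[of "(-1/s) \<odot>\<^bsub>E\<^esub> a \<oplus>\<^bsub>E\<^esub> my" "-s"] by simp
      with h(2)[OF Gsm[OF a, of "-1/s"]] show ?thesis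
        using 3 unfolding x(2) by (auto elim!: eventually_mono simp: field_simps)
    qed
  qed
  ultimately show thesis by (intro that)
qed

text \<open>Zorn's lemma runs over graphs of honest functions, so a maximal graph may relate many
  functions to one vector. \<open>v\<close> selects one of them, and the laws of linearity hold
  almost everywhere, with an exceptional set that depends on the vectors.\<close>

theorem hahn_banach_AE:
  assumes E: "module real_ring E" and M: "dedekind_complete_measure M" and q: "sublinear E q"
    and G0: "dominated_graph E M q G0"
  obtains v where "\<And>x. x \<in> carrier E \<Longrightarrow> v x \<in> borel_measurable M"
    "\<And>x. x \<in> carrier E \<Longrightarrow> AE t in M. v x t \<le> q x"
    "\<And>x y. x \<in> carrier E \<Longrightarrow> y \<in> carrier E \<Longrightarrow> AE t in M. v (x \<oplus>\<^bsub>E\<^esub> y) t = v x t + v y t"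
    "\<And>c x. x \<in> carrier E \<Longrightarrow> AE t in M. v (c \<odot>\<^bsub>E\<^esub> x) t = c * v x t"
    "\<And>x f. (x, f) \<in> G0 \<Longrightarrow> AE t in M. v x t = f t"
proof -
  interpret real_module E using E by (simp add: real_module_iff)
  define GG where "GG = {G. G0 \<subseteq> G \<and> dominated_graph E M q G}"
  have "\<exists>G\<in>GG. \<forall>H\<in>GG. G \<subseteq> H \<longrightarrow> H = G"
  proof (rule subset_Zorn_nonempty)
    show "GG \<noteq> {}" using G0 by (auto simp: GG_def)
    fix \<C> assume ne: "\<C> \<noteq> {}" and ch: "subset.chain GG \<C>"
    then have C: "\<And>G. G \<in> \<C> \<Longrightarrow> G0 \<subseteq> G" "\<And>G. G \<in> \<C> \<Longrightarrow> dominated_graph E M q G"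
      by (auto simp: subset.chain_def GG_def)
    have "dominated_graph E M q (\<Union>\<C>)"
      unfolding dominated_graph_def
    proof (intro conjI allI impI)
      show "\<Union>\<C> \<noteq> {}" using ne C(2) by (force simp: dominated_graph_def)
      show "\<Union>\<C> \<subseteq> carrier E \<times> borel_measurable M" using C(2) unfolding dominated_graph_def by blast
      fix x f assume xf: "(x, f) \<in> \<Union>\<C>"
      then obtain G where G: "G \<in> \<C>" "(x, f) \<in> G" by auto
      show "(c \<odot>\<^bsub>E\<^esub> x, \<lambda>t. c * f t) \<in> \<Union>\<C>" for c
        using dominated_graphD(5)[OF C(2)[OF G(1)] G(2)] by (rule UnionI[OF G(1)])
      show "AE t in M. f t \<le> q x" by (rule dominated_graphD(3)[OF C(2)[OF G(1)] G(2)])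
      fix y g assume "(y, g) \<in> \<Union>\<C>"
      then obtain G' where G': "G' \<in> \<C>" "(y, g) \<in> G'" by auto
      have "G \<subseteq> G' \<or> G' \<subseteq> G" using ch G(1) G'(1) by (auto simp: subset.chain_def)
      then obtain H where H: "H \<in> \<C>" "(x, f) \<in> H" "(y, g) \<in> H" using G G' by blast
      show "(x \<oplus>\<^bsub>E\<^esub> y, \<lambda>t. f t + g t) \<in> \<Union>\<C>"
        using dominated_graphD(4)[OF C(2)[OF H(1)] H(2,3)] by (rule UnionI[OF H(1)])
    qed
    then show "\<Union>\<C> \<in> GG" using ne C(1) by (auto simp: GG_def)
  qed
  then obtain G where "G \<in> GG" and max': "\<forall>H\<in>GG. G \<subseteq> H \<longrightarrow> H = G" by (rule bexE)
  then have G: "G0 \<subseteq> G" "dominated_graph E M q G" by (auto simp: GG_def)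
  have max: "H = G" if "dominated_graph E M q H" "G \<subseteq> H" for H
    using max' that G(1) by (auto simp: GG_def)
  \<comment> \<open>Otherwise the one-dimensional step would enlarge the maximal graph.\<close>
  have "\<exists>f. (x, f) \<in> G" if x: "x \<in> carrier E" for x
    using dominated_graph_extend[OF E M q G(2) x] max by metis
  then obtain v where v: "\<And>x. x \<in> carrier E \<Longrightarrow> (x, v x) \<in> G" by metis
  note Gc = dominated_graphD(1)[OF G(2)] and Gm = dominated_graphD(2)[OF G(2)]
    and Gq = dominated_graphD(3)[OF G(2)] and Gadd = dominated_graphD(4)[OF G(2)]
    and Gsm = dominated_graphD(5)[OF G(2)]
  \<comment> \<open>Homogeneity is demanded for positive scalars only; doubling the zero vector
    gives q 0 = 2 q 0.\<close>
  have q0: "q \<zero>\<^bsub>E\<^esub> = 0"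
  proof -
    have "\<forall>x\<in>carrier E. q (2 \<odot>\<^bsub>E\<^esub> x) = 2 * q x" using q by (simp add: sublinear_def)
    then have "q (2 \<odot>\<^bsub>E\<^esub> \<zero>\<^bsub>E\<^esub>) = 2 * q \<zero>\<^bsub>E\<^esub>" by (rule bspec) simp
    then show ?thesis by (simp add: sm_simps)
  qed
  \<comment> \<open>Domination is applied to the difference of the two values, which belongs to x -
    x = 0.\<close>
  have le: "AE t in M. f t \<le> g t" if xf: "(x, f) \<in> G" and xg: "(x, g) \<in> G" for x f g
  proof -
    have "AE t in M. f t + (-1) * g t \<le> q (x \<oplus>\<^bsub>E\<^esub> (-1) \<odot>\<^bsub>E\<^esub> x)"
      by (rule Gq[OF Gadd[OF xf Gsm[OF xg]]])
    then show ?thesis using q0 sm_cancel[OF Gc[OF xf]] by simp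
  qed
  have uniq: "AE t in M. f t = g t" if "(x, f) \<in> G" "(x, g) \<in> G" for x f g
    using le[OF that] le[OF that(2,1)] by eventually_elim simp
  show thesis
  proof
    show "v x \<in> borel_measurable M" "AE t in M. v x t \<le> q x" if "x \<in> carrier E" for x
      using Gm Gq v that by blast+
    show "AE t in M. v (x \<oplus>\<^bsub>E\<^esub> y) t = v x t + v y t" if "x \<in> carrier E" "y \<in> carrier E" for x y
      using uniq[OF v Gadd[OF v v]] that by simp
    show "AE t in M. v (c \<odot>\<^bsub>E\<^esub> x) t = c * v x t" if "x \<in> carrier E" for c x
      using uniq[OF v Gsm[OF v]] that by simp
    show "AE t in M. v x t = f t" if "(x, f) \<in> G0" for x f
      using uniq[OF v] that G Gc by blast
  qed
qed

text \<open>Over a one-point space with counting measure, functions are numbers and almost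
  everywhere means everywhere.\<close>

corollary hahn_banach_real:
  assumes E: "module real_ring E" and q: "sublinear E q"
    and G0: "G0 \<noteq> {}" "G0 \<subseteq> carrier E \<times> UNIV"
      "\<And>x a y b. (x, a) \<in> G0 \<Longrightarrow> (y, b) \<in> G0 \<Longrightarrow> (x \<oplus>\<^bsub>E\<^esub> y, a + b) \<in> G0"
      "\<And>c x a. (x, a) \<in> G0 \<Longrightarrow> (c \<odot>\<^bsub>E\<^esub> x, c * a) \<in> G0"
      "\<And>x a. (x, a) \<in> G0 \<Longrightarrow> a \<le> q x"
  obtains \<phi> :: "'e \<Rightarrow> real" where "\<And>x. x \<in> carrier E \<Longrightarrow> \<phi> x \<le> q x"
    "\<And>x y. x \<in> carrier E \<Longrightarrow> y \<in> carrier E \<Longrightarrow> \<phi> (x \<oplus>\<^bsub>E\<^esub> y) = \<phi> x + \<phi> y"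
    "\<And>c x. x \<in> carrier E \<Longrightarrow> \<phi> (c \<odot>\<^bsub>E\<^esub> x) = c * \<phi> x"
    "\<And>x a. (x, a) \<in> G0 \<Longrightarrow> \<phi> x = a"
proof -
  let ?M = "count_space (UNIV :: unit set)"
  let ?G = "(\<lambda>(x, a). (x, \<lambda>_::unit. a)) ` G0"
  have mem: "(x, f) \<in> ?G \<longleftrightarrow> (x, f ()) \<in> G0" for x f
    by (auto simp: image_iff intro!: bexI[of _ "(x, f ())"])
  have G: "dominated_graph E ?M q ?G"
    unfolding dominated_graph_def mem using G0 by (auto simp: AE_count_space)
  obtain v where v: "\<And>x. x \<in> carrier E \<Longrightarrow> AE t in ?M. v x t \<le> q x"
    "\<And>x y. x \<in> carrier E \<Longrightarrow> y \<in> carrier E \<Longrightarrow> AE t in ?M. v (x \<oplus>\<^bsub>E\<^esub> y) t = v x t + v y t"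
    "\<And>c x. x \<in> carrier E \<Longrightarrow> AE t in ?M. v (c \<odot>\<^bsub>E\<^esub> x) t = c * v x t"
    "\<And>x f. (x, f) \<in> ?G \<Longrightarrow> AE t in ?M. v x t = f t"
    by (rule hahn_banach_AE[OF E dedekind_complete_count_space q G]) blast
  show thesis
    by (rule that[of "\<lambda>x. v x ()"]) (use v in \<open>force simp: AE_count_space\<close>)+
qed

section \<open>The seminorms of \<open>L\<^sup>q\<close>\<close>

lemma exponent_cases:
  fixes q :: ennreal
  assumes "1 \<le> q"
  obtains "q = top_class.top" | r where "q = ennreal r" "1 \<le> r"
proof (cases q)
  case (real r)
  then have "1 \<le> r" using assms by (metis ennreal_1 ennreal_le_iff)
  with real show ?thesis using that by auto
qed (use that in auto)

lemma conjugate_exponent_cases: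
  fixes p p' :: ennreal
  assumes p: "1 \<le> p" and pp: "1 / p + 1 / p' = 1"
  obtains "p = 1" "p' = top_class.top" | "p = top_class.top" "p' = 1"
    | r s where "p = ennreal r" "p' = ennreal s" "1 < r" "1 < s" "1 / r + 1 / s = 1"
  using p
proof (cases p rule: exponent_cases)
  case 1
  then have "1 / p' = 1" using pp by simp
  then have "p' = 1" by (simp add: divide_eq_1_ennreal)
  with 1 show ?thesis using that by auto
next
  case (2 r)
  have p1: "1 / p = ennreal (1 / r)"
    using 2 by (metis divide_ennreal ennreal_1 less_le_trans zero_le_one zero_less_one)
  show ?thesis
  proof (cases p')
    case (real s)
    \<comment> \<open>In \<open>ennreal\<close> the quotient 1 / 0 is infinite, which the equation
      between the reciprocals excludes.\<close>
    have "s \<noteq> 0" using pp real by (auto simp: ennreal_divide_eq_top_iff divide_ennreal_def)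
    then have s: "s > 0" using real by auto
    then have "1 / p' = ennreal (1 / s)" using real by (metis divide_ennreal ennreal_1 zero_le_one)
    then have "ennreal (1 / r + 1 / s) = ennreal 1"
      using pp p1 2 s by (simp add: ennreal_plus)
    then have rs: "1 / r + 1 / s = 1" using 2 s
      by (subst (asm) ennreal_inj) (auto intro: add_nonneg_nonneg)
    have "1 / r < 1" using rs s by (smt (verit) zero_less_divide_1_iff)
    then have r: "1 < r" using 2 by (simp add: field_simps)
    have "1 / s < 1" using rs r by (smt (verit) zero_less_divide_1_iff)
    then have "1 < s" using s by (simp add: field_simps)
    with rs r show ?thesis using that(3) real 2 by auto
  next
    case top
    then have "ennreal (1 / r) = ennreal 1" using pp p1 by simp
    then have "r = 1" using 2 by (subst (asm) ennreal_inj) auto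
    with top 2 show ?thesis using that by auto
  qed
qed

lemma conjugate_exponent_ge_1:
  fixes p p' :: ennreal
  assumes "1 \<le> p" "1 / p + 1 / p' = 1"
  shows "1 \<le> p'"
  by (cases rule: conjugate_exponent_cases[OF assms]) (auto simp flip: ennreal_1)

text \<open>If one argument is 0, the claim reads (b z)^r \<le> b z^r and follows from b^r \<le> b
  for b in [0, 1].\<close>

lemma convex_powr_nonneg:
  fixes x y :: real
  assumes "0 \<le> x" "0 \<le> y" "0 \<le> a" "a \<le> 1" "1 \<le> r"
  shows "(a * x + (1 - a) * y) powr r \<le> a * x powr r + (1 - a) * y powr r"
proof -
  have sc: "(b * z) powr r \<le> b * z powr r" if "0 \<le> b" "b \<le> 1" "0 \<le> z" for b z :: real
  proof -
    have "b powr r \<le> b powr 1"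
    proof (cases "b = 0")
      case False
      then show ?thesis using that assms by (intro powr_mono') auto
    qed (use assms in auto)
    then have "b powr r * z powr r \<le> b * z powr r" using that by (intro mult_right_mono) auto
    then show ?thesis using that by (simp add: powr_mult)
  qed
  consider "x = 0" | "y = 0" | "x > 0" "y > 0" using assms by linarith
  then show ?thesis
  proof cases
    case 3
    then show ?thesis
      using convex_onD[OF powr_convex[OF assms(5)], of "1 - a" x y] assms by (simp add: algebra_simps)
  qed (use sc[of a x] sc[of "1 - a" y] assms in \<open>auto\<close>)
qed

section \<open>The seminorm of Lq and Minkowski's inequality\<close>

lemma Lq_norm_real:
  "1 \<le> r \<Longrightarrow> Lq_norm (ennreal r) M f = (\<integral>x. \<bar>f x\<bar> powr r \<partial>M) powr (1 / r)"
  by (simp add: Lq_norm_def)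

lemma Lq_fun_real:
  "1 \<le> r \<Longrightarrow> f \<in> Lq_fun (ennreal r) M \<longleftrightarrow> f \<in> borel_measurable M \<and> integrable M (\<lambda>x. \<bar>f x\<bar> powr r)"
  by (simp add: Lq_fun_def)

lemma Lq_fun_top:
  "f \<in> Lq_fun top_class.top M \<longleftrightarrow> f \<in> borel_measurable M \<and> (\<exists>c. AE x in M. \<bar>f x\<bar> \<le> c)"
  by (simp add: Lq_fun_def)

lemma Lq_fun_measurable [measurable_dest]: "f \<in> Lq_fun q M \<Longrightarrow> f \<in> borel_measurable M"
  by (simp add: Lq_fun_def)

lemma Lq_norm_cong_AE:
  assumes "AE x in M. f x = g x" "f \<in> borel_measurable M" "g \<in> borel_measurable M"
  shows "Lq_norm q M f = Lq_norm q M g"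
proof -
  have "(AE x in M. \<bar>f x\<bar> \<le> c) \<longleftrightarrow> (AE x in M. \<bar>g x\<bar> \<le> c)" for c
    by (rule eventually_cong[OF assms(1)]) auto
  moreover have "(\<integral>x. \<bar>f x\<bar> powr enn2real q \<partial>M) = (\<integral>x. \<bar>g x\<bar> powr enn2real q \<partial>M)"
    using assms by (intro integral_cong_AE) auto
  ultimately show ?thesis by (simp add: Lq_norm_def)
qed

lemma Linf_norm_le: "AE x in M. \<bar>f x\<bar> \<le> c \<Longrightarrow> 0 \<le> c \<Longrightarrow> Lq_norm top_class.top M f \<le> c"
  unfolding Lq_norm_def by (auto intro!: cInf_lower bdd_belowI[of _ 0])

text \<open>The infimum that defines the essential supremum is attained: the bound increased by
  1/(n+1) holds off a null set for every n, and countably many null sets are discarded.\<close>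

lemma Linf_norm_AE:
  assumes "f \<in> Lq_fun top_class.top M"
  shows "AE x in M. \<bar>f x\<bar> \<le> Lq_norm top_class.top M f"
proof -
  define C where "C = {c. 0 \<le> c \<and> (AE x in M. \<bar>f x\<bar> \<le> c)}"
  obtain c where c: "AE x in M. \<bar>f x\<bar> \<le> c" using assms by (auto simp: Lq_fun_top)
  then have "max 0 c \<in> C" by (auto simp: C_def elim!: eventually_mono)
  then have ne: "C \<noteq> {}" by auto
  have N: "Lq_norm top_class.top M f = Inf C" by (simp add: Lq_norm_def C_def)
  have "AE x in M. \<forall>n. \<bar>f x\<bar> \<le> Inf C + inverse (real (Suc n))"
    unfolding AE_all_countable
  proof
    fix n
    obtain c where "c \<in> C" "c < Inf C + inverse (real (Suc n))"
      using cInf_lessD[OF ne, of "Inf C + inverse (real (Suc n))"] by auto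
    then show "AE x in M. \<bar>f x\<bar> \<le> Inf C + inverse (real (Suc n))"
      by (auto simp: C_def elim!: eventually_mono)
  qed
  then show ?thesis
  proof eventually_elim
    case (elim x)
    have "(\<lambda>n. Inf C + inverse (real (Suc n))) \<longlonglongrightarrow> Inf C"
      by (rule LIMSEQ_inverse_real_of_nat_add)
    then show ?case unfolding N using elim by (intro LIMSEQ_le_const) auto
  qed
qed

lemma Lq_norm_nonneg: "f \<in> Lq_fun q M \<Longrightarrow> 0 \<le> Lq_norm q M f"
proof (cases "q = top_class.top")
  case True
  assume f: "f \<in> Lq_fun q M"
  obtain c where "AE x in M. \<bar>f x\<bar> \<le> c" using f True by (auto simp: Lq_fun_top)
  then have "max 0 c \<in> {c. 0 \<le> c \<and> (AE x in M. \<bar>f x\<bar> \<le> c)}" by (auto elim!: eventually_mono)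
  then show ?thesis using True unfolding Lq_norm_def by (auto intro!: cInf_greatest)
qed (simp add: Lq_norm_def)

lemma Lq_norm_powr:
  assumes "1 \<le> r" shows "Lq_norm (ennreal r) M f powr r = (\<integral>x. \<bar>f x\<bar> powr r \<partial>M)"
  using assms by (simp add: Lq_norm_real powr_powr)

lemma Lq_norm_real_le:
  assumes "1 \<le> r" "0 \<le> c" "(\<integral>x. \<bar>f x\<bar> powr r \<partial>M) \<le> c powr r"
  shows "Lq_norm (ennreal r) M f \<le> c"
proof -
  have "(\<integral>x. \<bar>f x\<bar> powr r \<partial>M) powr (1 / r) \<le> (c powr r) powr (1 / r)"
    using assms by (intro powr_mono2) auto
  then show ?thesis using assms by (simp add: Lq_norm_real powr_powr)
qed

lemma Lq_fun_scale:
  assumes q: "1 \<le> q" and f: "f \<in> Lq_fun q M"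
  shows "(\<lambda>x. c * f x) \<in> Lq_fun q M" and "Lq_norm q M (\<lambda>x. c * f x) = \<bar>c\<bar> * Lq_norm q M f"
proof -
  have [measurable]: "f \<in> borel_measurable M" using f by measurable
  have "(\<lambda>x. c * f x) \<in> Lq_fun q M \<and> Lq_norm q M (\<lambda>x. c * f x) = \<bar>c\<bar> * Lq_norm q M f"
    using q
  proof (cases q rule: exponent_cases)
    case 1
    have mem: "(\<lambda>x. c * f x) \<in> Lq_fun top_class.top M" for c
    proof -
      have "AE x in M. \<bar>c * f x\<bar> \<le> \<bar>c\<bar> * Lq_norm top_class.top M f"
        using Linf_norm_AE[OF f[unfolded 1]]
        by eventually_elim (simp add: abs_mult mult_left_mono)
      then show ?thesis by (auto simp: Lq_fun_top)
    qed
    have le: "Lq_norm top_class.top M (\<lambda>x. c * f x) \<le> \<bar>c\<bar> * Lq_norm top_class.top M f" if "f \<in> Lq_fun top_class.top M" for c f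
      using Linf_norm_AE[OF that] Lq_norm_nonneg[OF that]
      by (intro Linf_norm_le) (auto elim!: eventually_mono simp: abs_mult mult_left_mono)
    have "\<bar>c\<bar> * Lq_norm top_class.top M f \<le> Lq_norm top_class.top M (\<lambda>x. c * f x)"
    proof (cases "c = 0")
      case True then show ?thesis using Lq_norm_nonneg[OF mem[of c]] by simp
    next
      case False
      then show ?thesis using le[OF mem[of c], of "1 / c"] by (simp add: field_simps)
    qed
    then show ?thesis using le[of f c] mem[of c] f 1 by auto
  next
    case (2 r)
    then show ?thesis using f
      by (auto simp: Lq_fun_real Lq_norm_real abs_mult powr_mult powr_powr)
  qed
  then show "(\<lambda>x. c * f x) \<in> Lq_fun q M" "Lq_norm q M (\<lambda>x. c * f x) = \<bar>c\<bar> * Lq_norm q M f" by auto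
qed

text \<open>Minkowski's inequality. For a finite exponent r, the function |f + g| / (a + b) is at
  most a convex combination of |f| / a and |g| / b with weights proportional to a and b. Convexity
  of the r-th power then bounds the integral of its r-th power by 1 once a and b are at least the
  two norms.\<close>

lemma Lq_fun_add:
  assumes q: "1 \<le> q" and f: "f \<in> Lq_fun q M" and g: "g \<in> Lq_fun q M"
  shows "(\<lambda>x. f x + g x) \<in> Lq_fun q M"
    and "Lq_norm q M (\<lambda>x. f x + g x) \<le> Lq_norm q M f + Lq_norm q M g"
proof -
  have [measurable]: "f \<in> borel_measurable M" "g \<in> borel_measurable M" using f g by measurable
  have "(\<lambda>x. f x + g x) \<in> Lq_fun q M \<and> Lq_norm q M (\<lambda>x. f x + g x) \<le> Lq_norm q M f + Lq_norm q M g"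
    using q
  proof (cases q rule: exponent_cases)
    case 1
    have "AE x in M. \<bar>f x + g x\<bar> \<le> Lq_norm top_class.top M f + Lq_norm top_class.top M g"
      using Linf_norm_AE[OF f[unfolded 1]] Linf_norm_AE[OF g[unfolded 1]] by eventually_elim auto
    then show ?thesis using Lq_norm_nonneg[OF f] Lq_norm_nonneg[OF g] 1
      by (auto simp: Lq_fun_top intro!: Linf_norm_le)
  next
    case (2 r)
    have fi: "integrable M (\<lambda>x. \<bar>f x\<bar> powr r)" and gi: "integrable M (\<lambda>x. \<bar>g x\<bar> powr r)"
      using f g 2 by (auto simp: Lq_fun_real)
    have pt: "\<bar>f x + g x\<bar> powr r \<le> (a + b) powr r *
        (a / (a + b) * (\<bar>f x\<bar> powr r / a powr r) + b / (a + b) * (\<bar>g x\<bar> powr r / b powr r))"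
      if ab: "a > 0" "b > 0" for a b x
    proof -
      define l where "l = a / (a + b)"
      have l: "0 \<le> l" "l \<le> 1" "1 - l = b / (a + b)" using ab by (auto simp: l_def field_simps)
      have "(a + b) * (l * (\<bar>f x\<bar> / a)) = \<bar>f x\<bar>" using ab by (simp add: l_def)
      moreover have "(a + b) * ((1 - l) * (\<bar>g x\<bar> / b)) = \<bar>g x\<bar>" using ab by (simp add: l(3))
      ultimately have "\<bar>f x + g x\<bar> \<le> (a + b) * (l * (\<bar>f x\<bar> / a) + (1 - l) * (\<bar>g x\<bar> / b))"
        using abs_triangle_ineq[of "f x" "g x"] unfolding distrib_left by simp
      then have "\<bar>f x + g x\<bar> powr r \<le> ((a + b) * (l * (\<bar>f x\<bar> / a) + (1 - l) * (\<bar>g x\<bar> / b))) powr r"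
        using 2 by (intro powr_mono2) auto
      also have "\<dots> = (a + b) powr r * (l * (\<bar>f x\<bar> / a) + (1 - l) * (\<bar>g x\<bar> / b)) powr r"
        using ab l by (intro powr_mult) 
      also have "\<dots> \<le> (a + b) powr r * (l * (\<bar>f x\<bar> / a) powr r + (1 - l) * (\<bar>g x\<bar> / b) powr r)"
        using convex_powr_nonneg[of "\<bar>f x\<bar> / a" "\<bar>g x\<bar> / b" l r] ab l 2 by (intro mult_left_mono) auto
      finally show ?thesis using ab l by (simp add: l_def powr_divide)
    qed
    \<comment> \<open>The pointwise bound with a = b = 1 already yields integrability.\<close>
    have int: "integrable M (\<lambda>x. \<bar>f x + g x\<bar> powr r)"
      by (rule Bochner_Integration.integrable_bound[where f="\<lambda>x. (1 + 1) powr r *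
        (1 / (1 + 1) * (\<bar>f x\<bar> powr r / 1 powr r) + 1 / (1 + 1) * (\<bar>g x\<bar> powr r / 1 powr r))"])
        (use fi gi pt[of 1 1] in \<open>auto intro!: AE_I2\<close>)
    have "Lq_norm q M (\<lambda>x. f x + g x) \<le> Lq_norm q M f + Lq_norm q M g + e" if e: "e > 0" for e
    proof -
      \<comment> \<open>The surplus e / 2 keeps both divisors positive when a norm vanishes.\<close>
      define a where "a = Lq_norm q M f + e / 2"
      define b where "b = Lq_norm q M g + e / 2"
      have ab: "a > 0" "b > 0" using e Lq_norm_nonneg[OF f] Lq_norm_nonneg[OF g] by (auto simp: a_def b_def)
      have "(\<integral>x. \<bar>h x\<bar> powr r \<partial>M) / (Lq_norm q M h + e / 2) powr r \<le> 1" if "h \<in> Lq_fun q M" for h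
      proof -
        have "(\<integral>x. \<bar>h x\<bar> powr r \<partial>M) \<le> (Lq_norm q M h + e / 2) powr r"
          using 2 e Lq_norm_nonneg[OF that] by (simp add: Lq_norm_powr[symmetric] powr_mono2)
        then show ?thesis by (simp add: divide_le_eq_1)
      qed
      then have fa: "(\<integral>x. \<bar>f x\<bar> powr r \<partial>M) / a powr r \<le> 1" and gb: "(\<integral>x. \<bar>g x\<bar> powr r \<partial>M) / b powr r \<le> 1"
        using f g by (auto simp: a_def b_def)
      have "(\<integral>x. \<bar>f x + g x\<bar> powr r \<partial>M) \<le> (\<integral>x. (a + b) powr r *
          (a / (a + b) * (\<bar>f x\<bar> powr r / a powr r) + b / (a + b) * (\<bar>g x\<bar> powr r / b powr r)) \<partial>M)"
        using int fi gi pt[OF ab] by (intro integral_mono) auto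
      also have "\<dots> = (a + b) powr r * (a / (a + b) * ((\<integral>x. \<bar>f x\<bar> powr r \<partial>M) / a powr r) +
          b / (a + b) * ((\<integral>x. \<bar>g x\<bar> powr r \<partial>M) / b powr r))"
        using fi gi by simp
      also have "\<dots> \<le> (a + b) powr r * (a / (a + b) * 1 + b / (a + b) * 1)"
        using fa gb ab by (intro mult_left_mono add_mono) auto
      also have "\<dots> = (a + b) powr r" using ab by (simp add: add_divide_distrib[symmetric])
      finally have "Lq_norm q M (\<lambda>x. f x + g x) \<le> a + b"
        using 2 ab by (auto intro!: Lq_norm_real_le)
      then show ?thesis by (simp add: a_def b_def)
    qed
    then have "Lq_norm q M (\<lambda>x. f x + g x) \<le> Lq_norm q M f + Lq_norm q M g"
      by (rule field_le_epsilon)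
    then show ?thesis using int 2 by (auto simp: Lq_fun_real)
  qed
  then show "(\<lambda>x. f x + g x) \<in> Lq_fun q M"
    "Lq_norm q M (\<lambda>x. f x + g x) \<le> Lq_norm q M f + Lq_norm q M g" by auto
qed

lemma Lq_fun_zero: "(\<lambda>_. 0) \<in> Lq_fun q M"
  by (auto simp: Lq_fun_def)

lemma Lq_norm_eq_0:
  assumes q: "1 \<le> q" and f: "f \<in> Lq_fun q M"
  shows "Lq_norm q M f = 0 \<longleftrightarrow> (AE x in M. f x = 0)"
proof
  have [measurable]: "f \<in> borel_measurable M" using f by measurable
  assume "AE x in M. f x = 0"
  then have "Lq_norm q M f = Lq_norm q M (\<lambda>x. 0 * f x)" by (intro Lq_norm_cong_AE) auto
  then show "Lq_norm q M f = 0" using Lq_fun_scale(2)[OF q f, of 0] by simp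
next
  assume 0: "Lq_norm q M f = 0"
  show "AE x in M. f x = 0" using q
  proof (cases q rule: exponent_cases)
    case 1 then show ?thesis using Linf_norm_AE[of f M] f 0 by auto
  next
    case (2 r)
    then have "(\<integral>x. \<bar>f x\<bar> powr r \<partial>M) = 0" using Lq_norm_powr[of r M f] 0 by simp
    then have "AE x in M. \<bar>f x\<bar> powr r = 0"
      using f 2 by (subst (asm) integral_nonneg_eq_0_iff_AE) (auto simp: Lq_fun_real)
    then show ?thesis by simp
  qed
qed

text \<open>For 1 < p < \<infinity>, Young's inequality for |f| / a and |g| / b is integrated with a
  and b slightly above the two norms; since 1/r + 1/s = 1, the result is a b. The endpoint cases are
  the estimate by the essential supremum, with the roles of f and g exchanged for p =
  \<infinity>.\<close>

lemma Holder_integral: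
  assumes p: "1 \<le> p" and pp: "1 / p + 1 / p' = 1"
    and f: "f \<in> Lq_fun p M" and g: "g \<in> Lq_fun p' M"
  shows "integrable M (\<lambda>x. f x * g x)"
    and "(\<integral>x. \<bar>f x * g x\<bar> \<partial>M) \<le> Lq_norm p M f * Lq_norm p' M g"
proof -
  have inf: "integrable M (\<lambda>x. f x * g x) \<and> (\<integral>x. \<bar>f x * g x\<bar> \<partial>M) \<le> Lq_norm 1 M f * Lq_norm top_class.top M g"
    if f: "f \<in> Lq_fun 1 M" and g: "g \<in> Lq_fun top_class.top M" for f g
  proof -
    have [measurable]: "f \<in> borel_measurable M" "g \<in> borel_measurable M" using f g by measurable
    have fi: "integrable M f"
      using f Lq_fun_real[of 1 f M] by (simp add: integrable_abs_iff)
    have le: "AE x in M. \<bar>f x * g x\<bar> \<le> \<bar>f x\<bar> * Lq_norm top_class.top M g"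
      using Linf_norm_AE[OF g] by eventually_elim (auto simp: abs_mult mult_left_mono)
    have i: "integrable M (\<lambda>x. f x * g x)"
      by (rule Bochner_Integration.integrable_bound[where f="\<lambda>x. \<bar>f x\<bar> * Lq_norm top_class.top M g"])
        (use fi le Lq_norm_nonneg[OF g] in \<open>auto\<close>)
    have "(\<integral>x. \<bar>f x * g x\<bar> \<partial>M) \<le> (\<integral>x. \<bar>f x\<bar> * Lq_norm top_class.top M g \<partial>M)"
      using i fi le by (intro integral_mono_AE) auto
    also have "\<dots> = Lq_norm 1 M f * Lq_norm top_class.top M g"
      using Lq_norm_real[of 1 M f] by simp
    finally show ?thesis using i by auto
  qed
  have [measurable]: "f \<in> borel_measurable M" "g \<in> borel_measurable M" using f g by measurable
  have "integrable M (\<lambda>x. f x * g x) \<and> (\<integral>x. \<bar>f x * g x\<bar> \<partial>M) \<le> Lq_norm p M f * Lq_norm p' M g"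
    using p pp
  proof (cases rule: conjugate_exponent_cases)
    case 1 then show ?thesis using inf f g by auto
  next
    case 2 then show ?thesis using inf[of g f] f g by (auto simp: mult.commute)
  next
    case (3 r s)
    have fi: "integrable M (\<lambda>x. \<bar>f x\<bar> powr r)" and gi: "integrable M (\<lambda>x. \<bar>g x\<bar> powr s)"
      using f g 3 by (auto simp: Lq_fun_real)
    have pt: "\<bar>f x * g x\<bar> \<le> a * b * (\<bar>f x\<bar> powr r / a powr r / r + \<bar>g x\<bar> powr s / b powr s / s)"
      if ab: "a > 0" "b > 0" for a b x
    proof -
      have "(\<bar>f x\<bar> / a) * (\<bar>g x\<bar> / b) \<le> (\<bar>f x\<bar> / a) powr r / r + (\<bar>g x\<bar> / b) powr s / s"
        using 3 ab by (intro Youngs_inequality) auto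
      then have "a * b * ((\<bar>f x\<bar> / a) * (\<bar>g x\<bar> / b)) \<le> a * b * ((\<bar>f x\<bar> / a) powr r / r + (\<bar>g x\<bar> / b) powr s / s)"
        using ab by (intro mult_left_mono) auto
      then show ?thesis using ab by (simp add: powr_divide abs_mult)
    qed
    have int: "integrable M (\<lambda>x. f x * g x)"
      by (rule Bochner_Integration.integrable_bound[where f="\<lambda>x. 1 * 1 *
          (\<bar>f x\<bar> powr r / 1 powr r / r + \<bar>g x\<bar> powr s / 1 powr s / s)"])
        (use fi gi 3 pt[of 1 1] in \<open>auto intro!: AE_I2\<close>)
    have "(\<integral>x. \<bar>f x * g x\<bar> \<partial>M) \<le> (Lq_norm p M f + e) * (Lq_norm p' M g + e)" if e: "e > 0" for e
    proof -
      define a where "a = Lq_norm p M f + e"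
      define b where "b = Lq_norm p' M g + e"
      have ab: "a > 0" "b > 0" using e Lq_norm_nonneg[OF f] Lq_norm_nonneg[OF g] by (auto simp: a_def b_def)
      have *: "(\<integral>x. \<bar>h x\<bar> powr t \<partial>M) / (Lq_norm (ennreal t) M h + e) powr t \<le> 1"
        if "h \<in> Lq_fun (ennreal t) M" "1 < t" for h t
      proof -
        have "(\<integral>x. \<bar>h x\<bar> powr t \<partial>M) \<le> (Lq_norm (ennreal t) M h + e) powr t"
          using that(2) e Lq_norm_nonneg[OF that(1)] by (simp add: Lq_norm_powr[symmetric] powr_mono2)
        then show ?thesis by (simp add: divide_le_eq_1)
      qed
      have fa: "(\<integral>x. \<bar>f x\<bar> powr r \<partial>M) / a powr r \<le> 1" and gb: "(\<integral>x. \<bar>g x\<bar> powr s \<partial>M) / b powr s \<le> 1"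
        using *[of f r] *[of g s] f g 3 by (auto simp: a_def b_def)
      have "(\<integral>x. \<bar>f x * g x\<bar> \<partial>M) \<le> (\<integral>x. a * b * (\<bar>f x\<bar> powr r / a powr r / r + \<bar>g x\<bar> powr s / b powr s / s) \<partial>M)"
        using int fi gi pt[OF ab] by (intro integral_mono) auto
      also have "\<dots> = a * b * ((\<integral>x. \<bar>f x\<bar> powr r \<partial>M) / a powr r / r + (\<integral>x. \<bar>g x\<bar> powr s \<partial>M) / b powr s / s)"
        using fi gi by simp
      also have "\<dots> \<le> a * b * (1 / r + 1 / s)"
        using fa gb ab 3 by (intro mult_left_mono add_mono divide_right_mono) auto
      also have "\<dots> = a * b" using 3 by simp
      finally show ?thesis by (simp add: a_def b_def)
    qed
    \<comment> \<open>The surplus e enters a product of norms, so it is removed by a limit and not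
      by an additive epsilon.\<close>
    moreover have "((\<lambda>e. (Lq_norm p M f + e) * (Lq_norm p' M g + e)) \<longlongrightarrow>
        (Lq_norm p M f + 0) * (Lq_norm p' M g + 0)) (at_right 0)"
      by (intro tendsto_intros)
    ultimately have "(\<integral>x. \<bar>f x * g x\<bar> \<partial>M) \<le> (Lq_norm p M f + 0) * (Lq_norm p' M g + 0)"
      by (intro tendsto_lowerbound[where F="at_right 0"])
        (auto simp: eventually_at_right_less eventually_at_topological)
    then show ?thesis using int by simp
  qed
  then show "integrable M (\<lambda>x. f x * g x)"
    "(\<integral>x. \<bar>f x * g x\<bar> \<partial>M) \<le> Lq_norm p M f * Lq_norm p' M g" by auto
qed

section \<open>The spaces \<open>\<ell>\<^sup>p\<^sub>n\<close> and step functions\<close>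

lemma lp_simps [simp]:
  "carrier (lp p n) = {..<n} \<rightarrow>\<^sub>E UNIV" "\<zero>\<^bsub>lp p n\<^esub> = (\<lambda>j\<in>{..<n}. 0)"
  "a \<oplus>\<^bsub>lp p n\<^esub> b = (\<lambda>j\<in>{..<n}. a j + b j)" "c \<odot>\<^bsub>lp p n\<^esub> a = (\<lambda>j\<in>{..<n}. c * a j)"
  by (simp_all add: lp_def)

lemma Lq_fun_finite: "1 \<le> q \<Longrightarrow> a \<in> Lq_fun q (count_space {..<n::nat})"
  by (cases q rule: exponent_cases)
    (auto simp: Lq_fun_top Lq_fun_real AE_count_space integrable_count_space intro!: exI[of _ "Max ((\<lambda>j. \<bar>a j\<bar>) ` {..<n})"])

text \<open>Through this identification the triangle inequality and Hoelder's inequality for tuples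
  are inherited from counting measure. For p = \<infinity> the maximum needs a nonempty index set,
  hence n \<ge> 1.\<close>

lemma lp_norm_eq_Lq:
  assumes p: "1 \<le> p" and n: "1 \<le> n"
  shows "nrm (lp p n) a = Lq_norm p (count_space {..<n}) a"
  using p
proof (cases p rule: exponent_cases)
  case 1
  have "nrm (lp p n) a = Max ((\<lambda>j. \<bar>a j\<bar>) ` {..<n})" using 1 by (simp add: lp_def)
  also have "\<dots> = Lq_norm top_class.top (count_space {..<n}) a"
  proof (rule antisym)
    have "\<forall>j\<in>{..<n}. \<bar>a j\<bar> \<le> Lq_norm top_class.top (count_space {..<n}) a"
      using Linf_norm_AE[OF Lq_fun_finite[of top_class.top a n]] by (simp add: AE_count_space)
    then show "Max ((\<lambda>j. \<bar>a j\<bar>) ` {..<n}) \<le> Lq_norm top_class.top (count_space {..<n}) a"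
      using n by (subst Max_le_iff) (auto simp: lessThan_empty_iff)
    have *: "\<bar>a j\<bar> \<le> Max ((\<lambda>j. \<bar>a j\<bar>) ` {..<n})" if "j < n" for j using that by (intro Max_ge) auto
    show "Lq_norm top_class.top (count_space {..<n}) a \<le> Max ((\<lambda>j. \<bar>a j\<bar>) ` {..<n})"
      using order_trans[OF abs_ge_zero *[of 0]] n by (intro Linf_norm_le) (auto simp: AE_count_space *)
  qed
  finally show ?thesis using 1 by simp
next
  case (2 r)
  then show ?thesis
    by (simp add: lp_def Lq_norm_real lebesgue_integral_count_space_finite)
qed

context
  fixes p :: ennreal and n :: nat
  assumes p: "1 \<le> p" and n: "1 \<le> n"
begin

lemma lp_norm_nonneg: "0 \<le> nrm (lp p n) a"
  using Lq_norm_nonneg[OF Lq_fun_finite[OF p]] by (simp add: lp_norm_eq_Lq[OF p n])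

lemma lp_norm_scale: "nrm (lp p n) (\<lambda>j. c * a j) = \<bar>c\<bar> * nrm (lp p n) a"
  using Lq_fun_scale(2)[OF p Lq_fun_finite[OF p]] by (simp add: lp_norm_eq_Lq[OF p n])

lemma lp_norm_cong: "(\<And>j. j < n \<Longrightarrow> a j = b j) \<Longrightarrow> nrm (lp p n) a = nrm (lp p n) b"
  unfolding lp_norm_eq_Lq[OF p n] by (rule Lq_norm_cong_AE) (auto simp: AE_count_space)

lemma lp_norm_mono:
  assumes "\<And>j. j < n \<Longrightarrow> \<bar>a j\<bar> \<le> \<bar>b j\<bar>"
  shows "nrm (lp p n) a \<le> nrm (lp p n) b"
  using p
proof (cases p rule: exponent_cases)
  case 1
  have "AE j in count_space {..<n}. \<bar>b j\<bar> \<le> Lq_norm top_class.top (count_space {..<n}) b"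
    by (rule Linf_norm_AE[OF Lq_fun_finite]) simp
  then have "Lq_norm top_class.top (count_space {..<n}) a \<le> Lq_norm top_class.top (count_space {..<n}) b"
    using assms lp_norm_nonneg[of b] lp_norm_eq_Lq[OF p n, of b] 1
    by (intro Linf_norm_le) (auto simp: AE_count_space intro: order_trans)
  then show ?thesis unfolding lp_norm_eq_Lq[OF p n] using 1 by simp
next
  case (2 r)
  then show ?thesis using assms
    by (auto simp: lp_def intro!: powr_mono2 sum_mono sum_nonneg)
qed

lemma lp_norm_coord:
  assumes "j < n" shows "\<bar>a j\<bar> \<le> nrm (lp p n) a"
  using p
proof (cases p rule: exponent_cases)
  case 1 then show ?thesis using assms by (auto simp: lp_def intro!: Max_ge)
next
  case (2 r)
  have "\<bar>a j\<bar> = (\<bar>a j\<bar> powr r) powr (1 / r)" using 2 by (simp add: powr_powr)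
  also have "\<dots> \<le> (\<Sum>j<n. \<bar>a j\<bar> powr r) powr (1 / r)"
    using 2 assms by (intro powr_mono2 member_le_sum) auto
  finally show ?thesis using 2 by (simp add: lp_def)
qed

text \<open>With s the sum of the |a j|, each |a j|^r is at most |a j| s^(r-1), and summation gives
  s^r.\<close>

lemma lp_norm_sum_le: "nrm (lp p n) a \<le> (\<Sum>j<n. \<bar>a j\<bar>)"
  using p
proof (cases p rule: exponent_cases)
  case 1
  then show ?thesis using n
    by (auto simp: lp_def lessThan_empty_iff intro!: Max.boundedI member_le_sum[where f="\<lambda>j. \<bar>a j\<bar>"])
next
  case (2 r)
  define s where "s = (\<Sum>j<n. \<bar>a j\<bar>)"
  have s: "s \<ge> 0" by (auto simp: s_def intro: sum_nonneg)
  have "(\<Sum>j<n. \<bar>a j\<bar> powr r) \<le> s powr r"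
  proof (cases "s = 0")
    case True
    then have "a j = 0" if "j < n" for j using that by (simp add: s_def sum_nonneg_eq_0_iff)
    then show ?thesis by simp
  next
    case False
    have "\<bar>a j\<bar> powr r \<le> \<bar>a j\<bar> * s powr (r - 1)" if j: "j < n" for j
    proof (cases "a j = 0")
      case False
      have "\<bar>a j\<bar> \<le> s" using j unfolding s_def by (intro member_le_sum) auto
      then have "\<bar>a j\<bar> powr (r - 1) \<le> s powr (r - 1)" using 2 by (intro powr_mono2) auto
      moreover have "\<bar>a j\<bar> powr r = \<bar>a j\<bar> * \<bar>a j\<bar> powr (r - 1)"
        using False by (simp add: powr_mult_base)
      ultimately show ?thesis by (simp add: mult_left_mono)
    qed simp
    then have "(\<Sum>j<n. \<bar>a j\<bar> powr r) \<le> (\<Sum>j<n. \<bar>a j\<bar> * s powr (r - 1))" by (intro sum_mono) auto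
    also have "\<dots> = s * s powr (r - 1)" by (simp add: s_def sum_distrib_right)
    also have "\<dots> = s powr r" using s False by (simp add: powr_mult_base)
    finally show ?thesis .
  qed
  then have "(\<Sum>j<n. \<bar>a j\<bar> powr r) powr (1 / r) \<le> (s powr r) powr (1 / r)"
    using 2 by (intro powr_mono2 sum_nonneg) auto
  then show ?thesis using 2 s by (simp add: lp_def powr_powr s_def)
qed

end

lemma Holder_sum:
  assumes p: "1 \<le> p" "1 / p + 1 / p' = 1" and n: "1 \<le> n"
  shows "(\<Sum>j<n. \<bar>a j * b j\<bar>) \<le> nrm (lp p n) a * nrm (lp p' n) b"
  using Holder_integral(2)[OF p Lq_fun_finite[OF p(1), of a n] Lq_fun_finite[OF conjugate_exponent_ge_1[OF p], of b]]
  by (simp add: lp_norm_eq_Lq[OF p(1) n] lp_norm_eq_Lq[OF conjugate_exponent_ge_1[OF p] n]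
      lebesgue_integral_count_space_finite)

text \<open>These are the extremal vectors of Hoelder's inequality: all signs for p = 1, the sign at
  one coordinate of maximal modulus for p = \<infinity>, and otherwise sgn (a j) |a j|^(r-1) divided
  by the (r-1)-st power of the norm.\<close>

lemma lp_norming:
  assumes p: "1 \<le> p" "1 / p + 1 / p' = 1" and n: "1 \<le> n"
  obtains b where "nrm (lp p' n) b \<le> 1" "(\<Sum>j<n. a j * b j) = nrm (lp p n) a"
  using p
proof (cases rule: conjugate_exponent_cases)
  case 1
  show thesis
  proof (rule that[of "\<lambda>j. sgn (a j)"])
    show "nrm (lp p' n) (\<lambda>j. sgn (a j)) \<le> 1"
      using n 1 by (auto simp: lp_def lessThan_empty_iff abs_sgn_eq intro!: Max.boundedI)
    show "(\<Sum>j<n. a j * sgn (a j)) = nrm (lp p n) a"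
      using 1 by (simp add: lp_def abs_sgn[symmetric] sum_nonneg)
  qed
next
  case 2
  have "Max ((\<lambda>j. \<bar>a j\<bar>) ` {..<n}) \<in> (\<lambda>j. \<bar>a j\<bar>) ` {..<n}"
    using n by (intro Max_in) (auto simp: lessThan_empty_iff)
  then obtain k where k: "k < n" "nrm (lp p n) a = \<bar>a k\<bar>" using 2 by (auto simp: lp_def)
  show thesis
  proof (rule that[of "\<lambda>j. if j = k then sgn (a k) else 0"])
    have "(\<Sum>j<n. \<bar>if j = k then sgn (a k) else 0\<bar>) = \<bar>sgn (a k)\<bar>"
      using k by (subst sum.remove[of _ k]) auto
    then show "nrm (lp p' n) (\<lambda>j. if j = k then sgn (a k) else 0) \<le> 1"
      using 2 sum_nonneg[of "{..<n}" "\<lambda>j. \<bar>if j = k then sgn (a k) else 0\<bar>"]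
      by (auto simp: lp_def abs_sgn_eq)
    show "(\<Sum>j<n. a j * (if j = k then sgn (a k) else 0)) = nrm (lp p n) a"
      using k by (subst sum.remove[of _ k]) (auto simp: abs_sgn)
  qed
next
  case (3 r s)
  define A where "A = nrm (lp p n) a"
  have A0: "A \<ge> 0" using lp_norm_nonneg[OF p(1) n] by (simp add: A_def)
  have Ar: "A powr r = (\<Sum>j<n. \<bar>a j\<bar> powr r)"
    using 3 by (simp add: A_def lp_def powr_powr sum_nonneg)
  show thesis
  proof (cases "A = 0")
    case True
    show thesis
    proof (rule that[of "\<lambda>_. 0"])
      show "nrm (lp p' n) (\<lambda>_. 0) \<le> 1" using 3 by (simp add: lp_def)
    qed (use True in \<open>auto simp: A_def\<close>)
  next
    case False
    have rs: "(r - 1) * s = r" using 3 by (simp add: field_simps)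
    define b where "b j = sgn (a j) * \<bar>a j\<bar> powr (r - 1) / A powr (r - 1)" for j
    have ab: "a j * b j = \<bar>a j\<bar> powr r / A powr (r - 1)" for j
    proof (cases "a j = 0")
      case False
      have "a j * b j = \<bar>a j\<bar> * \<bar>a j\<bar> powr (r - 1) / A powr (r - 1)"
        by (simp add: b_def abs_sgn mult.assoc[symmetric])
      then show ?thesis using False by (simp add: powr_mult_base)
    qed (simp add: b_def)
    have bs: "\<bar>b j\<bar> powr s = \<bar>a j\<bar> powr r / A powr r" for j
    proof (cases "a j = 0")
      case False
      then have "\<bar>b j\<bar> = \<bar>a j\<bar> powr (r - 1) / A powr (r - 1)" by (simp add: b_def abs_mult abs_sgn_eq)
      then show ?thesis by (simp add: powr_divide powr_powr rs)
    qed (use 3 in \<open>simp add: b_def\<close>)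
    show thesis
    proof (rule that[of b])
      have "(\<Sum>j<n. \<bar>b j\<bar> powr s) = 1"
        using False A0 by (simp add: bs sum_divide_distrib[symmetric] Ar[symmetric])
      then show "nrm (lp p' n) b \<le> 1" using 3 by (simp add: lp_def)
      have "(\<Sum>j<n. a j * b j) = A powr r / A powr (r - 1)"
        by (simp add: ab Ar sum_divide_distrib[symmetric])
      also have "\<dots> = A" using False A0 by (simp add: powr_diff)
      finally show "(\<Sum>j<n. a j * b j) = nrm (lp p n) a" by (simp add: A_def)
    qed
  qed
qed

text \<open>Since \<open>0 powr 0 = 0\<close>, null sets have weight 0 even for \<open>q = \<infinity>\<close>.\<close>

definition wt :: "ennreal \<Rightarrow> 'a measure \<Rightarrow> 'a set \<Rightarrow> real" where
  "wt q M A = measure M A powr (1 / enn2real q)"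

lemma wt_nonneg: "0 \<le> wt q M A" by (simp add: wt_def)

lemma wt_eq_0: "wt q M A = 0 \<longleftrightarrow> measure M A = 0" by (simp add: wt_def)

text \<open>\<open>enn2real\<close> sends \<infinity> to 0 and 1 / 0 is 0, so for the infinite
  exponent a set of nonzero measure has weight 1 and the product is still the measure.\<close>

lemma wt_mult:
  assumes "1 \<le> p" "1 / p + 1 / p' = 1"
  shows "wt p M A * wt p' M A = measure M A"
proof (cases "measure M A = 0")
  case False
  then show ?thesis
    by (cases rule: conjugate_exponent_cases[OF assms]) (auto simp: wt_def powr_add[symmetric])
qed (simp add: wt_def)

abbreviation sint :: "'a measure \<Rightarrow> 'a set \<Rightarrow> ('a \<Rightarrow> real) \<Rightarrow> real" where
  "sint M A h \<equiv> (\<integral>x. indicator A x * h x \<partial>M)"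

section \<open>Step functions on finite partitions\<close>

lemma sum_indicator_disjoint:
  fixes f :: "nat \<Rightarrow> real"
  assumes "disjoint_family_on A {..<m}" "k < m" "x \<in> A k"
  shows "(\<Sum>j<m. f j * indicator (A j) x) = f k"
proof -
  have "indicator (A j) x = (0 :: real)" if "j < m" "j \<noteq> k" for j
    using assms that unfolding disjoint_family_on_def by (auto simp: indicator_def)
  then show ?thesis using assms by (subst sum.remove[of _ k]) auto
qed

lemma sum_indicator_outside:
  fixes f :: "nat \<Rightarrow> real"
  shows "x \<notin> (\<Union>k<m. A k) \<Longrightarrow> (\<Sum>j<m. f j * indicator (A j) x) = 0"
  by (intro sum.neutral) auto

text \<open>Indicators of disjoint sets divided by their weights span an isometric copy of an
  \<open>\<ell>\<^sup>q\<close> space; null sets drop out on both sides. This is the bridge by which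
  estimates for functions become estimates for matrices between \<open>\<ell>\<^sup>q\<close>
  spaces.\<close>

lemma step_function_norm:
  assumes q: "1 \<le> q" and m: "1 \<le> m"
    and A: "disjoint_family_on A {..<m}" "\<And>k. k < m \<Longrightarrow> A k \<in> fmeasurable M"
  shows "(\<lambda>x. \<Sum>k<m. c k * indicator (A k) x) \<in> Lq_fun q M" (is "?g \<in> _")
    and "Lq_norm q M (\<lambda>x. \<Sum>k<m. c k * indicator (A k) x) = nrm (lp q m) (\<lambda>k. wt q M (A k) * c k)"
proof -
  have Am: "A k \<in> sets M" and Af: "emeasure M (A k) < top_class.top" if "k < m" for k
    using A(2)[OF that] by (auto simp: fmeasurable_def)
  have gm [measurable]: "?g \<in> borel_measurable M"
    by (intro borel_measurable_sum borel_measurable_times borel_measurable_const borel_measurable_indicator) (simp add: Am)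
  have "?g \<in> Lq_fun q M \<and> Lq_norm q M ?g = nrm (lp q m) (\<lambda>k. wt q M (A k) * c k)"
    using q
  proof (cases q rule: exponent_cases)
    case 1
    have wt1: "wt q M B = (if measure M B = 0 then 0 else 1)" for B using 1 by (simp add: wt_def)
    have lpm: "nrm (lp q m) (\<lambda>k. wt q M (A k) * c k) = Max ((\<lambda>k. \<bar>wt q M (A k) * c k\<bar>) ` {..<m})"
      using 1 by (simp add: lp_def)
    have ne: "{..<m} \<noteq> {}" using m by (auto simp: lessThan_empty_iff)
    have ge: "\<bar>wt q M (A k) * c k\<bar> \<le> nrm (lp q m) (\<lambda>k. wt q M (A k) * c k)" if "k < m" for k
      using that unfolding lpm by (intro Max_ge) auto
    \<comment> \<open>For the infinite exponent, members of measure 0 have weight 0, so their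
      coefficients must be invisible almost everywhere.\<close>
    have "AE x in M. \<forall>k\<in>{k. k < m \<and> measure M (A k) = 0}. x \<notin> A k"
    proof (rule AE_finite_allI)
      fix k assume k: "k \<in> {k. k < m \<and> measure M (A k) = 0}"
      then have "A k \<in> null_sets M" using Am[of k] Af[of k]
        by (auto simp: null_sets_def measure_def enn2real_eq_0_iff)
      then show "AE x in M. x \<notin> A k" by (rule AE_not_in)
    qed simp
    then have AE1: "AE x in M. \<bar>?g x\<bar> \<le> nrm (lp q m) (\<lambda>k. wt q M (A k) * c k)"
    proof eventually_elim
      case (elim x)
      show ?case
      proof (cases "x \<in> (\<Union>k<m. A k)")
        case True
        then obtain k where k: "k < m" "x \<in> A k" by auto
        then show ?thesis using elim ge[OF k(1)] sum_indicator_disjoint[OF A(1) k, of c]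
          by (auto simp: wt1 split: if_splits)
      next
        case False
        then show ?thesis using sum_indicator_outside[of x A m c] lp_norm_nonneg[OF q m] by simp
      qed
    qed
    then have mem: "?g \<in> Lq_fun q M" unfolding 1 Lq_fun_top using gm by blast
    have le: "\<bar>wt q M (A k) * c k\<bar> \<le> Lq_norm q M ?g" if k: "k < m" for k
    proof (cases "measure M (A k) = 0")
      case True then show ?thesis using Lq_norm_nonneg[OF mem] by (simp add: wt1)
    next
      case False
      \<comment> \<open>A member of positive measure is not contained in a null set; a point of it
        outside the exceptional set reads off the coefficient.\<close>
      have "\<not> (AE x in M. x \<notin> A k)"
      proof
        assume "AE x in M. x \<notin> A k"
        then have "A k \<in> null_sets M" using Am[OF k] by (simp add: AE_iff_null_sets)
        then show False using False by (simp add: measure_eq_0_null_sets)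
      qed
      have L: "AE x in M. \<bar>?g x\<bar> \<le> Lq_norm q M ?g"
        using mem unfolding 1 by (rule Linf_norm_AE)
      have "\<exists>x. x \<in> A k \<and> \<bar>?g x\<bar> \<le> Lq_norm q M ?g"
      proof (rule ccontr)
        assume "\<nexists>x. x \<in> A k \<and> \<bar>?g x\<bar> \<le> Lq_norm q M ?g"
        then have "AE x in M. x \<notin> A k" by (intro eventually_mono[OF L]) blast
        with \<open>\<not> (AE x in M. x \<notin> A k)\<close> show False by blast
      qed
      then obtain x where "x \<in> A k" "\<bar>?g x\<bar> \<le> Lq_norm q M ?g" by auto
      then show ?thesis using sum_indicator_disjoint[OF A(1) k, of x c] False by (simp add: wt1)
    qed
    have "Lq_norm q M ?g \<le> nrm (lp q m) (\<lambda>k. wt q M (A k) * c k)"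
      using AE1 lp_norm_nonneg[OF q m] 1 by (auto intro!: Linf_norm_le)
    moreover have "nrm (lp q m) (\<lambda>k. wt q M (A k) * c k) \<le> Lq_norm q M ?g"
      unfolding lpm using ne le by (subst Max_le_iff) auto
    ultimately show ?thesis using mem by auto
  next
    case (2 r)
    have pw: "\<bar>?g x\<bar> powr r = (\<Sum>k<m. (\<bar>c k\<bar> powr r) * indicator (A k) x)" for x
    proof (cases "x \<in> (\<Union>k<m. A k)")
      case True
      then obtain k where k: "k < m" "x \<in> A k" by auto
      show ?thesis using sum_indicator_disjoint[OF A(1) k] by simp
    next
      case False
      then show ?thesis using sum_indicator_outside[OF False] 2 by simp
    qed
    have i: "integrable M (\<lambda>x. (\<bar>c k\<bar> powr r) * indicator (A k) x)" if "k < m" for k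
      using Am[OF that] Af[OF that] by auto
    have "integrable M (\<lambda>x. \<bar>?g x\<bar> powr r)" unfolding pw by (intro Bochner_Integration.integrable_sum i) auto
    moreover have "(\<integral>x. \<bar>?g x\<bar> powr r \<partial>M) = (\<Sum>k<m. \<bar>c k\<bar> powr r * measure M (A k))"
      unfolding pw using i Am by (subst Bochner_Integration.integral_sum) auto
    moreover have "\<bar>wt q M (A k) * c k\<bar> powr r = \<bar>c k\<bar> powr r * measure M (A k)" for k
      using 2 by (simp add: wt_def abs_mult powr_mult powr_powr)
    ultimately show ?thesis using 2 gm
      by (simp add: Lq_fun_real Lq_norm_real lp_def del: sum_mult_indicator)
  qed
  then show "?g \<in> Lq_fun q M" "Lq_norm q M ?g = nrm (lp q m) (\<lambda>k. wt q M (A k) * c k)" by auto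
qed

text \<open>The indicator of a set of finite measure lies in \<open>L\<^sup>p\<close>, so Hoelder's
  inequality applies even if h itself is not integrable.\<close>

lemma Lq_set_integrable:
  assumes p: "1 \<le> p" "1 / p + 1 / p' = 1" and h: "h \<in> Lq_fun p' M" and A: "A \<in> fmeasurable M"
  shows "integrable M (\<lambda>x. indicator A x * h x)"
proof -
  have "indicator A \<in> Lq_fun p M"
    using step_function_norm(1)[OF p(1), of 1 "\<lambda>_. A" M "\<lambda>_. 1"] A
    by (auto simp: disjoint_family_on_def)
  then show ?thesis using Holder_integral(1)[OF p _ h] by simp
qed

lemma Holder_step:
  assumes p: "1 \<le> p" "1 / p + 1 / p' = 1" and h: "h \<in> Lq_fun p' M" and m: "1 \<le> m"
    and A: "disjoint_family_on A {..<m}" "\<And>k. k < m \<Longrightarrow> A k \<in> fmeasurable M"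
  shows "\<bar>\<Sum>k<m. c k * sint M (A k) h\<bar> \<le> nrm (lp p m) (\<lambda>k. wt p M (A k) * c k) * Lq_norm p' M h"
proof -
  let ?g = "\<lambda>x. \<Sum>k<m. c k * indicator (A k) x"
  have g: "?g \<in> Lq_fun p M" "Lq_norm p M ?g = nrm (lp p m) (\<lambda>k. wt p M (A k) * c k)"
    using step_function_norm[OF p(1) m A] by blast+
  have "(\<Sum>k<m. c k * sint M (A k) h) = (\<integral>x. (\<Sum>k<m. c k * (indicator (A k) x * h x)) \<partial>M)"
    using Lq_set_integrable[OF p h A(2)] by (subst Bochner_Integration.integral_sum) auto
  also have "\<dots> = (\<integral>x. ?g x * h x \<partial>M)" by (simp only: sum_distrib_right mult.assoc)
  finally have "\<bar>\<Sum>k<m. c k * sint M (A k) h\<bar> \<le> (\<integral>x. \<bar>?g x * h x\<bar> \<partial>M)" by simp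
  also have "\<dots> \<le> Lq_norm p M ?g * Lq_norm p' M h" by (rule Holder_integral(2)[OF p g(1) h])
  finally show ?thesis unfolding g(2) .
qed

section \<open>Completeness\<close>

lemma (in real_module) diff_eq_zero_iff:
  assumes "x \<in> carrier E" "y \<in> carrier E" shows "x \<ominus> y = \<zero> \<longleftrightarrow> x = y"
proof
  assume "x \<ominus> y = \<zero>"
  have "(x \<ominus> y) \<oplus> y = x \<oplus> (y \<oplus> (-1) \<odot> y)" using assms by (simp add: minus_eq_sm a_ac)
  also have "\<dots> = x" using assms by (simp add: sm_cancel)
  finally show "x = y" using assms by (simp add: \<open>x \<ominus> y = \<zero>\<close>)
qed (use assms in \<open>simp add: minus_eq_sm sm_cancel\<close>)

lemma (in normed_space) real_module: "real_module E"
  by (simp add: real_module_def module_axioms)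

lemma (in normed_space) nrm_zero: "nrm E \<zero> = 0"
  using nrm_eq_0 by blast

lemma (in normed_space) minus_diff:
  assumes "x \<in> carrier E" "y \<in> carrier E" "z \<in> carrier E"
  shows "nrm E (x \<ominus> z) \<le> nrm E (x \<ominus> y) + nrm E (y \<ominus> z)"
proof -
  interpret real_module E by (rule real_module)
  have "(x \<ominus> y) \<oplus> (y \<ominus> z) = x \<oplus> ((y \<oplus> (-1) \<odot> y) \<oplus> (-1) \<odot> z)"
    using assms by (simp add: minus_eq_sm a_ac)
  also have "\<dots> = x \<ominus> z" using assms by (simp add: sm_cancel minus_eq_sm)
  finally show ?thesis using nrm_triangle[of "x \<ominus> y" "y \<ominus> z"] assms by simp
qed

lemma (in normed_space) nrm_minus_commute:
  assumes "x \<in> carrier E" "y \<in> carrier E" shows "nrm E (x \<ominus> y) = nrm E (y \<ominus> x)"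
proof -
  interpret real_module E by (rule real_module)
  have "y \<ominus> x = (-1) \<odot> (x \<ominus> y)" using assms by (simp add: minus_eq_sm sm_simps a_ac)
  then show ?thesis using nrm_smult[of "x \<ominus> y" "-1"] assms by simp
qed

lemma (in normed_space) Metric_space_ndist: "Metric_space (carrier E) (ndist E)"
proof
  show "0 \<le> ndist E x y" for x y by (auto simp: ndist_def intro: nrm_nonneg)
  show "ndist E x y = ndist E y x" for x y by (auto simp: ndist_def nrm_minus_commute)
  show "ndist E x y = 0 \<longleftrightarrow> x = y" if "x \<in> carrier E" "y \<in> carrier E" for x y
    using that nrm_eq_0[of "x \<ominus> y"] real_module.diff_eq_zero_iff[OF real_module, of x y]
    by (simp add: ndist_def)
  show "ndist E x z \<le> ndist E x y + ndist E y z"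
    if "x \<in> carrier E" "y \<in> carrier E" "z \<in> carrier E" for x y z
    using that minus_diff by (simp add: ndist_def)
qed

text \<open>A Cauchy sequence converges as soon as a subsequence does, and it has a subsequence with
  increments at most 2^-n. So only such fast sequences need a limit.\<close>

lemma (in normed_space) banach_spaceI:
  assumes lim: "\<And>\<sigma> :: nat \<Rightarrow> 'a. (\<And>n. \<sigma> n \<in> carrier E) \<Longrightarrow>
      (\<And>n. nrm E (\<sigma> (Suc n) \<ominus> \<sigma> n) \<le> (1 / 2) ^ n) \<Longrightarrow>
      \<exists>l\<in>carrier E. (\<lambda>n. nrm E (\<sigma> n \<ominus> l)) \<longlonglongrightarrow> 0"
  shows "banach_space E"
proof (rule banach_space.intro)
  show "normed_space E" by (rule normed_space_axioms)
  interpret Metric_space "carrier E" "ndist E" by (rule Metric_space_ndist)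
  show "banach_space_axioms E"
    unfolding banach_space_axioms_def mcomplete_def
  proof (intro allI impI)
    fix \<sigma> assume C: "MCauchy \<sigma>"
    have c: "\<sigma> n \<in> carrier E" for n using C by (auto simp: MCauchy_def)
    have "\<exists>N. \<forall>m n. N \<le> m \<longrightarrow> N \<le> n \<longrightarrow> nrm E (\<sigma> m \<ominus> \<sigma> n) < (1 / 2) ^ k" for k :: nat
    proof -
      have "\<exists>N. \<forall>m n. N \<le> m \<longrightarrow> N \<le> n \<longrightarrow> ndist E (\<sigma> m) (\<sigma> n) < (1 / 2) ^ k"
        using C unfolding MCauchy_def by (auto dest!: spec[of _ "(1/2)^k :: real"])
      then show ?thesis using c by (simp add: ndist_def)
    qed
    then obtain N where N: "\<And>k m n. N k \<le> m \<Longrightarrow> N k \<le> n \<Longrightarrow> nrm E (\<sigma> m \<ominus> \<sigma> n) < (1 / 2) ^ k"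
      by metis
    \<comment> \<open>Partial sums turn the thresholds \<open>N\<close> into nondecreasing indices
      that stay above them.\<close>
    define s where "s k = (\<Sum>i\<le>k. N i)" for k
    have s: "N k \<le> s k" "s k \<le> s (Suc k)" for k by (auto simp: s_def intro: member_le_sum)
    have "nrm E (\<sigma> (s (Suc k)) \<ominus> \<sigma> (s k)) \<le> (1 / 2) ^ k" for k
      using N[of k "s (Suc k)" "s k"] s(1)[of k] s(2)[of k] by simp
    then obtain l where l: "l \<in> carrier E" "(\<lambda>k. nrm E (\<sigma> (s k) \<ominus> l)) \<longlonglongrightarrow> 0"
      using lim[of "\<lambda>k. \<sigma> (s k)"] c by auto
    have "limitin mtopology \<sigma> l sequentially"
      unfolding limit_metric_sequentially
    proof (intro conjI allI impI)
      fix e :: real assume e: "0 < e"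
      obtain k1 where k1: "\<And>k. k \<ge> k1 \<Longrightarrow> nrm E (\<sigma> (s k) \<ominus> l) < e / 2"
        using order_tendstoD(2)[OF l(2), of "e / 2"] e by (auto simp: eventually_sequentially)
      obtain k2 where k2: "(1 / 2 :: real) ^ k2 < e / 2"
        using real_arch_pow_inv[of "e / 2" "1 / 2"] e by auto
      define k where "k = max k1 k2"
      have "(1 / 2 :: real) ^ k \<le> (1 / 2) ^ k2" unfolding k_def by (rule power_decreasing) auto
      with k2 have k3: "(1 / 2 :: real) ^ k < e / 2" by linarith
      have "ndist E (\<sigma> n) l < e" if n: "n \<ge> N k" for n
      proof -
        have "nrm E (\<sigma> n \<ominus> l) \<le> nrm E (\<sigma> n \<ominus> \<sigma> (s k)) + nrm E (\<sigma> (s k) \<ominus> l)"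
          using minus_diff c l(1) by blast
        also have "\<dots> < e" using N[of k n "s k"] n s(1)[of k] k1[of k] k3 by (simp add: k_def)
        finally show ?thesis using c l(1) by (simp add: ndist_def)
      qed
      then show "\<exists>N. \<forall>n\<ge>N. \<sigma> n \<in> carrier E \<and> ndist E (\<sigma> n) l < e" using c by blast
    qed (use l in auto)
    then show "\<exists>x. limitin mtopology \<sigma> x sequentially" by blast
  qed
qed

section \<open>The Riesz--Fischer theorem\<close>

lemma Lq_nn_integral:
  assumes r: "1 \<le> r" and f: "f \<in> Lq_fun (ennreal r) M"
  shows "(\<integral>\<^sup>+x. ennreal (\<bar>f x\<bar> powr r) \<partial>M) = ennreal (Lq_norm (ennreal r) M f powr r)"
  using f r by (subst nn_integral_eq_integral) (auto simp: Lq_norm_powr Lq_fun_real)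

lemma Lq_funI_nn_integral:
  assumes r: "1 \<le> r" and f: "f \<in> borel_measurable M" and c: "0 \<le> c"
    and le: "(\<integral>\<^sup>+x. ennreal (\<bar>f x\<bar> powr r) \<partial>M) \<le> ennreal (c powr r)"
  shows "f \<in> Lq_fun (ennreal r) M" and "Lq_norm (ennreal r) M f \<le> c"
proof -
  have "integrable M (\<lambda>x. \<bar>f x\<bar> powr r)"
    using f le_less_trans[OF le ennreal_less_top] by (intro integrableI_bounded) auto
  then show m: "f \<in> Lq_fun (ennreal r) M" using f r by (simp add: Lq_fun_real)
  have "Lq_norm (ennreal r) M f powr r \<le> c powr r"
    using le unfolding Lq_nn_integral[OF r m] by simp
  then show "Lq_norm (ennreal r) M f \<le> c"
    unfolding Lq_norm_powr[OF r] by (rule Lq_norm_real_le[OF r c])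
qed

lemma Lq_fun_diff:
  assumes q: "1 \<le> q" and f: "f \<in> Lq_fun q M" "g \<in> Lq_fun q M"
  shows "(\<lambda>x. f x - g x) \<in> Lq_fun q M"
    and "Lq_norm q M (\<lambda>x. f x - g x) \<le> Lq_norm q M f + Lq_norm q M g"
  using Lq_fun_add[OF q f(1) Lq_fun_scale(1)[OF q f(2), of "-1"]] Lq_fun_scale(2)[OF q f(2), of "-1"]
  by simp_all

text \<open>The geometric sum is kept exact, with its negative term, so that the induction
  closes.\<close>

lemma Lq_norm_telescope:
  assumes q: "1 \<le> q" and f: "\<And>n. f n \<in> Lq_fun q M"
    and le: "\<And>n. Lq_norm q M (\<lambda>x. f (Suc n) x - f n x) \<le> (1 / 2) ^ n"
  shows "Lq_norm q M (\<lambda>x. f (n + k) x - f n x) \<le> 2 * (1 / 2) ^ n - 2 * (1 / 2) ^ (n + k)"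
proof (induction k)
  case 0
  show ?case using Lq_norm_eq_0[OF q Lq_fun_zero, of M] by simp
next
  case (Suc k)
  have "Lq_norm q M (\<lambda>x. f (n + Suc k) x - f n x) =
      Lq_norm q M (\<lambda>x. (f (Suc (n + k)) x - f (n + k) x) + (f (n + k) x - f n x))" by simp
  also have "\<dots> \<le> (1 / 2) ^ (n + k) + (2 * (1 / 2) ^ n - 2 * (1 / 2) ^ (n + k))"
    using Lq_fun_add(2)[OF q Lq_fun_diff(1)[OF q f f] Lq_fun_diff(1)[OF q f f], of "Suc (n + k)" "n + k" "n + k" n]
      le[of "n + k"] Suc by linarith
  finally show ?case by simp
qed

text \<open>For a finite exponent the sums of absolute increments have norm at most 2, so by
  monotone convergence the telescoping series converges absolutely almost everywhere, and Fatou's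
  lemma carries the rate over to the limit. For the infinite exponent the sequence is uniformly
  Cauchy off one null set.\<close>

lemma Lq_complete:
  assumes q: "1 \<le> q" and f: "\<And>n. f n \<in> Lq_fun q M"
    and le: "\<And>n. Lq_norm q M (\<lambda>x. f (Suc n) x - f n x) \<le> (1 / 2) ^ n"
  obtains g where "g \<in> Lq_fun q M" "\<And>n. Lq_norm q M (\<lambda>x. f n x - g x) \<le> 2 * (1 / 2) ^ n"
proof -
  have [measurable]: "f n \<in> borel_measurable M" for n using f by measurable
  \<comment> \<open>Where the sequence diverges, \<open>lim\<close> has an unspecified value, yet
    the function is measurable; convergence is established almost everywhere.\<close>
  define g where "g x = lim (\<lambda>n. f n x)" for x
  have gm [measurable]: "g \<in> borel_measurable M" unfolding g_def by measurable
  note d = Lq_fun_diff(1)[OF q f f]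
  have tel: "Lq_norm q M (\<lambda>x. f n x - f m x) \<le> 2 * (1 / 2) ^ m" if "m \<le> n" for m n
  proof -
    have "Lq_norm q M (\<lambda>x. f (m + (n - m)) x - f m x) \<le> 2 * (1 / 2) ^ m - 2 * (1 / 2) ^ (m + (n - m))"
      by (rule Lq_norm_telescope[OF q f le])
    also have "\<dots> \<le> 2 * (1 / 2) ^ m" by simp
    finally show ?thesis using that by simp
  qed
  have tel': "Lq_norm q M (\<lambda>x. f m x - f n x) \<le> 2 * (1 / 2) ^ m" if "m \<le> n" for m n
    using tel[OF that] Lq_fun_scale(2)[OF q d[of n m], of "-1"] by simp
  have g': "Lq_norm q M (\<lambda>x. g x - f 0 x) \<le> 2 \<and> (\<lambda>x. g x - f 0 x) \<in> Lq_fun q M \<and>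
      (\<forall>n. Lq_norm q M (\<lambda>x. f n x - g x) \<le> 2 * (1 / 2) ^ n)"
    if n: "\<And>n. (\<lambda>x. f n x - g x) \<in> Lq_fun q M \<and> Lq_norm q M (\<lambda>x. f n x - g x) \<le> 2 * (1 / 2) ^ n"
    using Lq_fun_scale[OF q conjunct1[OF n[of 0]], of "-1"] n n[of 0] by simp
  have main: "(\<lambda>x. f n x - g x) \<in> Lq_fun q M \<and> Lq_norm q M (\<lambda>x. f n x - g x) \<le> 2 * (1 / 2) ^ n" for n
    using q
  proof (cases q rule: exponent_cases)
    case 1
    have "AE x in M. \<forall>m n. \<bar>f m x - f n x\<bar> \<le> Lq_norm q M (\<lambda>x. f m x - f n x)"
      unfolding AE_all_countable using Linf_norm_AE d unfolding 1 by blast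
    then have "AE x in M. \<bar>f n x - g x\<bar> \<le> 2 * (1 / 2) ^ n"
    proof eventually_elim
      case (elim x)
      have b: "\<bar>f m x - f n x\<bar> \<le> 2 * (1 / 2) ^ m" if "m \<le> n" for m n
        using elim[rule_format, of m n] tel'[OF that] by linarith
      have "Cauchy (\<lambda>n. f n x)"
      proof (rule CauchyI')
        fix e :: real assume "0 < e"
        then obtain k where k: "(1 / 2 :: real) ^ k < e / 2"
          using real_arch_pow_inv[of "e / 2" "1 / 2"] by auto
        have "dist (f m x) (f n x) < e" if "k \<le> m" "m < n" for m n
        proof -
          have "(1 / 2 :: real) ^ m \<le> (1 / 2) ^ k" using that by (intro power_decreasing) auto
          then show ?thesis using b[of m n] k that unfolding dist_real_def by linarith
        qed
        then show "\<exists>M. \<forall>m\<ge>M. \<forall>n>m. dist (f m x) (f n x) < e" by blast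
      qed
      then have "(\<lambda>n. f n x) \<longlonglongrightarrow> g x"
        unfolding g_def by (simp add: Cauchy_convergent_iff convergent_LIMSEQ_iff)
      then have "(\<lambda>k. \<bar>f n x - f k x\<bar>) \<longlonglongrightarrow> \<bar>f n x - g x\<bar>" by (intro tendsto_intros)
      then show ?case by (rule LIMSEQ_le_const2) (use b in blast)
    qed
    then show ?thesis unfolding 1 Lq_fun_top by (intro conjI exI Linf_norm_le) auto
  next
    case (2 r)
    define G where "G k x = (\<Sum>i<k. \<bar>f (Suc i) x - f i x\<bar>)" for k x
    have Gm [measurable]: "G k \<in> borel_measurable M" for k unfolding G_def by measurable
    have Gle: "G k \<in> Lq_fun q M \<and> Lq_norm q M (G k) \<le> 2 - 2 * (1 / 2) ^ k" for k
    proof (induction k)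
      case 0
      show ?case using Lq_norm_eq_0[OF q Lq_fun_zero, of M] Lq_fun_zero by (simp add: G_def[abs_def])
    next
      case (Suc k)
      have a: "(\<lambda>x. \<bar>f (Suc k) x - f k x\<bar>) \<in> Lq_fun q M"
        "Lq_norm q M (\<lambda>x. \<bar>f (Suc k) x - f k x\<bar>) = Lq_norm q M (\<lambda>x. f (Suc k) x - f k x)"
        using d[of "Suc k" k] 2 by (auto simp: Lq_fun_real Lq_norm_real)
      have "G (Suc k) = (\<lambda>x. G k x + \<bar>f (Suc k) x - f k x\<bar>)" by (simp add: G_def[abs_def])
      then show ?case
        using Lq_fun_add[OF q conjunct1[OF Suc] a(1)] le[of k] Suc a(2) by simp
    qed
    have Gmono: "G k x \<le> G (Suc k) x" and G0: "0 \<le> G k x" for k x by (auto simp: G_def intro: sum_nonneg)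
    have "(\<integral>\<^sup>+x. (SUP k. ennreal (G k x powr r)) \<partial>M) = (SUP k. \<integral>\<^sup>+x. ennreal (G k x powr r) \<partial>M)"
      using Gmono G0 2 by (intro nn_integral_monotone_convergence_SUP)
        (auto simp: incseq_Suc_iff le_fun_def intro!: ennreal_leI powr_mono2)
    also have "\<dots> \<le> ennreal (2 powr r)"
    proof (rule SUP_least)
      fix k
      have "(\<integral>\<^sup>+x. ennreal (G k x powr r) \<partial>M) = ennreal (Lq_norm q M (G k) powr r)"
        using Lq_nn_integral[of r "G k" M] Gle[of k] 2 G0 by simp
      also have "\<dots> \<le> ennreal (2 powr r)"
      proof (rule ennreal_leI, rule powr_mono2)
        show "Lq_norm q M (G k) \<le> 2" using Gle[of k] zero_le_power[of "1/2::real" k] by linarith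
      qed (use 2 Gle[of k] Lq_norm_nonneg in auto)
      finally show "(\<integral>\<^sup>+x. ennreal (G k x powr r) \<partial>M) \<le> ennreal (2 powr r)" .
    qed
    finally have "(\<integral>\<^sup>+x. (SUP k. ennreal (G k x powr r)) \<partial>M) \<noteq> \<infinity>"
      using ennreal_less_top by (metis infinity_ennreal_def not_le)
    then have "AE x in M. (SUP k. ennreal (G k x powr r)) \<noteq> \<infinity>"
      by (intro nn_integral_noteq_infinite) auto
    then have conv: "AE x in M. (\<lambda>n. f n x) \<longlonglongrightarrow> g x"
    proof eventually_elim
      case (elim x)
      then obtain c where c: "c \<ge> 0" "(SUP k. ennreal (G k x powr r)) = ennreal c"
        by (cases "SUP k. ennreal (G k x powr r)") auto
      have "G k x \<le> c powr (1 / r)" for k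
      proof -
        have "ennreal (G k x powr r) \<le> ennreal c" unfolding c(2)[symmetric] by (rule SUP_upper) simp
        then have "(G k x powr r) powr (1 / r) \<le> c powr (1 / r)"
          using c(1) 2 by (intro powr_mono2) auto
        then show ?thesis using 2 G0 by (simp add: powr_powr)
      qed
      then have "summable (\<lambda>i. \<bar>f (Suc i) x - f i x\<bar>)"
        by (intro summableI_nonneg_bounded[where x="c powr (1 / r)"]) (auto simp: G_def)
      then have "summable (\<lambda>i. f (Suc i) x - f i x)" by (rule summable_rabs_cancel)
      then have "(\<lambda>n. \<Sum>i<n. f (Suc i) x - f i x) \<longlonglongrightarrow> (\<Sum>i. f (Suc i) x - f i x)"
        by (rule summable_LIMSEQ)
      then have "(\<lambda>n. f n x - f 0 x) \<longlonglongrightarrow> (\<Sum>i. f (Suc i) x - f i x)"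
        by (simp add: sum_lessThan_telescope[of "\<lambda>i. f i x"])
      then have "(\<lambda>n. (f n x - f 0 x) + f 0 x) \<longlonglongrightarrow> (\<Sum>i. f (Suc i) x - f i x) + f 0 x"
        by (intro tendsto_intros)
      then have "convergent (\<lambda>n. f n x)" by (auto simp: convergent_def)
      then show ?case unfolding g_def by (simp add: convergent_LIMSEQ_iff)
    qed
    have "(\<integral>\<^sup>+x. ennreal (\<bar>f n x - g x\<bar> powr r) \<partial>M) =
        (\<integral>\<^sup>+x. liminf (\<lambda>m. ennreal (\<bar>f n x - f m x\<bar> powr r)) \<partial>M)"
    proof (rule nn_integral_cong_AE)
      show "AE x in M. ennreal (\<bar>f n x - g x\<bar> powr r) = liminf (\<lambda>m. ennreal (\<bar>f n x - f m x\<bar> powr r))"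
        using conv
      proof eventually_elim
        case (elim x)
        have "(\<lambda>m. ennreal (\<bar>f n x - f m x\<bar> powr r)) \<longlonglongrightarrow> ennreal (\<bar>f n x - g x\<bar> powr r)"
          using elim 2 by (intro tendsto_ennrealI tendsto_powr' tendsto_intros) auto
        then show ?case by (rule lim_imp_Liminf[OF trivial_limit_sequentially, symmetric])
      qed
    qed
    also have "\<dots> \<le> liminf (\<lambda>m. \<integral>\<^sup>+x. ennreal (\<bar>f n x - f m x\<bar> powr r) \<partial>M)"
      by (rule nn_integral_liminf) auto
    also have "\<dots> \<le> ennreal ((2 * (1 / 2) ^ n) powr r)"
    proof (rule order_trans[OF Liminf_le_Limsup[OF trivial_limit_sequentially] Limsup_bounded],
        rule eventually_mono[OF eventually_ge_at_top[of n]])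
      fix m assume "n \<le> m"
      have "(\<integral>\<^sup>+x. ennreal (\<bar>f n x - f m x\<bar> powr r) \<partial>M) = ennreal (Lq_norm q M (\<lambda>x. f n x - f m x) powr r)"
        using Lq_nn_integral[of r "\<lambda>x. f n x - f m x" M] d 2 by simp
      also have "\<dots> \<le> ennreal ((2 * (1 / 2) ^ n) powr r)"
        using tel'[OF \<open>n \<le> m\<close>] Lq_norm_nonneg[OF d] 2 by (intro ennreal_leI powr_mono2) auto
      finally show "(\<integral>\<^sup>+x. ennreal (\<bar>f n x - f m x\<bar> powr r) \<partial>M) \<le> ennreal ((2 * (1 / 2) ^ n) powr r)" .
    qed
    finally show ?thesis
      using Lq_funI_nn_integral[of r "\<lambda>x. f n x - g x" M "2 * (1 / 2) ^ n"] 2 by auto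
  qed
  show thesis
  proof
    show "g \<in> Lq_fun q M"
      using Lq_fun_diff(1)[OF q f[of 0] conjunct1[OF main[of 0]]] by simp
    show "Lq_norm q M (\<lambda>x. f n x - g x) \<le> 2 * (1 / 2) ^ n" for n using main by blast
  qed
qed

section \<open>The Banach space \<open>L\<^sup>q(\<mu>)\<close>\<close>

abbreviation cls :: "ennreal \<Rightarrow> 'a measure \<Rightarrow> ('a \<Rightarrow> real) \<Rightarrow> ('a \<Rightarrow> real) set" where
  "cls q M f \<equiv> Lq_rel q M `` {f}"

lemma equiv_Lq_rel: "equiv (Lq_fun q M) (Lq_rel q M)"
  by (rule equivI) (auto simp: Lq_rel_def refl_on_def sym_def trans_def elim: eventually_elim2 eventually_mono)

lemma cls_eq_iff:
  "f \<in> Lq_fun q M \<Longrightarrow> g \<in> Lq_fun q M \<Longrightarrow> cls q M f = cls q M g \<longleftrightarrow> (AE x in M. f x = g x)"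
  by (simp add: eq_equiv_class_iff[OF equiv_Lq_rel]) (simp add: Lq_rel_def)

lemma cls_in_carrier: "f \<in> Lq_fun q M \<Longrightarrow> cls q M f \<in> carrier (Lq q M)"
  by (simp add: Lq_def quotientI)

lemma Lq_carrierE:
  assumes "F \<in> carrier (Lq q M)" obtains f where "f \<in> Lq_fun q M" "F = cls q M f"
  using assms by (auto simp: Lq_def elim: quotientE)

lemma Lq_zero: "\<zero>\<^bsub>Lq q M\<^esub> = cls q M (\<lambda>_. 0)"
  by (simp add: Lq_def)

lemma Lq_add:
  assumes q: "1 \<le> q" and "f \<in> Lq_fun q M" "g \<in> Lq_fun q M"
  shows "cls q M f \<oplus>\<^bsub>Lq q M\<^esub> cls q M g = cls q M (\<lambda>x. f x + g x)"
proof -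
  have "congruent2 (Lq_rel q M) (Lq_rel q M) (\<lambda>f g. cls q M (\<lambda>x. f x + g x))"
  proof (rule congruent2I')
    fix f1 g1 f2 g2 assume a: "(f1, g1) \<in> Lq_rel q M" "(f2, g2) \<in> Lq_rel q M"
    then have "AE x in M. f1 x + f2 x = g1 x + g2 x"
      by (auto simp: Lq_rel_def elim: eventually_elim2)
    then show "cls q M (\<lambda>x. f1 x + f2 x) = cls q M (\<lambda>x. g1 x + g2 x)"
      using a Lq_fun_add(1)[OF q] by (subst cls_eq_iff) (auto simp: Lq_rel_def)
  qed
  then show ?thesis using assms(2,3)
    by (simp add: Lq_def UN_equiv_class2[OF equiv_Lq_rel equiv_Lq_rel])
qed

lemma Lq_smult:
  assumes q: "1 \<le> q" and "f \<in> Lq_fun q M"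
  shows "c \<odot>\<^bsub>Lq q M\<^esub> cls q M f = cls q M (\<lambda>x. c * f x)"
proof -
  have "congruent (Lq_rel q M) (\<lambda>f. cls q M (\<lambda>x. c * f x))"
  proof (rule congruentI)
    fix f g assume a: "(f, g) \<in> Lq_rel q M"
    then have "AE x in M. c * f x = c * g x" by (auto simp: Lq_rel_def elim: eventually_mono)
    then show "cls q M (\<lambda>x. c * f x) = cls q M (\<lambda>x. c * g x)"
      using a Lq_fun_scale(1)[OF q] by (subst cls_eq_iff) (auto simp: Lq_rel_def)
  qed
  then show ?thesis using assms(2) by (simp add: Lq_def UN_equiv_class[OF equiv_Lq_rel])
qed

text \<open>The choice is literally the one in the norm of \<open>Lq\<close>, so that norm is
  \<open>Lq_norm\<close> of the representative.\<close>

definition rep :: "('a \<Rightarrow> real) set \<Rightarrow> 'a \<Rightarrow> real" where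
  "rep F = (SOME f. f \<in> F)"

lemma rep_cls:
  assumes "f \<in> Lq_fun q M"
  shows "rep (cls q M f) \<in> Lq_fun q M" "AE x in M. rep (cls q M f) x = f x"
proof -
  have "f \<in> cls q M f" using equiv_class_self[OF equiv_Lq_rel assms] .
  then have "rep (cls q M f) \<in> cls q M f" unfolding rep_def by (rule someI[of "\<lambda>g. g \<in> cls q M f"])
  then show "rep (cls q M f) \<in> Lq_fun q M" "AE x in M. rep (cls q M f) x = f x"
    by (auto simp: Lq_rel_def elim: eventually_mono)
qed

lemma rep_carrier:
  assumes "F \<in> carrier (Lq q M)"
  shows "rep F \<in> Lq_fun q M" "cls q M (rep F) = F"
proof -
  obtain f where f: "f \<in> Lq_fun q M" "F = cls q M f" using assms by (rule Lq_carrierE)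
  show "rep F \<in> Lq_fun q M" using rep_cls(1)[OF f(1)] f(2) by simp
  then show "cls q M (rep F) = F" using rep_cls[OF f(1)] f by (simp add: cls_eq_iff)
qed

lemma nrm_Lq: "nrm (Lq q M) F = Lq_norm q M (rep F)"
  by (simp add: Lq_def rep_def)

lemma nrm_Lq_cls:
  assumes "f \<in> Lq_fun q M" shows "nrm (Lq q M) (cls q M f) = Lq_norm q M f"
  unfolding nrm_Lq using rep_cls[OF assms] assms by (intro Lq_norm_cong_AE) auto

lemma normed_space_Lq:
  assumes q: "1 \<le> q" shows "normed_space (Lq q M)"
proof -
  note [simp] = Lq_add[OF q] Lq_smult[OF q] Lq_fun_add(1)[OF q] Lq_fun_scale(1)[OF q] cls_in_carrier
    Lq_zero Lq_fun_zero
  have "module real_ring (Lq q M)"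
    by (rule real_moduleI) (auto elim!: Lq_carrierE simp: algebra_simps)
  moreover have "normed_space_axioms (Lq q M)"
  proof
    fix F assume "F \<in> carrier (Lq q M)"
    then obtain f where f: "f \<in> Lq_fun q M" "F = cls q M f" by (rule Lq_carrierE)
    show "0 \<le> nrm (Lq q M) F" using f by (simp add: nrm_Lq_cls Lq_norm_nonneg)
    show "nrm (Lq q M) F = 0 \<longleftrightarrow> F = \<zero>\<^bsub>Lq q M\<^esub>"
      using f by (simp add: nrm_Lq_cls Lq_norm_eq_0[OF q] cls_eq_iff)
    show "nrm (Lq q M) (c \<odot>\<^bsub>Lq q M\<^esub> F) = \<bar>c\<bar> * nrm (Lq q M) F" for c
      using f by (simp add: nrm_Lq_cls Lq_fun_scale(2)[OF q])
    fix G assume "G \<in> carrier (Lq q M)"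
    then obtain g where "g \<in> Lq_fun q M" "G = cls q M g" by (rule Lq_carrierE)
    then show "nrm (Lq q M) (F \<oplus>\<^bsub>Lq q M\<^esub> G) \<le> nrm (Lq q M) F + nrm (Lq q M) G"
      using f by (simp add: nrm_Lq_cls Lq_fun_add(2)[OF q])
  qed
  ultimately show ?thesis by (rule normed_space.intro)
qed

lemma Lq_minus:
  assumes q: "1 \<le> q" and "f \<in> Lq_fun q M" "g \<in> Lq_fun q M"
  shows "cls q M f \<ominus>\<^bsub>Lq q M\<^esub> cls q M g = cls q M (\<lambda>x. f x - g x)"
proof -
  interpret normed_space "Lq q M" by (rule normed_space_Lq[OF q])
  show ?thesis
    using assms real_module.minus_eq_sm[OF real_module, of "cls q M f" "cls q M g"]
      Lq_fun_scale(1)[OF q, of g M "-1"] Lq_add[OF q, of f M "\<lambda>x. - g x"]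
    by (simp add: cls_in_carrier Lq_smult[OF q])
qed

lemma banach_space_Lq:
  assumes q: "1 \<le> q" shows "banach_space (Lq q M)"
proof -
  interpret normed_space "Lq q M" by (rule normed_space_Lq[OF q])
  show ?thesis
  proof (rule banach_spaceI)
    fix \<sigma> :: "nat \<Rightarrow> ('a \<Rightarrow> real) set"
    assume s: "\<And>n. \<sigma> n \<in> carrier (Lq q M)"
      and le: "\<And>n. nrm (Lq q M) (\<sigma> (Suc n) \<ominus>\<^bsub>Lq q M\<^esub> \<sigma> n) \<le> (1 / 2) ^ n"
    define f where "f n = rep (\<sigma> n)" for n
    have f: "f n \<in> Lq_fun q M" "\<sigma> n = cls q M (f n)" for n
      using rep_carrier[OF s] by (simp_all add: f_def)
    have le': "Lq_norm q M (\<lambda>x. f (Suc n) x - f n x) \<le> (1 / 2) ^ n" for n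
      using le[of n] f by (simp add: Lq_minus[OF q] nrm_Lq_cls Lq_fun_diff(1)[OF q])
    obtain g where g: "g \<in> Lq_fun q M" "\<And>n. Lq_norm q M (\<lambda>x. f n x - g x) \<le> 2 * (1 / 2) ^ n"
      by (rule Lq_complete[OF q f(1) le']) blast
    have n: "nrm (Lq q M) (\<sigma> n \<ominus>\<^bsub>Lq q M\<^esub> cls q M g) = Lq_norm q M (\<lambda>x. f n x - g x)" for n
      using f g(1) by (simp add: Lq_minus[OF q] nrm_Lq_cls Lq_fun_diff(1)[OF q])
    have "(\<lambda>n. nrm (Lq q M) (\<sigma> n \<ominus>\<^bsub>Lq q M\<^esub> cls q M g)) \<longlonglongrightarrow> 0"
      unfolding n
    proof (rule tendsto_sandwich[of "\<lambda>_. 0" _ _ "\<lambda>n. 2 * (1 / 2) ^ n"])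
      show "(\<lambda>n. 2 * (1 / 2 :: real) ^ n) \<longlonglongrightarrow> 0"
        by (rule tendsto_mult_right_zero, rule LIMSEQ_power_zero) simp
    qed (use g f Lq_norm_nonneg[OF Lq_fun_diff(1)[OF q f(1) g(1)]] in \<open>auto intro!: always_eventually\<close>)
    then show "\<exists>l\<in>carrier (Lq q M). (\<lambda>n. nrm (Lq q M) (\<sigma> n \<ominus>\<^bsub>Lq q M\<^esub> l)) \<longlonglongrightarrow> 0"
      using cls_in_carrier[OF g(1)] by blast
  qed
qed

section \<open>Tensor products and operator norms\<close>

lemma tensor_module_simps [simp]:
  "carrier (tensor_module n E) = {..<n} \<rightarrow>\<^sub>E carrier E"
  "\<zero>\<^bsub>tensor_module n E\<^esub> = (\<lambda>j\<in>{..<n}. \<zero>\<^bsub>E\<^esub>)"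
  "v \<oplus>\<^bsub>tensor_module n E\<^esub> w = (\<lambda>j\<in>{..<n}. v j \<oplus>\<^bsub>E\<^esub> w j)"
  "c \<odot>\<^bsub>tensor_module n E\<^esub> w = (\<lambda>j\<in>{..<n}. c \<odot>\<^bsub>E\<^esub> w j)"
  by (simp_all add: tensor_module_def)

lemma tensor_space_simps [simp]:
  "carrier (tensor_space n E) = {..<n} \<rightarrow>\<^sub>E carrier E"
  "\<zero>\<^bsub>tensor_space n E\<^esub> = (\<lambda>j\<in>{..<n}. \<zero>\<^bsub>E\<^esub>)"
  "v \<oplus>\<^bsub>tensor_space n E\<^esub> w = (\<lambda>j\<in>{..<n}. v j \<oplus>\<^bsub>E\<^esub> w j)"
  "c \<odot>\<^bsub>tensor_space n E\<^esub> w = (\<lambda>j\<in>{..<n}. c \<odot>\<^bsub>E\<^esub> w j)"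
  "nrm (tensor_space n E) = mnrm E n"
  by (simp_all add: tensor_space_def tensor_module_def module.defs nspace.defs)

lemma max_mn_simps [simp]:
  "carrier (max_mn p E) = carrier E" "\<zero>\<^bsub>max_mn p E\<^esub> = \<zero>\<^bsub>E\<^esub>"
  "x \<oplus>\<^bsub>max_mn p E\<^esub> y = x \<oplus>\<^bsub>E\<^esub> y" "c \<odot>\<^bsub>max_mn p E\<^esub> x = c \<odot>\<^bsub>E\<^esub> x"
  "nrm (max_mn p E) = nrm E" "mnrm (max_mn p E) n = proj_norm p n E"
  by (simp_all add: max_mn_def nspace.defs mnspace.defs)

lemma real_line_simps [simp]:
  "carrier real_line = UNIV" "\<zero>\<^bsub>real_line\<^esub> = 0" "x \<oplus>\<^bsub>real_line\<^esub> y = x + y"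
  "c \<odot>\<^bsub>real_line\<^esub> x = c * x" "nrm real_line x = \<bar>x\<bar>"
  by (simp_all add: real_line_def)

lemma normed_space_real_line: "normed_space real_line"
proof (rule normed_space.intro)
  show "module real_ring real_line" by (rule real_moduleI) (auto simp: algebra_simps)
  show "normed_space_axioms real_line" by unfold_locales (auto simp: abs_mult)
qed

lemma normed_space_lp:
  assumes p: "1 \<le> p" and n: "1 \<le> n" shows "normed_space (lp p n)"
proof (rule normed_space.intro)
  show "module real_ring (lp p n)"
    by (rule real_moduleI) (auto simp: algebra_simps fun_eq_iff restrict_def PiE_def extensional_def)
  show "normed_space_axioms (lp p n)"
  proof
    fix a assume a: "a \<in> carrier (lp p n)"
    show "0 \<le> nrm (lp p n) a" by (rule lp_norm_nonneg[OF p n])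
    show "nrm (lp p n) a = 0 \<longleftrightarrow> a = \<zero>\<^bsub>lp p n\<^esub>"
    proof
      assume "nrm (lp p n) a = 0"
      then have "a j = 0" if "j < n" for j using lp_norm_coord[OF p n that, of a] by simp
      then show "a = \<zero>\<^bsub>lp p n\<^esub>" using a by (auto simp: fun_eq_iff PiE_def extensional_def)
    next
      assume "a = \<zero>\<^bsub>lp p n\<^esub>"
      then have "nrm (lp p n) a \<le> 0" using lp_norm_sum_le[OF p n, of a] by simp
      then show "nrm (lp p n) a = 0" using lp_norm_nonneg[OF p n, of a] by simp
    qed
    show "nrm (lp p n) (c \<odot>\<^bsub>lp p n\<^esub> a) = \<bar>c\<bar> * nrm (lp p n) a" for c
      using lp_norm_cong[OF p n, of "c \<odot>\<^bsub>lp p n\<^esub> a" "\<lambda>j. c * a j"] lp_norm_scale[OF p n, of c a] by simp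
    fix b
    have "nrm (lp p n) (a \<oplus>\<^bsub>lp p n\<^esub> b) = nrm (lp p n) (\<lambda>j. a j + b j)"
      by (rule lp_norm_cong[OF p n]) simp
    then show "nrm (lp p n) (a \<oplus>\<^bsub>lp p n\<^esub> b) \<le> nrm (lp p n) a + nrm (lp p n) b"
      unfolding lp_norm_eq_Lq[OF p n] using Lq_fun_add(2)[OF p Lq_fun_finite[OF p] Lq_fun_finite[OF p]] by simp
  qed
qed

lemma module_tensor:
  assumes E: "module real_ring E" shows "module real_ring (tensor_module n E)"
proof -
  interpret real_module E using E by (simp add: real_module_iff)
  show ?thesis
    by (rule real_moduleI)
      (auto simp: sm_simps a_ac fun_eq_iff restrict_def PiE_def Pi_def extensional_def)
qed

lemma (in normed_space) linear_map_zero: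
  assumes "normed_space F" "linear_map E F u" shows "u \<zero> = \<zero>\<^bsub>F\<^esub>"
proof -
  interpret real_module E by (rule real_module)
  interpret F: normed_space F by fact
  interpret F: real_module F by (rule F.real_module)
  have "u (0 \<odot> \<zero>) = 0 \<odot>\<^bsub>F\<^esub> u \<zero>" "u \<zero> \<in> carrier F"
    using assms(2) zero_closed unfolding linear_map_def by blast+
  then show ?thesis by (simp add: sm_simps F.sm_simps)
qed

lemma (in normed_space) op_norm_bound:
  assumes F: "normed_space F" and u: "linear_map E F u" and x: "x \<in> carrier E"
  shows "ennreal (nrm F (u x)) \<le> op_norm E F u * ennreal (nrm E x)"
proof (cases "nrm E x = 0")
  \<comment> \<open>Here x cannot be normalised. Linearity gives u x = 0, so the product of a
    possibly infinite operator norm with 0, which is 0 in \<open>ennreal\<close>, is still an upper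
    bound.\<close>
  case True
  then have "u x = \<zero>\<^bsub>F\<^esub>" using nrm_eq_0[OF x] linear_map_zero[OF F u] by simp
  then show ?thesis using normed_space.nrm_zero[OF F] by simp
next
  case False
  interpret real_module E by (rule real_module)
  interpret F: normed_space F by (rule F)
  define c where "c = nrm E x"
  have c: "c > 0" using False nrm_nonneg[OF x] by (simp add: c_def)
  have ux: "u x \<in> carrier F" using u x by (auto simp: linear_map_def)
  have "nrm E ((1 / c) \<odot> x) \<le> 1" using c nrm_smult[OF x] by (simp add: c_def)
  then have "ennreal (nrm F (u ((1 / c) \<odot> x))) \<le> op_norm E F u"
    unfolding op_norm_def using x by (intro SUP_upper) auto
  moreover have "u ((1 / c) \<odot> x) = (1 / c) \<odot>\<^bsub>F\<^esub> u x" using u x by (auto simp: linear_map_def)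
  ultimately have "ennreal (nrm F (u x) / c) \<le> op_norm E F u"
    using F.nrm_smult[OF ux, of "1 / c"] c by simp
  then have "ennreal (nrm F (u x) / c) * ennreal c \<le> op_norm E F u * ennreal c"
    by (rule mult_right_mono) simp
  moreover have "ennreal (nrm F (u x) / c) * ennreal c = ennreal (nrm F (u x))"
    using c F.nrm_nonneg[OF ux] by (simp add: ennreal_mult[symmetric])
  ultimately show ?thesis by (simp add: c_def)
qed

lemma op_norm_le:
  assumes "0 \<le> c" "\<And>x. x \<in> carrier E \<Longrightarrow> nrm E x \<le> 1 \<Longrightarrow> nrm F (u x) \<le> c"
  shows "op_norm E F u \<le> ennreal c"
  unfolding op_norm_def using assms by (auto intro!: SUP_least ennreal_leI)

lemma (in normed_space) dual_ball_bound:
  assumes "g \<in> dual_ball E" "x \<in> carrier E" shows "\<bar>g x\<bar> \<le> nrm E x"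
proof -
  have g: "linear_map E real_line g" "op_norm E real_line g \<le> 1"
    using assms by (auto simp: dual_ball_def bounded_ops_def)
  have "ennreal \<bar>g x\<bar> \<le> op_norm E real_line g * ennreal (nrm E x)"
    using op_norm_bound[OF normed_space_real_line g(1) assms(2)] by simp
  also have "\<dots> \<le> 1 * ennreal (nrm E x)" using g(2) by (intro mult_right_mono) auto
  finally show ?thesis using nrm_nonneg[OF assms(2)] by simp
qed

text \<open>Linearity is given on the carrier only, so the expansion runs through truncations
  \<open>B k\<close> that differ in one coordinate.\<close>

lemma lp_expand:
  fixes \<phi> :: "(nat \<Rightarrow> real) \<Rightarrow> real"
  assumes add: "\<And>a b. a \<in> carrier (lp p n) \<Longrightarrow> b \<in> carrier (lp p n) \<Longrightarrow> \<phi> (a \<oplus>\<^bsub>lp p n\<^esub> b) = \<phi> a + \<phi> b"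
    and smult: "\<And>c a. a \<in> carrier (lp p n) \<Longrightarrow> \<phi> (c \<odot>\<^bsub>lp p n\<^esub> a) = c * \<phi> a"
    and a: "a \<in> carrier (lp p n)"
  shows "\<phi> a = (\<Sum>j<n. a j * \<phi> (unit_vec n j))"
proof -
  have u: "unit_vec n j \<in> carrier (lp p n)" for j by (simp add: unit_vec_def)
  define B where "B k = (\<lambda>j\<in>{..<n}. if j < k then a j else 0)" for k
  have B: "B k \<in> carrier (lp p n)" for k by (simp add: B_def)
  have "\<phi> (B k) = (\<Sum>j<k. a j * \<phi> (unit_vec n j))" if "k \<le> n" for k
    using that
  proof (induction k)
    case 0
    have "B 0 = 0 \<odot>\<^bsub>lp p n\<^esub> a" by (auto simp: B_def)
    then show ?case using smult[OF a, of 0] by (simp only: lessThan_0 sum.empty mult_zero_left)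
  next
    case (Suc k)
    have "B (Suc k) = B k \<oplus>\<^bsub>lp p n\<^esub> (a k \<odot>\<^bsub>lp p n\<^esub> unit_vec n k)"
      by (auto simp: B_def unit_vec_def fun_eq_iff less_Suc_eq)
    then have "\<phi> (B (Suc k)) = \<phi> (B k \<oplus>\<^bsub>lp p n\<^esub> (a k \<odot>\<^bsub>lp p n\<^esub> unit_vec n k))" by (rule arg_cong)
    also have "\<dots> = \<phi> (B k) + \<phi> (a k \<odot>\<^bsub>lp p n\<^esub> unit_vec n k)"
      by (rule add[OF B]) simp
    also have "\<dots> = \<phi> (B k) + a k * \<phi> (unit_vec n k)" unfolding smult[OF u] ..
    finally show ?case using Suc by simp
  qed
  moreover have "B n = a"
    using a by (auto simp: B_def fun_eq_iff PiE_def extensional_def)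
  ultimately show ?thesis by (metis order_refl)
qed

section \<open>Finite sums in modules\<close>

context real_module
begin

lemma finsum_lessThan_Suc:
  fixes n :: nat
  assumes "\<And>k. k < Suc n \<Longrightarrow> f k \<in> carrier E"
  shows "(\<Oplus>k\<in>{..<Suc n}. f k) = (\<Oplus>k\<in>{..<n}. f k) \<oplus> f n"
  unfolding lessThan_Suc using assms by (subst finsum_insert) (auto simp: a_comm)

lemma finsum_in: "(\<And>k. k \<in> A \<Longrightarrow> f k \<in> carrier E) \<Longrightarrow> (\<Oplus>k\<in>A. f k) \<in> carrier E"
  by (rule finsum_closed) auto

lemma finsum_add_split:
  fixes m n :: nat
  assumes "\<And>k. k < m + n \<Longrightarrow> f k \<in> carrier E"
  shows "(\<Oplus>k\<in>{..<m + n}. f k) = (\<Oplus>k\<in>{..<m}. f k) \<oplus> (\<Oplus>k\<in>{..<n}. f (m + k))"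
  using assms
proof (induction n)
  case (Suc n)
  have "(\<Oplus>k\<in>{..<m + Suc n}. f k) = (\<Oplus>k\<in>{..<m + n}. f k) \<oplus> f (m + n)"
    using finsum_lessThan_Suc[of "m + n" f] Suc.prems by simp
  also have "\<dots> = ((\<Oplus>k\<in>{..<m}. f k) \<oplus> (\<Oplus>k\<in>{..<n}. f (m + k))) \<oplus> f (m + n)"
    using Suc by simp
  also have "\<dots> = (\<Oplus>k\<in>{..<m}. f k) \<oplus> ((\<Oplus>k\<in>{..<n}. f (m + k)) \<oplus> f (m + n))"
    using Suc.prems by (intro a_assoc finsum_in) auto
  also have "(\<Oplus>k\<in>{..<n}. f (m + k)) \<oplus> f (m + n) = (\<Oplus>k\<in>{..<Suc n}. f (m + k))"
    using Suc.prems by (subst finsum_lessThan_Suc) auto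
  finally show ?case .
qed (simp add: finsum_in)

lemma finsum_smult_sum:
  assumes "finite A" "x \<in> carrier E"
  shows "(\<Oplus>k\<in>A. c k \<odot> x) = (\<Sum>k\<in>A. c k) \<odot> x"
  using assms(1) by induction (use assms(2) in \<open>auto simp: sm_simps\<close>)

text \<open>Shows how a representation of a tensor changes when coefficients act on its first
  factor: the vectors \<open>x k\<close> stay, and only the scalars in front of them are
  transformed.\<close>

lemma finsum_swap_smult:
  fixes m n :: nat
  assumes w: "\<And>j. j < n \<Longrightarrow> w j = (\<Oplus>k\<in>{..<m}. a k j \<odot> x k)" and x: "\<And>k. k < m \<Longrightarrow> x k \<in> carrier E"
  shows "(\<Oplus>j\<in>{..<n}. b j \<odot> w j) = (\<Oplus>k\<in>{..<m}. (\<Sum>j<n. b j * a k j) \<odot> x k)"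
  using w
proof (induction n)
  case 0
  have "(\<Oplus>k\<in>{..<m}. 0 \<odot> x k) = (\<Oplus>k\<in>{..<m}. \<zero>)" using x by (intro finsum_cong') (auto simp: sm_simps)
  then show ?case by simp
next
  case (Suc n)
  have wc: "w j \<in> carrier E" if "j < Suc n" for j using Suc.prems[OF that] x by (auto intro!: finsum_in)
  have "(\<Oplus>j\<in>{..<Suc n}. b j \<odot> w j) = (\<Oplus>j\<in>{..<n}. b j \<odot> w j) \<oplus> b n \<odot> w n"
    using wc by (intro finsum_lessThan_Suc) auto
  also have "(\<Oplus>j\<in>{..<n}. b j \<odot> w j) = (\<Oplus>k\<in>{..<m}. (\<Sum>j<n. b j * a k j) \<odot> x k)"
    using Suc by auto
  also have "b n \<odot> w n = (\<Oplus>k\<in>{..<m}. (b n * a k n) \<odot> x k)"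
  proof -
    have "b n \<odot> w n = (\<Oplus>k\<in>{..<m}. b n \<odot> (a k n \<odot> x k))"
      unfolding Suc.prems[OF lessI] using x by (intro finsum_sm) auto
    also have "\<dots> = (\<Oplus>k\<in>{..<m}. (b n * a k n) \<odot> x k)"
      using x by (intro finsum_cong') (auto simp: sm_simps)
    finally show ?thesis .
  qed
  also have "(\<Oplus>k\<in>{..<m}. (\<Sum>j<n. b j * a k j) \<odot> x k) \<oplus> (\<Oplus>k\<in>{..<m}. (b n * a k n) \<odot> x k)
      = (\<Oplus>k\<in>{..<m}. (\<Sum>j<n. b j * a k j) \<odot> x k \<oplus> (b n * a k n) \<odot> x k)"
    using x by (intro finsum_addf[symmetric]) auto
  also have "\<dots> = (\<Oplus>k\<in>{..<m}. (\<Sum>j<Suc n. b j * a k j) \<odot> x k)"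
    using x by (intro finsum_cong') (auto simp: sm_simps)
  finally show ?case .
qed

lemma finsum_single:
  assumes "finite A" "k \<in> A" "\<And>j. j \<in> A \<Longrightarrow> j \<noteq> k \<Longrightarrow> f j = \<zero>" "f k \<in> carrier E"
  shows "(\<Oplus>j\<in>A. f j) = f k"
proof -
  have "(\<Oplus>j\<in>A. f j) = (\<Oplus>j\<in>insert k (A - {k}). f j)" using assms(2) by (simp add: insert_absorb)
  also have "\<dots> = f k \<oplus> (\<Oplus>j\<in>A - {k}. f j)"
    using assms by (subst finsum_insert) (auto simp: Pi_def)
  also have "(\<Oplus>j\<in>A - {k}. f j) = (\<Oplus>j\<in>A - {k}. \<zero>)" using assms(3) by (intro finsum_cong') auto
  finally show ?thesis using assms(4) by simp
qed

lemma additive_finsum: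
  fixes \<phi> :: "'a \<Rightarrow> real"
  assumes add: "\<And>x y. x \<in> carrier E \<Longrightarrow> y \<in> carrier E \<Longrightarrow> \<phi> (x \<oplus> y) = \<phi> x + \<phi> y"
    and A: "finite A" "\<And>k. k \<in> A \<Longrightarrow> f k \<in> carrier E"
  shows "\<phi> (\<Oplus>k\<in>A. f k) = (\<Sum>k\<in>A. \<phi> (f k))"
  using A
proof (induction A rule: finite_induct)
  case empty
  then show ?case using add[of \<zero> \<zero>] by simp
next
  case (insert k A)
  then show ?case using add by (subst finsum_insert) (auto simp: finsum_in)
qed

end

lemma (in normed_space) nrm_finsum_le:
  assumes "finite A" "\<And>k. k \<in> A \<Longrightarrow> f k \<in> carrier E"
  shows "nrm E (\<Oplus>k\<in>A. f k) \<le> (\<Sum>k\<in>A. nrm E (f k))"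
  using assms
proof (induction A rule: finite_induct)
  case empty
  then show ?case by (simp add: nrm_zero)
next
  case (insert k A)
  then have "nrm E (f k \<oplus> (\<Oplus>k\<in>A. f k)) \<le> nrm E (f k) + nrm E (\<Oplus>k\<in>A. f k)"
    by (intro nrm_triangle finsum_closed) auto
  then show ?case using insert by (subst finsum_insert) auto
qed

lemma tensor_finsum:
  assumes E: "module real_ring E" and A: "finite A" "\<And>k. k \<in> A \<Longrightarrow> f k \<in> carrier (tensor_module n E)"
  shows "(\<Oplus>\<^bsub>tensor_module n E\<^esub>k\<in>A. f k) = (\<lambda>j\<in>{..<n}. \<Oplus>\<^bsub>E\<^esub>k\<in>A. f k j)"
  using A
proof (induction A rule: finite_induct)
  interpret real_module E using E by (simp add: real_module_iff)
  interpret T: real_module "tensor_module n E" using module_tensor[OF E] by (simp add: real_module_iff)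
  {
    case empty
    then show ?case by simp
  next
    case (insert k A)
    have "(\<Oplus>\<^bsub>tensor_module n E\<^esub>k\<in>insert k A. f k) = f k \<oplus>\<^bsub>tensor_module n E\<^esub> (\<Oplus>\<^bsub>tensor_module n E\<^esub>k\<in>A. f k)"
      using insert by (subst T.finsum_insert) auto
    also have "\<dots> = (\<lambda>j\<in>{..<n}. f k j \<oplus>\<^bsub>E\<^esub> (\<Oplus>\<^bsub>E\<^esub>k\<in>A. f k j))" using insert by (auto simp: fun_eq_iff)
    also have "\<dots> = (\<lambda>j\<in>{..<n}. \<Oplus>\<^bsub>E\<^esub>k\<in>insert k A. f k j)"
    proof (rule restrict_ext)
      fix j assume "j \<in> {..<n}"
      then have "f l j \<in> carrier E" if "l \<in> insert k A" for l using insert.prems[OF that] by auto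
      then show "f k j \<oplus>\<^bsub>E\<^esub> (\<Oplus>\<^bsub>E\<^esub>k\<in>A. f k j) = (\<Oplus>\<^bsub>E\<^esub>k\<in>insert k A. f k j)"
        using insert by (subst finsum_insert) auto
    qed
    finally show ?case .
  }
qed

text \<open>The second axiom follows from the other two. A functional f of norm at most 1 is a
  contraction T into the one-dimensional space \<open>lp p 1\<close>, and T \<otimes> I sends w to 1
  \<otimes> z, where z is the image of w under f \<otimes> I. So the norm of z is at most that of w,
  and g is applied to z.\<close>

lemma p_multinormed_spaceI:
  fixes E (structure)
  assumes E: "banach_space E" and p: "1 \<le> p"
    and nrm: "\<And>n. n \<ge> 1 \<Longrightarrow> normed_space (tensor_space n E)"
    and elem: "\<And>n a x. n \<ge> 1 \<Longrightarrow> a \<in> carrier (lp p n) \<Longrightarrow> x \<in> carrier E \<Longrightarrow>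
       mnrm E n (elem_tensor n E a x) = nrm (lp p n) a * nrm E x"
    and left: "\<And>n m T w. n \<ge> 1 \<Longrightarrow> m \<ge> 1 \<Longrightarrow> T \<in> bounded_ops (lp p n) (lp p m) \<Longrightarrow>
       w \<in> carrier (tensor_space n E) \<Longrightarrow>
       ennreal (mnrm E m (tensor_left n m E T w)) \<le> op_norm (lp p n) (lp p m) T * ennreal (mnrm E n w)"
  shows "p_multinormed_space p E"
proof (rule p_multinormed_space.intro)
  interpret banach_space E by (rule E)
  interpret real_module E by (rule real_module)
  show "banach_space E" by (rule E)
  show "p_multinormed_space_axioms p E"
  proof (rule p_multinormed_space_axioms.intro)
    show "normed_space (tensor_space n E)" if "n \<ge> 1" for n by (rule nrm[OF that])
    show "mnrm E n (elem_tensor n E a x) = nrm (lp p n) a * nrm E x"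
      if "n \<ge> 1" "a \<in> carrier (lp p n)" "x \<in> carrier E" for n a x by (rule elem[OF that])
    show "ennreal (mnrm E m (tensor_left n m E T w)) \<le> op_norm (lp p n) (lp p m) T * ennreal (mnrm E n w)"
      if "n \<ge> 1" "m \<ge> 1" "T \<in> bounded_ops (lp p n) (lp p m)" "w \<in> carrier (tensor_space n E)" for n m T w
      by (rule left[OF that])
    fix n w f g
    assume n: "n \<ge> (1::nat)" and w: "w \<in> carrier (tensor_space n E)"
      and f: "f \<in> dual_ball (lp p n)" and g: "g \<in> dual_ball E"
    interpret L: normed_space "lp p n" by (rule normed_space_lp[OF p n])
    interpret T: normed_space "tensor_space n E" by (rule nrm[OF n])
    have wc: "w j \<in> carrier E" if "j < n" for j using w that by auto
    have lin: "linear_map (lp p n) real_line f" using f by (auto simp: dual_ball_def bounded_ops_def)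
    define T where "T a = (\<lambda>i\<in>{..<1::nat}. f a)" for a
    \<comment> \<open>The norm of a single coordinate is squeezed between that coordinate and the
      sum of all coordinates.\<close>
    have lp1: "nrm (lp p 1) (\<lambda>i\<in>{..<1}. c) = \<bar>c\<bar>" for c
    proof (rule antisym)
      show "nrm (lp p 1) (\<lambda>i\<in>{..<1}. c) \<le> \<bar>c\<bar>" using lp_norm_sum_le[OF p order_refl, of "\<lambda>i\<in>{..<1}. c"] by simp
      show "\<bar>c\<bar> \<le> nrm (lp p 1) (\<lambda>i\<in>{..<1}. c)" using lp_norm_coord[OF p order_refl, of 0 "\<lambda>i\<in>{..<1}. c"] by simp
    qed
    have "linear_map (lp p n) (lp p 1) T"
      using lin by (auto simp: linear_map_def T_def fun_eq_iff)
    moreover have T1: "op_norm (lp p n) (lp p 1) T \<le> ennreal 1"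
    proof (rule op_norm_le)
      fix a assume "a \<in> carrier (lp p n)" "nrm (lp p n) a \<le> 1"
      then show "nrm (lp p 1) (T a) \<le> 1" using L.dual_ball_bound[OF f, of a] unfolding T_def lp1 by simp
    qed simp
    ultimately have T: "T \<in> bounded_ops (lp p n) (lp p 1)"
      by (auto simp: bounded_ops_def intro: le_less_trans)
    define z where "z = (\<Oplus>j\<in>{..<n}. f (unit_vec n j) \<odot> w j)"
    have z: "z \<in> carrier E" using wc by (auto simp: z_def intro!: finsum_in)
    have "tensor_left n 1 E T w = elem_tensor 1 E (\<lambda>i\<in>{..<1}. 1) z"
    proof -
      have "tensor_left n 1 E T w = (\<lambda>i\<in>{..<1}. z)" 
        by (auto simp: tensor_left_def T_def z_def fun_eq_iff)
      then show ?thesis using z by (auto simp: elem_tensor_def fun_eq_iff sm_simps)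
    qed
    then have "mnrm E 1 (tensor_left n 1 E T w) = nrm E z"
      using elem[of 1 "\<lambda>i\<in>{..<1}. 1" z] z lp1[of 1] by simp
    then have "ennreal (nrm E z) \<le> op_norm (lp p n) (lp p 1) T * ennreal (mnrm E n w)"
      using left[OF n order_refl T w] by simp
    also have "\<dots> \<le> 1 * ennreal (mnrm E n w)" using T1 by (intro mult_right_mono) auto
    finally have zw: "nrm E z \<le> mnrm E n w" using T.nrm_nonneg[OF w] by simp
    have glin: "linear_map E real_line g" using g by (auto simp: dual_ball_def bounded_ops_def)
    have "g z = (\<Sum>j<n. g (f (unit_vec n j) \<odot> w j))"
      unfolding z_def using glin wc by (intro additive_finsum) (auto simp: linear_map_def)
    also have "\<dots> = tensor_pair n f g w"
      unfolding tensor_pair_def using glin wc by (intro sum.cong) (auto simp: linear_map_def)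
    finally show "\<bar>tensor_pair n f g w\<bar> \<le> mnrm E n w"
      using dual_ball_bound[OF g z] zw by simp
  qed
qed

section \<open>The projective norm\<close>

text \<open>The coordinate form of writing w as a sum of elementary tensors a k \<otimes> x k. The
  coefficient vectors may take any values from n on, so no restriction has to be carried along when
  they are transformed.\<close>

definition proj_rep ::
    "nat \<Rightarrow> ('a, 'm) nspace_scheme \<Rightarrow> (nat \<Rightarrow> 'a) \<Rightarrow> nat \<Rightarrow> (nat \<Rightarrow> nat \<Rightarrow> real) \<Rightarrow> (nat \<Rightarrow> 'a) \<Rightarrow> bool" where
  "proj_rep n E w K a x \<longleftrightarrow> (\<forall>k<K. x k \<in> carrier E) \<and>
     (\<forall>j<n. w j = (\<Oplus>\<^bsub>E\<^esub>k\<in>{..<K}. a k j \<odot>\<^bsub>E\<^esub> x k))"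

definition proj_sum ::
    "ennreal \<Rightarrow> nat \<Rightarrow> ('a, 'm) nspace_scheme \<Rightarrow> nat \<Rightarrow> (nat \<Rightarrow> nat \<Rightarrow> real) \<Rightarrow> (nat \<Rightarrow> 'a) \<Rightarrow> real" where
  "proj_sum p n E K a x = (\<Sum>k<K. nrm (lp p n) (a k) * nrm E (x k))"

locale proj_space = normed_space E for E :: "'a nspace" (structure) +
  fixes p :: ennreal and n :: nat
  assumes p: "1 \<le> p" and n: "1 \<le> n"

sublocale proj_space \<subseteq> real_module E by (rule real_module)

context proj_space
begin

lemma proj_norm_eq:
  assumes w: "w \<in> {..<n} \<rightarrow>\<^sub>E carrier E"
  shows "proj_norm p n E w = Inf {proj_sum p n E K a x | K a x. proj_rep n E w K a x}"
  unfolding proj_norm_def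
proof (intro arg_cong[where f=Inf] Collect_cong iffI)
  fix s
  assume "\<exists>(K::nat) a x. s = (\<Sum>k<K. nrm (lp p n) (a k) * nrm E (x k)) \<and>
    (\<forall>k<K. a k \<in> carrier (lp p n) \<and> x k \<in> carrier E) \<and>
    w = (\<Oplus>\<^bsub>tensor_module n E\<^esub>k\<in>{..<K}. elem_tensor n E (a k) (x k))"
  then obtain K :: nat and a x where s: "s = (\<Sum>k<K. nrm (lp p n) (a k) * nrm E (x k))"
    and x': "\<forall>k<K. a k \<in> carrier (lp p n) \<and> x k \<in> carrier E"
    and w': "w = (\<Oplus>\<^bsub>tensor_module n E\<^esub>k\<in>{..<K}. elem_tensor n E (a k) (x k))"
    by blast
  have x: "x k \<in> carrier E" if "k < K" for k using x' that by blast
  have "w = (\<lambda>j\<in>{..<n}. \<Oplus>k\<in>{..<K}. elem_tensor n E (a k) (x k) j)"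
    unfolding w' by (rule tensor_finsum) (use x module_axioms in \<open>auto simp: elem_tensor_def\<close>)
  then have "proj_rep n E w K a x"
    using x by (auto simp: proj_rep_def elem_tensor_def intro!: finsum_cong')
  then show "\<exists>K a x. s = proj_sum p n E K a x \<and> proj_rep n E w K a x"
    using s by (auto simp: proj_sum_def)
next
  fix s
  assume "\<exists>K a x. s = proj_sum p n E K a x \<and> proj_rep n E w K a x"
  then obtain K a x where s: "s = proj_sum p n E K a x" and r: "proj_rep n E w K a x" by auto
  define a' where "a' k = restrict (a k) {..<n}" for k
  have x: "\<And>k. k < K \<Longrightarrow> x k \<in> carrier E" using r by (auto simp: proj_rep_def)
  have "(\<Oplus>\<^bsub>tensor_module n E\<^esub>k\<in>{..<K}. elem_tensor n E (a' k) (x k)) =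
      (\<lambda>j\<in>{..<n}. \<Oplus>k\<in>{..<K}. elem_tensor n E (a' k) (x k) j)"
    by (rule tensor_finsum) (use x module_axioms in \<open>auto simp: elem_tensor_def\<close>)
  also have "\<dots> = (\<lambda>j\<in>{..<n}. w j)"
  proof (rule restrict_ext)
    fix j assume j: "j \<in> {..<n}"
    have "(\<Oplus>k\<in>{..<K}. elem_tensor n E (a' k) (x k) j) = (\<Oplus>k\<in>{..<K}. a k j \<odot> x k)"
      using x j by (intro finsum_cong') (auto simp: elem_tensor_def a'_def)
    then show "(\<Oplus>k\<in>{..<K}. elem_tensor n E (a' k) (x k) j) = w j"
      using r j by (simp add: proj_rep_def)
  qed
  also have "\<dots> = w" using w by (auto simp: fun_eq_iff PiE_def extensional_def)
  finally have "w = (\<Oplus>\<^bsub>tensor_module n E\<^esub>k\<in>{..<K}. elem_tensor n E (a' k) (x k))" by simp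
  moreover have "nrm (lp p n) (a' k) = nrm (lp p n) (a k)" for k
    by (rule lp_norm_cong[OF p n]) (simp add: a'_def)
  ultimately show "\<exists>(K::nat) a x. s = (\<Sum>k<K. nrm (lp p n) (a k) * nrm E (x k)) \<and>
    (\<forall>k<K. a k \<in> carrier (lp p n) \<and> x k \<in> carrier E) \<and>
    w = (\<Oplus>\<^bsub>tensor_module n E\<^esub>k\<in>{..<K}. elem_tensor n E (a k) (x k))"
    using s x by (intro exI[of _ K] exI[of _ a'] exI[of _ x]) (auto simp: proj_sum_def a'_def)
qed

lemma proj_sum_nonneg: "proj_rep n E w K a x \<Longrightarrow> 0 \<le> proj_sum p n E K a x"
  unfolding proj_sum_def proj_rep_def
  by (auto intro!: sum_nonneg mult_nonneg_nonneg nrm_nonneg lp_norm_nonneg[OF p n])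

text \<open>Every tuple is the sum of its coordinates tensored with unit vectors; hence the infimum
  in the projective norm runs over a nonempty set.\<close>

lemma proj_rep_unit:
  assumes "\<And>j. j < n \<Longrightarrow> w j \<in> carrier E"
  shows "proj_rep n E w n (\<lambda>k j. if j = k then 1 else 0) w"
  unfolding proj_rep_def
proof (intro conjI allI impI)
  fix j assume j: "j < n"
  have "(\<Oplus>k\<in>{..<n}. (if j = k then 1 else 0) \<odot> w k) = (if j = j then 1 else 0) \<odot> w j"
    by (rule finsum_single) (use j assms in \<open>auto simp: sm_simps\<close>)
  then show "w j = (\<Oplus>k\<in>{..<n}. (if j = k then 1 else 0) \<odot> w k)" using assms[OF j] by (simp add: sm_simps)
qed (use assms in auto)

lemma proj_norm_le:
  assumes w: "w \<in> {..<n} \<rightarrow>\<^sub>E carrier E" and r: "proj_rep n E w K a x"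
  shows "proj_norm p n E w \<le> proj_sum p n E K a x"
  unfolding proj_norm_eq[OF w] using r proj_sum_nonneg by (intro cInf_lower bdd_belowI[of _ 0]) auto

lemma proj_norm_ge:
  assumes w: "w \<in> {..<n} \<rightarrow>\<^sub>E carrier E"
    and c: "\<And>K a x. proj_rep n E w K a x \<Longrightarrow> c \<le> proj_sum p n E K a x"
  shows "c \<le> proj_norm p n E w"
proof -
  have "proj_rep n E w n (\<lambda>k j. if j = k then 1 else 0) w" by (rule proj_rep_unit) (use w in auto)
  then show ?thesis unfolding proj_norm_eq[OF w] using c by (intro cInf_greatest) auto
qed

lemma proj_norm_approx:
  assumes w: "w \<in> {..<n} \<rightarrow>\<^sub>E carrier E" and e: "e > 0"
  obtains K a x where "proj_rep n E w K a x" "proj_sum p n E K a x < proj_norm p n E w + e"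
proof -
  have "\<not> (\<forall>K a x. proj_rep n E w K a x \<longrightarrow> proj_norm p n E w + e \<le> proj_sum p n E K a x)"
    using proj_norm_ge[OF w, of "proj_norm p n E w + e"] e by auto
  then show thesis using that by (meson not_le)
qed

lemma proj_norm_nonneg: "w \<in> {..<n} \<rightarrow>\<^sub>E carrier E \<Longrightarrow> 0 \<le> proj_norm p n E w"
  by (rule proj_norm_ge) (auto intro: proj_sum_nonneg)

lemma proj_norm_le_sum:
  assumes w: "w \<in> {..<n} \<rightarrow>\<^sub>E carrier E"
  shows "proj_norm p n E w \<le> (\<Sum>j<n. nrm E (w j))"
proof -
  have wc: "w j \<in> carrier E" if "j < n" for j using w that by auto
  have "proj_norm p n E w \<le> proj_sum p n E n (\<lambda>k j. if j = k then 1 else 0) w"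
    by (rule proj_norm_le[OF w proj_rep_unit[OF wc]])
  also have "\<dots> \<le> (\<Sum>j<n. 1 * nrm E (w j))"
    unfolding proj_sum_def
  proof (intro sum_mono mult_right_mono)
    fix k assume k: "k \<in> {..<n}"
    have "nrm (lp p n) (\<lambda>j. if j = k then 1 else 0) \<le> (\<Sum>j<n. \<bar>if j = k then 1 else 0\<bar>)"
      by (rule lp_norm_sum_le[OF p n])
    also have "\<dots> = 1" using k by (subst sum.remove[of _ k]) auto
    finally show "nrm (lp p n) (\<lambda>j. if j = k then 1 else 0) \<le> 1" .
  qed (use wc nrm_nonneg in auto)
  finally show ?thesis by simp
qed

text \<open>A functional b of norm at most 1 on \<open>lp p n\<close> induces a contraction b
  \<otimes> I from the projective tensor product to E. This is the source of all lower bounds for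
  projective norms in this context.\<close>

lemma proj_rep_coord_le:
  assumes r: "proj_rep n E w K a x" and b: "\<And>k. k < K \<Longrightarrow> \<bar>\<Sum>j<n. b j * a k j\<bar> \<le> nrm (lp p n) (a k)"
  shows "nrm E (\<Oplus>j\<in>{..<n}. b j \<odot> w j) \<le> proj_sum p n E K a x"
proof -
  have x: "\<And>k. k < K \<Longrightarrow> x k \<in> carrier E" using r by (auto simp: proj_rep_def)
  have "(\<Oplus>j\<in>{..<n}. b j \<odot> w j) = (\<Oplus>k\<in>{..<K}. (\<Sum>j<n. b j * a k j) \<odot> x k)"
    using r by (intro finsum_swap_smult) (auto simp: proj_rep_def)
  also have "nrm E \<dots> \<le> (\<Sum>k<K. nrm E ((\<Sum>j<n. b j * a k j) \<odot> x k))"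
    using x by (intro nrm_finsum_le) auto
  also have "\<dots> \<le> proj_sum p n E K a x"
    unfolding proj_sum_def using x b by (intro sum_mono) (auto simp: nrm_smult intro!: mult_right_mono nrm_nonneg)
  finally show ?thesis .
qed

lemma nrm_coord_le_proj_norm:
  assumes w: "w \<in> {..<n} \<rightarrow>\<^sub>E carrier E" and i: "i < n"
  shows "nrm E (w i) \<le> proj_norm p n E w"
proof (rule proj_norm_ge[OF w])
  fix K a x assume r: "proj_rep n E w K a x"
  have "(\<Oplus>j\<in>{..<n}. (if j = i then 1 else 0) \<odot> w j) = (if i = i then 1 else 0) \<odot> w i"
    by (rule finsum_single) (use i w in \<open>auto simp: sm_simps PiE_iff\<close>)
  then have e: "(\<Oplus>j\<in>{..<n}. (if j = i then 1 else 0) \<odot> w j) = w i" using w i by (auto simp: sm_simps PiE_iff)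
  have "(\<Sum>j<n. (if j = i then 1 else 0) * a k j) = a k i" for k
    using i by (subst sum.remove[of _ i]) auto
  then show "nrm E (w i) \<le> proj_sum p n E K a x"
    unfolding e[symmetric] using lp_norm_coord[OF p n i] by (intro proj_rep_coord_le[OF r]) simp
qed

text \<open>For the lower bound, every representation is tested with b \<otimes> I, where b norms
  a.\<close>

lemma proj_norm_elem:
  assumes x: "x \<in> carrier E"
  shows "proj_norm p n E (elem_tensor n E a x) = nrm (lp p n) a * nrm E x"
proof (rule antisym)
  let ?w = "elem_tensor n E a x"
  have w: "?w \<in> {..<n} \<rightarrow>\<^sub>E carrier E" using x by (auto simp: elem_tensor_def)
  have "proj_rep n E ?w 1 (\<lambda>_. a) (\<lambda>_. x)" using x by (auto simp: proj_rep_def elem_tensor_def lessThan_Suc)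
  from proj_norm_le[OF w this] show "proj_norm p n E ?w \<le> nrm (lp p n) a * nrm E x"
    by (simp add: proj_sum_def)
  show "nrm (lp p n) a * nrm E x \<le> proj_norm p n E ?w"
  proof (rule proj_norm_ge[OF w])
    fix K a' x' assume r: "proj_rep n E ?w K a' x'"
    \<comment> \<open>The conjugate exponent computed in \<open>ennreal\<close>: for p = 1 the
      denominator is 0 and p' is infinite.\<close>
    define p' where "p' = 1 / (1 - 1 / p)"
    have pp: "1 / p + 1 / p' = 1"
    proof -
      have "1 / p \<le> 1" using p less_le_trans[OF zero_less_one p] by (intro divide_le_posI_ennreal) auto
      then show ?thesis unfolding p'_def one_divide_one_divide_ennreal by (rule add_diff_inverse_ennreal)
    qed
    obtain b where b: "nrm (lp p' n) b \<le> 1" "(\<Sum>j<n. a j * b j) = nrm (lp p n) a"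
      by (rule lp_norming[OF p pp n])
    have le: "\<bar>\<Sum>j<n. b j * c j\<bar> \<le> nrm (lp p n) c" for c
    proof -
      have "\<bar>\<Sum>j<n. b j * c j\<bar> \<le> (\<Sum>j<n. \<bar>c j * b j\<bar>)"
        by (rule order_trans[OF sum_abs]) (simp add: mult.commute)
      also have "\<dots> \<le> nrm (lp p n) c * nrm (lp p' n) b" by (rule Holder_sum[OF p pp n])
      also have "\<dots> \<le> nrm (lp p n) c * 1" using b lp_norm_nonneg[OF p n] by (intro mult_left_mono) auto
      finally show ?thesis by simp
    qed
    have "(\<Oplus>j\<in>{..<n}. b j \<odot> ?w j) = (\<Oplus>j\<in>{..<n}. (b j * a j) \<odot> x)"
      using x by (intro finsum_cong') (auto simp: elem_tensor_def sm_simps)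
    also have "\<dots> = (\<Sum>j<n. b j * a j) \<odot> x" using x by (simp add: finsum_smult_sum)
    finally have "nrm E (\<Oplus>j\<in>{..<n}. b j \<odot> ?w j) = nrm (lp p n) a * nrm E x"
      using b(2) x lp_norm_nonneg[OF p n, of a] by (simp add: nrm_smult mult.commute)
    then show "nrm (lp p n) a * nrm E x \<le> proj_sum p n E K a' x'"
      using proj_rep_coord_le[OF r, of b] le by simp
  qed
qed

text \<open>The triangle inequality concatenates two nearly optimal representations. Definiteness
  holds because the projective norm dominates the norm of every coordinate.\<close>

lemma normed_space_proj: "normed_space (tensor_space n (max_mn p E))"
proof (rule normed_space.intro)
  have eq: "carrier (tensor_space n (max_mn p E)) = {..<n} \<rightarrow>\<^sub>E carrier E" by simp
  show "module real_ring (tensor_space n (max_mn p E))"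
    by (rule real_moduleI)
      (auto simp: sm_simps a_ac fun_eq_iff restrict_def PiE_def Pi_def extensional_def)
  show "normed_space_axioms (tensor_space n (max_mn p E))"
  proof
    fix w assume "w \<in> carrier (tensor_space n (max_mn p E))"
    then have w: "w \<in> {..<n} \<rightarrow>\<^sub>E carrier E" by simp
    then have wc: "w j \<in> carrier E" if "j < n" for j using that by auto
    show "0 \<le> nrm (tensor_space n (max_mn p E)) w" using proj_norm_nonneg[OF w] by simp
    have zero_le: "proj_norm p n E (\<lambda>j\<in>{..<n}. \<zero>) = 0"
      using proj_norm_le_sum[of "\<lambda>j\<in>{..<n}. \<zero>"] proj_norm_nonneg[of "\<lambda>j\<in>{..<n}. \<zero>"] by (simp add: nrm_zero)
    show "nrm (tensor_space n (max_mn p E)) w = 0 \<longleftrightarrow> w = \<zero>\<^bsub>tensor_space n (max_mn p E)\<^esub>"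
    proof
      assume "nrm (tensor_space n (max_mn p E)) w = 0"
      then have "nrm E (w j) = 0" if "j < n" for j
        using nrm_coord_le_proj_norm[OF w that] nrm_nonneg[OF wc[OF that]] by simp
      then have "w j = \<zero>" if "j < n" for j using that nrm_eq_0[OF wc] by auto
      then show "w = \<zero>\<^bsub>tensor_space n (max_mn p E)\<^esub>" using w by (auto simp: fun_eq_iff PiE_def extensional_def)
    qed (use zero_le in simp)
    \<comment> \<open>One inequality is enough, since scaling back by 1 / c yields the
      other.\<close>
    have sm: "proj_norm p n E (\<lambda>j\<in>{..<n}. c \<odot> v j) \<le> \<bar>c\<bar> * proj_norm p n E v"
      if v: "v \<in> {..<n} \<rightarrow>\<^sub>E carrier E" for c v
    proof (cases "c = 0")
      case True
      have "(\<lambda>j\<in>{..<n}. c \<odot> v j) = (\<lambda>j\<in>{..<n}. \<zero>)" using True v by (auto simp: fun_eq_iff sm_simps PiE_iff)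
      then show ?thesis using True zero_le by simp
    next
      case False
      have cv: "(\<lambda>j\<in>{..<n}. c \<odot> v j) \<in> {..<n} \<rightarrow>\<^sub>E carrier E" using v by auto
      have "proj_norm p n E (\<lambda>j\<in>{..<n}. c \<odot> v j) / \<bar>c\<bar> \<le> proj_norm p n E v"
      proof (rule proj_norm_ge[OF v])
        fix K a x assume r: "proj_rep n E v K a x"
        then have x: "\<And>k. k < K \<Longrightarrow> x k \<in> carrier E" by (auto simp: proj_rep_def)
        have "proj_rep n E (\<lambda>j\<in>{..<n}. c \<odot> v j) K (\<lambda>k j. c * a k j) x"
          unfolding proj_rep_def
        proof (intro conjI allI impI)
          fix j assume j: "j < n"
          then have "v j = (\<Oplus>k\<in>{..<K}. a k j \<odot> x k)" using r by (auto simp: proj_rep_def)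
          then have "c \<odot> v j = (\<Oplus>k\<in>{..<K}. c \<odot> (a k j \<odot> x k))" using x by (simp add: finsum_sm)
          also have "\<dots> = (\<Oplus>k\<in>{..<K}. (c * a k j) \<odot> x k)" using x by (intro finsum_cong') (auto simp: sm_simps)
          finally show "(\<lambda>j\<in>{..<n}. c \<odot> v j) j = (\<Oplus>k\<in>{..<K}. (c * a k j) \<odot> x k)" using j by simp
        qed (use x in auto)
        from proj_norm_le[OF cv this]
        have "proj_norm p n E (\<lambda>j\<in>{..<n}. c \<odot> v j) \<le> \<bar>c\<bar> * proj_sum p n E K a x"
          by (simp add: proj_sum_def lp_norm_scale[OF p n] sum_distrib_left mult.assoc)
        then show "proj_norm p n E (\<lambda>j\<in>{..<n}. c \<odot> v j) / \<bar>c\<bar> \<le> proj_sum p n E K a x"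
          using False by (simp add: divide_le_eq mult.commute)
      qed
      then show ?thesis using False by (simp add: divide_le_eq mult.commute)
    qed
    show "nrm (tensor_space n (max_mn p E)) (c \<odot>\<^bsub>tensor_space n (max_mn p E)\<^esub> w) =
        \<bar>c\<bar> * nrm (tensor_space n (max_mn p E)) w" for c
    proof (cases "c = 0")
      case True
      then show ?thesis using sm[OF w, of 0] proj_norm_nonneg[of "\<lambda>j\<in>{..<n}. 0 \<odot> w j"] w
        by (force intro!: antisym)
    next
      case False
      have cw: "(\<lambda>j\<in>{..<n}. c \<odot> w j) \<in> {..<n} \<rightarrow>\<^sub>E carrier E" using w by auto
      have "(\<lambda>j\<in>{..<n}. (1 / c) \<odot> (\<lambda>j\<in>{..<n}. c \<odot> w j) j) = w"
        using w False by (auto simp: fun_eq_iff sm_simps PiE_iff extensional_def)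
      then have "proj_norm p n E w \<le> \<bar>1 / c\<bar> * proj_norm p n E (\<lambda>j\<in>{..<n}. c \<odot> w j)"
        using sm[OF cw, of "1 / c"] by simp
      then have "\<bar>c\<bar> * proj_norm p n E w \<le> proj_norm p n E (\<lambda>j\<in>{..<n}. c \<odot> w j)"
        using False by (simp add: field_simps)
      then show ?thesis using sm[OF w, of c] by simp
    qed
    fix v assume "v \<in> carrier (tensor_space n (max_mn p E))"
    then have v: "v \<in> {..<n} \<rightarrow>\<^sub>E carrier E" by simp
    then have vc: "v j \<in> carrier E" if "j < n" for j using that by auto
    have wv: "(\<lambda>j\<in>{..<n}. w j \<oplus> v j) \<in> {..<n} \<rightarrow>\<^sub>E carrier E" using wc vc by auto
    have "proj_norm p n E (\<lambda>j\<in>{..<n}. w j \<oplus> v j) \<le> proj_norm p n E w + proj_norm p n E v + e"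
      if e: "e > 0" for e
    proof -
      obtain K a x where 1: "proj_rep n E w K a x" "proj_sum p n E K a x < proj_norm p n E w + e / 2"
        by (rule proj_norm_approx[OF w, of "e / 2"]) (use e in auto)
      obtain L b y where 2: "proj_rep n E v L b y" "proj_sum p n E L b y < proj_norm p n E v + e / 2"
        by (rule proj_norm_approx[OF v, of "e / 2"]) (use e in auto)
      define c where "c k = (if k < K then a k else b (k - K))" for k
      define z where "z k = (if k < K then x k else y (k - K))" for k
      have z: "z k \<in> carrier E" if "k < K + L" for k using 1(1) 2(1) that by (auto simp: z_def proj_rep_def)
      have "proj_rep n E (\<lambda>j\<in>{..<n}. w j \<oplus> v j) (K + L) c z"
        unfolding proj_rep_def
      proof (intro conjI allI impI)
        fix j assume j: "j < n"
        have "(\<Oplus>k\<in>{..<K + L}. c k j \<odot> z k) = (\<Oplus>k\<in>{..<K}. c k j \<odot> z k) \<oplus> (\<Oplus>k\<in>{..<L}. c (K + k) j \<odot> z (K + k))"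
          using z by (intro finsum_add_split) auto
        also have "(\<Oplus>k\<in>{..<K}. c k j \<odot> z k) = (\<Oplus>k\<in>{..<K}. a k j \<odot> x k)"
          using 1(1) by (intro finsum_cong') (auto simp: c_def z_def proj_rep_def)
        also have "(\<Oplus>k\<in>{..<L}. c (K + k) j \<odot> z (K + k)) = (\<Oplus>k\<in>{..<L}. b k j \<odot> y k)"
          using 2(1) by (intro finsum_cong') (auto simp: c_def z_def proj_rep_def)
        finally show "(\<lambda>j\<in>{..<n}. w j \<oplus> v j) j = (\<Oplus>k\<in>{..<K + L}. c k j \<odot> z k)"
          using 1(1) 2(1) j by (simp add: proj_rep_def)
      qed (use z in auto)
      from proj_norm_le[OF wv this]
      have "proj_norm p n E (\<lambda>j\<in>{..<n}. w j \<oplus> v j) \<le> proj_sum p n E (K + L) c z" .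
      also have "\<dots> = proj_sum p n E K a x + proj_sum p n E L b y"
      proof -
        have split: "(\<Sum>k<K + L. f k) = (\<Sum>k<K. f k) + (\<Sum>k<L. f (K + k))" for f :: "nat \<Rightarrow> real"
          by (induction L) auto
        show ?thesis unfolding proj_sum_def split by (simp add: c_def z_def)
      qed
      finally show ?thesis using 1(2) 2(2) by simp
    qed
    then have "proj_norm p n E (\<lambda>j\<in>{..<n}. w j \<oplus> v j) \<le> proj_norm p n E w + proj_norm p n E v"
      by (rule field_le_epsilon)
    then show "nrm (tensor_space n (max_mn p E)) (w \<oplus>\<^bsub>tensor_space n (max_mn p E)\<^esub> v) \<le>
        nrm (tensor_space n (max_mn p E)) w + nrm (tensor_space n (max_mn p E)) v"
      by simp
  qed
qed

end

text \<open>For the third axiom, T turns the representation by a k and x k into the one by T (a k)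
  and the same x k.\<close>

lemma max_mn_p_multinormed:
  fixes E (structure)
  assumes E: "banach_space E" and p: "1 \<le> p"
  shows "p_multinormed_space p (max_mn p E)"
proof (rule p_multinormed_spaceI)
  interpret banach_space E by (rule E)
  interpret real_module E by (rule real_module)
  note ms = module_axioms
  show "banach_space (max_mn p E)"
  proof -
    have m: "module real_ring (max_mn p E)"
      by (rule real_moduleI) (auto simp: sm_simps a_ac)
    have "a_inv (max_mn p E) x = a_inv E x" for x
      by (simp add: a_inv_def m_inv_def)
    then have nd: "ndist (max_mn p E) = ndist E"
      by (intro ext) (simp add: ndist_def a_minus_def)
    have "normed_space (max_mn p E)"
      by (intro normed_space.intro m normed_space_axioms.intro)
        (simp_all add: nrm_nonneg nrm_eq_0 nrm_smult nrm_triangle)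
    then show ?thesis using complete
      by (intro banach_space.intro banach_space_axioms.intro) (simp_all add: nd)
  qed
  fix n :: nat assume n: "n \<ge> 1"
  interpret proj_space E p n by unfold_locales (use p n in auto)
  show "normed_space (tensor_space n (max_mn p E))" by (rule normed_space_proj)
  show "mnrm (max_mn p E) n (elem_tensor n (max_mn p E) a x) = nrm (lp p n) a * nrm (max_mn p E) x"
    if "x \<in> carrier (max_mn p E)" for a x
    using proj_norm_elem[of x a] that by (simp add: elem_tensor_def)
  fix m :: nat and T w
  assume m: "m \<ge> 1" and T: "T \<in> bounded_ops (lp p n) (lp p m)" and "w \<in> carrier (tensor_space n (max_mn p E))"
  then have w: "w \<in> {..<n} \<rightarrow>\<^sub>E carrier E" by simp
  interpret m: proj_space E p m by unfold_locales (use p m in auto)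
  interpret L: normed_space "lp p n" by (rule normed_space_lp[OF p n])
  have lin: "linear_map (lp p n) (lp p m) T" and fin: "op_norm (lp p n) (lp p m) T < \<infinity>"
    using T by (auto simp: bounded_ops_def)
  define N where "N = enn2real (op_norm (lp p n) (lp p m) T)"
  have N: "op_norm (lp p n) (lp p m) T = ennreal N" "N \<ge> 0" using fin by (simp_all add: N_def)
  have "(\<oplus>\<^bsub>max_mn p E\<^esub>) = (\<oplus>\<^bsub>E\<^esub>)" by (intro ext) simp
  then have fs: "finsum (max_mn p E) f A = finsum E f A" for f A
    by (simp add: finsum_def finprod_def)
  define v where "v = tensor_left n m (max_mn p E) T w"
  have v_eq: "v = (\<lambda>i\<in>{..<m}. \<Oplus>j\<in>{..<n}. T (unit_vec n j) i \<odot> w j)"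
    by (simp add: v_def tensor_left_def fs)
  have v: "v \<in> {..<m} \<rightarrow>\<^sub>E carrier E" using w unfolding v_eq by (auto intro!: finsum_in)
  have "proj_norm p m E v \<le> N * proj_norm p n E w + e" if e: "e > 0" for e
  proof -
    \<comment> \<open>The tolerance e / (N + 1) stays below e after multiplication by N and makes
      sense for N = 0.\<close>
    obtain K a x where r: "proj_rep n E w K a x" "proj_sum p n E K a x < proj_norm p n E w + e / (N + 1)"
      by (rule proj_norm_approx[OF w, of "e / (N + 1)"]) (use e N in auto)
    have x: "\<And>k. k < K \<Longrightarrow> x k \<in> carrier E" using r(1) by (auto simp: proj_rep_def)
    define Ta where "Ta k = T (restrict (a k) {..<n})" for k
    have ex: "T b i = (\<Sum>j<n. b j * T (unit_vec n j) i)" if "b \<in> carrier (lp p n)" "i < m" for b i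
      by (rule lp_expand[where \<phi>="\<lambda>b. T b i" and p=p]) (use lin that in \<open>auto simp: linear_map_def\<close>)
    have "proj_rep m E v K Ta x"
      unfolding proj_rep_def
    proof (intro conjI allI impI)
      fix i assume i: "i < m"
      have "v i = (\<Oplus>j\<in>{..<n}. T (unit_vec n j) i \<odot> w j)" using i by (simp add: v_eq)
      also have "\<dots> = (\<Oplus>k\<in>{..<K}. (\<Sum>j<n. T (unit_vec n j) i * a k j) \<odot> x k)"
        using r(1) by (intro finsum_swap_smult) (auto simp: proj_rep_def)
      also have "\<dots> = (\<Oplus>k\<in>{..<K}. Ta k i \<odot> x k)"
        using x i by (intro finsum_cong') (auto simp: Ta_def ex mult.commute intro!: arg_cong2[where f="smult E"] sum.cong)
      finally show "v i = (\<Oplus>k\<in>{..<K}. Ta k i \<odot> x k)" .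
    qed (use x in auto)
    then have "proj_norm p m E v \<le> proj_sum p m E K Ta x" by (rule m.proj_norm_le[OF v])
    also have "\<dots> \<le> (\<Sum>k<K. N * nrm (lp p n) (a k) * nrm E (x k))"
      unfolding proj_sum_def
    proof (intro sum_mono mult_right_mono)
      fix k
      have "ennreal (nrm (lp p m) (Ta k)) \<le> ennreal N * ennreal (nrm (lp p n) (restrict (a k) {..<n}))"
        unfolding Ta_def N(1)[symmetric] by (rule L.op_norm_bound[OF normed_space_lp[OF p m] lin]) simp
      also have "\<dots> = ennreal (N * nrm (lp p n) (a k))"
        using N lp_norm_cong[OF p n, of "restrict (a k) {..<n}" "a k"] lp_norm_nonneg[OF p n]
        by (simp add: ennreal_mult)
      finally show "nrm (lp p m) (Ta k) \<le> N * nrm (lp p n) (a k)"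
        using N lp_norm_nonneg[OF p n] by (subst (asm) ennreal_le_iff) auto
    qed (use x nrm_nonneg in auto)
    also have "\<dots> = N * proj_sum p n E K a x" by (simp add: proj_sum_def sum_distrib_left mult.assoc)
    also have "\<dots> \<le> N * (proj_norm p n E w + e / (N + 1))" using r(2) N by (intro mult_left_mono) auto
    also have "\<dots> \<le> N * proj_norm p n E w + e" using N e by (simp add: field_simps)
    finally show ?thesis .
  qed
  then have "proj_norm p m E v \<le> N * proj_norm p n E w" by (rule field_le_epsilon)
  then show "ennreal (mnrm (max_mn p E) m (tensor_left n m (max_mn p E) T w)) \<le>
      op_norm (lp p n) (lp p m) T * ennreal (mnrm (max_mn p E) n w)"
    unfolding N(1) v_def[symmetric] using N(2) proj_norm_nonneg[OF w]
    by (simp add: ennreal_mult[symmetric] ennreal_leI)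
qed (use p in auto)

section \<open>Direct sums\<close>

text \<open>The inequality for scalar multiples implies equality by scaling back with 1 / c.\<close>

lemma normed_spaceI:
  fixes E (structure)
  assumes E: "module real_ring E"
    and nonneg: "\<And>x. x \<in> carrier E \<Longrightarrow> 0 \<le> nrm E x"
    and eq_0: "\<And>x. x \<in> carrier E \<Longrightarrow> nrm E x = 0 \<Longrightarrow> x = \<zero>"
    and smult: "\<And>c x. x \<in> carrier E \<Longrightarrow> nrm E (c \<odot> x) \<le> \<bar>c\<bar> * nrm E x"
    and triangle: "\<And>x y. x \<in> carrier E \<Longrightarrow> y \<in> carrier E \<Longrightarrow> nrm E (x \<oplus> y) \<le> nrm E x + nrm E y"
  shows "normed_space E"
proof (intro normed_space.intro normed_space_axioms.intro)
  interpret real_module E using E by (simp add: real_module_iff)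
  have zero: "nrm E \<zero> = 0" using smult[of \<zero> 0] nonneg[of \<zero>] by (simp add: sm_simps)
  fix x c assume x: "x \<in> carrier E"
  show "nrm E x = 0 \<longleftrightarrow> x = \<zero>" using eq_0[OF x] zero by auto
  show "nrm E (c \<odot> x) = \<bar>c\<bar> * nrm E x"
  proof (cases "c = 0")
    case True then show ?thesis using x zero by (simp add: sm_simps)
  next
    case False
    have "(1 / c) \<odot> (c \<odot> x) = x" using False x by (simp add: sm_simps)
    then have "nrm E x \<le> \<bar>1 / c\<bar> * nrm E (c \<odot> x)" using smult[of "c \<odot> x" "1 / c"] x by simp
    then have "\<bar>c\<bar> * nrm E x \<le> nrm E (c \<odot> x)" using False by (simp add: field_simps)
    with smult[OF x, of c] show ?thesis by simp
  qed
qed (use assms in auto)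

text \<open>The rate is the same in every Banach space, which makes limits taken separately in the
  summands of a direct sum uniform over the summands.\<close>

lemma (in banach_space) fast_limit:
  fixes \<sigma> :: "nat \<Rightarrow> 'a"
  assumes s: "\<And>n. \<sigma> n \<in> carrier E" and le: "\<And>n. nrm E (\<sigma> (Suc n) \<ominus> \<sigma> n) \<le> (1 / 2) ^ n"
  obtains l where "l \<in> carrier E" "\<And>n. nrm E (\<sigma> n \<ominus> l) \<le> 2 * (1 / 2) ^ n"
proof -
  interpret Metric_space "carrier E" "ndist E" by (rule Metric_space_ndist)
  have tel: "nrm E (\<sigma> (n + k) \<ominus> \<sigma> n) \<le> 2 * (1 / 2) ^ n - 2 * (1 / 2) ^ (n + k)" for n k
  proof (induction k)
    case 0
    have "\<sigma> n \<ominus> \<sigma> n = \<zero>" using s real_module.diff_eq_zero_iff[OF real_module] by simp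
    then show ?case by (simp add: nrm_zero)
  next
    case (Suc k)
    have "nrm E (\<sigma> (n + Suc k) \<ominus> \<sigma> n) \<le> nrm E (\<sigma> (Suc (n + k)) \<ominus> \<sigma> (n + k)) + nrm E (\<sigma> (n + k) \<ominus> \<sigma> n)"
      using minus_diff[OF s s s, of "Suc (n + k)" n "n + k"] by simp
    then show ?case using Suc le[of "n + k"] by simp
  qed
  have tel': "nrm E (\<sigma> m \<ominus> \<sigma> n) \<le> 2 * (1 / 2) ^ n" if "n \<le> m" for m n
  proof -
    have "nrm E (\<sigma> (n + (m - n)) \<ominus> \<sigma> n) \<le> 2 * (1 / 2) ^ n"
      using order_trans[OF tel[of n "m - n"]] by simp
    then show ?thesis using that by simp
  qed
  have "MCauchy \<sigma>"
    unfolding MCauchy_def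
  proof (intro conjI allI impI)
    fix e :: real assume "0 < e"
    then obtain k where k: "(1 / 2 :: real) ^ k < e / 4" using real_arch_pow_inv[of "e / 4" "1 / 2"] by auto
    have "ndist E (\<sigma> m) (\<sigma> n) < e" if "k \<le> m" "k \<le> n" for m n
    proof -
      have "nrm E (\<sigma> m \<ominus> \<sigma> n) \<le> nrm E (\<sigma> m \<ominus> \<sigma> k) + nrm E (\<sigma> k \<ominus> \<sigma> n)" by (rule minus_diff[OF s s s])
      also have "\<dots> \<le> 2 * (1 / 2) ^ k + 2 * (1 / 2) ^ k"
        using tel'[OF that(1)] tel'[OF that(2)] nrm_minus_commute[OF s s, of k n] by linarith
      also have "\<dots> < e" using k by linarith
      finally show ?thesis using s by (simp add: ndist_def)
    qed
    then show "\<exists>N. \<forall>n n'. N \<le> n \<longrightarrow> N \<le> n' \<longrightarrow> ndist E (\<sigma> n) (\<sigma> n') < e" by blast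
  qed (use s in auto)
  then obtain l where "limitin mtopology \<sigma> l sequentially"
    using complete by (auto simp: mcomplete_def)
  then have l: "l \<in> carrier E" "\<And>e. e > 0 \<Longrightarrow> \<exists>N. \<forall>n\<ge>N. ndist E (\<sigma> n) l < e"
    unfolding limit_metric_sequentially by blast+
  show thesis
  proof (rule that[OF l(1)], rule field_le_epsilon)
    fix n :: nat and e :: real assume "0 < e"
    then obtain N where N: "\<And>m. m \<ge> N \<Longrightarrow> ndist E (\<sigma> m) l < e" using l(2) by blast
    have "nrm E (\<sigma> n \<ominus> l) \<le> nrm E (\<sigma> n \<ominus> \<sigma> (max N n)) + nrm E (\<sigma> (max N n) \<ominus> l)"
      by (rule minus_diff[OF s s l(1)])
    also have "\<dots> \<le> 2 * (1 / 2) ^ n + e"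
      using tel'[of n "max N n"] nrm_minus_commute[OF s s, of n "max N n"] N[of "max N n"] s l(1)
      by (simp add: ndist_def)
    finally show "nrm E (\<sigma> n \<ominus> l) \<le> 2 * (1 / 2) ^ n + e" .
  qed
qed

text \<open>The triangle inequality over the slices of w along unit vectors, each of which is an
  elementary tensor. The bound makes suprema over the summands of a direct sum finite.\<close>

lemma (in p_multinormed_space) mnrm_le_sum:
  assumes p: "1 \<le> p" and n: "1 \<le> n" and w: "w \<in> {..<n} \<rightarrow>\<^sub>E carrier E"
  shows "mnrm E n w \<le> (\<Sum>j<n. nrm E (w j))"
proof -
  interpret real_module E by (rule real_module)
  interpret T: normed_space "tensor_space n E" by (rule mnrm_norm[OF n])
  define B where "B k = (\<lambda>j\<in>{..<n}. if j < k then w j else \<zero>)" for k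
  have wc: "w j \<in> carrier E" if "j < n" for j using w that by auto
  have B: "B k \<in> carrier (tensor_space n E)" for k using wc by (auto simp: B_def)
  have "mnrm E n (B k) \<le> (\<Sum>j<k. nrm E (w j))" if "k \<le> n" for k
    using that
  proof (induction k)
    case 0
    have "B 0 = \<zero>\<^bsub>tensor_space n E\<^esub>" by (auto simp: B_def)
    then have "mnrm E n (B 0) = 0" using T.nrm_zero by (simp only: tensor_space_simps)
    then show ?case by simp
  next
    case (Suc k)
    let ?e = "elem_tensor n E (unit_vec n k) (w k)"
    have k: "k < n" using Suc by simp
    have e: "?e \<in> carrier (tensor_space n E)" using wc[OF k] by (auto simp: elem_tensor_def)
    have "B (Suc k) = B k \<oplus>\<^bsub>tensor_space n E\<^esub> ?e"
      using wc wc[OF k] by (auto simp: B_def elem_tensor_def unit_vec_def fun_eq_iff less_Suc_eq sm_simps)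
    then have "mnrm E n (B (Suc k)) \<le> mnrm E n (B k) + mnrm E n ?e"
      using T.nrm_triangle[OF B[of k] e] by simp
    also have "mnrm E n ?e = nrm (lp p n) (unit_vec n k) * nrm E (w k)"
      using n wc[OF k] by (intro mnrm_elem_tensor) (auto simp: unit_vec_def)
    also have "nrm (lp p n) (unit_vec n k) \<le> 1"
    proof -
      have "nrm (lp p n) (unit_vec n k) \<le> (\<Sum>j<n. \<bar>unit_vec n k j\<bar>)" by (rule lp_norm_sum_le[OF p n])
      also have "\<dots> = 1" using k by (subst sum.remove[of _ k]) (auto simp: unit_vec_def)
      finally show ?thesis .
    qed
    finally show ?case using Suc nrm_nonneg[OF wc[OF k]] by (simp add: mult_right_mono)
  qed
  moreover have "B n = w" using w by (auto simp: B_def fun_eq_iff PiE_def extensional_def)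
  ultimately show ?thesis by (metis order_refl)
qed

lemma linf_sum_simps [simp]:
  "carrier (linf_sum I E) = {x \<in> \<Pi>\<^sub>E i\<in>I. carrier (E i). bdd_above ((\<lambda>i. nrm (E i) (x i)) ` I)}"
  "\<zero>\<^bsub>linf_sum I E\<^esub> = (\<lambda>i\<in>I. \<zero>\<^bsub>E i\<^esub>)"
  "x \<oplus>\<^bsub>linf_sum I E\<^esub> y = (\<lambda>i\<in>I. x i \<oplus>\<^bsub>E i\<^esub> y i)"
  "c \<odot>\<^bsub>linf_sum I E\<^esub> x = (\<lambda>i\<in>I. c \<odot>\<^bsub>E i\<^esub> x i)"
  by (simp_all add: linf_sum_def)

lemma nrm_linf_le:
  "0 \<le> c \<Longrightarrow> (\<And>i. i \<in> I \<Longrightarrow> nrm (E i) (x i) \<le> c) \<Longrightarrow> nrm (linf_sum I E) x \<le> c"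
  by (auto simp: linf_sum_def intro!: cSup_least)

lemma mnrm_linf_le:
  "0 \<le> c \<Longrightarrow> (\<And>i. i \<in> I \<Longrightarrow> mnrm (E i) n (\<lambda>j\<in>{..<n}. w j i) \<le> c) \<Longrightarrow> mnrm (linf_sum I E) n w \<le> c"
  by (auto simp: linf_sum_def intro!: cSup_least)

lemma nrm_linf_ge:
  "bdd_above ((\<lambda>i. nrm (E i) (x i)) ` I) \<Longrightarrow> i \<in> I \<Longrightarrow> nrm (E i) (x i) \<le> nrm (linf_sum I E) x"
  by (auto simp: linf_sum_def intro!: cSup_upper)

lemma mnrm_linf_ge:
  "bdd_above ((\<lambda>i. mnrm (E i) n (\<lambda>j\<in>{..<n}. w j i)) ` I) \<Longrightarrow> i \<in> I \<Longrightarrow>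
    mnrm (E i) n (\<lambda>j\<in>{..<n}. w j i) \<le> mnrm (linf_sum I E) n w"
  by (auto simp: linf_sum_def intro!: cSup_upper)

lemma nrm_linf_nonneg: "bdd_above ((\<lambda>i. nrm (E i) (x i)) ` I) \<Longrightarrow> 0 \<le> nrm (linf_sum I E) x"
  by (auto simp: linf_sum_def intro!: cSup_upper)

lemma mnrm_linf_nonneg:
  "bdd_above ((\<lambda>i. mnrm (E i) n (\<lambda>j\<in>{..<n}. w j i)) ` I) \<Longrightarrow> 0 \<le> mnrm (linf_sum I E) n w"
  by (auto simp: linf_sum_def intro!: cSup_upper)

lemma module_tensor_space:
  assumes E: "module real_ring E" shows "module real_ring (tensor_space n E)"
proof -
  interpret real_module E using E by (simp add: real_module_iff)
  show ?thesis
    by (rule real_moduleI)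
      (auto simp: sm_simps a_ac fun_eq_iff restrict_def PiE_def Pi_def extensional_def)
qed

text \<open>Each axiom is checked in the summands and passed to the supremum. Suprema of reals are
  meaningful only for bounded sets; for the multinorms this is \<open>bdd\<close>, which rests on
  \<open>mnrm_le_sum\<close>.\<close>

lemma linf_sum_p_multinormed:
  fixes E :: "'i \<Rightarrow> 'a mnspace"
  assumes p: "1 \<le> p" and E: "\<And>i. i \<in> I \<Longrightarrow> p_multinormed_space p (E i)"
  shows "p_multinormed_space p (linf_sum I E)"
proof -
  let ?Z = "linf_sum I E"
  have En: "normed_space (E i)" and Eb: "banach_space (E i)" and Er: "real_module (E i)" if "i \<in> I" for i
    using E[OF that] by (auto simp: p_multinormed_space_def banach_space_def intro: normed_space.real_module)
  have Zc: "x i \<in> carrier (E i)" "nrm (E i) (x i) \<le> nrm ?Z x" if "x \<in> carrier ?Z" "i \<in> I" for x i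
    using that nrm_linf_ge[of E x I i] by auto
  have ZI: "x \<in> carrier ?Z" if "x \<in> (\<Pi>\<^sub>E i\<in>I. carrier (E i))" "\<And>i. i \<in> I \<Longrightarrow> nrm (E i) (x i) \<le> c" for x c
    using that by (auto intro!: bdd_aboveI[of _ c])
  have Zadd: "x \<oplus>\<^bsub>?Z\<^esub> y \<in> carrier ?Z" if "x \<in> carrier ?Z" "y \<in> carrier ?Z" for x y
  proof (rule ZI[where c="nrm ?Z x + nrm ?Z y"])
    show "x \<oplus>\<^bsub>?Z\<^esub> y \<in> (\<Pi>\<^sub>E i\<in>I. carrier (E i))"
      using Zc that real_module.axioms(1)[OF Er] by (auto intro!: abelian_monoid.a_closed simp: module_def abelian_group_def)
    fix i assume i: "i \<in> I"
    show "nrm (E i) ((x \<oplus>\<^bsub>?Z\<^esub> y) i) \<le> nrm ?Z x + nrm ?Z y"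
      using normed_space.nrm_triangle[OF En[OF i] Zc(1)[OF that(1) i] Zc(1)[OF that(2) i]]
        Zc(2)[OF that(1) i] Zc(2)[OF that(2) i] i by simp
  qed
  have Zsm: "c \<odot>\<^bsub>?Z\<^esub> x \<in> carrier ?Z" if "x \<in> carrier ?Z" for c x
  proof (rule ZI[where c="\<bar>c\<bar> * nrm ?Z x"])
    show "c \<odot>\<^bsub>?Z\<^esub> x \<in> (\<Pi>\<^sub>E i\<in>I. carrier (E i))"
      using Zc(1)[OF that] real_module.sm_closed[OF Er] by auto
    show "nrm (E i) ((c \<odot>\<^bsub>?Z\<^esub> x) i) \<le> \<bar>c\<bar> * nrm ?Z x" if i: "i \<in> I" for i
      using normed_space.nrm_smult[OF En[OF i] Zc(1)[OF \<open>x \<in> carrier ?Z\<close> i], of c]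
        Zc(2)[OF \<open>x \<in> carrier ?Z\<close> i] i by (simp add: mult_left_mono)
  qed
  have Zzero: "\<zero>\<^bsub>?Z\<^esub> \<in> carrier ?Z"
  proof (rule ZI[where c=0])
    fix i assume i: "i \<in> I"
    interpret normed_space "E i" by (rule En[OF i])
    show "nrm (E i) (\<zero>\<^bsub>?Z\<^esub> i) \<le> 0" using nrm_zero i by simp
  next
    have "\<zero>\<^bsub>E i\<^esub> \<in> carrier (E i)" if "i \<in> I" for i
    proof -
      interpret normed_space "E i" by (rule En[OF that])
      show ?thesis by simp
    qed
    then show "\<zero>\<^bsub>?Z\<^esub> \<in> (\<Pi>\<^sub>E i\<in>I. carrier (E i))" by auto
  qed
  have alg1: "\<zero>\<^bsub>E i\<^esub> \<oplus>\<^bsub>E i\<^esub> x = x" "(a + b) \<odot>\<^bsub>E i\<^esub> x = a \<odot>\<^bsub>E i\<^esub> x \<oplus>\<^bsub>E i\<^esub> b \<odot>\<^bsub>E i\<^esub> x"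
    "(a * b) \<odot>\<^bsub>E i\<^esub> x = a \<odot>\<^bsub>E i\<^esub> (b \<odot>\<^bsub>E i\<^esub> x)" "1 \<odot>\<^bsub>E i\<^esub> x = x" "0 \<odot>\<^bsub>E i\<^esub> x = \<zero>\<^bsub>E i\<^esub>"
    if "i \<in> I" "x \<in> carrier (E i)" for i x a b
  proof -
    interpret real_module "E i" by (rule Er[OF that(1)])
    show "\<zero>\<^bsub>E i\<^esub> \<oplus>\<^bsub>E i\<^esub> x = x" "(a + b) \<odot>\<^bsub>E i\<^esub> x = a \<odot>\<^bsub>E i\<^esub> x \<oplus>\<^bsub>E i\<^esub> b \<odot>\<^bsub>E i\<^esub> x"
      "(a * b) \<odot>\<^bsub>E i\<^esub> x = a \<odot>\<^bsub>E i\<^esub> (b \<odot>\<^bsub>E i\<^esub> x)" "1 \<odot>\<^bsub>E i\<^esub> x = x" "0 \<odot>\<^bsub>E i\<^esub> x = \<zero>\<^bsub>E i\<^esub>"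
      using that by (simp_all add: sm_simps)
  qed
  have alg2: "x \<oplus>\<^bsub>E i\<^esub> y = y \<oplus>\<^bsub>E i\<^esub> x"
    "a \<odot>\<^bsub>E i\<^esub> (x \<oplus>\<^bsub>E i\<^esub> y) = a \<odot>\<^bsub>E i\<^esub> x \<oplus>\<^bsub>E i\<^esub> a \<odot>\<^bsub>E i\<^esub> y"
    if "i \<in> I" "x \<in> carrier (E i)" "y \<in> carrier (E i)" for i x y a
  proof -
    interpret real_module "E i" by (rule Er[OF that(1)])
    show "x \<oplus>\<^bsub>E i\<^esub> y = y \<oplus>\<^bsub>E i\<^esub> x" using that by (simp add: a_comm)
    show "a \<odot>\<^bsub>E i\<^esub> (x \<oplus>\<^bsub>E i\<^esub> y) = a \<odot>\<^bsub>E i\<^esub> x \<oplus>\<^bsub>E i\<^esub> a \<odot>\<^bsub>E i\<^esub> y"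
      using that by (simp add: sm_simps)
  qed
  have alg3: "(x \<oplus>\<^bsub>E i\<^esub> y) \<oplus>\<^bsub>E i\<^esub> z = x \<oplus>\<^bsub>E i\<^esub> (y \<oplus>\<^bsub>E i\<^esub> z)"
    if "i \<in> I" "x \<in> carrier (E i)" "y \<in> carrier (E i)" "z \<in> carrier (E i)" for i x y z
  proof -
    interpret real_module "E i" by (rule Er[OF that(1)])
    show ?thesis using that by (simp add: a_assoc)
  qed
  have mod: "module real_ring ?Z"
  proof (rule real_moduleI)
    fix x y z a b
    assume x: "x \<in> carrier ?Z"
    then have xe: "x \<in> extensional I" by (auto simp: PiE_def)
    show "\<zero>\<^bsub>?Z\<^esub> \<oplus>\<^bsub>?Z\<^esub> x = x" "1 \<odot>\<^bsub>?Z\<^esub> x = x"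
      using alg1 Zc(1)[OF x] xe by (auto simp: fun_eq_iff extensional_def)
    show "0 \<odot>\<^bsub>?Z\<^esub> x = \<zero>\<^bsub>?Z\<^esub>" "(a + b) \<odot>\<^bsub>?Z\<^esub> x = a \<odot>\<^bsub>?Z\<^esub> x \<oplus>\<^bsub>?Z\<^esub> b \<odot>\<^bsub>?Z\<^esub> x"
      "(a * b) \<odot>\<^bsub>?Z\<^esub> x = a \<odot>\<^bsub>?Z\<^esub> (b \<odot>\<^bsub>?Z\<^esub> x)"
      using alg1 Zc(1)[OF x] by (auto simp: fun_eq_iff)
    assume y: "y \<in> carrier ?Z"
    show "x \<oplus>\<^bsub>?Z\<^esub> y = y \<oplus>\<^bsub>?Z\<^esub> x" using alg2(1) Zc(1)[OF x] Zc(1)[OF y] by (auto simp: fun_eq_iff)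
    show "a \<odot>\<^bsub>?Z\<^esub> (x \<oplus>\<^bsub>?Z\<^esub> y) = a \<odot>\<^bsub>?Z\<^esub> x \<oplus>\<^bsub>?Z\<^esub> a \<odot>\<^bsub>?Z\<^esub> y"
      using alg2(2) Zc(1)[OF x] Zc(1)[OF y] by (auto simp: fun_eq_iff)
    assume z: "z \<in> carrier ?Z"
    show "(x \<oplus>\<^bsub>?Z\<^esub> y) \<oplus>\<^bsub>?Z\<^esub> z = x \<oplus>\<^bsub>?Z\<^esub> (y \<oplus>\<^bsub>?Z\<^esub> z)"
      using alg3 Zc(1)[OF x] Zc(1)[OF y] Zc(1)[OF z] by (auto simp: fun_eq_iff)
  qed (use Zadd Zsm Zzero in blast)+
  interpret Z: real_module ?Z using mod by (simp add: real_module_iff)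
  have Znn: "0 \<le> nrm ?Z x" if "x \<in> carrier ?Z" for x using that by (intro nrm_linf_nonneg) auto
  have Zn: "normed_space ?Z"
  proof (rule normed_spaceI[OF mod])
    fix x assume x: "x \<in> carrier ?Z"
    show "0 \<le> nrm ?Z x" by (rule Znn[OF x])
    show "nrm ?Z (c \<odot>\<^bsub>?Z\<^esub> x) \<le> \<bar>c\<bar> * nrm ?Z x" for c
      using Znn[OF x] Zc[OF x] normed_space.nrm_smult[OF En]
      by (intro nrm_linf_le) (auto simp: mult_left_mono)
    show "x = \<zero>\<^bsub>?Z\<^esub>" if 0: "nrm ?Z x = 0"
    proof -
      have "x i = \<zero>\<^bsub>E i\<^esub>" if i: "i \<in> I" for i
        using Zc[OF x i] 0 normed_space.nrm_nonneg[OF En[OF i]] normed_space.nrm_eq_0[OF En[OF i]]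
        by (metis order_antisym)
      then show ?thesis using x by (auto simp: fun_eq_iff PiE_def extensional_def)
    qed
    fix y assume y: "y \<in> carrier ?Z"
    show "nrm ?Z (x \<oplus>\<^bsub>?Z\<^esub> y) \<le> nrm ?Z x + nrm ?Z y"
    proof (rule nrm_linf_le)
      fix i assume i: "i \<in> I"
      show "nrm (E i) ((x \<oplus>\<^bsub>?Z\<^esub> y) i) \<le> nrm ?Z x + nrm ?Z y"
        using normed_space.nrm_triangle[OF En[OF i] Zc(1)[OF x i] Zc(1)[OF y i]] Zc(2)[OF x i] Zc(2)[OF y i] i
        by simp
    qed (use Znn x y in auto)
  qed
  interpret Z: normed_space ?Z by (rule Zn)
  have Zminus: "(x \<ominus>\<^bsub>?Z\<^esub> y) i = x i \<ominus>\<^bsub>E i\<^esub> y i" if "x \<in> carrier ?Z" "y \<in> carrier ?Z" "i \<in> I" for x y i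
    unfolding Z.minus_eq_sm[OF that(1,2)]
      real_module.minus_eq_sm[OF Er[OF that(3)] Zc(1)[OF that(1,3)] Zc(1)[OF that(2,3)]]
    using that(3) by simp
  have Zb: "banach_space ?Z"
  proof (rule Z.banach_spaceI)
    fix \<sigma> :: "nat \<Rightarrow> 'i \<Rightarrow> 'a"
    assume s: "\<And>n. \<sigma> n \<in> carrier ?Z" and le: "\<And>n. nrm ?Z (\<sigma> (Suc n) \<ominus>\<^bsub>?Z\<^esub> \<sigma> n) \<le> (1 / 2) ^ n"
    have "\<exists>l. l \<in> carrier (E i) \<and> (\<forall>n. nrm (E i) (\<sigma> n i \<ominus>\<^bsub>E i\<^esub> l) \<le> 2 * (1 / 2) ^ n)" if i: "i \<in> I" for i
    proof -
      interpret banach_space "E i" by (rule Eb[OF i])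
      have lei: "nrm (E i) (\<sigma> (Suc n) i \<ominus>\<^bsub>E i\<^esub> \<sigma> n i) \<le> (1 / 2) ^ n" for n
        using order_trans[OF Zc(2)[OF Z.minus_closed[OF s s] i] le[of n]] Zminus[OF s s i] by simp
      obtain l where "l \<in> carrier (E i)" "\<And>n. nrm (E i) (\<sigma> n i \<ominus>\<^bsub>E i\<^esub> l) \<le> 2 * (1 / 2) ^ n"
        by (rule fast_limit[of "\<lambda>n. \<sigma> n i", OF Zc(1)[OF s i] lei]) blast
      then show ?thesis by auto
    qed
    then obtain l where l: "\<And>i. i \<in> I \<Longrightarrow> l i \<in> carrier (E i)"
      "\<And>i n. i \<in> I \<Longrightarrow> nrm (E i) (\<sigma> n i \<ominus>\<^bsub>E i\<^esub> l i) \<le> 2 * (1 / 2) ^ n" by metis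
    have lZ: "restrict l I \<in> carrier ?Z"
    \<comment> \<open>In every summand the limit differs from the 0-th term by at most 2.\<close>
    proof (rule ZI[where c="2 + nrm ?Z (\<sigma> 0)"])
      fix i assume i: "i \<in> I"
      interpret normed_space "E i" by (rule En[OF i])
      interpret real_module "E i" by (rule real_module)
      have c: "\<sigma> 0 i \<in> carrier (E i)" "l i \<in> carrier (E i)" using Zc(1)[OF s i] l(1)[OF i] by auto
      have "l i = (l i \<ominus>\<^bsub>E i\<^esub> \<sigma> 0 i) \<oplus>\<^bsub>E i\<^esub> \<sigma> 0 i"
        using c sm_cancel[OF c(1)] by (simp add: minus_eq_sm a_assoc) (simp add: a_comm)
      then have "nrm (E i) (l i) \<le> nrm (E i) (l i \<ominus>\<^bsub>E i\<^esub> \<sigma> 0 i) + nrm (E i) (\<sigma> 0 i)"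
        using nrm_triangle[of "l i \<ominus>\<^bsub>E i\<^esub> \<sigma> 0 i" "\<sigma> 0 i"] c by simp
      then show "nrm (E i) (restrict l I i) \<le> 2 + nrm ?Z (\<sigma> 0)"
        using l(2)[OF i, of 0] nrm_minus_commute[OF c] Zc(2)[OF s i, of 0] i by simp
    qed (use l in auto)
    have le2: "nrm ?Z (\<sigma> n \<ominus>\<^bsub>?Z\<^esub> restrict l I) \<le> 2 * (1 / 2) ^ n" for n
    proof (rule nrm_linf_le)
      fix i assume i: "i \<in> I"
      show "nrm (E i) ((\<sigma> n \<ominus>\<^bsub>?Z\<^esub> restrict l I) i) \<le> 2 * (1 / 2) ^ n"
        unfolding Zminus[OF s lZ i] using l(2)[OF i] i by simp
    qed simp
    have "(\<lambda>n. nrm ?Z (\<sigma> n \<ominus>\<^bsub>?Z\<^esub> restrict l I)) \<longlonglongrightarrow> 0"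
    proof (rule tendsto_sandwich[of "\<lambda>_. 0" _ _ "\<lambda>n. 2 * (1 / 2) ^ n"])
      show "(\<lambda>n. 2 * (1 / 2 :: real) ^ n) \<longlonglongrightarrow> 0"
        by (rule tendsto_mult_right_zero, rule LIMSEQ_power_zero) simp
    qed (use le2 Znn[OF Z.minus_closed[OF s lZ]] in \<open>auto intro!: always_eventually\<close>)
    then show "\<exists>l\<in>carrier ?Z. (\<lambda>n. nrm ?Z (\<sigma> n \<ominus>\<^bsub>?Z\<^esub> l)) \<longlonglongrightarrow> 0" using lZ by blast
  qed
  \<comment> \<open>The slice of a tuple of families at one index; it commutes with sums, scalars
    and the action of operators on the first factor.\<close>
  define sl where "sl n w i = (\<lambda>j\<in>{..<n}. w j i)" for n :: nat and w :: "nat \<Rightarrow> 'i \<Rightarrow> 'a" and i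
  have slc: "sl n w i \<in> carrier (tensor_space n (E i))" if "w \<in> {..<n} \<rightarrow>\<^sub>E carrier ?Z" "i \<in> I" for n w i
    using Zc(1) that by (auto simp: sl_def PiE_iff simp del: linf_sum_simps)
  have Tn: "normed_space (tensor_space n (E i))" if "n \<ge> 1" "i \<in> I" for n i
    using p_multinormed_space.mnrm_norm[OF E[OF that(2)] that(1)] .
  have bdd: "bdd_above ((\<lambda>i. mnrm (E i) n (\<lambda>j\<in>{..<n}. w j i)) ` I)"
    if n: "n \<ge> 1" and w: "w \<in> {..<n} \<rightarrow>\<^sub>E carrier ?Z" for n w
  proof (rule bdd_aboveI2)
    fix i assume i: "i \<in> I"
    have "mnrm (E i) n (sl n w i) \<le> (\<Sum>j<n. nrm (E i) (sl n w i j))"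
      using slc[OF w i] by (intro p_multinormed_space.mnrm_le_sum[OF E[OF i] p n]) simp
    also have "\<dots> \<le> (\<Sum>j<n. nrm ?Z (w j))"
      using w i Zc(2) by (intro sum_mono) (auto simp: sl_def PiE_iff simp del: linf_sum_simps)
    finally show "mnrm (E i) n (\<lambda>j\<in>{..<n}. w j i) \<le> (\<Sum>j<n. nrm ?Z (w j))" by (simp add: sl_def)
  qed
  have Mge: "mnrm (E i) n (sl n w i) \<le> mnrm ?Z n w" if "n \<ge> 1" "w \<in> {..<n} \<rightarrow>\<^sub>E carrier ?Z" "i \<in> I" for n w i
    using mnrm_linf_ge[OF bdd[OF that(1,2)] that(3)] by (simp add: sl_def)
  have Mnn: "0 \<le> mnrm ?Z n w" if "n \<ge> 1" "w \<in> {..<n} \<rightarrow>\<^sub>E carrier ?Z" for n w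
    by (rule mnrm_linf_nonneg[OF bdd[OF that]])
  have Mle: "mnrm ?Z n w \<le> c" if "0 \<le> c" "\<And>i. i \<in> I \<Longrightarrow> mnrm (E i) n (sl n w i) \<le> c" for n w c
    by (rule mnrm_linf_le[OF that(1)]) (use that(2) in \<open>simp add: sl_def\<close>)
  show ?thesis
  proof (rule p_multinormed_spaceI[OF Zb p])
    fix n :: nat assume n: "n \<ge> 1"
    show "normed_space (tensor_space n ?Z)"
    proof (rule normed_spaceI)
      show "module real_ring (tensor_space n ?Z)" by (rule module_tensor_space[OF mod])
      fix w assume "w \<in> carrier (tensor_space n ?Z)"
      then have w: "w \<in> {..<n} \<rightarrow>\<^sub>E carrier ?Z" by simp
      show "0 \<le> nrm (tensor_space n ?Z) w" using Mnn[OF n w] by simp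
      show "w = \<zero>\<^bsub>tensor_space n ?Z\<^esub>" if "nrm (tensor_space n ?Z) w = 0"
      proof -
        have "w j i = \<zero>\<^bsub>E i\<^esub>" if i: "i \<in> I" and j: "j < n" for i j
        proof -
          interpret normed_space "tensor_space n (E i)" by (rule Tn[OF n i])
          have "mnrm (E i) n (sl n w i) = 0"
            using Mge[OF n w i] nrm_nonneg[OF slc[OF w i]] \<open>nrm (tensor_space n ?Z) w = 0\<close> by simp
          then have "sl n w i = \<zero>\<^bsub>tensor_space n (E i)\<^esub>" using nrm_eq_0[OF slc[OF w i]] by simp
          then have "sl n w i j = (\<lambda>j\<in>{..<n}. \<zero>\<^bsub>E i\<^esub>) j" by simp
          then show ?thesis using j by (simp add: sl_def)
        qed
        moreover have "w j \<in> extensional I" if "j < n" for j using w that by (auto simp: PiE_iff)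
        ultimately show ?thesis using w by (auto simp: fun_eq_iff PiE_def extensional_def)
      qed
      show "nrm (tensor_space n ?Z) (c \<odot>\<^bsub>tensor_space n ?Z\<^esub> w) \<le> \<bar>c\<bar> * nrm (tensor_space n ?Z) w" for c
      proof -
        have "mnrm ?Z n (\<lambda>j\<in>{..<n}. c \<odot>\<^bsub>?Z\<^esub> w j) \<le> \<bar>c\<bar> * mnrm ?Z n w"
        proof (rule Mle)
          fix i assume i: "i \<in> I"
          have "sl n (\<lambda>j\<in>{..<n}. c \<odot>\<^bsub>?Z\<^esub> w j) i = c \<odot>\<^bsub>tensor_space n (E i)\<^esub> sl n w i"
            using i by (auto simp: sl_def fun_eq_iff)
          then show "mnrm (E i) n (sl n (\<lambda>j\<in>{..<n}. c \<odot>\<^bsub>?Z\<^esub> w j) i) \<le> \<bar>c\<bar> * mnrm ?Z n w"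
            using normed_space.nrm_smult[OF Tn[OF n i] slc[OF w i], of c] Mge[OF n w i]
            by (simp add: mult_left_mono)
        qed (use Mnn[OF n w] in simp)
        then show ?thesis by (simp del: linf_sum_simps)
      qed
      fix v assume "v \<in> carrier (tensor_space n ?Z)"
      then have v: "v \<in> {..<n} \<rightarrow>\<^sub>E carrier ?Z" by simp
      have "mnrm ?Z n (\<lambda>j\<in>{..<n}. w j \<oplus>\<^bsub>?Z\<^esub> v j) \<le> mnrm ?Z n w + mnrm ?Z n v"
      proof (rule Mle)
        fix i assume i: "i \<in> I"
        have "sl n (\<lambda>j\<in>{..<n}. w j \<oplus>\<^bsub>?Z\<^esub> v j) i = sl n w i \<oplus>\<^bsub>tensor_space n (E i)\<^esub> sl n v i"
          using i by (auto simp: sl_def fun_eq_iff)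
        then show "mnrm (E i) n (sl n (\<lambda>j\<in>{..<n}. w j \<oplus>\<^bsub>?Z\<^esub> v j) i) \<le> mnrm ?Z n w + mnrm ?Z n v"
          using normed_space.nrm_triangle[OF Tn[OF n i] slc[OF w i] slc[OF v i]] Mge[OF n w i] Mge[OF n v i]
          by simp
      qed (use Mnn[OF n w] Mnn[OF n v] in simp)
      then show "nrm (tensor_space n ?Z) (w \<oplus>\<^bsub>tensor_space n ?Z\<^esub> v) \<le>
          nrm (tensor_space n ?Z) w + nrm (tensor_space n ?Z) v" by (simp del: linf_sum_simps)
    qed
    show "mnrm ?Z n (elem_tensor n ?Z a x) = nrm (lp p n) a * nrm ?Z x"
      if a: "a \<in> carrier (lp p n)" and x: "x \<in> carrier ?Z" for a x
    proof -
      have sle: "sl n (elem_tensor n ?Z a x) i = elem_tensor n (E i) a (x i)" if "i \<in> I" for i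
        using that by (auto simp: sl_def elem_tensor_def fun_eq_iff)
      have el: "mnrm (E i) n (elem_tensor n (E i) a (x i)) = nrm (lp p n) a * nrm (E i) (x i)" if i: "i \<in> I" for i
        by (rule p_multinormed_space.mnrm_elem_tensor[OF E[OF i] n a Zc(1)[OF x i]])
      have ec: "elem_tensor n ?Z a x \<in> {..<n} \<rightarrow>\<^sub>E carrier ?Z" using Zsm[OF x] by (auto simp: elem_tensor_def simp del: linf_sum_simps)
      note a0 = lp_norm_nonneg[OF p n, of a]
      show ?thesis
      proof (rule antisym)
        show "mnrm ?Z n (elem_tensor n ?Z a x) \<le> nrm (lp p n) a * nrm ?Z x"
          using a0 Znn[OF x] Zc(2)[OF x] by (intro Mle) (auto simp: sle el intro!: mult_left_mono)
        show "nrm (lp p n) a * nrm ?Z x \<le> mnrm ?Z n (elem_tensor n ?Z a x)"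
        proof (cases "nrm (lp p n) a = 0")
          case True then show ?thesis using Mnn[OF n ec] by simp
        next
          case False
          then have a1: "nrm (lp p n) a > 0" using a0 by simp
          have "nrm ?Z x \<le> mnrm ?Z n (elem_tensor n ?Z a x) / nrm (lp p n) a"
          proof (rule nrm_linf_le)
            fix i assume i: "i \<in> I"
            show "nrm (E i) (x i) \<le> mnrm ?Z n (elem_tensor n ?Z a x) / nrm (lp p n) a"
              using Mge[OF n ec i] a1 by (simp add: sle[OF i] el[OF i] le_divide_eq mult.commute)
          qed (use Mnn[OF n ec] a0 in simp)
          then show ?thesis using a1 by (simp add: le_divide_eq mult.commute)
        qed
      qed
    qed
    fix m :: nat and T w
    assume m: "m \<ge> 1" and T: "T \<in> bounded_ops (lp p n) (lp p m)" and "w \<in> carrier (tensor_space n ?Z)"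
    then have w: "w \<in> {..<n} \<rightarrow>\<^sub>E carrier ?Z" by simp
    have wc: "w j \<in> carrier ?Z" if "j < n" for j using w that by (auto simp del: linf_sum_simps)
    have fin: "op_norm (lp p n) (lp p m) T < \<infinity>" using T by (auto simp: bounded_ops_def)
    define N where "N = enn2real (op_norm (lp p n) (lp p m) T)"
    have N: "op_norm (lp p n) (lp p m) T = ennreal N" "N \<ge> 0" using fin by (simp_all add: N_def)
    have fs: "(\<Oplus>\<^bsub>?Z\<^esub>k\<in>A. f k) i = (\<Oplus>\<^bsub>E i\<^esub>k\<in>A. f k i)"
      if "finite A" "\<And>k. k \<in> A \<Longrightarrow> f k \<in> carrier ?Z" and i: "i \<in> I" for A :: "nat set" and f i
    proof -
      interpret Ei: real_module "E i" by (rule Er[OF i])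
      show ?thesis using that(1,2)
      proof (induction A rule: finite_induct)
        case empty then show ?case using i by simp
      next
        case (insert k A)
        have "(\<Oplus>\<^bsub>?Z\<^esub>k\<in>insert k A. f k) = f k \<oplus>\<^bsub>?Z\<^esub> (\<Oplus>\<^bsub>?Z\<^esub>k\<in>A. f k)"
          using insert by (intro Z.finsum_insert) (auto simp del: linf_sum_simps)
        moreover have "(\<Oplus>\<^bsub>E i\<^esub>k\<in>insert k A. f k i) = f k i \<oplus>\<^bsub>E i\<^esub> (\<Oplus>\<^bsub>E i\<^esub>k\<in>A. f k i)"
          using insert Zc(1)[OF _ i] by (intro Ei.finsum_insert) (auto simp del: linf_sum_simps)
        ultimately show ?case using insert i by simp
      qed
    qed
    have slT: "sl m (tensor_left n m ?Z T w) i = tensor_left n m (E i) T (sl n w i)" if i: "i \<in> I" for i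
    proof -
      interpret Ei: real_module "E i" by (rule Er[OF i])
      have "(\<Oplus>\<^bsub>?Z\<^esub>j\<in>{..<n}. T (unit_vec n j) k \<odot>\<^bsub>?Z\<^esub> w j) i =
          (\<Oplus>\<^bsub>E i\<^esub>j\<in>{..<n}. T (unit_vec n j) k \<odot>\<^bsub>E i\<^esub> sl n w i j)" for k
      proof -
        have "(\<Oplus>\<^bsub>?Z\<^esub>j\<in>{..<n}. T (unit_vec n j) k \<odot>\<^bsub>?Z\<^esub> w j) i =
            (\<Oplus>\<^bsub>E i\<^esub>j\<in>{..<n}. (T (unit_vec n j) k \<odot>\<^bsub>?Z\<^esub> w j) i)"
          using Zsm[OF wc] i by (intro fs) (auto simp del: linf_sum_simps)
        also have "\<dots> = (\<Oplus>\<^bsub>E i\<^esub>j\<in>{..<n}. T (unit_vec n j) k \<odot>\<^bsub>E i\<^esub> sl n w i j)"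
          using i Zc(1)[OF wc i] by (intro Ei.finsum_cong') (auto simp: sl_def)
        finally show ?thesis .
      qed
      then show ?thesis unfolding tensor_left_def by (auto simp: sl_def[of m] fun_eq_iff simp del: linf_sum_simps)
    qed
    have "mnrm ?Z m (tensor_left n m ?Z T w) \<le> N * mnrm ?Z n w"
    proof (rule Mle)
      fix i assume i: "i \<in> I"
      have "ennreal (mnrm (E i) m (sl m (tensor_left n m ?Z T w) i)) \<le> ennreal N * ennreal (mnrm (E i) n (sl n w i))"
        unfolding slT[OF i] N(1)[symmetric]
        by (rule p_multinormed_space.mnrm_tensor_left[OF E[OF i] n m T slc[OF w i]])
      also have "\<dots> \<le> ennreal N * ennreal (mnrm ?Z n w)"
        by (intro mult_left_mono ennreal_leI Mge[OF n w i]) simp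
      also have "\<dots> = ennreal (N * mnrm ?Z n w)" using N(2) Mnn[OF n w] by (simp add: ennreal_mult)
      finally show "mnrm (E i) m (sl m (tensor_left n m ?Z T w) i) \<le> N * mnrm ?Z n w"
        using N(2) Mnn[OF n w] by (subst (asm) ennreal_le_iff) auto
    qed (use N(2) Mnn[OF n w] in simp)
    then show "ennreal (mnrm ?Z m (tensor_left n m ?Z T w)) \<le>
        op_norm (lp p n) (lp p m) T * ennreal (mnrm ?Z n w)"
      unfolding N(1) using N(2) Mnn[OF n w] by (simp add: ennreal_mult[symmetric] ennreal_leI)
  qed
qed

section \<open>Vector-valued simple functions\<close>

lemma Lq_norm_mono:
  assumes q: "1 \<le> q" and f: "f \<in> Lq_fun q M" and g: "g \<in> Lq_fun q M"
    and le: "AE x in M. \<bar>f x\<bar> \<le> \<bar>g x\<bar>"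
  shows "Lq_norm q M f \<le> Lq_norm q M g"
  using q
proof (cases q rule: exponent_cases)
  case 1
  have "AE x in M. \<bar>f x\<bar> \<le> Lq_norm top_class.top M g"
    using le Linf_norm_AE[OF g[unfolded 1]] by eventually_elim simp
  then show ?thesis using Lq_norm_nonneg[OF g] 1 by (simp add: Linf_norm_le)
next
  case (2 r)
  have "(\<integral>x. \<bar>f x\<bar> powr r \<partial>M) \<le> (\<integral>x. \<bar>g x\<bar> powr r \<partial>M)"
  proof (rule integral_mono_AE)
    show "AE x in M. \<bar>f x\<bar> powr r \<le> \<bar>g x\<bar> powr r"
      using le by eventually_elim (use 2 in \<open>auto intro: powr_mono2\<close>)
  qed (use f g 2 in \<open>auto simp: Lq_fun_real\<close>)
  then show ?thesis using 2 by (simp add: Lq_norm_real powr_mono2)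
qed

text \<open>The third axiom for a matrix, in the form in which it is applied: what remains to be
  checked is an inequality between two \<open>\<ell>\<^sup>p\<close> norms.\<close>

lemma (in p_multinormed_space) mnrm_contraction:
  assumes p: "1 \<le> p" and n: "1 \<le> n" and m: "1 \<le> m"
    and t: "\<And>a. nrm (lp p m) (\<lambda>i. \<Sum>j<n. t i j * a j) \<le> nrm (lp p n) a"
    and w: "w \<in> {..<n} \<rightarrow>\<^sub>E carrier E"
  shows "mnrm E m (\<lambda>i\<in>{..<m}. \<Oplus>j\<in>{..<n}. t i j \<odot> w j) \<le> mnrm E n w"
proof -
  interpret real_module E by (rule real_module)
  define T where "T a = (\<lambda>i\<in>{..<m}. \<Sum>j<n. t i j * a j)" for a :: "nat \<Rightarrow> real"
  have "linear_map (lp p n) (lp p m) T"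
    by (auto simp: linear_map_def T_def fun_eq_iff algebra_simps sum.distrib sum_distrib_left)
  moreover have T1: "op_norm (lp p n) (lp p m) T \<le> ennreal 1"
  proof (rule op_norm_le)
    fix a assume "nrm (lp p n) a \<le> 1"
    moreover have "nrm (lp p m) (T a) = nrm (lp p m) (\<lambda>i. \<Sum>j<n. t i j * a j)"
      by (rule lp_norm_cong[OF p m]) (simp add: T_def)
    ultimately show "nrm (lp p m) (T a) \<le> 1" using t[of a] by simp
  qed simp
  ultimately have T: "T \<in> bounded_ops (lp p n) (lp p m)"
    by (auto simp: bounded_ops_def intro: le_less_trans)
  have Te: "T (unit_vec n j) i = t i j" if "i < m" "j < n" for i j
  proof -
    have "T (unit_vec n j) i = (\<Sum>k<n. t i k * (if k = j then 1 else 0))"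
      using that by (auto simp: T_def unit_vec_def intro!: sum.cong)
    also have "\<dots> = t i j" using that by (subst sum.remove[of _ j]) auto
    finally show ?thesis .
  qed
  have "tensor_left n m E T w = (\<lambda>i\<in>{..<m}. \<Oplus>j\<in>{..<n}. t i j \<odot> w j)"
    unfolding tensor_left_def
    by (intro restrict_ext finsum_cong') (use w Te in \<open>auto simp: PiE_iff\<close>)
  then have "ennreal (mnrm E m (\<lambda>i\<in>{..<m}. \<Oplus>j\<in>{..<n}. t i j \<odot> w j))
      \<le> op_norm (lp p n) (lp p m) T * ennreal (mnrm E n w)"
    using mnrm_tensor_left[OF n m T, of w] w by simp
  also have "\<dots> \<le> 1 * ennreal (mnrm E n w)" using T1 by (intro mult_right_mono) auto
  finally show ?thesis using normed_space.nrm_nonneg[OF mnrm_norm[OF n], of w] w by simp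
qed

text \<open>The sets need not cover the space and may be empty or null. At least one set is demanded
  because the multinorms are constrained for n \<ge> 1 only; the zero function is represented with
  one empty set.\<close>

definition fpartition :: "'a measure \<Rightarrow> nat \<Rightarrow> (nat \<Rightarrow> 'a set) \<Rightarrow> bool" where
  "fpartition M m A \<longleftrightarrow> 1 \<le> m \<and> disjoint_family_on A {..<m} \<and> (\<forall>k<m. A k \<in> fmeasurable M)"

locale simple_functions = Y: p_multinormed_space p Y
  for p :: ennreal and Y :: "'y mnspace" (structure) +
  fixes M :: "'a measure"
  assumes p: "1 \<le> p"

sublocale simple_functions \<subseteq> Y: real_module Y by (rule Y.real_module)

context simple_functions
begin

text \<open>The norm of the simple function with value \<open>y k\<close> on \<open>A k\<close>,
  measured in the multinorm of Y on \<open>lp p m\<close> when the k-th unit vector stands for the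
  indicator of \<open>A k\<close> divided by its weight.\<close>

definition val :: "nat \<Rightarrow> (nat \<Rightarrow> 'a set) \<Rightarrow> (nat \<Rightarrow> 'y) \<Rightarrow> real" where
  "val m A y = mnrm Y m (\<lambda>k\<in>{..<m}. wt p M (A k) \<odot> y k)"

definition Rep :: "('a \<Rightarrow> 'y) \<Rightarrow> nat \<Rightarrow> (nat \<Rightarrow> 'a set) \<Rightarrow> (nat \<Rightarrow> 'y) \<Rightarrow> bool" where
  "Rep \<omega> m A y \<longleftrightarrow> fpartition M m A \<and> (\<forall>k<m. y k \<in> carrier Y) \<and>
     (\<forall>k<m. \<forall>t\<in>A k. \<omega> t = y k) \<and> (\<forall>t. t \<notin> (\<Union>k<m. A k) \<longrightarrow> \<omega> t = \<zero>)"

text \<open>Functions are not identified almost everywhere. The field \<open>nrm\<close> is left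
  unspecified; the space is a module on which \<open>snorm\<close> acts as a sublinear
  functional.\<close>

definition simple_space :: "('a \<Rightarrow> 'y) nspace" where
  "simple_space = \<lparr>carrier = {\<omega>. \<exists>m A y. Rep \<omega> m A y}, mult = undefined, one = undefined,
     zero = (\<lambda>_. \<zero>), add = (\<lambda>\<omega> \<eta> t. \<omega> t \<oplus> \<eta> t), smult = (\<lambda>c \<omega> t. c \<odot> \<omega> t), nrm = undefined\<rparr>"

lemma simple_space_simps [simp]:
  "carrier simple_space = {\<omega>. \<exists>m A y. Rep \<omega> m A y}" "\<zero>\<^bsub>simple_space\<^esub> = (\<lambda>_. \<zero>)"
  "\<omega> \<oplus>\<^bsub>simple_space\<^esub> \<eta> = (\<lambda>t. \<omega> t \<oplus> \<eta> t)" "c \<odot>\<^bsub>simple_space\<^esub> \<omega> = (\<lambda>t. c \<odot> \<omega> t)"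
  by (simp_all add: simple_space_def)

lemma Rep_carrier: "Rep \<omega> m A y \<Longrightarrow> \<omega> t \<in> carrier Y"
  unfolding Rep_def by (cases "t \<in> (\<Union>k<m. A k)") (force, simp)

lemma partition_tensor:
  "(\<And>k. k < m \<Longrightarrow> y k \<in> carrier Y) \<Longrightarrow> (\<lambda>k\<in>{..<m}. c k \<odot> y k) \<in> carrier (tensor_space m Y)"
  by auto

lemma val_nonneg:
  assumes "1 \<le> m" "\<And>k. k < m \<Longrightarrow> y k \<in> carrier Y" shows "0 \<le> val m A y"
proof -
  have "(\<lambda>k\<in>{..<m}. wt p M (A k) \<odot> y k) \<in> carrier (tensor_space m Y)"
    by (rule partition_tensor) (rule assms(2))
  then show ?thesis
    unfolding val_def using normed_space.nrm_nonneg[OF Y.mnrm_norm[OF assms(1)]] by simp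
qed

text \<open>Passing to B is the action of a contraction from \<open>lp p m\<close> to
  \<open>lp p N\<close>: read as a map of step functions, it restricts to the sets of B and so
  decreases absolute values pointwise. An index \<open>\<kappa> l \<ge> m\<close> marks a piece
  outside the sets of A, where the value is 0. The sets of B may leave out parts of A, which later
  permits shrinking a partition.\<close>

lemma val_refine:
  assumes A: "fpartition M m A" and B: "fpartition M N B"
    and y: "\<And>k. k < m \<Longrightarrow> y k \<in> carrier Y" and \<kappa>: "\<And>l. l < N \<Longrightarrow> \<kappa> l < m \<Longrightarrow> B l \<subseteq> A (\<kappa> l)"
  shows "val N B (\<lambda>l. if \<kappa> l < m then y (\<kappa> l) else \<zero>) \<le> val m A y"
proof -
  have m: "1 \<le> m" "disjoint_family_on A {..<m}" "\<And>k. k < m \<Longrightarrow> A k \<in> fmeasurable M"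
    using A by (auto simp: fpartition_def)
  have N: "1 \<le> N" "disjoint_family_on B {..<N}" "\<And>k. k < N \<Longrightarrow> B k \<in> fmeasurable M"
    using B by (auto simp: fpartition_def)
  \<comment> \<open>The matrix of the restriction with respect to normalised indicators. For a null
    \<open>A k\<close> the quotient is 0, in accordance with \<open>wt0\<close>.\<close>
  define t where "t l k = (if \<kappa> l = k then wt p M (B l) / wt p M (A k) else 0)" for l k
  have wt0: "wt p M (B l) = 0" if "l < N" "\<kappa> l < m" "wt p M (A (\<kappa> l)) = 0" for l
  proof -
    have "measure M (B l) \<le> measure M (A (\<kappa> l))"
      using \<kappa>[OF that(1,2)] N(3)[OF that(1)] m(3)[OF that(2)] by (intro measure_mono_fmeasurable) (auto simp: fmeasurable_def)
    then show ?thesis using that(3) by (simp add: wt_eq_0 measure_le_0_iff)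
  qed
  have tc: "nrm (lp p N) (\<lambda>l. \<Sum>k<m. t l k * a k) \<le> nrm (lp p m) a" for a
  proof -
    \<comment> \<open>The coefficients of the step function for which a stands; they vanish from m
      on, so that pieces outside A receive the value 0.\<close>
    define c where "c k = (if k < m then a k / wt p M (A k) else 0)" for k
    have sum_t: "(\<Sum>k<m. t l k * a k) = wt p M (B l) * c (\<kappa> l)" for l
    proof (cases "\<kappa> l < m")
      case True
      then show ?thesis by (subst sum.remove[of _ "\<kappa> l"]) (auto simp: t_def c_def)
    next
      case False
      then show ?thesis by (simp add: t_def c_def)
    qed
    let ?g = "\<lambda>x. \<Sum>l<N. c (\<kappa> l) * indicator (B l) x" and ?f = "\<lambda>x. \<Sum>k<m. c k * indicator (A k) x"
    have "nrm (lp p N) (\<lambda>l. \<Sum>k<m. t l k * a k) = Lq_norm p M ?g"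
      unfolding sum_t by (rule step_function_norm(2)[OF p N, symmetric])
    also have "\<dots> \<le> Lq_norm p M ?f"
    proof (rule Lq_norm_mono[OF p])
      show "?g \<in> Lq_fun p M" by (rule step_function_norm(1)[OF p N])
      show "?f \<in> Lq_fun p M" by (rule step_function_norm(1)[OF p m])
      show "AE x in M. \<bar>?g x\<bar> \<le> \<bar>?f x\<bar>"
      proof (rule AE_I2)
      fix x
      show "\<bar>?g x\<bar> \<le> \<bar>?f x\<bar>"
      proof (cases "x \<in> (\<Union>l<N. B l)")
        case True
        then obtain l where l: "l < N" "x \<in> B l" by auto
        have g: "?g x = c (\<kappa> l)" using sum_indicator_disjoint[OF N(2) l, of "\<lambda>l. c (\<kappa> l)"] .
        show ?thesis
        proof (cases "\<kappa> l < m")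
          case True
          then show ?thesis using sum_indicator_disjoint[OF m(2) True, of x c] \<kappa>[OF l(1) True] l(2) unfolding g by auto
        next
          case False
          then show ?thesis unfolding g by (simp add: c_def)
        qed
      next
        case False
        then show ?thesis using sum_indicator_outside[of x B N "\<lambda>l. c (\<kappa> l)"] by simp
      qed
      qed
    qed
    also have "\<dots> = nrm (lp p m) (\<lambda>k. wt p M (A k) * c k)" by (rule step_function_norm(2)[OF p m])
    also have "\<dots> \<le> nrm (lp p m) a" by (rule lp_norm_mono[OF p m(1)]) (simp add: c_def)
    finally show ?thesis .
  qed
  have yt: "(\<lambda>k\<in>{..<m}. wt p M (A k) \<odot> y k) \<in> {..<m} \<rightarrow>\<^sub>E carrier Y" using y by auto
  have "(\<Oplus>k\<in>{..<m}. t l k \<odot> (\<lambda>k\<in>{..<m}. wt p M (A k) \<odot> y k) k) =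
      wt p M (B l) \<odot> (if \<kappa> l < m then y (\<kappa> l) else \<zero>)" if l: "l < N" for l
  proof (cases "\<kappa> l < m")
    case True
    have "(\<Oplus>k\<in>{..<m}. t l k \<odot> (\<lambda>k\<in>{..<m}. wt p M (A k) \<odot> y k) k) =
        t l (\<kappa> l) \<odot> (\<lambda>k\<in>{..<m}. wt p M (A k) \<odot> y k) (\<kappa> l)"
      by (rule Y.finsum_single) (use y True in \<open>auto simp: t_def Y.sm_simps\<close>)
    also have "\<dots> = wt p M (B l) \<odot> y (\<kappa> l)"
      using True y wt0[OF l True] by (auto simp: t_def Y.sm_simps)
    finally show ?thesis using True by simp
  next
    case False
    have "(\<Oplus>k\<in>{..<m}. t l k \<odot> (\<lambda>k\<in>{..<m}. wt p M (A k) \<odot> y k) k) = (\<Oplus>k\<in>{..<m}. \<zero>)"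
      using False y by (intro Y.finsum_cong') (auto simp: t_def Y.sm_simps)
    then show ?thesis using False by (simp add: Y.sm_simps)
  qed
  then have "val N B (\<lambda>l. if \<kappa> l < m then y (\<kappa> l) else \<zero>) =
      mnrm Y N (\<lambda>l\<in>{..<N}. \<Oplus>k\<in>{..<m}. t l k \<odot> (\<lambda>k\<in>{..<m}. wt p M (A k) \<odot> y k) k)"
    unfolding val_def by (intro arg_cong[where f="mnrm Y N"] restrict_ext) simp
  also have "\<dots> \<le> val m A y"
    unfolding val_def by (rule Y.mnrm_contraction[OF p m(1) N(1) tc yt])
  finally show ?thesis .
qed

text \<open>Pairs of indices are coded by quotient and remainder modulo m' + 1. The extra index m
  stands for the part covered by the second partition alone, and m' for the part covered by the
  first alone, so both functions are represented on the union of both domains.\<close>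

lemma common_refinement:
  assumes 1: "Rep \<omega> m A y" and 2: "Rep \<eta> m' A' y'"
  obtains N B \<kappa> \<kappa>' where
    "Rep \<omega> N B (\<lambda>l. if \<kappa> l < m then y (\<kappa> l) else \<zero>)" "Rep \<eta> N B (\<lambda>l. if \<kappa>' l < m' then y' (\<kappa>' l) else \<zero>)"
    "val N B (\<lambda>l. if \<kappa> l < m then y (\<kappa> l) else \<zero>) \<le> val m A y"
    "val N B (\<lambda>l. if \<kappa>' l < m' then y' (\<kappa>' l) else \<zero>) \<le> val m' A' y'"
proof -
  define W where "W = (\<Union>k<m. A k)"
  define W' where "W' = (\<Union>k<m'. A' k)"
  define C where "C k = (if k < m then A k else W' - W)" for k
  define C' where "C' k = (if k < m' then A' k else W - W')" for k
  define N where "N = Suc m * Suc m'"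
  define \<kappa> where "\<kappa> r = r div Suc m'" for r
  define \<kappa>' where "\<kappa>' r = r mod Suc m'" for r
  define B where "B r = C (\<kappa> r) \<inter> C' (\<kappa>' r)" for r
  have \<kappa>_le: "\<kappa> r \<le> m" if "r < N" for r
    using that unfolding \<kappa>_def N_def by (simp add: less_mult_imp_div_less less_Suc_eq_le[symmetric] del: mult_Suc)
  have \<kappa>'_le: "\<kappa>' r \<le> m'" for r unfolding \<kappa>'_def by (simp add: less_Suc_eq_le[symmetric])
  have A: "disjoint_family_on A {..<m}" "\<And>k. k < m \<Longrightarrow> A k \<in> fmeasurable M" "1 \<le> m"
    and A': "disjoint_family_on A' {..<m'}" "\<And>k. k < m' \<Longrightarrow> A' k \<in> fmeasurable M"
    using 1 2 by (auto simp: Rep_def fpartition_def)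
  have Wf: "W \<in> fmeasurable M" "W' \<in> fmeasurable M"
    unfolding W_def W'_def using A A' by (auto intro!: fmeasurable.finite_UN)
  have Cf: "C k \<in> fmeasurable M" "C' k \<in> fmeasurable M" for k
    using A A' Wf by (auto simp: C_def C'_def intro: fmeasurable_Diff)
  have Cd: "C k \<inter> C l = {}" if "k \<le> m" "l \<le> m" "k \<noteq> l" for k l
    using A(1) that by (auto simp: C_def W_def disjoint_family_on_def)
  have C'd: "C' k \<inter> C' l = {}" if "k \<le> m'" "l \<le> m'" "k \<noteq> l" for k l
    using A'(1) that by (auto simp: C'_def W'_def disjoint_family_on_def)
  have B: "fpartition M N B"
    unfolding fpartition_def
  proof (intro conjI allI impI)
    show "1 \<le> N" by (simp add: N_def)
    show "disjoint_family_on B {..<N}"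
      unfolding disjoint_family_on_def
    proof (intro ballI impI)
      fix r s assume rs: "r \<in> {..<N}" "s \<in> {..<N}" "r \<noteq> s"
      then have "\<kappa> r \<noteq> \<kappa> s \<or> \<kappa>' r \<noteq> \<kappa>' s" unfolding \<kappa>_def \<kappa>'_def by (metis div_mult_mod_eq)
      then show "B r \<inter> B s = {}"
        using Cd[of "\<kappa> r" "\<kappa> s"] C'd[of "\<kappa>' r" "\<kappa>' s"] \<kappa>_le \<kappa>'_le rs unfolding B_def by auto
    qed
    show "B r \<in> fmeasurable M" for r unfolding B_def using Cf by (intro fmeasurable_Int_fmeasurable) (auto simp: fmeasurable_def)
  qed
  have cover: "\<exists>r<N. t \<in> B r" if t: "t \<in> W \<union> W'" for t
  proof -
    have "\<exists>k\<le>m. t \<in> C k" using t by (cases "t \<in> W") (force simp: C_def W_def intro: less_imp_le)+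
    moreover have "\<exists>l\<le>m'. t \<in> C' l" using t by (cases "t \<in> W'") (force simp: C'_def W'_def intro: less_imp_le)+
    ultimately obtain k l where kl: "k \<le> m" "t \<in> C k" "l \<le> m'" "t \<in> C' l" by auto
    let ?r = "k * Suc m' + l"
    have kr: "\<kappa> ?r = k" "\<kappa>' ?r = l" unfolding \<kappa>_def \<kappa>'_def using kl by (simp_all del: mult_Suc mult_Suc_right)
    have "t \<in> B ?r" unfolding B_def kr using kl by blast
    moreover have "?r < N"
    proof -
      have "?r < k * Suc m' + Suc m'" using kl by simp
      also have "\<dots> = Suc k * Suc m'" by simp
      also have "\<dots> \<le> N" unfolding N_def using kl by (intro mult_le_mono1) simp
      finally show ?thesis .
    qed
    ultimately show ?thesis by blast
  qed
  have r1: "Rep \<omega> N B (\<lambda>l. if \<kappa> l < m then y (\<kappa> l) else \<zero>)"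
    unfolding Rep_def
  proof (intro conjI allI impI ballI)
    show "(if \<kappa> k < m then y (\<kappa> k) else \<zero>) \<in> carrier Y" for k using 1 by (auto simp: Rep_def)
    show "\<omega> t = (if \<kappa> k < m then y (\<kappa> k) else \<zero>)" if "t \<in> B k" for k t
      using that 1 by (auto simp: Rep_def B_def C_def W_def)
    show "\<omega> t = \<zero>" if "t \<notin> (\<Union>k<N. B k)" for t
    proof -
      have "t \<notin> W" using cover[of t] that by blast
      then show ?thesis using 1 by (simp add: Rep_def W_def)
    qed
  qed (rule B)
  have r2: "Rep \<eta> N B (\<lambda>l. if \<kappa>' l < m' then y' (\<kappa>' l) else \<zero>)"
    unfolding Rep_def
  proof (intro conjI allI impI ballI)
    show "(if \<kappa>' k < m' then y' (\<kappa>' k) else \<zero>) \<in> carrier Y" for k using 2 by (auto simp: Rep_def)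
    show "\<eta> t = (if \<kappa>' k < m' then y' (\<kappa>' k) else \<zero>)" if "t \<in> B k" for k t
      using that 2 by (auto simp: Rep_def B_def C'_def W'_def)
    show "\<eta> t = \<zero>" if "t \<notin> (\<Union>k<N. B k)" for t
    proof -
      have "t \<notin> W'" using cover[of t] that by blast
      then show ?thesis using 2 by (simp add: Rep_def W'_def)
    qed
  qed (rule B)
  have "val N B (\<lambda>l. if \<kappa> l < m then y (\<kappa> l) else \<zero>) \<le> val m A y"
    by (rule val_refine[OF _ B]) (use 1 in \<open>auto simp: Rep_def B_def C_def\<close>)
  moreover have "val N B (\<lambda>l. if \<kappa>' l < m' then y' (\<kappa>' l) else \<zero>) \<le> val m' A' y'"
    by (rule val_refine[OF _ B]) (use 2 in \<open>auto simp: Rep_def B_def C'_def\<close>)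
  ultimately show thesis using that r1 r2 by blast
qed

lemma Rep_add:
  assumes "Rep \<omega> N B z" "Rep \<eta> N B z'"
  shows "Rep (\<lambda>t. \<omega> t \<oplus> \<eta> t) N B (\<lambda>l. z l \<oplus> z' l)" "val N B (\<lambda>l. z l \<oplus> z' l) \<le> val N B z + val N B z'"
proof -
  show "Rep (\<lambda>t. \<omega> t \<oplus> \<eta> t) N B (\<lambda>l. z l \<oplus> z' l)" using assms by (auto simp: Rep_def)
  have N: "1 \<le> N" and z: "\<And>l. l < N \<Longrightarrow> z l \<in> carrier Y" "\<And>l. l < N \<Longrightarrow> z' l \<in> carrier Y"
    using assms by (auto simp: Rep_def fpartition_def)
  have e: "(\<lambda>k\<in>{..<N}. wt p M (B k) \<odot> (z k \<oplus> z' k)) = (\<lambda>k\<in>{..<N}. wt p M (B k) \<odot> z k)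
      \<oplus>\<^bsub>tensor_space N Y\<^esub> (\<lambda>k\<in>{..<N}. wt p M (B k) \<odot> z' k)"
    using z by (auto simp: fun_eq_iff Y.sm_simps)
  have "(\<lambda>k\<in>{..<N}. wt p M (B k) \<odot> z k) \<in> carrier (tensor_space N Y)"
    "(\<lambda>k\<in>{..<N}. wt p M (B k) \<odot> z' k) \<in> carrier (tensor_space N Y)"
    by (rule partition_tensor, erule z)+
  from normed_space.nrm_triangle[OF Y.mnrm_norm[OF N] this]
  show "val N B (\<lambda>l. z l \<oplus> z' l) \<le> val N B z + val N B z'"
    unfolding val_def e by (simp only: tensor_space_simps)
qed

lemma Rep_smult:
  assumes "Rep \<omega> N B z"
  shows "Rep (\<lambda>t. c \<odot> \<omega> t) N B (\<lambda>l. c \<odot> z l)" "val N B (\<lambda>l. c \<odot> z l) = \<bar>c\<bar> * val N B z"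
proof -
  show "Rep (\<lambda>t. c \<odot> \<omega> t) N B (\<lambda>l. c \<odot> z l)" using assms by (auto simp: Rep_def Y.sm_simps)
  have N: "1 \<le> N" and z: "\<And>l. l < N \<Longrightarrow> z l \<in> carrier Y"
    using assms by (auto simp: Rep_def fpartition_def)
  have e: "(\<lambda>k\<in>{..<N}. wt p M (B k) \<odot> (c \<odot> z k)) = c \<odot>\<^bsub>tensor_space N Y\<^esub> (\<lambda>k\<in>{..<N}. wt p M (B k) \<odot> z k)"
    using z by (auto simp: fun_eq_iff Y.sm_simps mult.commute)
  have "(\<lambda>k\<in>{..<N}. wt p M (B k) \<odot> z k) \<in> carrier (tensor_space N Y)"
    by (rule partition_tensor, erule z)
  from normed_space.nrm_smult[OF Y.mnrm_norm[OF N] this, of c]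
  show "val N B (\<lambda>l. c \<odot> z l) = \<bar>c\<bar> * val N B z"
    unfolding val_def e by (simp only: tensor_space_simps)
qed

lemma module_simple_space: "module real_ring simple_space"
proof (rule real_moduleI)
  have "Rep (\<lambda>_. \<zero>) 1 (\<lambda>_. {}) (\<lambda>_. \<zero>)" by (auto simp: Rep_def fpartition_def disjoint_family_on_def)
  then show "\<zero>\<^bsub>simple_space\<^esub> \<in> carrier simple_space" by auto
  fix \<omega> \<eta> assume a: "\<omega> \<in> carrier simple_space" "\<eta> \<in> carrier simple_space"
  then obtain m A y m' A' y' where r: "Rep \<omega> m A y" "Rep \<eta> m' A' y'" by auto
  show "\<omega> \<oplus>\<^bsub>simple_space\<^esub> \<eta> \<in> carrier simple_space"
    by (rule common_refinement[OF r], drule (1) Rep_add(1)) auto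
  show "\<omega> \<oplus>\<^bsub>simple_space\<^esub> \<eta> = \<eta> \<oplus>\<^bsub>simple_space\<^esub> \<omega>"
    using Rep_carrier[OF r(1)] Rep_carrier[OF r(2)] by (auto simp: Y.a_comm)
  show "c \<odot>\<^bsub>simple_space\<^esub> (\<omega> \<oplus>\<^bsub>simple_space\<^esub> \<eta>) = c \<odot>\<^bsub>simple_space\<^esub> \<omega> \<oplus>\<^bsub>simple_space\<^esub> c \<odot>\<^bsub>simple_space\<^esub> \<eta>" for c
    using Rep_carrier[OF r(1)] Rep_carrier[OF r(2)] by (auto simp: Y.sm_simps)
  fix \<xi> assume "\<xi> \<in> carrier simple_space"
  then obtain m'' A'' y'' where "Rep \<xi> m'' A'' y''" by auto
  then show "\<omega> \<oplus>\<^bsub>simple_space\<^esub> \<eta> \<oplus>\<^bsub>simple_space\<^esub> \<xi> = \<omega> \<oplus>\<^bsub>simple_space\<^esub> (\<eta> \<oplus>\<^bsub>simple_space\<^esub> \<xi>)"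
    using Rep_carrier[OF r(1)] Rep_carrier[OF r(2)] Rep_carrier by (auto simp: Y.a_assoc)
next
  fix \<omega> a b assume "\<omega> \<in> carrier simple_space"
  then obtain m A y where r: "Rep \<omega> m A y" by auto
  show "a \<odot>\<^bsub>simple_space\<^esub> \<omega> \<in> carrier simple_space" using Rep_smult(1)[OF r] by auto
  note c = Rep_carrier[OF r]
  show "\<zero>\<^bsub>simple_space\<^esub> \<oplus>\<^bsub>simple_space\<^esub> \<omega> = \<omega>" "1 \<odot>\<^bsub>simple_space\<^esub> \<omega> = \<omega>" "0 \<odot>\<^bsub>simple_space\<^esub> \<omega> = \<zero>\<^bsub>simple_space\<^esub>"
    "(a + b) \<odot>\<^bsub>simple_space\<^esub> \<omega> = a \<odot>\<^bsub>simple_space\<^esub> \<omega> \<oplus>\<^bsub>simple_space\<^esub> b \<odot>\<^bsub>simple_space\<^esub> \<omega>"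
    "(a * b) \<odot>\<^bsub>simple_space\<^esub> \<omega> = a \<odot>\<^bsub>simple_space\<^esub> (b \<odot>\<^bsub>simple_space\<^esub> \<omega>)"
    using c by (auto simp: Y.sm_simps)
qed

text \<open>The infimum over representations avoids a proof that \<open>val\<close> is independent
  of the representation; that refinement does not increase \<open>val\<close> is then
  enough.\<close>

definition snorm :: "('a \<Rightarrow> 'y) \<Rightarrow> real" where
  "snorm \<omega> = Inf {val m A y | m A y. Rep \<omega> m A y}"

lemma snorm_le: "Rep \<omega> m A y \<Longrightarrow> snorm \<omega> \<le> val m A y"
  unfolding snorm_def
  by (intro cInf_lower bdd_belowI[of _ 0]) (auto simp: Rep_def fpartition_def intro!: val_nonneg)

lemma snorm_ge:
  assumes "Rep \<omega> m A y" "\<And>m A y. Rep \<omega> m A y \<Longrightarrow> c \<le> val m A y" shows "c \<le> snorm \<omega>"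
  unfolding snorm_def using assms by (intro cInf_greatest) auto

lemma snorm_approx:
  assumes r: "Rep \<omega> m A y" and e: "e > 0"
  obtains m A y where "Rep \<omega> m A y" "val m A y < snorm \<omega> + e"
proof -
  have "\<not> (\<forall>m A y. Rep \<omega> m A y \<longrightarrow> snorm \<omega> + e \<le> val m A y)"
    using snorm_ge[OF r, of "snorm \<omega> + e"] e by auto
  then show thesis using that by (meson not_le)
qed

text \<open>Nearly optimal representations of two functions are brought to a common refinement,
  which increases neither value, and there the multinorm of Y has a triangle inequality.\<close>

lemma sublinear_snorm:
  assumes C: "0 \<le> C" shows "sublinear simple_space (\<lambda>\<omega>. C * snorm \<omega>)"
  unfolding sublinear_def
proof (intro conjI ballI allI impI)
  fix \<omega> \<eta> assume a: "\<omega> \<in> carrier simple_space" "\<eta> \<in> carrier simple_space"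
  then obtain m0 A0 y0 m1 A1 y1 where r0: "Rep \<omega> m0 A0 y0" "Rep \<eta> m1 A1 y1" by auto
  have "snorm (\<lambda>t. \<omega> t \<oplus> \<eta> t) \<le> snorm \<omega> + snorm \<eta> + e" if e: "e > 0" for e
  proof -
    obtain m A y where 1: "Rep \<omega> m A y" "val m A y < snorm \<omega> + e / 2"
      by (rule snorm_approx[OF r0(1), of "e / 2"]) (use e in auto)
    obtain m' A' y' where 2: "Rep \<eta> m' A' y'" "val m' A' y' < snorm \<eta> + e / 2"
      by (rule snorm_approx[OF r0(2), of "e / 2"]) (use e in auto)
    obtain N B z z' where 3: "Rep \<omega> N B z" "Rep \<eta> N B z'" "val N B z \<le> val m A y" "val N B z' \<le> val m' A' y'"
      by (rule common_refinement[OF 1(1) 2(1)])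
    show ?thesis using snorm_le[OF Rep_add(1)[OF 3(1,2)]] Rep_add(2)[OF 3(1,2)] 3(3,4) 1(2) 2(2) by linarith
  qed
  then have "snorm (\<lambda>t. \<omega> t \<oplus> \<eta> t) \<le> snorm \<omega> + snorm \<eta>" by (rule field_le_epsilon)
  then have "C * snorm (\<lambda>t. \<omega> t \<oplus> \<eta> t) \<le> C * (snorm \<omega> + snorm \<eta>)" using C by (rule mult_left_mono)
  then show "C * snorm (\<omega> \<oplus>\<^bsub>simple_space\<^esub> \<eta>) \<le> C * snorm \<omega> + C * snorm \<eta>" by (simp add: distrib_left)
next
  have le: "snorm (\<lambda>t. c \<odot> \<omega> t) \<le> c * snorm \<omega>" if c: "c > 0" and w: "\<omega> \<in> carrier simple_space" for c \<omega>
  proof -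
    obtain m A y where r: "Rep \<omega> m A y" using w by auto
    have "snorm (\<lambda>t. c \<odot> \<omega> t) / c \<le> snorm \<omega>"
    proof (rule snorm_ge[OF r])
      fix m A y assume "Rep \<omega> m A y"
      from snorm_le[OF Rep_smult(1)[OF this, of c]] Rep_smult(2)[OF this, of c]
      show "snorm (\<lambda>t. c \<odot> \<omega> t) / c \<le> val m A y" using c by (simp add: divide_le_eq mult.commute)
    qed
    then show ?thesis using c by (simp add: divide_le_eq mult.commute)
  qed
  fix c :: real and \<omega> assume c: "c > 0" and w: "\<omega> \<in> carrier simple_space"
  then obtain m A y where r: "Rep \<omega> m A y" by auto
  have "(\<lambda>t. (1 / c) \<odot> (c \<odot> \<omega> t)) = \<omega>" using c Rep_carrier[OF r] by (auto simp: Y.sm_simps)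
  then have "snorm \<omega> \<le> (1 / c) * snorm (\<lambda>t. c \<odot> \<omega> t)"
    using le[of "1 / c" "\<lambda>t. c \<odot> \<omega> t"] c Rep_smult(1)[OF r] by auto
  then have "c * snorm \<omega> \<le> snorm (\<lambda>t. c \<odot> \<omega> t)" using c by (simp add: field_simps)
  with le[OF c w] have "snorm (\<lambda>t. c \<odot> \<omega> t) = c * snorm \<omega>" by simp
  then show "C * snorm (c \<odot>\<^bsub>simple_space\<^esub> \<omega>) = c * (C * snorm \<omega>)" by simp
qed

end

text \<open>The data define a functional on S-valued simple functions: \<omega> is sent to the
  integral of \<open>U (\<omega> t) t\<close>. By \<open>Ubound\<close> it is dominated by C times
  \<open>snorm\<close>, so it extends to Y-valued simple functions, and \<open>\<nu> y A\<close> is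
  the extension at the function with value y on A. \<open>U\<close> is abstract because it will be
  instantiated twice: by representatives of u, and by norming functionals over counting
  measure.\<close>

lemma (in simple_functions) vector_measure_extension:
  assumes S: "submodule S real_ring Y" and C: "0 \<le> C"
    and Um: "\<And>x. x \<in> S \<Longrightarrow> U x \<in> borel_measurable M"
    and Uint: "\<And>x A. x \<in> S \<Longrightarrow> A \<in> fmeasurable M \<Longrightarrow> integrable M (\<lambda>t. indicator A t * U x t)"
    and Uadd: "\<And>x y. x \<in> S \<Longrightarrow> y \<in> S \<Longrightarrow> AE t in M. U (x \<oplus> y) t = U x t + U y t"
    and Usm: "\<And>c x. x \<in> S \<Longrightarrow> AE t in M. U (c \<odot> x) t = c * U x t"
    and Ubound: "\<And>m A x. fpartition M m A \<Longrightarrow> (\<And>k. k < m \<Longrightarrow> x k \<in> S) \<Longrightarrow>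
      (\<Sum>k<m. sint M (A k) (U (x k))) \<le> C * val m A x"
  obtains \<nu> :: "'y \<Rightarrow> 'a set \<Rightarrow> real" where
    "\<And>y A B. y \<in> carrier Y \<Longrightarrow> A \<in> fmeasurable M \<Longrightarrow> B \<in> fmeasurable M \<Longrightarrow> A \<inter> B = {} \<Longrightarrow>
      \<nu> y (A \<union> B) = \<nu> y A + \<nu> y B"
    "\<And>x y A. x \<in> carrier Y \<Longrightarrow> y \<in> carrier Y \<Longrightarrow> A \<in> fmeasurable M \<Longrightarrow> \<nu> (x \<oplus> y) A = \<nu> x A + \<nu> y A"
    "\<And>c y A. y \<in> carrier Y \<Longrightarrow> A \<in> fmeasurable M \<Longrightarrow> \<nu> (c \<odot> y) A = c * \<nu> y A"
    "\<And>x A. x \<in> S \<Longrightarrow> A \<in> fmeasurable M \<Longrightarrow> \<nu> x A = sint M A (U x)"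
    "\<And>m A y. fpartition M m A \<Longrightarrow> (\<And>k. k < m \<Longrightarrow> y k \<in> carrier Y) \<Longrightarrow> (\<Sum>k<m. \<nu> (y k) (A k)) \<le> C * val m A y"
proof -
  interpret S: submodule S real_ring Y by (rule S)
  have Sc: "x \<in> carrier Y" if "x \<in> S" for x using that S.subset by auto
  have S0: "\<zero> \<in> S" using S.one_closed by simp
  have Sadd: "x \<oplus> y \<in> S" if "x \<in> S" "y \<in> S" for x y using S.m_closed[OF that] by simp
  have Ssm: "c \<odot> x \<in> S" if "x \<in> S" for c x using that S.smult_closed by simp
  \<comment> \<open>As an integral, the value visibly does not depend on a representation of
    \<omega>.\<close>
  define \<Phi> where "\<Phi> \<omega> = (\<integral>t. U (\<omega> t) t \<partial>M)" for \<omega>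
  have U0: "AE t in M. U \<zero> t = 0" using Usm[OF S0, of 0] by (simp add: Y.sm_simps)
  have \<Phi>: "\<Phi> \<omega> = (\<Sum>k<m. sint M (A k) (U (x k)))"
    if r: "Rep \<omega> m A x" and x: "\<And>k. k < m \<Longrightarrow> x k \<in> S" for \<omega> m A x
  proof -
    have A: "disjoint_family_on A {..<m}" "\<And>k. k < m \<Longrightarrow> A k \<in> fmeasurable M"
      using r by (auto simp: Rep_def fpartition_def)
    have i: "integrable M (\<lambda>t. \<Sum>k<m. indicator (A k) t * U (x k) t)"
      by (intro Bochner_Integration.integrable_sum Uint x A) auto
    have AE: "AE t in M. U (\<omega> t) t = (\<Sum>k<m. indicator (A k) t * U (x k) t)"
      using U0
    proof eventually_elim
      case (elim t)
      show ?case
      proof (cases "t \<in> (\<Union>k<m. A k)")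
        case True
        then obtain k where k: "k < m" "t \<in> A k" by auto
        have "(\<Sum>k<m. indicator (A k) t * U (x k) t) = (\<Sum>k<m. U (x k) t * indicator (A k) t)"
          by (simp only: mult.commute)
        also have "\<dots> = U (x k) t" by (rule sum_indicator_disjoint[OF A(1) k])
        finally show ?thesis using r k by (simp add: Rep_def)
      next
        case False
        then have "\<omega> t = \<zero>" using r by (simp add: Rep_def)
        moreover have "(\<Sum>k<m. indicator (A k) t * U (x k) t) = 0" using False by (intro sum.neutral) auto
        ultimately show ?thesis using elim by simp
      qed
    qed
    \<comment> \<open>An identity at every point, because comparing the integrals also requires
      measurability of the left-hand side, while \<open>U \<zero>\<close> vanishes only almost
      everywhere.\<close>
    have "U (\<omega> t) t = (\<Sum>k<m. U (x k) t * indicator (A k) t) + (1 - indicator (\<Union>k<m. A k) t) * U \<zero> t" for t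
    proof (cases "t \<in> (\<Union>k<m. A k)")
      case True
      then obtain k where k: "k < m" "t \<in> A k" by auto
      have "(\<Sum>k<m. U (x k) t * indicator (A k) t) = U (x k) t" by (rule sum_indicator_disjoint[OF A(1) k])
      then show ?thesis using r k True by (simp add: Rep_def del: sum_mult_indicator)
    next
      case False
      then have "\<omega> t = \<zero>" using r by (simp add: Rep_def)
      moreover have "(\<Sum>k<m. U (x k) t * indicator (A k) t) = 0" by (rule sum_indicator_outside[OF False])
      ultimately show ?thesis using False by (simp del: sum_mult_indicator)
    qed
    then have eq: "(\<lambda>t. U (\<omega> t) t) =
        (\<lambda>t. (\<Sum>k<m. U (x k) t * indicator (A k) t) + (1 - indicator (\<Union>k<m. A k) t) * U \<zero> t)" by blast
    have "(\<lambda>t. U (\<omega> t) t) \<in> borel_measurable M"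
    proof -
      have [measurable]: "U \<zero> \<in> borel_measurable M" by (rule Um[OF S0])
      have [measurable]: "(\<lambda>t. \<Sum>k<m. U (x k) t * indicator (A k) t) \<in> borel_measurable M"
        by (intro borel_measurable_sum borel_measurable_times borel_measurable_indicator Um x) (use A in \<open>auto simp: fmeasurable_def\<close>)
      have [measurable]: "(\<Union>k<m. A k) \<in> sets M" using A(2) by (auto simp: fmeasurable_def)
      show ?thesis unfolding eq by measurable
    qed
    then have "\<Phi> \<omega> = (\<integral>t. (\<Sum>k<m. indicator (A k) t * U (x k) t) \<partial>M)"
      unfolding \<Phi>_def using AE i by (intro integral_cong_AE) auto
    also have "\<dots> = (\<Sum>k<m. sint M (A k) (U (x k)))"
      by (intro Bochner_Integration.integral_sum Uint x A) auto
    finally show ?thesis .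
  qed
  \<comment> \<open>A representation of an S-valued function may carry values outside S on empty
    sets. They are replaced by 0, which leaves \<open>val\<close> unchanged since empty sets have
    weight 0.\<close>
  have norml: "\<exists>x. Rep \<omega> m A x \<and> (\<forall>k<m. x k \<in> S) \<and> val m A x = val m A y"
    if r: "Rep \<omega> m A y" and w: "\<And>t. \<omega> t \<in> S" for \<omega> m A y
  proof (intro exI conjI allI impI)
    define x where "x k = (if A k = {} then \<zero> else y k)" for k
    show "Rep \<omega> m A x" using r by (auto simp: Rep_def x_def)
    show "x k \<in> S" if "k < m" for k
    proof (cases "A k = {}")
      case False
      then obtain t where "t \<in> A k" by auto
      then have "\<omega> t = y k" using r that by (auto simp: Rep_def)
      then show ?thesis using w[of t] False by (simp add: x_def)
    qed (simp add: x_def S0)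
    show "val m A x = val m A y"
      unfolding val_def
      by (intro arg_cong[where f="mnrm Y m"] restrict_ext) (use r in \<open>auto simp: x_def Rep_def wt_def Y.sm_simps\<close>)
  qed
  define G0 where "G0 = {(\<omega>, \<Phi> \<omega>) | \<omega>. \<omega> \<in> carrier simple_space \<and> (\<forall>t. \<omega> t \<in> S)}"
  interpret E: real_module simple_space using module_simple_space by (simp add: real_module_iff)
  have sint_add: "sint M A (U (x \<oplus> y)) = sint M A (U x) + sint M A (U y)"
    if "x \<in> S" "y \<in> S" "A \<in> fmeasurable M" for x y A
  proof -
    have "sint M A (U (x \<oplus> y)) = (\<integral>t. indicator A t * U x t + indicator A t * U y t \<partial>M)"
    proof (rule integral_cong_AE)
      show "AE t in M. indicator A t * U (x \<oplus> y) t = indicator A t * U x t + indicator A t * U y t"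
        using Uadd[OF that(1,2)] by eventually_elim (simp add: distrib_left)
    qed (use Uint[OF Sadd[OF that(1,2)] that(3)] Uint[OF that(1,3)] Uint[OF that(2,3)] in auto)
    also have "\<dots> = sint M A (U x) + sint M A (U y)"
      by (rule Bochner_Integration.integral_add[OF Uint[OF that(1,3)] Uint[OF that(2,3)]])
    finally show ?thesis .
  qed
  have sint_sm: "sint M A (U (c \<odot> x)) = c * sint M A (U x)"
    if "x \<in> S" "A \<in> fmeasurable M" for c x A
  proof -
    have "sint M A (U (c \<odot> x)) = (\<integral>t. c * (indicator A t * U x t) \<partial>M)"
    proof (rule integral_cong_AE)
      show "AE t in M. indicator A t * U (c \<odot> x) t = c * (indicator A t * U x t)"
        using Usm[OF that(1), of c] by eventually_elim simp
    qed (use Uint[OF Ssm[OF that(1)] that(2)] Uint[OF that] in auto)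
    then show ?thesis by simp
  qed
  have sub: "sublinear simple_space (\<lambda>\<omega>. C * snorm \<omega>)" by (rule sublinear_snorm[OF C])
  obtain \<phi> where \<phi>: "\<And>\<omega>. \<omega> \<in> carrier simple_space \<Longrightarrow> \<phi> \<omega> \<le> C * snorm \<omega>"
    "\<And>\<omega> \<eta>. \<omega> \<in> carrier simple_space \<Longrightarrow> \<eta> \<in> carrier simple_space \<Longrightarrow> \<phi> (\<omega> \<oplus>\<^bsub>simple_space\<^esub> \<eta>) = \<phi> \<omega> + \<phi> \<eta>"
    "\<And>c \<omega>. \<omega> \<in> carrier simple_space \<Longrightarrow> \<phi> (c \<odot>\<^bsub>simple_space\<^esub> \<omega>) = c * \<phi> \<omega>"
    "\<And>\<omega> a. (\<omega>, a) \<in> G0 \<Longrightarrow> \<phi> \<omega> = a"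
  proof (rule hahn_banach_real[OF module_simple_space sub, of G0])
    show "G0 \<noteq> {}" using E.zero_closed S0 by (auto simp: G0_def simp del: simple_space_simps(1))
    show "G0 \<subseteq> carrier simple_space \<times> UNIV" by (auto simp: G0_def)
  next
    fix \<omega> a \<eta> b assume "(\<omega>, a) \<in> G0" "(\<eta>, b) \<in> G0"
    then have w: "\<omega> \<in> carrier simple_space" "\<And>t. \<omega> t \<in> S" "\<eta> \<in> carrier simple_space" "\<And>t. \<eta> t \<in> S"
      and ab: "a = \<Phi> \<omega>" "b = \<Phi> \<eta>" by (auto simp: G0_def)
    obtain m A y m' A' y' where "Rep \<omega> m A y" "Rep \<eta> m' A' y'" using w(1,3) by auto
    from norml[OF this(1) w(2)] norml[OF this(2) w(4)]
    obtain x x' where x: "Rep \<omega> m A x" "\<forall>k<m. x k \<in> S" "Rep \<eta> m' A' x'" "\<forall>k<m'. x' k \<in> S"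
      by (elim exE conjE) (rule that)
    obtain N B \<kappa> \<kappa>' where R: "Rep \<omega> N B (\<lambda>l. if \<kappa> l < m then x (\<kappa> l) else \<zero>)"
      "Rep \<eta> N B (\<lambda>l. if \<kappa>' l < m' then x' (\<kappa>' l) else \<zero>)"
      by (rule common_refinement[OF x(1,3)])
    define z where "z l = (if \<kappa> l < m then x (\<kappa> l) else \<zero>)" for l
    define z' where "z' l = (if \<kappa>' l < m' then x' (\<kappa>' l) else \<zero>)" for l
    have z: "z l \<in> S" "z' l \<in> S" for l using x S0 by (auto simp: z_def z'_def)
    have R': "Rep \<omega> N B z" "Rep \<eta> N B z'" using R by (simp_all add: z_def[abs_def] z'_def[abs_def])
    have Bf: "B k \<in> fmeasurable M" if "k < N" for k using R'(1) that by (auto simp: Rep_def fpartition_def)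
    have "\<Phi> (\<lambda>t. \<omega> t \<oplus> \<eta> t) = (\<Sum>k<N. sint M (B k) (U (z k \<oplus> z' k)))"
      by (rule \<Phi>[OF Rep_add(1)[OF R']]) (use z Sadd in blast)
    also have "\<dots> = (\<Sum>k<N. sint M (B k) (U (z k)) + sint M (B k) (U (z' k)))"
      using z Bf by (intro sum.cong refl sint_add) auto
    also have "\<dots> = \<Phi> \<omega> + \<Phi> \<eta>" using \<Phi>[OF R'(1)] \<Phi>[OF R'(2)] z by (simp add: sum.distrib)
    finally show "(\<omega> \<oplus>\<^bsub>simple_space\<^esub> \<eta>, a + b) \<in> G0"
      using E.a_closed[OF w(1,3)] w Sadd unfolding G0_def ab by (auto simp del: simple_space_simps(1))
  next
    fix c \<omega> a assume "(\<omega>, a) \<in> G0"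
    then have w: "\<omega> \<in> carrier simple_space" "\<And>t. \<omega> t \<in> S" and a: "a = \<Phi> \<omega>" by (auto simp: G0_def)
    obtain m A y where "Rep \<omega> m A y" using w(1) by auto
    from norml[OF this w(2)] obtain x where x: "Rep \<omega> m A x" "\<forall>k<m. x k \<in> S"
      by (elim exE conjE) (rule that)
    have "\<Phi> (\<lambda>t. c \<odot> \<omega> t) = (\<Sum>k<m. sint M (A k) (U (c \<odot> x k)))"
      by (rule \<Phi>[OF Rep_smult(1)[OF x(1)]]) (use x Ssm in blast)
    also have "\<dots> = (\<Sum>k<m. c * sint M (A k) (U (x k)))"
      using x by (intro sum.cong refl sint_sm) (auto simp: Rep_def fpartition_def)
    also have "\<dots> = c * \<Phi> \<omega>" using \<Phi>[OF x(1)] x(2) by (simp add: sum_distrib_left)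
    finally show "(c \<odot>\<^bsub>simple_space\<^esub> \<omega>, c * a) \<in> G0"
      using E.sm_closed[OF w(1), of c] w Ssm unfolding G0_def a by (auto simp del: simple_space_simps(1))
  next
    fix \<omega> a assume "(\<omega>, a) \<in> G0"
    then have w: "\<omega> \<in> carrier simple_space" "\<And>t. \<omega> t \<in> S" and a: "a = \<Phi> \<omega>" by (auto simp: G0_def)
    obtain m0 A0 y0 where r0: "Rep \<omega> m0 A0 y0" using w(1) by auto
    have le: "\<Phi> \<omega> \<le> C * val m A y" if r: "Rep \<omega> m A y" for m A y
    proof -
      obtain x where x: "Rep \<omega> m A x" "\<forall>k<m. x k \<in> S" "val m A x = val m A y"
        using norml[OF r w(2)] by (elim exE conjE) (rule that)
      then show ?thesis using \<Phi>[OF x(1)] Ubound[of m A x] by (simp add: Rep_def)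
    qed
    show "a \<le> C * snorm \<omega>"
    \<comment> \<open>The bounds by C times each value pass to the infimum after division by
      C.\<close>
    proof (cases "C = 0")
      case True then show ?thesis using le[OF r0] by (simp add: a)
    next
      case False
      then have "C > 0" using C by simp
      have "\<Phi> \<omega> / C \<le> snorm \<omega>"
        by (rule snorm_ge[OF r0]) (use le \<open>C > 0\<close> in \<open>simp add: divide_le_eq mult.commute\<close>)
      then show ?thesis using \<open>C > 0\<close> by (simp add: a divide_le_eq mult.commute)
    qed
  qed blast
  define ind where "ind A y = (\<lambda>t. if t \<in> A then y else \<zero>)" for A :: "'a set" and y
  have ind: "Rep (ind A y) 1 (\<lambda>_. A) (\<lambda>_. y)" if "A \<in> fmeasurable M" "y \<in> carrier Y" for A y
    using that by (auto simp: Rep_def fpartition_def ind_def disjoint_family_on_def)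
  have indc: "ind A y \<in> carrier simple_space" if "A \<in> fmeasurable M" "y \<in> carrier Y" for A y
    using ind[OF that] by auto
  define \<nu> where "\<nu> y A = \<phi> (ind A y)" for y A
  show thesis
  proof (rule that[of \<nu>])
    show "\<nu> y (A \<union> B) = \<nu> y A + \<nu> y B"
      if "y \<in> carrier Y" "A \<in> fmeasurable M" "B \<in> fmeasurable M" "A \<inter> B = {}" for y A B
    proof -
      have "ind (A \<union> B) y = ind A y \<oplus>\<^bsub>simple_space\<^esub> ind B y" using that by (auto simp: ind_def fun_eq_iff)
      then show ?thesis unfolding \<nu>_def using \<phi>(2)[OF indc indc] that by metis
    qed
    show "\<nu> (x \<oplus> y) A = \<nu> x A + \<nu> y A"
      if "x \<in> carrier Y" "y \<in> carrier Y" "A \<in> fmeasurable M" for x y A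
    proof -
      have "ind A (x \<oplus> y) = ind A x \<oplus>\<^bsub>simple_space\<^esub> ind A y" using that by (auto simp: ind_def fun_eq_iff)
      then show ?thesis unfolding \<nu>_def using \<phi>(2)[OF indc indc] that by metis
    qed
    show "\<nu> (c \<odot> y) A = c * \<nu> y A" if "y \<in> carrier Y" "A \<in> fmeasurable M" for c y A
    proof -
      have "ind A (c \<odot> y) = c \<odot>\<^bsub>simple_space\<^esub> ind A y" using that by (auto simp: ind_def Y.sm_simps fun_eq_iff)
      then show ?thesis unfolding \<nu>_def using \<phi>(3)[OF indc] that by metis
    qed
    show "\<nu> x A = sint M A (U x)" if x: "x \<in> S" and A: "A \<in> fmeasurable M" for x A
    proof -
      have "(ind A x, \<Phi> (ind A x)) \<in> G0"
        using indc[OF A Sc[OF x]] x S0 unfolding G0_def by (auto simp: ind_def simp del: simple_space_simps(1))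
      then have "\<nu> x A = \<Phi> (ind A x)" unfolding \<nu>_def by (rule \<phi>(4))
      then show ?thesis using \<Phi>[OF ind[OF A Sc[OF x]]] x by simp
    qed
    show "(\<Sum>k<m. \<nu> (y k) (A k)) \<le> C * val m A y"
      if P: "fpartition M m A" and y: "\<And>k. k < m \<Longrightarrow> y k \<in> carrier Y" for m A y
    proof -
      have A: "disjoint_family_on A {..<m}" "\<And>k. k < m \<Longrightarrow> A k \<in> fmeasurable M" "1 \<le> m"
        using P by (auto simp: fpartition_def)
      \<comment> \<open>One indicator is added at a time; starting with k = 1 keeps every stage a
        partition in the sense of \<open>fpartition\<close>.\<close>
      have "\<exists>\<omega>. Rep \<omega> k A y \<and> \<phi> \<omega> = (\<Sum>j<k. \<nu> (y j) (A j))" if "1 \<le> k" "k \<le> m" for k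
        using that
      proof (induction k rule: nat_induct_at_least)
        case base
        then show ?case using A y
          by (intro exI[of _ "ind (A 0) (y 0)"])
            (auto simp: Rep_def fpartition_def \<nu>_def ind_def disjoint_family_on_def)
      next
        case (Suc k)
        then obtain \<omega> where w: "Rep \<omega> k A y" "\<phi> \<omega> = (\<Sum>j<k. \<nu> (y j) (A j))" by auto
        let ?\<eta> = "ind (A k) (y k)"
        have k: "k < m" using Suc by simp
        have "Rep (\<lambda>t. \<omega> t \<oplus> ?\<eta> t) (Suc k) A y"
          unfolding Rep_def
        proof (intro conjI allI impI ballI)
          show "fpartition M (Suc k) A" using A k by (auto simp: fpartition_def disjoint_family_on_def)
          show "y j \<in> carrier Y" if "j < Suc k" for j using y k that by auto
          show "\<omega> t \<oplus> ?\<eta> t = y j" if j: "j < Suc k" and t: "t \<in> A j" for j t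
          proof (cases "j = k")
            case True
            have "t \<notin> A i" if "i < k" for i
            proof -
              have "A i \<inter> A k = {}" using A(1) k that by (auto simp: disjoint_family_on_def)
              then show ?thesis using t True by blast
            qed
            then have "t \<notin> (\<Union>i<k. A i)" by blast
            then have "\<omega> t = \<zero>" using w(1) by (simp add: Rep_def)
            then show ?thesis using True t y[OF k] by (simp add: ind_def)
          next
            case False
            then have j': "j < k" using j by simp
            have "A j \<inter> A k = {}" using A(1) k j' by (auto simp: disjoint_family_on_def)
            then have "t \<notin> A k" using t by blast
            moreover have "\<omega> t = y j" using w(1) j' t by (simp add: Rep_def)
            ultimately show ?thesis using y[of j] j' k by (simp add: ind_def)
          qed
          show "\<omega> t \<oplus> ?\<eta> t = \<zero>" if "t \<notin> (\<Union>j<Suc k. A j)" for t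
          proof -
            have "t \<notin> (\<Union>j<k. A j)" "t \<notin> A k" using that by (auto simp: less_Suc_eq)
            then show ?thesis using w(1) by (simp add: Rep_def ind_def)
          qed
        qed
        moreover have "\<phi> (\<lambda>t. \<omega> t \<oplus> ?\<eta> t) = (\<Sum>j<Suc k. \<nu> (y j) (A j))"
        proof -
          have "\<omega> \<in> carrier simple_space" using w(1) by auto
          from \<phi>(2)[OF this indc[OF A(2)[OF k] y[OF k]]] show ?thesis using w(2) by (simp add: \<nu>_def)
        qed
        ultimately show ?case by blast
      qed
      from this[OF A(3) order_refl] obtain \<omega> where w: "Rep \<omega> m A y" "\<phi> \<omega> = (\<Sum>j<m. \<nu> (y j) (A j))" by blast
      have "\<phi> \<omega> \<le> C * snorm \<omega>" using w(1) by (intro \<phi>(1)) auto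
      also have "\<dots> \<le> C * val m A y" using C snorm_le[OF w(1)] by (intro mult_left_mono)
      finally show ?thesis using w(2) by simp
    qed
  qed
qed

section \<open>Simple approximation in \<open>L\<^sup>q\<close>\<close>

lemma Lq_fun_bound:
  assumes q: "1 \<le> q" and f: "f \<in> Lq_fun q M" and g: "g \<in> borel_measurable M"
    and le: "AE x in M. \<bar>g x\<bar> \<le> \<bar>f x\<bar>"
  shows "g \<in> Lq_fun q M"
  using q
proof (cases q rule: exponent_cases)
  case 1
  have "AE x in M. \<bar>g x\<bar> \<le> Lq_norm top_class.top M f"
    using le Linf_norm_AE[OF f[unfolded 1]] by eventually_elim simp
  then show ?thesis using g unfolding 1 Lq_fun_top by blast
next
  case (2 r)
  have "integrable M (\<lambda>x. \<bar>g x\<bar> powr r)"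
  proof (rule Bochner_Integration.integrable_bound[where f="\<lambda>x. \<bar>f x\<bar> powr r"])
    show "AE x in M. norm (\<bar>g x\<bar> powr r) \<le> norm (\<bar>f x\<bar> powr r)"
      using le by eventually_elim (use 2 in \<open>auto intro: powr_mono2\<close>)
  qed (use f g 2 in \<open>auto simp: Lq_fun_real\<close>)
  then show ?thesis using g 2 by (simp add: Lq_fun_real)
qed

lemma Lq_simple_approx:
  assumes r: "1 \<le> r" and f: "f \<in> Lq_fun (ennreal r) M" and e: "0 < e"
  obtains g where "simple_function M g" "g \<in> Lq_fun (ennreal r) M"
    "Lq_norm (ennreal r) M (\<lambda>x. f x - g x) \<le> e"
proof -
  have q: "1 \<le> ennreal r" using r by simp
  have fm [measurable]: "f \<in> borel_measurable M" using f by measurable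
  obtain F where F: "\<And>i. simple_function M (F i)" "\<And>x. x \<in> space M \<Longrightarrow> (\<lambda>i. F i x) \<longlonglongrightarrow> f x"
    "\<And>i x. x \<in> space M \<Longrightarrow> dist (F i x) 0 \<le> 2 * dist (f x) 0"
    using borel_measurable_implies_sequence_metric[OF fm, of 0] by blast
  have Fm [measurable]: "F i \<in> borel_measurable M" for i using F(1) by (rule borel_measurable_simple_function)
  have FL: "F i \<in> Lq_fun (ennreal r) M" for i
    by (rule Lq_fun_bound[OF q Lq_fun_scale(1)[OF q f, of 2] Fm]) (use F(3) in \<open>auto simp: abs_mult\<close>)
  have "(\<lambda>i. \<integral>x. \<bar>f x - F i x\<bar> powr r \<partial>M) \<longlonglongrightarrow> (\<integral>x. 0 \<partial>M)"
  \<comment> \<open>The approximants satisfy |F i| \<le> 2 |f|, hence |f - F i| \<le> 3 |f|.\<close>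
  proof (rule integral_dominated_convergence[where w="\<lambda>x. \<bar>3 * f x\<bar> powr r"])
    show "integrable M (\<lambda>x. \<bar>3 * f x\<bar> powr r)"
      using Lq_fun_scale(1)[OF q f, of 3] r by (simp add: Lq_fun_real)
    show "AE x in M. (\<lambda>i. \<bar>f x - F i x\<bar> powr r) \<longlonglongrightarrow> 0"
    proof (rule AE_I2)
      fix x assume "x \<in> space M"
      from F(2)[OF this] have "(\<lambda>i. \<bar>f x - F i x\<bar> powr r) \<longlonglongrightarrow> \<bar>f x - f x\<bar> powr r"
        using r by (intro tendsto_powr' tendsto_intros) auto
      then show "(\<lambda>i. \<bar>f x - F i x\<bar> powr r) \<longlonglongrightarrow> 0" using r by simp
    qed
    show "AE x in M. norm (\<bar>f x - F i x\<bar> powr r) \<le> \<bar>3 * f x\<bar> powr r" for i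
    proof (rule AE_I2)
      fix x assume "x \<in> space M"
      from F(3)[OF this, of i] have "\<bar>f x - F i x\<bar> \<le> \<bar>3 * f x\<bar>" by simp
      then show "norm (\<bar>f x - F i x\<bar> powr r) \<le> \<bar>3 * f x\<bar> powr r" using r by (simp add: powr_mono2)
    qed
  qed auto
  then have "eventually (\<lambda>i. (\<integral>x. \<bar>f x - F i x\<bar> powr r \<partial>M) < e powr r) sequentially"
    using e by (intro order_tendstoD(2)[where y="\<integral>x. 0 \<partial>M"]) auto
  then obtain i where "(\<integral>x. \<bar>f x - F i x\<bar> powr r \<partial>M) < e powr r"
    by (auto simp: eventually_sequentially)
  then have "Lq_norm (ennreal r) M (\<lambda>x. f x - F i x) \<le> e" using e r by (intro Lq_norm_real_le) auto
  then show thesis using that F(1) FL by blast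
qed

text \<open>The sets are the joint level sets of the n functions. The level set of the zero vector
  is dropped, as its measure may be infinite; on any other one some function is a nonzero constant,
  and integrability of its r-th power makes the measure finite.\<close>

lemma simple_functions_common_partition:
  fixes n :: nat
  assumes r: "1 \<le> r" and g: "\<And>j. j < n \<Longrightarrow> simple_function M (g j)" "\<And>j. j < n \<Longrightarrow> g j \<in> Lq_fun (ennreal r) M"
  obtains m A c where "fpartition M m A"
    "\<And>j x. j < n \<Longrightarrow> x \<in> space M \<Longrightarrow> g j x = (\<Sum>k<m. c j k * indicator (A k) x)"
proof -
  define G where "G x = (\<lambda>j\<in>{..<n}. g j x)" for x
  define Z where "Z = (\<lambda>j\<in>{..<n}. 0 :: real)"
  have "G ` space M \<subseteq> (\<Pi>\<^sub>E j\<in>{..<n}. g j ` space M)"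
    by (auto simp: G_def PiE_iff restrict_def extensional_def split: if_splits)
  moreover have "finite (\<Pi>\<^sub>E j\<in>{..<n}. g j ` space M)"
    using g(1) by (intro finite_PiE) (auto simp: simple_function_def)
  ultimately have fin: "finite (G ` space M - {Z})" by (meson finite_Diff finite_subset)
  define m0 where "m0 = card (G ` space M - {Z})"
  obtain v where v: "bij_betw v {..<m0} (G ` space M - {Z})"
    using ex_bij_betw_nat_finite[OF fin] unfolding m0_def by (auto simp: atLeast0LessThan)
  \<comment> \<open>One empty set is added, so that the partition has a member even when all
    functions vanish.\<close>
  define m where "m = Suc m0"
  define A where "A k = (if k < m0 then {x \<in> space M. G x = v k} else {})" for k
  have inj: "v k \<noteq> v l" if "k < m0" "l < m0" "k \<noteq> l" for k l
    using v that by (auto simp: bij_betw_def inj_on_def)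
  have A: "A k \<in> fmeasurable M" for k
  proof (cases "k < m0")
    case True
    then have vk: "v k \<in> G ` space M" "v k \<noteq> Z" using v by (auto simp: bij_betw_def)
    then obtain x0 where x0: "v k = G x0" by auto
    have "\<exists>j<n. v k j \<noteq> 0"
    proof (rule ccontr)
      assume "\<not> (\<exists>j<n. v k j \<noteq> 0)"
      then have "v k = Z" unfolding x0 by (auto simp: Z_def G_def fun_eq_iff)
      then show False using vk by simp
    qed
    then obtain j where j: "j < n" "v k j \<noteq> 0" by auto
    have gm [measurable]: "g j \<in> borel_measurable M" if "j < n" for j
      using g(1)[OF that] by (rule borel_measurable_simple_function)
    have eqA: "A k = (\<Inter>j\<in>{..<n}. {x \<in> space M. g j x = v k j}) \<inter> space M"
      using True unfolding x0 A_def by (auto simp: G_def fun_eq_iff)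
    have Am: "A k \<in> sets M"
    proof (cases "n = 0")
      case True then show ?thesis using j by simp
    next
      case False
      have "(\<Inter>j\<in>{..<n}. {x \<in> space M. g j x = v k j}) \<in> sets M"
        using gm False by (intro sets.finite_INT) (auto simp: lessThan_empty_iff)
      then show ?thesis unfolding eqA by auto
    qed
    have "integrable M (\<lambda>x. \<bar>v k j\<bar> powr r * indicator (A k) x)"
    proof (rule Bochner_Integration.integrable_bound[where f="\<lambda>x. \<bar>g j x\<bar> powr r"])
      show "AE x in M. norm (\<bar>v k j\<bar> powr r * indicator (A k) x) \<le> norm (\<bar>g j x\<bar> powr r)"
        using j True by (intro AE_I2) (auto simp: A_def G_def indicator_def restrict_def split: if_splits dest!: fun_cong[of _ _ j])
    qed (use g(2)[OF j(1)] Am r in \<open>auto simp: Lq_fun_real\<close>)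
    then have "integrable M (indicator (A k) :: _ \<Rightarrow> real)"
      using j(2) by (simp add: integrable_mult_right_iff)
    then have "emeasure M (A k \<inter> space M) < \<infinity>" unfolding integrable_indicator_iff by blast
    then show ?thesis using Am sets.Int_space_eq2[OF Am] by (simp add: fmeasurable_def)
  qed (simp add: A_def)
  show thesis
  proof (rule that[of m A "\<lambda>j k. v k j"])
    show "fpartition M m A"
      using A inj by (auto simp: fpartition_def m_def disjoint_family_on_def A_def)
    then have dis: "disjoint_family_on A {..<m}" by (simp add: fpartition_def)
    fix j x assume j: "j < n" and x: "x \<in> space M"
    show "g j x = (\<Sum>k<m. v k j * indicator (A k) x)"
    proof (cases "G x = Z")
      case True
      then have "x \<notin> A k" for k using v by (auto simp: A_def bij_betw_def)
      then have "(\<Sum>k<m. v k j * indicator (A k) x) = 0" by (intro sum.neutral) auto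
      moreover have "g j x = G x j" using j by (simp add: G_def)
      ultimately show ?thesis using True j by (simp add: Z_def)
    next
      case False
      then have "G x \<in> v ` {..<m0}" using v x by (auto simp: bij_betw_def)
      then obtain k where k: "k < m0" "G x = v k" by auto
      then have "x \<in> A k" "k < m" using x by (auto simp: A_def m_def)
      then have "(\<Sum>k<m. v k j * indicator (A k) x) = v k j"
        by (intro sum_indicator_disjoint[OF dis]) auto
      moreover have "g j x = G x j" using j by (simp add: G_def)
      ultimately show ?thesis using k by simp
    qed
  qed
qed

section \<open>The density of a finitely additive set function\<close>

text \<open>Absolute continuity of the integral: over a set of small measure, the part of |g| below
  a level n contributes at most n times the measure, and the part above that level has a small
  integral over all of A.\<close>

lemma sint_small:
  assumes g: "integrable M (\<lambda>x. indicator A x * g x)" and A: "A \<in> sets M" and e: "0 < e"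
  obtains d where "0 < d"
    "\<And>N. N \<in> fmeasurable M \<Longrightarrow> N \<subseteq> A \<Longrightarrow> measure M N < d \<Longrightarrow> \<bar>sint M N g\<bar> < e"
proof -
  define h where "h x = \<bar>indicator A x * g x\<bar>" for x
  have hi: "integrable M h" unfolding h_def using g by simp
  have [measurable]: "h \<in> borel_measurable M" using hi by auto
  have "(\<lambda>n. \<integral>x. max (h x - real n) 0 \<partial>M) \<longlonglongrightarrow> (\<integral>x. 0 \<partial>M)"
  proof (rule integral_dominated_convergence[where w=h])
    show "AE x in M. (\<lambda>n. max (h x - real n) 0) \<longlonglongrightarrow> 0"
    proof (rule AE_I2, rule tendsto_eventually)
      fix x
      obtain N where "h x < real N" using reals_Archimedean2 by blast
      then show "eventually (\<lambda>n. max (h x - real n) 0 = 0) sequentially"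
        by (auto simp: eventually_sequentially max_def intro!: exI[of _ N])
    qed
    show "AE x in M. norm (max (h x - real n) 0) \<le> h x" for n by (auto simp: h_def)
  qed (use hi in auto)
  then have "eventually (\<lambda>n. (\<integral>x. max (h x - real n) 0 \<partial>M) < e / 2) sequentially"
    using e by (intro order_tendstoD(2)[where y="\<integral>x. 0 \<partial>M"]) auto
  then obtain n where n: "(\<integral>x. max (h x - real n) 0 \<partial>M) < e / 2"
    by (auto simp: eventually_sequentially)
  have mi: "integrable M (\<lambda>x. max (h x - real n) 0)"
  proof (rule Bochner_Integration.integrable_bound[OF hi])
    show "(\<lambda>x. max (h x - real n) 0) \<in> borel_measurable M" by measurable
    show "AE x in M. norm (max (h x - real n) 0) \<le> norm (h x)" by (auto simp: h_def)
  qed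
  show thesis
  proof (rule that[of "e / (2 * (real n + 1))"])
    show "0 < e / (2 * (real n + 1))" using e by simp
    fix N assume N: "N \<in> fmeasurable M" "N \<subseteq> A" "measure M N < e / (2 * (real n + 1))"
    have Ni: "integrable M (\<lambda>x. real n * indicator N x)" using N(1) by (auto simp: fmeasurable_def)
    have Nm [measurable]: "N \<in> sets M" using N(1) by auto
    have eq: "(\<lambda>x. indicator N x * g x) = (\<lambda>x. indicator N x * (indicator A x * g x))"
      using N(2) by (auto simp: indicator_def fun_eq_iff)
    have "\<bar>sint M N g\<bar> \<le> (\<integral>x. \<bar>indicator N x * (indicator A x * g x)\<bar> \<partial>M)" unfolding eq by simp
    also have "\<dots> \<le> (\<integral>x. max (h x - real n) 0 + real n * indicator N x \<partial>M)"
    proof (rule integral_mono)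
      show "integrable M (\<lambda>x. \<bar>indicator N x * (indicator A x * g x)\<bar>)"
        using integrable_mult_indicator[OF Nm g] by simp
      show "\<bar>indicator N x * (indicator A x * g x)\<bar> \<le> max (h x - real n) 0 + real n * indicator N x" for x
        by (auto simp: h_def indicator_def)
    qed (use mi Ni in auto)
    also have "\<dots> = (\<integral>x. max (h x - real n) 0 \<partial>M) + real n * measure M N"
      using mi Ni by simp
    also have "\<dots> < e / 2 + e / 2"
    proof -
      have "real n * measure M N \<le> (real n + 1) * measure M N" by (simp add: mult_right_mono)
      also have "\<dots> \<le> e / 2" using N(3) by (simp add: field_simps)
      finally show ?thesis using n by simp
    qed
    finally show "\<bar>sint M N g\<bar> < e" by simp
  qed
qed

text \<open>\<open>f\<close> is the density of the absolutely continuous part of \<open>\<nu>\<close>, expressed without splitting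
  \<open>\<nu>\<close>: off sets of arbitrarily small measure, \<open>\<nu>\<close> and \<open>f\<close> nearly agree. In this form
  linearity in \<open>(\<nu>, f)\<close> is immediate.\<close>

definition has_density :: "'a measure \<Rightarrow> ('a set \<Rightarrow> real) \<Rightarrow> ('a \<Rightarrow> real) \<Rightarrow> bool" where
  "has_density M \<nu> f \<longleftrightarrow> (\<forall>A\<in>fmeasurable M. \<forall>e>0. \<exists>B\<in>sets M. B \<subseteq> A \<and> measure M (A - B) < e \<and>
     (\<forall>D\<in>sets M. D \<subseteq> B \<longrightarrow> \<bar>\<nu> D - sint M D f\<bar> < e))"

lemma has_densityD:
  assumes "has_density M \<nu> f" "A \<in> fmeasurable M" "0 < e"
  obtains B where "B \<in> fmeasurable M" "B \<subseteq> A" "measure M (A - B) < e"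
    "\<And>D. D \<in> sets M \<Longrightarrow> D \<subseteq> B \<Longrightarrow> \<bar>\<nu> D - sint M D f\<bar> < e"
proof -
  obtain B where B: "B \<in> sets M" "B \<subseteq> A" "measure M (A - B) < e"
    "\<And>D. D \<in> sets M \<Longrightarrow> D \<subseteq> B \<Longrightarrow> \<bar>\<nu> D - sint M D f\<bar> < e"
    using bspec[OF assms(1)[unfolded has_density_def] assms(2)] assms(3) by auto
  have "B \<in> fmeasurable M" using B(1,2) assms(2) by (rule_tac fmeasurableI2[of A]) auto
  then show thesis by (rule that[OF _ B(2,3)]) (rule B(4))
qed

lemma has_density_self: "has_density M (\<lambda>A. sint M A f) f"
  unfolding has_density_def
proof (intro ballI allI impI)
  fix A and e :: real assume "A \<in> fmeasurable M" "0 < e"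
  then show "\<exists>B\<in>sets M. B \<subseteq> A \<and> measure M (A - B) < e \<and>
      (\<forall>D\<in>sets M. D \<subseteq> B \<longrightarrow> \<bar>sint M D f - sint M D f\<bar> < e)"
    by (intro bexI[of _ A]) auto
qed

lemma has_density_cong:
  assumes "\<And>A. A \<in> fmeasurable M \<Longrightarrow> \<nu> A = \<nu>' A" "has_density M \<nu> f"
  shows "has_density M \<nu>' f"
  unfolding has_density_def
proof (intro ballI allI impI)
  fix A and e :: real assume A: "A \<in> fmeasurable M" and e: "0 < e"
  obtain B where B: "B \<in> fmeasurable M" "B \<subseteq> A" "measure M (A - B) < e"
    "\<And>D. D \<in> sets M \<Longrightarrow> D \<subseteq> B \<Longrightarrow> \<bar>\<nu> D - sint M D f\<bar> < e"
    by (rule has_densityD[OF assms(2) A e]) blast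
  moreover have "\<nu> D = \<nu>' D" if "D \<in> sets M" "D \<subseteq> B" for D
    using that B(1) by (auto intro!: assms(1) intro: fmeasurableI2[of B])
  ultimately show "\<exists>B\<in>sets M. B \<subseteq> A \<and> measure M (A - B) < e \<and>
     (\<forall>D\<in>sets M. D \<subseteq> B \<longrightarrow> \<bar>\<nu>' D - sint M D f\<bar> < e)" by (intro bexI[of _ B]) auto
qed

lemma has_density_lincomb:
  assumes 1: "has_density M \<nu> f" "\<And>A. A \<in> fmeasurable M \<Longrightarrow> integrable M (\<lambda>x. indicator A x * f x)"
    and 2: "has_density M \<mu> g" "\<And>A. A \<in> fmeasurable M \<Longrightarrow> integrable M (\<lambda>x. indicator A x * g x)"
  shows "has_density M (\<lambda>A. a * \<nu> A + b * \<mu> A) (\<lambda>x. a * f x + b * g x)"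
  unfolding has_density_def
proof (intro ballI allI impI)
  fix A and e :: real assume A: "A \<in> fmeasurable M" and e: "0 < e"
  \<comment> \<open>The choice gives 2 d \<le> e for the two exceptional sets and (|a| + |b|) d < e
    for the values.\<close>
  define d where "d = e / (2 * (\<bar>a\<bar> + \<bar>b\<bar> + 1))"
  have d: "0 < d" "2 * d \<le> e" "\<bar>a\<bar> * d + \<bar>b\<bar> * d < e"
  proof -
    show "0 < d" using e by (auto simp: d_def intro!: divide_pos_pos)
    define c where "c = 2 * (\<bar>a\<bar> + \<bar>b\<bar> + 1)"
    have "c > 0" by (simp add: c_def add_nonneg_pos)
    have "d = e / c" by (simp only: d_def c_def)
    with \<open>c > 0\<close> have "d * c = e" by simp
    then have "2 * (\<bar>a\<bar> * d) + 2 * (\<bar>b\<bar> * d) + 2 * d = e" by (simp add: c_def algebra_simps)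
    moreover have "0 \<le> \<bar>a\<bar> * d" "0 \<le> \<bar>b\<bar> * d" using \<open>0 < d\<close> by simp_all
    ultimately show "2 * d \<le> e" "\<bar>a\<bar> * d + \<bar>b\<bar> * d < e" using \<open>0 < d\<close> by linarith+
  qed
  obtain B1 where B1: "B1 \<in> fmeasurable M" "B1 \<subseteq> A" "measure M (A - B1) < d"
    "\<And>D. D \<in> sets M \<Longrightarrow> D \<subseteq> B1 \<Longrightarrow> \<bar>\<nu> D - sint M D f\<bar> < d"
    by (rule has_densityD[OF 1(1) A d(1)]) blast
  obtain B2 where B2: "B2 \<in> fmeasurable M" "B2 \<subseteq> A" "measure M (A - B2) < d"
    "\<And>D. D \<in> sets M \<Longrightarrow> D \<subseteq> B2 \<Longrightarrow> \<bar>\<mu> D - sint M D g\<bar> < d"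
    by (rule has_densityD[OF 2(1) A d(1)]) blast
  show "\<exists>B\<in>sets M. B \<subseteq> A \<and> measure M (A - B) < e \<and>
     (\<forall>D\<in>sets M. D \<subseteq> B \<longrightarrow> \<bar>a * \<nu> D + b * \<mu> D - sint M D (\<lambda>x. a * f x + b * g x)\<bar> < e)"
  proof (intro bexI[of _ "B1 \<inter> B2"] conjI ballI impI)
    have "measure M (A - B1 \<inter> B2) \<le> measure M ((A - B1) \<union> (A - B2))"
      using A B1(1) B2(1) by (intro measure_mono_fmeasurable) (auto intro: fmeasurable_Diff)
    also have "\<dots> \<le> measure M (A - B1) + measure M (A - B2)"
      using A B1(1) B2(1) by (intro measure_Un_le) auto
    finally show "measure M (A - B1 \<inter> B2) < e" using B1(3) B2(3) d(2) by simp
    fix D assume D: "D \<in> sets M" "D \<subseteq> B1 \<inter> B2"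
    then have Df: "D \<in> fmeasurable M" using B1(1) by (rule_tac fmeasurableI2[of B1]) auto
    have "sint M D (\<lambda>x. a * f x + b * g x) = (\<integral>x. a * (indicator D x * f x) + b * (indicator D x * g x) \<partial>M)"
      by (simp add: algebra_simps)
    also have "\<dots> = a * sint M D f + b * sint M D g" using 1(2)[OF Df] 2(2)[OF Df] by simp
    finally have "a * \<nu> D + b * \<mu> D - sint M D (\<lambda>x. a * f x + b * g x) =
        a * (\<nu> D - sint M D f) + b * (\<mu> D - sint M D g)" by (simp add: algebra_simps)
    also have "\<bar>\<dots>\<bar> \<le> \<bar>a\<bar> * d + \<bar>b\<bar> * d"
      using B1(4)[of D] B2(4)[of D] D
      by (intro order_trans[OF abs_triangle_ineq] add_mono) (auto simp: abs_mult intro!: mult_left_mono intro: less_imp_le)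
    finally show "\<bar>a * \<nu> D + b * \<mu> D - sint M D (\<lambda>x. a * f x + b * g x)\<bar> < e" using d(3) by simp
  qed (use B1 B2 in auto)
qed

text \<open>Off a set of small measure all integrals of h over measurable subsets are small, in
  particular those over the parts where h is nonnegative and where it is negative; the rest is
  controlled by absolute continuity. So h vanishes on sets of finite measure, and the sets where |h|
  \<ge> 1/(n+1) are of this kind because |h|^r is integrable.\<close>

lemma has_density_zero:
  assumes r: "1 \<le> r" and h: "h \<in> Lq_fun (ennreal r) M" and d: "has_density M (\<lambda>_. 0) h"
    and i: "\<And>A. A \<in> fmeasurable M \<Longrightarrow> integrable M (\<lambda>x. indicator A x * h x)"
  shows "AE x in M. h x = 0"
proof -
  have [measurable]: "h \<in> borel_measurable M" using h by measurable
  have AEA: "AE x in M. x \<in> A \<longrightarrow> h x = 0" if A: "A \<in> fmeasurable M" for A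
  proof -
    have Am [measurable]: "A \<in> sets M" using A by auto
    have ia: "integrable M (\<lambda>x. indicator A x * \<bar>h x\<bar>)"
      using integrable_abs[OF i[OF A]] by (simp add: abs_mult)
    have "sint M A (\<lambda>x. \<bar>h x\<bar>) \<le> e" if e: "0 < e" for e
    proof -
      obtain d where dd: "0 < d" "\<And>N. N \<in> fmeasurable M \<Longrightarrow> N \<subseteq> A \<Longrightarrow> measure M N < d \<Longrightarrow> \<bar>sint M N (\<lambda>x. \<bar>h x\<bar>)\<bar> < e / 3"
        using sint_small[OF ia Am, of "e / 3"] e by auto
      obtain B where B: "B \<in> fmeasurable M" "B \<subseteq> A" "measure M (A - B) < min d (e / 3)"
        "\<And>D. D \<in> sets M \<Longrightarrow> D \<subseteq> B \<Longrightarrow> \<bar>0 - sint M D h\<bar> < min d (e / 3)"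
        using has_densityD[OF d A, of "min d (e / 3)"] dd(1) e by auto
      have [measurable]: "B \<in> sets M" using B by auto
      define P where "P = B \<inter> {x \<in> space M. 0 \<le> h x}"
      define Q where "Q = B \<inter> {x \<in> space M. h x < 0}"
      have PQ: "P \<in> sets M" "Q \<in> sets M" "P \<subseteq> B" "Q \<subseteq> B" by (auto simp: P_def Q_def)
      then have PQf: "P \<in> fmeasurable M" "Q \<in> fmeasurable M" using B(1) by (auto intro: fmeasurableI2[of B])
      have ABf: "A - B \<in> fmeasurable M" using A B(1) by (auto intro: fmeasurable_Diff)
      have iAB: "integrable M (\<lambda>x. indicator (A - B) x * \<bar>h x\<bar>)"
        using integrable_abs[OF i[OF ABf]] by (simp add: abs_mult)
      have "sint M A (\<lambda>x. \<bar>h x\<bar>) = (\<integral>x. indicator (A - B) x * \<bar>h x\<bar> + (indicator P x * h x - indicator Q x * h x) \<partial>M)"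
        using B(2) by (intro Bochner_Integration.integral_cong refl) (auto simp: P_def Q_def indicator_def)
      also have "\<dots> = sint M (A - B) (\<lambda>x. \<bar>h x\<bar>) + (sint M P h - sint M Q h)"
        using iAB i[OF PQf(1)] i[OF PQf(2)] by simp
      also have "\<dots> \<le> e / 3 + (e / 3 + e / 3)"
        using dd(2)[OF ABf] B(3) B(4)[OF PQ(1,3)] B(4)[OF PQ(2,4)] by auto
      finally show ?thesis by simp
    qed
    then have "sint M A (\<lambda>x. \<bar>h x\<bar>) \<le> 0" by (rule field_le_epsilon[where y=0, simplified])
    moreover have "0 \<le> sint M A (\<lambda>x. \<bar>h x\<bar>)" by (intro integral_nonneg_AE AE_I2) simp
    ultimately have "sint M A (\<lambda>x. \<bar>h x\<bar>) = 0" by simp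
    then have "AE x in M. indicator A x * \<bar>h x\<bar> = 0"
      using ia by (subst (asm) integral_nonneg_eq_0_iff_AE) auto
    then show ?thesis by eventually_elim (auto simp: indicator_def)
  qed
  have f: "{x \<in> space M. 1 / real (Suc n) \<le> \<bar>h x\<bar>} \<in> fmeasurable M" for n
  proof -
    let ?A = "{x \<in> space M. 1 / real (Suc n) \<le> \<bar>h x\<bar>}"
    have "integrable M (\<lambda>x. (1 / real (Suc n)) powr r * indicator ?A x)"
    proof (rule Bochner_Integration.integrable_bound[where f="\<lambda>x. \<bar>h x\<bar> powr r"])
      show "AE x in M. norm ((1 / real (Suc n)) powr r * indicator ?A x) \<le> norm (\<bar>h x\<bar> powr r)"
        using r by (intro AE_I2) (auto simp: indicator_def intro!: powr_mono2)
    qed (use h r in \<open>auto simp: Lq_fun_real\<close>)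
    then have "integrable M (indicator ?A :: _ \<Rightarrow> real)" by (simp add: integrable_mult_right_iff)
    moreover have "?A \<inter> space M = ?A" by blast
    ultimately show ?thesis unfolding integrable_indicator_iff fmeasurable_def by simp
  qed
  have "AE x in M. \<forall>n. x \<in> {x \<in> space M. 1 / real (Suc n) \<le> \<bar>h x\<bar>} \<longrightarrow> h x = 0"
    unfolding AE_all_countable using AEA[OF f] by blast
  with AE_space show ?thesis
  proof eventually_elim
    case (elim x)
    show ?case
    proof (rule ccontr)
      assume "h x \<noteq> 0"
      then obtain n where "inverse (real (Suc n)) < \<bar>h x\<bar>" using reals_Archimedean[of "\<bar>h x\<bar>"] by auto
      then have "1 / real (Suc n) \<le> \<bar>h x\<bar>" by (simp only: inverse_eq_divide less_imp_le)
      then have "x \<in> {x \<in> space M. 1 / real (Suc n) \<le> \<bar>h x\<bar>}" using elim(1) by blast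
      then show False using spec[OF elim(2), of n] \<open>h x \<noteq> 0\<close> by blast
    qed
  qed
qed

section \<open>Existence of densities for bounded charges\<close>

lemma fmeasurable_subset: "A \<in> fmeasurable M \<Longrightarrow> B \<subseteq> A \<Longrightarrow> B \<in> sets M \<Longrightarrow> B \<in> fmeasurable M"
  by (rule fmeasurableI2)

text \<open>Sets with \<open>t B \<le> c * measure M B\<close> are enlarged greedily, each step
  gaining almost the largest possible measure; by \<open>dense\<close> the union cannot miss a part
  of positive measure. Since t is only finitely additive, the estimate does not pass to the union,
  so a late stage is returned at the price of a remainder of measure below e.\<close>

lemma measure_exhaustion:
  fixes t :: "'a set \<Rightarrow> real"
  assumes A: "A \<in> fmeasurable M"
    and add: "\<And>B D. B \<in> sets M \<Longrightarrow> D \<in> sets M \<Longrightarrow> B \<subseteq> A \<Longrightarrow> D \<subseteq> A \<Longrightarrow> B \<inter> D = {} \<Longrightarrow> t (B \<union> D) = t B + t D"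
    and nonneg: "\<And>B. B \<in> sets M \<Longrightarrow> B \<subseteq> A \<Longrightarrow> 0 \<le> t B"
    and dense: "\<And>D. D \<in> sets M \<Longrightarrow> D \<subseteq> A \<Longrightarrow> 0 < measure M D \<Longrightarrow>
      \<exists>D'\<in>sets M. D' \<subseteq> D \<and> t D' < c * measure M D'"
    and c: "0 < c" and e: "0 < e"
  obtains B where "B \<in> sets M" "B \<subseteq> A" "measure M (A - B) < e" "t B \<le> c * measure M B"
proof -
  have Am: "A \<in> sets M" using A by auto
  have fm: "B \<in> fmeasurable M" if "B \<in> sets M" "B \<subseteq> A" for B by (rule fmeasurable_subset[OF A that(2,1)])
  define \<D> where "\<D> = {B \<in> sets M. B \<subseteq> A \<and> t B \<le> c * measure M B}"
  have t0: "t {} = 0" using add[of "{}" "{}"] by simp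
  \<comment> \<open>The largest measure that an admissible enlargement of B can reach.\<close>
  define m where "m B = Sup {measure M B' | B'. B' \<in> \<D> \<and> B \<subseteq> B'}" for B
  have bdd: "bdd_above {measure M B' | B'. B' \<in> \<D> \<and> B \<subseteq> B'}" for B
    using A by (intro bdd_aboveI[of _ "measure M A"]) (auto simp: \<D>_def intro!: measure_mono_fmeasurable)
  have "\<exists>B. \<forall>n. B n \<in> \<D> \<and> (B n \<subseteq> B (Suc n) \<and> m (B n) - (1 / 2) ^ n < measure M (B (Suc n)))"
  proof (rule dependent_nat_choice)
    show "\<exists>B. B \<in> \<D>" using t0 by (auto simp: \<D>_def intro: exI[of _ "{}"])
    fix B and n :: nat assume B: "B \<in> \<D>"
    then have "{measure M B' | B'. B' \<in> \<D> \<and> B \<subseteq> B'} \<noteq> {}" by auto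
    then have "\<exists>x\<in>{measure M B' | B'. B' \<in> \<D> \<and> B \<subseteq> B'}. m B - (1 / 2) ^ n < x"
      unfolding m_def by (intro less_cSupD) auto
    then show "\<exists>B'. B' \<in> \<D> \<and> (B \<subseteq> B' \<and> m B - (1 / 2) ^ n < measure M B')" by auto
  qed
  then obtain B where B: "\<And>n. B n \<in> \<D>" "\<And>n. B n \<subseteq> B (Suc n)" "\<And>n. m (B n) - (1 / 2) ^ n < measure M (B (Suc n))"
    by auto
  have Bs: "B n \<in> sets M" "B n \<subseteq> A" "t (B n) \<le> c * measure M (B n)" for n using B(1)[of n] by (auto simp: \<D>_def)
  define U where "U = (\<Union>n. B n)"
  have U: "U \<in> sets M" "U \<subseteq> A" using Bs by (auto simp: U_def)
  have limB: "(\<lambda>n. measure M (B n)) \<longlonglongrightarrow> measure M U"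
  proof -
    have "(\<lambda>n. emeasure M (B n)) \<longlonglongrightarrow> emeasure M U"
      unfolding U_def
    proof (rule Lim_emeasure_incseq)
      show "range B \<subseteq> sets M" using Bs(1) by auto
      show "incseq B" using B(2) by (rule incseq_SucI)
    qed
    moreover have "emeasure M (B n) = ennreal (measure M (B n))" for n
      using fm[OF Bs(1,2)] by (intro emeasure_eq_measure2) (auto simp: fmeasurable_def)
    moreover have "emeasure M U = ennreal (measure M U)"
      using fm[OF U] by (intro emeasure_eq_measure2) (auto simp: fmeasurable_def)
    ultimately show ?thesis by (simp add: tendsto_ennreal_iff)
  qed
  have AU: "measure M (A - U) = 0"
  proof (rule ccontr)
    assume "measure M (A - U) \<noteq> 0"
    then have "0 < measure M (A - U)" by (simp add: order_less_le)
    then obtain D where D: "D \<in> sets M" "D \<subseteq> A - U" "t D < c * measure M D"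
      using dense[of "A - U"] U Am by auto
    \<comment> \<open>\<open>t D\<close> is nonnegative, so the strict inequality forces D to have
      positive measure.\<close>
    have "0 < c * measure M D" using nonneg[of D] D by force
    then have Dp: "0 < measure M D" using c by (simp add: zero_less_mult_iff)
    \<comment> \<open>D could have been added at every stage, so near-maximality makes each step
      gain almost the measure of D, which contradicts convergence of the measures.\<close>
    have "measure M (B n) + measure M D - (1 / 2) ^ n \<le> measure M (B (Suc n))" for n
    proof -
      have dis: "B n \<inter> D = {}" using D(2) by (auto simp: U_def)
      have ms: "measure M (B n \<union> D) = measure M (B n) + measure M D"
        using fm[OF Bs(1,2)] fm[of D] D dis by (intro measure_Un_AE) (auto intro: AE_I2)
      have "t (B n \<union> D) = t (B n) + t D" using D Bs dis by (intro add) auto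
      also have "\<dots> \<le> c * measure M (B n \<union> D)" using Bs(3)[of n] D(3) unfolding ms by (simp add: distrib_left)
      finally have "B n \<union> D \<in> \<D>" using D Bs by (auto simp: \<D>_def)
      then have "measure M (B n \<union> D) \<le> m (B n)" unfolding m_def by (intro cSup_upper bdd) auto
      then show ?thesis using B(3)[of n] ms by simp
    qed
    moreover have "(\<lambda>n. measure M (B n) + measure M D - (1 / 2) ^ n) \<longlonglongrightarrow> measure M U + measure M D - 0"
      by (intro tendsto_intros limB LIMSEQ_power_zero) auto
    moreover have "(\<lambda>n. measure M (B (Suc n))) \<longlonglongrightarrow> measure M U" using limB by (rule LIMSEQ_Suc)
    ultimately have "measure M U + measure M D - 0 \<le> measure M U" by (intro LIMSEQ_le) auto
    then show False using Dp by simp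
  qed
  have "measure M A = measure M U"
  proof -
    have "measure M (A - U) = measure M A - measure M U"
      using A U by (intro measure_Diff) (auto simp: fmeasurable_def less_top)
    then show ?thesis using AU by simp
  qed
  then have "eventually (\<lambda>n. measure M A - e < measure M (B n)) sequentially"
    using order_tendstoD(1)[OF limB, of "measure M A - e"] e by simp
  then obtain n where n: "measure M A - e < measure M (B n)" by (auto simp: eventually_sequentially)
  have "measure M (A - B n) = measure M A - measure M (B n)"
    using A Bs[of n] by (intro measure_Diff) (auto simp: fmeasurable_def less_top)
  then show thesis using that[OF Bs(1,2) _ Bs(3), of n] n by simp
qed

text \<open>Write a^s as a times a^(s-1) and enlarge the second factor. For ordered nonnegative
  functions this converts closeness of the integrals of s-th powers into smallness of the
  difference, and it does so for s = 1 too, where strict convexity fails.\<close>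

lemma powr_superadditive:
  fixes x y s :: real
  assumes "0 \<le> x" "0 \<le> y" "1 \<le> s" shows "x powr s + y powr s \<le> (x + y) powr s"
proof -
  have *: "a powr s \<le> a * (x + y) powr (s - 1)" if "0 \<le> a" "a \<le> x + y" for a
  proof (cases "a = 0")
    case False
    then have "a powr s = a * a powr (s - 1)" using that by (simp add: powr_mult_base)
    also have "\<dots> \<le> a * (x + y) powr (s - 1)" using that assms by (intro mult_left_mono powr_mono2) auto
    finally show ?thesis .
  qed (use assms in auto)
  have "x powr s + y powr s \<le> x * (x + y) powr (s - 1) + y * (x + y) powr (s - 1)"
    using *[of x] *[of y] assms by (intro add_mono) auto
  also have "\<dots> = (x + y) * (x + y) powr (s - 1)" by (simp add: distrib_right)
  also have "\<dots> = (x + y) powr s"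
    using assms by (cases "x + y = 0") (auto simp: powr_mult_base)
  finally show ?thesis .
qed

text \<open>A functional of norm at most K on the step functions in \<open>L\<^sup>p\<close>, viewed
  as a finitely additive set function.\<close>

definition bounded_charge :: "ennreal \<Rightarrow> 'a measure \<Rightarrow> real \<Rightarrow> ('a set \<Rightarrow> real) \<Rightarrow> bool" where
  "bounded_charge p M K \<nu> \<longleftrightarrow>
     (\<forall>A\<in>fmeasurable M. \<forall>B\<in>fmeasurable M. A \<inter> B = {} \<longrightarrow> \<nu> (A \<union> B) = \<nu> A + \<nu> B) \<and>
     (\<forall>m A a. fpartition M m A \<longrightarrow> (\<Sum>k<m. a k * \<nu> (A k)) \<le> K * nrm (lp p m) (\<lambda>k. wt p M (A k) * a k))"

text \<open>The exponent p' is finite here. The case p' = 1, where p = \<infinity>, is included;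
  there a bounded charge need not be given by a function, which is why a density has to agree with
  it only off small sets.\<close>

locale conjugate_exponents =
  fixes p p' :: ennreal and s :: real
  assumes p: "1 \<le> p" and pp: "1 / p + 1 / p' = 1" and s: "p' = ennreal s" "1 \<le> s"
begin

lemma p': "1 \<le> p'"
  using s by simp

lemma pp': "1 / p' + 1 / p = 1"
  using pp by (simp add: add.commute)

lemma set_integrable: "h \<in> Lq_fun p' M \<Longrightarrow> A \<in> fmeasurable M \<Longrightarrow> integrable M (\<lambda>x. indicator A x * h x)"
  by (rule Lq_set_integrable[OF p pp])

lemma sint_lincomb:
  assumes "f \<in> Lq_fun p' M" "g \<in> Lq_fun p' M" "A \<in> fmeasurable M"
  shows "sint M A (\<lambda>x. a * f x + b * g x) = a * sint M A f + b * sint M A g"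
proof -
  have "sint M A (\<lambda>x. a * f x + b * g x) = (\<integral>x. a * (indicator A x * f x) + b * (indicator A x * g x) \<partial>M)"
    by (simp add: algebra_simps)
  then show ?thesis using set_integrable[OF assms(1,3)] set_integrable[OF assms(2,3)] by simp
qed

lemma sint_diff:
  assumes "f \<in> Lq_fun p' M" "g \<in> Lq_fun p' M" "A \<in> fmeasurable M"
  shows "sint M A (\<lambda>x. f x - g x) = sint M A f - sint M A g"
  using sint_lincomb[OF assms, of 1 "-1"] by simp

lemma sint_Un:
  assumes "f \<in> Lq_fun p' M" "A \<in> fmeasurable M" "B \<in> fmeasurable M" "A \<inter> B = {}"
  shows "sint M (A \<union> B) f = sint M A f + sint M B f"
proof -
  have "sint M (A \<union> B) f = (\<integral>x. indicator A x * f x + indicator B x * f x \<partial>M)"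
    using assms(4) by (intro Bochner_Integration.integral_cong refl) (auto simp: indicator_def)
  then show ?thesis using set_integrable[OF assms(1,2)] set_integrable[OF assms(1,3)] by simp
qed

lemma sint_bound:
  assumes "h \<in> Lq_fun p' M" "A \<in> fmeasurable M"
  shows "\<bar>sint M A h\<bar> \<le> wt p M A * Lq_norm p' M h"
proof -
  have "\<bar>sint M A h\<bar> \<le> nrm (lp p 1) (\<lambda>k. wt p M A * 1) * Lq_norm p' M h"
    using Holder_step[OF p pp assms(1), of 1 "\<lambda>_. A" "\<lambda>_. 1"] assms(2)
    by (auto simp: disjoint_family_on_def)
  also have "\<dots> \<le> wt p M A * Lq_norm p' M h"
    using lp_norm_sum_le[OF p order_refl, of "\<lambda>_. wt p M A"] wt_nonneg[of p M A] Lq_norm_nonneg[OF assms(1)]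
    by (intro mult_right_mono) auto
  finally show ?thesis by simp
qed

text \<open>f is approximated by a simple g. On the partition of g its norm is a norm in
  \<open>lp p' m\<close>, and a norming vector divided by the weights is a step function in the unit
  ball of \<open>L\<^sup>p\<close>. Half of e is lost when g replaces f in the norm, the other half
  when f replaces g in the pairing.\<close>

lemma step_norming:
  assumes f: "f \<in> Lq_fun p' M" and e: "0 < e"
  obtains m A d where "fpartition M m A" "nrm (lp p m) (\<lambda>k. wt p M (A k) * d k) \<le> 1"
    "Lq_norm p' M f \<le> (\<Sum>k<m. d k * sint M (A k) f) + e"
proof -
  obtain g where g: "simple_function M g" "g \<in> Lq_fun p' M" "Lq_norm p' M (\<lambda>x. f x - g x) \<le> e / 2"
    using Lq_simple_approx[OF s(2) f[unfolded s(1)], of "e / 2"] e unfolding s(1) by auto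
  obtain m A c where P: "fpartition M m A"
    and c: "\<And>j x. j < (1::nat) \<Longrightarrow> x \<in> space M \<Longrightarrow> g x = (\<Sum>k<m. c j k * indicator (A k) x)"
    by (rule simple_functions_common_partition[OF s(2), of 1 M "\<lambda>_. g"]) (use g s in auto)
  define c0 where "c0 = c 0"
  have gx: "g x = (\<Sum>k<m. c0 k * indicator (A k) x)" if "x \<in> space M" for x using c[of 0 x] that by (simp add: c0_def)
  have m: "1 \<le> m" "disjoint_family_on A {..<m}" "\<And>k. k < m \<Longrightarrow> A k \<in> fmeasurable M"
    using P by (auto simp: fpartition_def)
  have ng: "Lq_norm p' M g = nrm (lp p' m) (\<lambda>k. wt p' M (A k) * c0 k)"
  proof -
    have "Lq_norm p' M g = Lq_norm p' M (\<lambda>x. \<Sum>k<m. c0 k * indicator (A k) x)"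
      using gx Lq_fun_measurable[OF g(2)] Lq_fun_measurable[OF step_function_norm(1)[OF p' m]]
      by (intro Lq_norm_cong_AE AE_I2) blast+
    then show ?thesis using step_function_norm(2)[OF p' m] by simp
  qed
  obtain b where b: "nrm (lp p m) b \<le> 1" "(\<Sum>k<m. (wt p' M (A k) * c0 k) * b k) = Lq_norm p' M g"
    unfolding ng by (rule lp_norming[OF p' pp' m(1)])
  define d where "d k = b k / wt p M (A k)" for k
  have sg: "sint M (A k) g = c0 k * measure M (A k)" if k: "k < m" for k
  proof -
    have "sint M (A k) g = (\<integral>x. c0 k * indicator (A k) x \<partial>M)"
    proof (rule Bochner_Integration.integral_cong[OF refl])
      fix x assume x: "x \<in> space M"
      show "indicator (A k) x * g x = c0 k * indicator (A k) x"
        using gx[OF x] sum_indicator_disjoint[OF m(2) k, of x c0] by (cases "x \<in> A k") auto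
    qed
    then show ?thesis using m(3)[OF k] by simp
  qed
  have t: "(wt p' M (A k) * c0 k) * b k = d k * sint M (A k) g" if "k < m" for k
  proof (cases "wt p M (A k) = 0")
    case True
    then have "wt p' M (A k) = 0" by (simp add: wt_eq_0)
    then show ?thesis using True by (simp add: d_def)
  next
    case False
    then show ?thesis unfolding sg[OF that] wt_mult[OF p pp, symmetric] by (simp add: d_def)
  qed
  have dn: "nrm (lp p m) (\<lambda>k. wt p M (A k) * d k) \<le> 1"
    using b(1) by (intro order_trans[OF lp_norm_mono[OF p m(1)] b(1)]) (simp add: d_def)
  show thesis
  proof (rule that[OF P dn])
    have fgL: "(\<lambda>x. g x - f x) \<in> Lq_fun p' M" by (rule Lq_fun_diff(1)[OF p' g(2) f])
    have fg2: "Lq_norm p' M (\<lambda>x. g x - f x) \<le> e / 2"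
      using Lq_fun_scale(2)[OF p' Lq_fun_diff(1)[OF p' f g(2)], of "-1"] g(3) by simp
    have "Lq_norm p' M f \<le> Lq_norm p' M g + Lq_norm p' M (\<lambda>x. f x - g x)"
      using Lq_fun_add(2)[OF p' g(2) Lq_fun_diff(1)[OF p' f g(2)]] by simp
    also have "Lq_norm p' M g = (\<Sum>k<m. d k * sint M (A k) g)" unfolding b(2)[symmetric] using t by simp
    also have "\<dots> = (\<Sum>k<m. d k * sint M (A k) f + d k * sint M (A k) (\<lambda>x. g x - f x))"
    proof (rule sum.cong[OF refl])
      fix k assume "k \<in> {..<m}"
      then have k: "A k \<in> fmeasurable M" using m(3) by simp
      show "d k * sint M (A k) g = d k * sint M (A k) f + d k * sint M (A k) (\<lambda>x. g x - f x)"
        unfolding sint_diff[OF g(2) f k] unfolding right_diff_distrib by simp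
    qed
    also have "\<dots> = (\<Sum>k<m. d k * sint M (A k) f) + (\<Sum>k<m. d k * sint M (A k) (\<lambda>x. g x - f x))"
      by (rule sum.distrib)
    also have "(\<Sum>k<m. d k * sint M (A k) (\<lambda>x. g x - f x)) \<le> 1 * (e / 2)"
    proof -
      have "\<bar>\<Sum>k<m. d k * sint M (A k) (\<lambda>x. g x - f x)\<bar> \<le>
          nrm (lp p m) (\<lambda>k. wt p M (A k) * d k) * Lq_norm p' M (\<lambda>x. g x - f x)"
        by (rule Holder_step[OF p pp fgL m])
      also have "\<dots> \<le> 1 * (e / 2)"
        using dn fg2 Lq_norm_nonneg[OF fgL] by (intro mult_mono) auto
      finally show ?thesis by simp
    qed
    finally show "Lq_norm p' M f \<le> (\<Sum>k<m. d k * sint M (A k) f) + e" using g(3) by simp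
  qed
qed

end

context conjugate_exponents
begin

text \<open>The density G is a largest function whose integrals stay below \<nu>. The competitors
  are closed under pointwise maxima and have norm at most K, so the integral of the s-th power can
  be maximised along an increasing sequence. What remains of \<nu> after subtracting G dominates no
  positive multiple of the measure on a set of positive measure, since G could be enlarged there; by
  exhaustion the remainder is small off sets of small measure.\<close>

lemma positive_charge_has_density:
  assumes \<nu>: "bounded_charge p M K \<nu>" and K: "0 \<le> K"
    and nonneg: "\<And>A. A \<in> fmeasurable M \<Longrightarrow> 0 \<le> \<nu> A"
  shows "\<exists>f\<in>Lq_fun p' M. has_density M \<nu> f"
proof -
  have \<nu>_Un: "\<nu> (A \<union> B) = \<nu> A + \<nu> B" if "A \<in> fmeasurable M" "B \<in> fmeasurable M" "A \<inter> B = {}" for A B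
    using \<nu> that by (auto simp: bounded_charge_def)
  have \<nu>_bd: "(\<Sum>k<m. a k * \<nu> (A k)) \<le> K * nrm (lp p m) (\<lambda>k. wt p M (A k) * a k)"
    if "fpartition M m A" for m A a using \<nu> that by (auto simp: bounded_charge_def)
  define F where "F = {f \<in> Lq_fun p' M. (AE x in M. 0 \<le> f x) \<and> (\<forall>A\<in>fmeasurable M. sint M A f \<le> \<nu> A)}"
  have FD: "f \<in> Lq_fun p' M" "AE x in M. 0 \<le> f x" "\<And>A. A \<in> fmeasurable M \<Longrightarrow> sint M A f \<le> \<nu> A"
    if "f \<in> F" for f using that by (auto simp: F_def)
  have F0: "(\<lambda>_. 0) \<in> F" using nonneg Lq_fun_zero by (auto simp: F_def)
  have FK: "Lq_norm p' M f \<le> K" if f: "f \<in> F" for f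
  proof (rule field_le_epsilon)
    fix e :: real assume e: "0 < e"
    obtain m A d where d: "fpartition M m A" "nrm (lp p m) (\<lambda>k. wt p M (A k) * d k) \<le> 1"
      "Lq_norm p' M f \<le> (\<Sum>k<m. d k * sint M (A k) f) + e"
      by (rule step_norming[OF FD(1)[OF f] e])
    have m: "1 \<le> m" "\<And>k. k < m \<Longrightarrow> A k \<in> fmeasurable M" using d(1) by (auto simp: fpartition_def)
    \<comment> \<open>Coefficients are replaced by their positive parts: the integrals of f are
      nonnegative, and the weighted norm does not increase.\<close>
    have "(\<Sum>k<m. d k * sint M (A k) f) \<le> (\<Sum>k<m. max (d k) 0 * \<nu> (A k))"
    proof (intro sum_mono)
      fix k assume "k \<in> {..<m}"
      then have k: "A k \<in> fmeasurable M" using m by auto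
      have "0 \<le> sint M (A k) f" using FD(2)[OF f] by (intro integral_nonneg_AE) (auto elim: eventually_mono)
      then show "d k * sint M (A k) f \<le> max (d k) 0 * \<nu> (A k)"
        using FD(3)[OF f k] nonneg[OF k] by (cases "0 \<le> d k") (auto simp: mult_left_mono mult_nonpos_nonneg)
    qed
    also have "\<dots> \<le> K * nrm (lp p m) (\<lambda>k. wt p M (A k) * max (d k) 0)" by (rule \<nu>_bd[OF d(1)])
    also have "\<dots> \<le> K * 1"
      using K wt_nonneg[of p M]
      by (intro mult_left_mono order_trans[OF lp_norm_mono[OF p m(1)] d(2)]) (auto simp: abs_mult intro!: mult_left_mono)
    finally show "Lq_norm p' M f \<le> K + e" using d(3) by simp
  qed
  define J where "J f = (\<integral>x. \<bar>f x\<bar> powr s \<partial>M)" for f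
  have J_norm: "J f = Lq_norm p' M f powr s" for f unfolding J_def s(1) by (rule Lq_norm_powr[OF s(2), symmetric])
  have Jint: "integrable M (\<lambda>x. \<bar>f x\<bar> powr s)" if "f \<in> Lq_fun p' M" for f
    using that s by (simp add: Lq_fun_real)
  have JK: "J f \<le> K powr s" if "f \<in> F" for f
    unfolding J_norm using FK[OF that] Lq_norm_nonneg[OF FD(1)[OF that]] s by (intro powr_mono2) auto
  have Fmax: "(\<lambda>x. max (f x) (g x)) \<in> F" if f: "f \<in> F" and g: "g \<in> F" for f g
  proof -
    have [measurable]: "f \<in> borel_measurable M" "g \<in> borel_measurable M"
      using FD(1)[OF f] FD(1)[OF g] by measurable
    have L: "(\<lambda>x. max (f x) (g x)) \<in> Lq_fun p' M"
    proof (rule Lq_fun_bound[OF p' Lq_fun_add(1)[OF p' FD(1)[OF f] FD(1)[OF g]]])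
      show "AE x in M. \<bar>max (f x) (g x)\<bar> \<le> \<bar>f x + g x\<bar>"
        using FD(2)[OF f] FD(2)[OF g] by eventually_elim auto
    qed measurable
    have "sint M A (\<lambda>x. max (f x) (g x)) \<le> \<nu> A" if A: "A \<in> fmeasurable M" for A
    proof -
      have [measurable]: "A \<in> sets M" using A by auto
      define P where "P = A \<inter> {x \<in> space M. g x \<le> f x}"
      define Q where "Q = A \<inter> {x \<in> space M. f x < g x}"
      have PQ: "P \<in> fmeasurable M" "Q \<in> fmeasurable M"
        by (rule fmeasurable_subset[OF A]; auto simp: P_def Q_def)+
      have PQA: "P \<union> Q = A" "P \<inter> Q = {}"
        using sets.sets_into_space[OF \<open>A \<in> sets M\<close>] by (auto simp: P_def Q_def)
      have "sint M A (\<lambda>x. max (f x) (g x)) = (\<integral>x. indicator P x * f x + indicator Q x * g x \<partial>M)"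
        by (intro Bochner_Integration.integral_cong refl) (auto simp: P_def Q_def indicator_def)
      also have "\<dots> = sint M P f + sint M Q g"
        using set_integrable[OF FD(1)[OF f] PQ(1)] set_integrable[OF FD(1)[OF g] PQ(2)] by simp
      also have "\<dots> \<le> \<nu> P + \<nu> Q" using FD(3)[OF f PQ(1)] FD(3)[OF g PQ(2)] by simp
      also have "\<dots> = \<nu> A" using \<nu>_Un[OF PQ PQA(2)] PQA(1) by simp
      finally show ?thesis .
    qed
    moreover have "AE x in M. 0 \<le> max (f x) (g x)" using FD(2)[OF f] by eventually_elim auto
    ultimately show ?thesis using L by (simp add: F_def)
  qed
  have Jmono: "J f \<le> J g" if "f \<in> Lq_fun p' M" "g \<in> Lq_fun p' M" "AE x in M. \<bar>f x\<bar> \<le> \<bar>g x\<bar>" for f g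
    unfolding J_def using Jint[OF that(1)] Jint[OF that(2)] that(3) s
    by (intro integral_mono_AE) (auto elim!: eventually_mono intro!: powr_mono2)
  define \<Sigma> where "\<Sigma> = Sup (J ` F)"
  have bddJ: "bdd_above (J ` F)" using JK by (intro bdd_aboveI2)
  have J_le: "J f \<le> \<Sigma>" if "f \<in> F" for f unfolding \<Sigma>_def using that bddJ by (intro cSup_upper) auto
  \<comment> \<open>An s-th power, so that successive differences have norm at most 2^-n.\<close>
  define \<epsilon> where "\<epsilon> n = ((1 / 2 :: real) ^ n) powr s" for n :: nat
  have "\<exists>g\<in>F. \<Sigma> - \<epsilon> n < J g" for n
  proof -
    have "\<exists>y\<in>J ` F. \<Sigma> - \<epsilon> n < y" unfolding \<Sigma>_def using F0 by (intro less_cSupD) (auto simp: \<epsilon>_def)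
    then show ?thesis by auto
  qed
  then obtain g where g: "\<And>n. g n \<in> F" "\<And>n. \<Sigma> - \<epsilon> n < J (g n)" by metis
  define f where "f = rec_nat (g 0) (\<lambda>n h x. max (h x) (g (Suc n) x))"
  have f_Suc: "f (Suc n) = (\<lambda>x. max (f n x) (g (Suc n) x))" and f_0: "f 0 = g 0" for n by (auto simp: f_def)
  have fF: "f n \<in> F" for n by (induction n) (auto simp: f_0 f_Suc g(1) intro: Fmax)
  have fL: "f n \<in> Lq_fun p' M" for n by (rule FD(1)[OF fF])
  have fJ: "\<Sigma> - \<epsilon> n < J (f n)" for n
  proof -
    have "AE x in M. \<bar>g n x\<bar> \<le> \<bar>f n x\<bar>"
      using FD(2)[OF g(1)[of n]] by eventually_elim (cases n; auto simp: f_0 f_Suc)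
    then have "J (g n) \<le> J (f n)" by (rule Jmono[OF FD(1)[OF g(1)] fL])
    then show ?thesis using g(2)[of n] by simp
  qed
  have "Lq_norm p' M (\<lambda>x. f (Suc n) x - f n x) \<le> (1 / 2) ^ n" for n
    unfolding s(1)
  proof (rule Lq_norm_real_le[OF s(2)])
    \<comment> \<open>Superadditivity for the nonnegative functions f (n+1) - f n and f n: the first
      term is at most J (f (n+1)) - J (f n), which is below \<epsilon> n.\<close>
    have "J (\<lambda>x. f (Suc n) x - f n x) + J (f n) = (\<integral>x. \<bar>f (Suc n) x - f n x\<bar> powr s + \<bar>f n x\<bar> powr s \<partial>M)"
      unfolding J_def by (rule Bochner_Integration.integral_add[symmetric, OF Jint[OF Lq_fun_diff(1)[OF p' fL fL]] Jint[OF fL]])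
    also have "\<dots> \<le> J (f (Suc n))"
      unfolding J_def
    proof (rule integral_mono_AE)
      show "AE x in M. \<bar>f (Suc n) x - f n x\<bar> powr s + \<bar>f n x\<bar> powr s \<le> \<bar>f (Suc n) x\<bar> powr s"
        using FD(2)[OF fF[of n]]
      proof eventually_elim
        case (elim x)
        then show ?case using powr_superadditive[of "f (Suc n) x - f n x" "f n x" s] s by (auto simp: f_Suc)
      qed
    qed (use Jint[OF Lq_fun_diff(1)[OF p' fL fL]] Jint[OF fL] in auto)
    also have "\<dots> \<le> \<Sigma>" by (rule J_le[OF fF])
    finally show "(\<integral>x. \<bar>f (Suc n) x - f n x\<bar> powr s \<partial>M) \<le> ((1 / 2) ^ n) powr s"
      using fJ[of n] by (simp add: J_def \<epsilon>_def)
  qed simp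
  then obtain G where G: "G \<in> Lq_fun p' M" "\<And>n. Lq_norm p' M (\<lambda>x. f n x - G x) \<le> 2 * (1 / 2) ^ n"
    by (rule Lq_complete[OF p' fL]) blast
  have lim2: "(\<lambda>n. c * (1 / 2 :: real) ^ n) \<longlonglongrightarrow> 0" for c
    by (rule tendsto_mult_right_zero, rule LIMSEQ_power_zero) simp
  note fG = Lq_fun_diff(1)[OF p' fL G(1)]
  have G0: "AE x in M. 0 \<le> G x"
  proof -
    \<comment> \<open>G where it is negative, and 0 elsewhere. Since f n is nonnegative, |H| \<le>
      |f n - G|, and the norm of the latter tends to 0.\<close>
    define H where "H x = G x - max (G x) 0" for x
    have [measurable]: "G \<in> borel_measurable M" using G(1) by measurable
    have "H \<in> borel_measurable M" unfolding H_def[abs_def] by measurable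
    then have HL: "H \<in> Lq_fun p' M"
      by (rule Lq_fun_bound[OF p' G(1)]) (auto simp: H_def)
    have "Lq_norm p' M H \<le> 2 * (1 / 2) ^ n" for n
    proof (rule order_trans[OF Lq_norm_mono[OF p' HL fG[of n]] G(2)])
      show "AE x in M. \<bar>H x\<bar> \<le> \<bar>f n x - G x\<bar>"
        using FD(2)[OF fF[of n]] by eventually_elim (auto simp: H_def)
    qed
    then have "Lq_norm p' M H \<le> 0" by (intro LIMSEQ_le_const[OF lim2[of 2]]) auto
    then have "Lq_norm p' M H = 0" using Lq_norm_nonneg[OF HL] by simp
    then have "AE x in M. H x = 0" using Lq_norm_eq_0[OF p' HL] by simp
    then show ?thesis by eventually_elim (auto simp: H_def max_def split: if_splits)
  qed
  have GF: "G \<in> F"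
  proof -
    have "sint M A G \<le> \<nu> A" if A: "A \<in> fmeasurable M" for A
    proof -
      have "sint M A G \<le> \<nu> A + wt p M A * 2 * (1 / 2) ^ n" for n
      proof -
        have "sint M A G = sint M A (f n) - sint M A (\<lambda>x. f n x - G x)" using sint_diff[OF fL G(1) A] by simp
        moreover have "\<bar>sint M A (\<lambda>x. f n x - G x)\<bar> \<le> wt p M A * (2 * (1 / 2) ^ n)"
          using sint_bound[OF fG A] G(2)[of n] wt_nonneg[of p M A] by (meson mult_left_mono order_trans)
        ultimately show ?thesis using FD(3)[OF fF A, of n] by simp
      qed
      moreover have "(\<lambda>n. \<nu> A + wt p M A * 2 * (1 / 2) ^ n) \<longlonglongrightarrow> \<nu> A + 0"
        by (intro tendsto_intros lim2)
      ultimately have "sint M A G \<le> \<nu> A + 0" by (intro LIMSEQ_le_const[of _ "\<nu> A + 0"]) blast+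
      then show ?thesis by simp
    qed
    then show ?thesis using G0 G(1) by (simp add: F_def)
  qed
  have Gmax: "J h \<le> J G" if "h \<in> F" for h
  proof -
    have "(\<lambda>n. Lq_norm p' M (f n)) \<longlonglongrightarrow> Lq_norm p' M G"
    proof (rule LIM_zero_cancel, rule Lim_null_comparison[OF _ lim2[of 2]], rule always_eventually, rule allI)
      fix n
      have "Lq_norm p' M (f n) \<le> Lq_norm p' M G + Lq_norm p' M (\<lambda>x. f n x - G x)"
        using Lq_fun_add(2)[OF p' G(1) fG[of n]] by simp
      moreover have "Lq_norm p' M G \<le> Lq_norm p' M (f n) + Lq_norm p' M (\<lambda>x. f n x - G x)"
        using Lq_fun_diff(2)[OF p' fL[of n] fG[of n]] by simp
      ultimately show "norm (Lq_norm p' M (f n) - Lq_norm p' M G) \<le> 2 * (1 / 2) ^ n" using G(2)[of n] by auto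
    qed
    then have "(\<lambda>n. J (f n)) \<longlonglongrightarrow> J G"
      unfolding J_norm using s Lq_norm_nonneg[OF fL] by (intro tendsto_powr' tendsto_const) auto
    moreover have "(\<lambda>n. \<Sigma> - \<epsilon> n) \<longlonglongrightarrow> \<Sigma> - 0"
    proof (intro tendsto_diff tendsto_const)
      have "(\<lambda>n. ((1 / 2 :: real) ^ n) powr s) \<longlonglongrightarrow> 0 powr s"
        using s lim2[of 1] by (intro tendsto_powr' tendsto_const) auto
      then show "\<epsilon> \<longlonglongrightarrow> 0" unfolding \<epsilon>_def using s by simp
    qed
    ultimately have "\<Sigma> - 0 \<le> J G" using fJ by (intro LIMSEQ_le[of "\<lambda>n. \<Sigma> - \<epsilon> n"]) (auto intro: less_imp_le)
    then show ?thesis using J_le[OF that] by simp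
  qed
  define t where "t D = \<nu> D - sint M D G" for D
  have t_nonneg: "0 \<le> t D" if "D \<in> fmeasurable M" for D using FD(3)[OF GF that] by (simp add: t_def)
  have t_Un: "t (A \<union> B) = t A + t B" if "A \<in> fmeasurable M" "B \<in> fmeasurable M" "A \<inter> B = {}" for A B
    using \<nu>_Un[OF that] sint_Un[OF G(1) that] by (simp add: t_def)
  \<comment> \<open>Otherwise G increased by c on D would be a competitor with a larger integral of
    the s-th power.\<close>
  have no_density: "measure M D = 0"
    if D: "D \<in> fmeasurable M" and c: "0 < c" and le: "\<And>D'. D' \<in> sets M \<Longrightarrow> D' \<subseteq> D \<Longrightarrow> c * measure M D' \<le> t D'" for D c
  proof -
    have [measurable]: "D \<in> sets M" using D by auto
    have iL: "(\<lambda>x. \<Sum>k<Suc 0. c * indicator D x) \<in> Lq_fun p' M"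
      using step_function_norm(1)[OF p', of "Suc 0" "\<lambda>_. D" M "\<lambda>_. c"] D by (auto simp: disjoint_family_on_def)
    then have iL: "(\<lambda>x. c * indicator D x) \<in> Lq_fun p' M" by simp
    define H where "H x = G x + c * indicator D x" for x
    have HL: "H \<in> Lq_fun p' M" unfolding H_def by (rule Lq_fun_add(1)[OF p' G(1) iL])
    have "H \<in> F"
    proof -
      have "sint M E H \<le> \<nu> E" if E: "E \<in> fmeasurable M" for E
      proof -
        have [measurable]: "E \<in> sets M" using E by auto
        have ED: "E \<inter> D \<in> fmeasurable M" "E - D \<in> fmeasurable M"
          by (rule fmeasurable_subset[OF E]; auto)+
        have "sint M E H = sint M E G + sint M E (\<lambda>x. c * indicator D x)"
          unfolding H_def using sint_lincomb[OF G(1) iL E, of 1 1] by simp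
        also have "sint M E (\<lambda>x. c * indicator D x) = (\<integral>x. c * indicator (E \<inter> D) x \<partial>M)"
          by (intro Bochner_Integration.integral_cong refl) (auto simp: indicator_def)
        also have "\<dots> = c * measure M (E \<inter> D)" using ED(1) by simp
        also have "\<dots> \<le> t (E \<inter> D)" by (rule le) auto
        also have "\<dots> \<le> t (E \<inter> D) + t (E - D)" using t_nonneg[OF ED(2)] by simp
        also have "\<dots> = t (E \<inter> D \<union> (E - D))" by (rule t_Un[OF ED, symmetric]) blast
        also have "E \<inter> D \<union> (E - D) = E" by blast
        finally show ?thesis by (simp add: t_def)
      qed
      moreover have "AE x in M. 0 \<le> H x" using G0 by eventually_elim (use c in \<open>auto simp: H_def\<close>)
      ultimately show ?thesis using HL by (simp add: F_def)
    qed
    then have "J H \<le> J G" by (rule Gmax)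
    moreover have "J G + c powr s * measure M D \<le> J H"
    proof -
      have ci: "integrable M (\<lambda>x. c powr s * indicator D x)" using D by (auto simp: fmeasurable_def)
      have "J G + c powr s * measure M D = (\<integral>x. \<bar>G x\<bar> powr s + c powr s * indicator D x \<partial>M)"
        unfolding J_def using Jint[OF G(1)] ci by simp
      also have "\<dots> \<le> J H"
        unfolding J_def
      proof (rule integral_mono_AE)
        show "AE x in M. \<bar>G x\<bar> powr s + c powr s * indicator D x \<le> \<bar>H x\<bar> powr s"
          using G0
        proof eventually_elim
          case (elim x)
          then show ?case using powr_superadditive[of "G x" c s] c s by (auto simp: H_def indicator_def)
        qed
      qed (use Jint[OF G(1)] Jint[OF HL] ci in auto)
      finally show ?thesis .
    qed
    ultimately have "c powr s * measure M D \<le> 0" by linarith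
    then show ?thesis using c by (simp add: mult_le_0_iff measure_le_0_iff)
  qed
  have "has_density M \<nu> G"
    unfolding has_density_def
  proof (intro ballI allI impI)
    fix A and e :: real assume A: "A \<in> fmeasurable M" and e: "0 < e"
    \<comment> \<open>The summand 1 makes c times the measure of A smaller than e even when A is
      null.\<close>
    define c where "c = e / (measure M A + 1)"
    have c: "0 < c" "c * measure M A < e"     proof -
      define b where "b = measure M A + 1"
      have b: "0 < b" by (simp add: b_def add_nonneg_pos)
      then have "c * b = e" "0 < c" using e by (simp_all add: c_def b_def[symmetric])
      then show "0 < c" "c * measure M A < e" by (simp_all add: b_def distrib_left)
    qed
    have fm: "B \<in> fmeasurable M" if "B \<in> sets M" "B \<subseteq> A" for B by (rule fmeasurable_subset[OF A that(2,1)])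
    obtain B where B: "B \<in> sets M" "B \<subseteq> A" "measure M (A - B) < e" "t B \<le> c * measure M B"
    proof (rule measure_exhaustion[OF A _ _ _ c(1) e, of t])
      show "t (B \<union> D) = t B + t D" if "B \<in> sets M" "D \<in> sets M" "B \<subseteq> A" "D \<subseteq> A" "B \<inter> D = {}" for B D
        by (rule t_Un[OF fm[OF that(1,3)] fm[OF that(2,4)] that(5)])
      show "0 \<le> t B" if "B \<in> sets M" "B \<subseteq> A" for B using fm[OF that] by (rule t_nonneg)
      show "\<exists>D'\<in>sets M. D' \<subseteq> D \<and> t D' < c * measure M D'" if D: "D \<in> sets M" "D \<subseteq> A" "0 < measure M D" for D
      proof (rule ccontr)
        assume "\<not> (\<exists>D'\<in>sets M. D' \<subseteq> D \<and> t D' < c * measure M D')"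
        then have "c * measure M D' \<le> t D'" if "D' \<in> sets M" "D' \<subseteq> D" for D' using that by (meson not_less)
        then have "measure M D = 0" by (rule no_density[OF fm[OF D(1,2)] c(1)])
        then show False using D(3) by simp
      qed
    qed
    show "\<exists>B\<in>sets M. B \<subseteq> A \<and> measure M (A - B) < e \<and> (\<forall>D\<in>sets M. D \<subseteq> B \<longrightarrow> \<bar>\<nu> D - sint M D G\<bar> < e)"
    proof (intro bexI[of _ B] conjI ballI impI)
      fix D assume D: "D \<in> sets M" "D \<subseteq> B"
      have "D \<subseteq> A" "B - D \<in> sets M" "B - D \<subseteq> A" using D B by auto
      then have fD: "D \<in> fmeasurable M" "B - D \<in> fmeasurable M" "B \<in> fmeasurable M" using D(1) B(1,2) fm by blast+
      \<comment> \<open>A nonnegative additive set function is monotone, so the estimate for B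
        bounds all its measurable subsets at once.\<close>
      have "t D \<le> t D + t (B - D)" using t_nonneg[OF fD(2)] by simp
      also have "\<dots> = t B" using t_Un[OF fD(1,2)] D by (simp add: Un_absorb1)
      also have "\<dots> \<le> c * measure M A"
        using B(4) c(1) measure_mono_fmeasurable[OF B(2,1) A] by (meson mult_left_mono less_imp_le order_trans)
      finally show "\<bar>\<nu> D - sint M D G\<bar> < e" using t_nonneg[OF fD(1)] c(2) by (simp add: t_def)
    qed (use B in auto)
  qed
  then show ?thesis using G(1) by blast
qed

text \<open>Jordan decomposition reduces to the positive case. The bound K survives: in a sum over a
  partition, negative coefficients are dropped and each set is replaced by a subset that almost
  attains the supremum, and neither change increases the weighted norm.\<close>

lemma charge_has_density:
  assumes \<nu>: "bounded_charge p M K \<nu>" and K: "0 \<le> K"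
  shows "\<exists>f\<in>Lq_fun p' M. has_density M \<nu> f"
proof -
  \<comment> \<open>The positive variation; on sets of finite measure the supremum is finite because
    of the bound K.\<close>
  define pos where "pos \<nu> A = Sup {\<nu> B | B. B \<in> sets M \<and> B \<subseteq> A}" for \<nu> :: "'a set \<Rightarrow> real" and A
  have pos: "bounded_charge p M K (pos \<nu>) \<and> (\<forall>A\<in>fmeasurable M. \<nu> A \<le> pos \<nu> A \<and> 0 \<le> pos \<nu> A) \<and>
      (\<forall>A\<in>fmeasurable M. \<forall>c. (\<forall>B\<in>sets M. B \<subseteq> A \<longrightarrow> \<nu> B \<le> c) \<longrightarrow> pos \<nu> A \<le> c) \<and>
      (\<forall>A\<in>fmeasurable M. \<forall>B\<in>sets M. B \<subseteq> A \<longrightarrow> \<nu> B \<le> pos \<nu> A)"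
    if \<nu>: "bounded_charge p M K \<nu>" for \<nu> :: "'a set \<Rightarrow> real"
  proof -
    have \<nu>_Un: "\<nu> (A \<union> B) = \<nu> A + \<nu> B" if "A \<in> fmeasurable M" "B \<in> fmeasurable M" "A \<inter> B = {}" for A B
      using \<nu> that by (auto simp: bounded_charge_def)
    have \<nu>_bd: "(\<Sum>k<m. a k * \<nu> (A k)) \<le> K * nrm (lp p m) (\<lambda>k. wt p M (A k) * a k)"
      if "fpartition M m A" for m A a using \<nu> that by (auto simp: bounded_charge_def)
    have \<nu>0: "\<nu> {} = 0" using \<nu>_Un[of "{}" "{}"] by simp
    have wt_mono: "wt p M B \<le> wt p M A" if "A \<in> fmeasurable M" "B \<subseteq> A" "B \<in> sets M" for A B
      unfolding wt_def using measure_mono_fmeasurable[OF that(2,3,1)] by (intro powr_mono2) auto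
    have bd1: "\<nu> B \<le> K * wt p M A" if A: "A \<in> fmeasurable M" "B \<subseteq> A" "B \<in> sets M" for A B
    proof -
      have "fpartition M 1 (\<lambda>_. B)"
        using fmeasurable_subset[OF A] by (auto simp: fpartition_def disjoint_family_on_def)
      from \<nu>_bd[OF this, of "\<lambda>_. 1"] have "\<nu> B \<le> K * nrm (lp p 1) (\<lambda>k. wt p M B * 1)" by simp
      also have "\<dots> \<le> K * wt p M B"
        using K lp_norm_sum_le[OF p order_refl, of "\<lambda>_. wt p M B"] wt_nonneg[of p M B] by (intro mult_left_mono) auto
      also have "\<dots> \<le> K * wt p M A" using K wt_mono[OF A] by (intro mult_left_mono)
      finally show ?thesis .
    qed
    have bdd: "bdd_above {\<nu> B | B. B \<in> sets M \<and> B \<subseteq> A}" if "A \<in> fmeasurable M" for A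
      using bd1[OF that] by (intro bdd_aboveI[of _ "K * wt p M A"]) auto
    have upper: "\<nu> B \<le> pos \<nu> A" if "A \<in> fmeasurable M" "B \<in> sets M" "B \<subseteq> A" for A B
      unfolding pos_def using that bdd by (intro cSup_upper) auto
    have least: "pos \<nu> A \<le> c" if "\<And>B. B \<in> sets M \<Longrightarrow> B \<subseteq> A \<Longrightarrow> \<nu> B \<le> c" for A c
      unfolding pos_def by (intro cSup_least) (use that in \<open>auto intro: exI[of _ "{}"]\<close>)
    have approx: "\<exists>B\<in>sets M. B \<subseteq> A \<and> pos \<nu> A < \<nu> B + e" if "0 < e" for A e
    proof (rule ccontr)
      assume "\<not> ?thesis"
      then have "pos \<nu> A \<le> pos \<nu> A - e" by (intro least) (force simp: not_less)
      then show False using that by simp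
    qed
    have Un: "pos \<nu> (A \<union> B) = pos \<nu> A + pos \<nu> B"
      if A: "A \<in> fmeasurable M" and B: "B \<in> fmeasurable M" and dis: "A \<inter> B = {}" for A B
    proof (rule antisym)
      have [measurable]: "A \<in> sets M" "B \<in> sets M" using A B by auto
      show "pos \<nu> (A \<union> B) \<le> pos \<nu> A + pos \<nu> B"
      proof (rule least)
        fix D assume D [measurable]: "D \<in> sets M" and DAB: "D \<subseteq> A \<union> B"
        have m: "D \<inter> A \<in> sets M" "D \<inter> B \<in> sets M" by auto
        have f: "D \<inter> A \<in> fmeasurable M" "D \<inter> B \<in> fmeasurable M"
          using fmeasurable_subset[OF A _ m(1)] fmeasurable_subset[OF B _ m(2)] by auto
        have "\<nu> D = \<nu> (D \<inter> A) + \<nu> (D \<inter> B)"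
          using \<nu>_Un[OF f] dis DAB by (simp add: Int_Un_distrib[symmetric] Int_absorb2 disjoint_iff) 
        then show "\<nu> D \<le> pos \<nu> A + pos \<nu> B" using upper[OF A m(1)] upper[OF B m(2)] by simp
      qed
      show "pos \<nu> A + pos \<nu> B \<le> pos \<nu> (A \<union> B)"
      proof (rule field_le_epsilon)
        fix e :: real assume e: "0 < e"
        obtain C where C: "C \<in> sets M" "C \<subseteq> A" "pos \<nu> A < \<nu> C + e / 2" using approx[of "e / 2" A] e by auto
        obtain D where D: "D \<in> sets M" "D \<subseteq> B" "pos \<nu> B < \<nu> D + e / 2" using approx[of "e / 2" B] e by auto
        have "\<nu> (C \<union> D) = \<nu> C + \<nu> D"
          using fmeasurable_subset[OF A C(2,1)] fmeasurable_subset[OF B D(2,1)] C D dis by (intro \<nu>_Un) auto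
        moreover have "\<nu> (C \<union> D) \<le> pos \<nu> (A \<union> B)"
          using A B C D by (intro upper fmeasurable.Un) auto
        ultimately show "pos \<nu> A + pos \<nu> B \<le> pos \<nu> (A \<union> B) + e" using C D by simp
      qed
    qed
    have nn: "0 \<le> pos \<nu> A" if "A \<in> fmeasurable M" for A using upper[OF that, of "{}"] \<nu>0 by simp
    have bd: "(\<Sum>k<m. a k * pos \<nu> (A k)) \<le> K * nrm (lp p m) (\<lambda>k. wt p M (A k) * a k)"
      if P: "fpartition M m A" for m A a
    proof (rule field_le_epsilon)
      fix e :: real assume e: "0 < e"
      have m: "1 \<le> m" "disjoint_family_on A {..<m}" "\<And>k. k < m \<Longrightarrow> A k \<in> fmeasurable M"
        using P by (auto simp: fpartition_def)
      define a' where "a' k = max (a k) 0" for k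
      \<comment> \<open>The errors of all suprema, weighted with the coefficients, add up to at most
        e.\<close>
      define d where "d = e / ((\<Sum>k<m. a' k) + 1)"
      have a'0: "0 \<le> (\<Sum>k<m. a' k)" by (intro sum_nonneg) (simp add: a'_def)
      then have d: "0 < d" "(\<Sum>k<m. a' k) * d \<le> e" using e by (auto simp: d_def field_simps)
      have "\<forall>k. \<exists>B. B \<in> sets M \<and> B \<subseteq> A k \<and> pos \<nu> (A k) < \<nu> B + d" using approx[OF d(1)] by blast
      then obtain B where "\<forall>k. B k \<in> sets M \<and> B k \<subseteq> A k \<and> pos \<nu> (A k) < \<nu> (B k) + d"
        by (rule choice[THEN exE])
      then have B: "\<And>k. B k \<in> sets M" "\<And>k. B k \<subseteq> A k" "\<And>k. pos \<nu> (A k) < \<nu> (B k) + d" by auto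
      have PB: "fpartition M m B"
        unfolding fpartition_def
      proof (intro conjI allI impI)
        show "disjoint_family_on B {..<m}" using m(2) B(2) unfolding disjoint_family_on_def by blast
        show "B k \<in> fmeasurable M" if "k < m" for k by (rule fmeasurable_subset[OF m(3)[OF that] B(2,1)])
      qed (rule m(1))
      have "(\<Sum>k<m. a k * pos \<nu> (A k)) \<le> (\<Sum>k<m. a' k * (\<nu> (B k) + d))"
      proof (intro sum_mono)
        fix k assume "k \<in> {..<m}"
        then have "a k * pos \<nu> (A k) \<le> a' k * pos \<nu> (A k)"
          using nn[OF m(3)] by (intro mult_right_mono) (auto simp: a'_def)
        also have "\<dots> \<le> a' k * (\<nu> (B k) + d)" using B(3)[of k] by (intro mult_left_mono) (auto simp: a'_def)
        finally show "a k * pos \<nu> (A k) \<le> a' k * (\<nu> (B k) + d)" .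
      qed
      also have "\<dots> = (\<Sum>k<m. a' k * \<nu> (B k)) + (\<Sum>k<m. a' k) * d"
        by (simp add: distrib_left sum.distrib sum_distrib_right)
      also have "\<dots> \<le> K * nrm (lp p m) (\<lambda>k. wt p M (B k) * a' k) + e"
        using \<nu>_bd[OF PB, of a'] d(2) by simp
      also have "K * nrm (lp p m) (\<lambda>k. wt p M (B k) * a' k) \<le> K * nrm (lp p m) (\<lambda>k. wt p M (A k) * a k)"
      proof (intro mult_left_mono[OF _ K] lp_norm_mono[OF p m(1)])
        fix k assume k: "k < m"
        have "\<bar>wt p M (B k) * a' k\<bar> = wt p M (B k) * \<bar>a' k\<bar>" by (simp add: abs_mult wt_nonneg)
        also have "\<dots> \<le> wt p M (A k) * \<bar>a k\<bar>"
          using wt_mono[OF m(3)[OF k] B(2,1)] by (intro mult_mono) (auto simp: a'_def wt_nonneg)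
        finally show "\<bar>wt p M (B k) * a' k\<bar> \<le> \<bar>wt p M (A k) * a k\<bar>" by (simp add: abs_mult wt_nonneg)
      qed
      finally show "(\<Sum>k<m. a k * pos \<nu> (A k)) \<le> K * nrm (lp p m) (\<lambda>k. wt p M (A k) * a k) + e" by simp
    qed
    show ?thesis
      unfolding bounded_charge_def
    proof (intro conjI ballI allI impI)
      show "pos \<nu> (A \<union> B) = pos \<nu> A + pos \<nu> B"
        if "A \<in> fmeasurable M" "B \<in> fmeasurable M" "A \<inter> B = {}" for A B by (rule Un[OF that])
      show "(\<Sum>k<m. a k * pos \<nu> (A k)) \<le> K * nrm (lp p m) (\<lambda>k. wt p M (A k) * a k)"
        if "fpartition M m A" for m A a by (rule bd[OF that])
      show "\<nu> A \<le> pos \<nu> A" if "A \<in> fmeasurable M" for A using upper[OF that _ subset_refl] that by auto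
      show "0 \<le> pos \<nu> A" if "A \<in> fmeasurable M" for A by (rule nn[OF that])
      show "pos \<nu> A \<le> c" if "\<forall>B\<in>sets M. B \<subseteq> A \<longrightarrow> \<nu> B \<le> c" for A c using that by (intro least) blast
      show "\<nu> B \<le> pos \<nu> A" if "A \<in> fmeasurable M" "B \<in> sets M" "B \<subseteq> A" for A B by (rule upper[OF that])
    qed
  qed
  have \<nu>': "bounded_charge p M K (\<lambda>A. - \<nu> A)"
    unfolding bounded_charge_def
  proof (intro conjI ballI allI impI)
    fix m A a assume P: "fpartition M m A"
    then have "(\<Sum>k<m. (- a k) * \<nu> (A k)) \<le> K * nrm (lp p m) (\<lambda>k. wt p M (A k) * (- a k))"
      using conjunct2[OF \<nu>[unfolded bounded_charge_def], rule_format, OF P, of "\<lambda>k. - a k"] by simp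
    also have "nrm (lp p m) (\<lambda>k. wt p M (A k) * (- a k)) = nrm (lp p m) (\<lambda>k. wt p M (A k) * a k)"
      using lp_norm_scale[OF p, of m "-1" "\<lambda>k. wt p M (A k) * a k"] P by (simp add: fpartition_def)
    finally show "(\<Sum>k<m. a k * - \<nu> (A k)) \<le> K * nrm (lp p m) (\<lambda>k. wt p M (A k) * a k)" by simp
  qed (use \<nu> in \<open>auto simp: bounded_charge_def\<close>)
  \<comment> \<open>For B inside A, \<nu> B = \<nu> A - \<nu> (A - B), so the two suprema over
    subsets of A differ by \<nu> A.\<close>
  have jordan: "\<nu> A = pos \<nu> A - pos (\<lambda>A. - \<nu> A) A" if A: "A \<in> fmeasurable M" for A
  proof -
    have \<nu>_Un: "\<nu> A = \<nu> B + \<nu> (A - B)" if "B \<in> sets M" "B \<subseteq> A" for B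
    proof -
      have "\<nu> (B \<union> (A - B)) = \<nu> B + \<nu> (A - B)"
      proof (rule conjunct1[OF \<nu>[unfolded bounded_charge_def], rule_format])
        show "B \<in> fmeasurable M" by (rule fmeasurable_subset[OF A that(2,1)])
        show "A - B \<in> fmeasurable M" using that(1) A by (intro fmeasurable_Diff)
      qed auto
      moreover have "B \<union> (A - B) = A" using that by auto
      ultimately show ?thesis by simp
    qed
    have "pos \<nu> A \<le> \<nu> A + pos (\<lambda>A. - \<nu> A) A"
    proof (intro pos[OF \<nu>, THEN conjunct2, THEN conjunct2, THEN conjunct1, rule_format, OF A])
      fix B assume B: "B \<in> sets M" "B \<subseteq> A"
      have "- \<nu> (A - B) \<le> pos (\<lambda>A. - \<nu> A) A"
        using pos[OF \<nu>'] A B by auto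
      then show "\<nu> B \<le> \<nu> A + pos (\<lambda>A. - \<nu> A) A" using \<nu>_Un[OF B] by simp
    qed
    moreover have "pos (\<lambda>A. - \<nu> A) A \<le> pos \<nu> A - \<nu> A"
    proof (intro pos[OF \<nu>', THEN conjunct2, THEN conjunct2, THEN conjunct1, rule_format, OF A])
      fix B assume B: "B \<in> sets M" "B \<subseteq> A"
      have "\<nu> (A - B) \<le> pos \<nu> A" using pos[OF \<nu>] A B by auto
      then show "- \<nu> B \<le> pos \<nu> A - \<nu> A" using \<nu>_Un[OF B] by simp
    qed
    ultimately show ?thesis by simp
  qed
  obtain f where f: "f \<in> Lq_fun p' M" "has_density M (pos \<nu>) f"
    using positive_charge_has_density[of M K "pos \<nu>", OF conjunct1[OF pos[OF \<nu>]] K] pos[OF \<nu>] by auto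
  obtain g where g: "g \<in> Lq_fun p' M" "has_density M (pos (\<lambda>A. - \<nu> A)) g"
    using positive_charge_has_density[of M K "pos (\<lambda>A. - \<nu> A)", OF conjunct1[OF pos[OF \<nu>']] K] pos[OF \<nu>'] by auto
  have "has_density M (\<lambda>A. 1 * pos \<nu> A + (-1) * pos (\<lambda>A. - \<nu> A) A) (\<lambda>x. 1 * f x + (-1) * g x)"
    by (rule has_density_lincomb[OF f(2) set_integrable[OF f(1)] g(2) set_integrable[OF g(1)]])
  then have "has_density M (\<lambda>A. 1 * pos \<nu> A + (-1) * pos (\<lambda>A. - \<nu> A) A) (\<lambda>x. f x - g x)" by simp
  then have "has_density M \<nu> (\<lambda>x. f x - g x)"
    by (rule has_density_cong[rotated]) (use jordan in simp)
  then show ?thesis using Lq_fun_diff(1)[OF p' f(1) g(1)] by blast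
qed

end

text \<open>On the line through x the functional with value t q x at t x is dominated by q; for t <
  0 this is 0 = q 0 \<le> q (t x) + q (- t x). Since it is given as a relation, it does not have to
  be shown well defined.\<close>

lemma sublinear_support:
  assumes E: "module real_ring E" and q: "sublinear E q" and x: "x \<in> carrier E"
  obtains \<phi> :: "'e \<Rightarrow> real" where "\<And>y. y \<in> carrier E \<Longrightarrow> \<phi> y \<le> q y"
    "\<And>y z. y \<in> carrier E \<Longrightarrow> z \<in> carrier E \<Longrightarrow> \<phi> (y \<oplus>\<^bsub>E\<^esub> z) = \<phi> y + \<phi> z"
    "\<And>c y. y \<in> carrier E \<Longrightarrow> \<phi> (c \<odot>\<^bsub>E\<^esub> y) = c * \<phi> y" "\<phi> x = q x"
proof -
  interpret real_module E using E by (simp add: real_module_iff)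
  have q_sm: "q (c \<odot>\<^bsub>E\<^esub> y) = c * q y" if "y \<in> carrier E" "c > 0" for c y
    using q that by (auto simp: sublinear_def)
  have q0: "q \<zero>\<^bsub>E\<^esub> = 0" using q_sm[OF zero_closed, of 2] by (simp add: sm_simps)
  let ?G = "{(t \<odot>\<^bsub>E\<^esub> x, t * q x) | t. True}"
  obtain \<phi> where \<phi>: "\<And>y. y \<in> carrier E \<Longrightarrow> \<phi> y \<le> q y"
    "\<And>y z. y \<in> carrier E \<Longrightarrow> z \<in> carrier E \<Longrightarrow> \<phi> (y \<oplus>\<^bsub>E\<^esub> z) = \<phi> y + \<phi> z"
    "\<And>c y. y \<in> carrier E \<Longrightarrow> \<phi> (c \<odot>\<^bsub>E\<^esub> y) = c * \<phi> y" "\<And>y a. (y, a) \<in> ?G \<Longrightarrow> \<phi> y = a"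
  proof (rule hahn_banach_real[OF E q, of ?G])
    show "?G \<noteq> {}" by auto
    show "?G \<subseteq> carrier E \<times> UNIV" using x by auto
    show "(y \<oplus>\<^bsub>E\<^esub> z, a + b) \<in> ?G" if yz: "(y, a) \<in> ?G" "(z, b) \<in> ?G" for y a z b
    proof -
      obtain t r where "y = t \<odot>\<^bsub>E\<^esub> x" "a = t * q x" "z = r \<odot>\<^bsub>E\<^esub> x" "b = r * q x" using yz by auto
      then have "(y \<oplus>\<^bsub>E\<^esub> z, a + b) = ((t + r) \<odot>\<^bsub>E\<^esub> x, (t + r) * q x)" using x by (simp add: sm_simps distrib_right)
      then show ?thesis by blast
    qed
    show "(c \<odot>\<^bsub>E\<^esub> y, c * a) \<in> ?G" if yz: "(y, a) \<in> ?G" for c y a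
    proof -
      obtain t where "y = t \<odot>\<^bsub>E\<^esub> x" "a = t * q x" using yz by auto
      then have "(c \<odot>\<^bsub>E\<^esub> y, c * a) = ((c * t) \<odot>\<^bsub>E\<^esub> x, (c * t) * q x)" using x by (simp add: sm_simps)
      then show ?thesis by blast
    qed
    show "a \<le> q y" if yz: "(y, a) \<in> ?G" for y a
    proof -
      obtain t where t: "y = t \<odot>\<^bsub>E\<^esub> x" "a = t * q x" using yz by auto
      consider "t = 0" | "t > 0" | "t < 0" by linarith
      then show ?thesis
      proof cases
        case 3
        have "q (t \<odot>\<^bsub>E\<^esub> x \<oplus>\<^bsub>E\<^esub> (- t) \<odot>\<^bsub>E\<^esub> x) \<le> q (t \<odot>\<^bsub>E\<^esub> x) + q ((- t) \<odot>\<^bsub>E\<^esub> x)"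
          using q x unfolding sublinear_def by blast
        moreover have "t \<odot>\<^bsub>E\<^esub> x \<oplus>\<^bsub>E\<^esub> (- t) \<odot>\<^bsub>E\<^esub> x = (t + (- t)) \<odot>\<^bsub>E\<^esub> x" using x by (simp only: sm_simps)
        ultimately show ?thesis using q_sm[OF x, of "- t"] 3 x q0 by (simp add: t sm_simps)
      qed (use x q0 q_sm in \<open>simp_all add: t sm_simps\<close>)
    qed
  qed blast
  have "(1 \<odot>\<^bsub>E\<^esub> x, 1 * q x) \<in> ?G" by blast
  then have "\<phi> x = q x" using \<phi>(4) x by (simp add: sm_simps)
  show thesis by (rule that[OF \<phi>(1) \<phi>(2) \<phi>(3) \<open>\<phi> x = q x\<close>])
qed

lemma (in normed_space) sublinear_nrm: "sublinear E (nrm E)"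
  unfolding sublinear_def using nrm_triangle nrm_smult by auto

lemma sum_slices_tensor:
  fixes \<psi> :: "(nat \<Rightarrow> 'e) \<Rightarrow> real" and n :: nat
  assumes E: "module real_ring E"
    and add: "\<And>v w. v \<in> {..<n} \<rightarrow>\<^sub>E carrier E \<Longrightarrow> w \<in> {..<n} \<rightarrow>\<^sub>E carrier E \<Longrightarrow>
      \<psi> (\<lambda>j\<in>{..<n}. v j \<oplus>\<^bsub>E\<^esub> w j) = \<psi> v + \<psi> w"
    and w: "w \<in> {..<n} \<rightarrow>\<^sub>E carrier E"
  shows "\<psi> w = (\<Sum>j<n. \<psi> (\<lambda>i\<in>{..<n}. if i = j then w j else \<zero>\<^bsub>E\<^esub>))"
proof -
  interpret real_module E using E by (simp add: real_module_iff)
  define B where "B k = (\<lambda>j\<in>{..<n}. if j < k then w j else \<zero>\<^bsub>E\<^esub>)" for k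
  have wc: "w j \<in> carrier E" if "j < n" for j using w that by auto
  have B: "B k \<in> {..<n} \<rightarrow>\<^sub>E carrier E" for k using wc by (auto simp: B_def)
  have main: "\<psi> (B k) = (\<Sum>j<k. \<psi> (\<lambda>i\<in>{..<n}. if i = j then w j else \<zero>\<^bsub>E\<^esub>))" if "k \<le> n" for k
    using that
  proof (induction k)
    case 0
    have "(\<lambda>j\<in>{..<n}. B 0 j \<oplus>\<^bsub>E\<^esub> B 0 j) = B 0" by (auto simp: B_def)
    then have "\<psi> (B 0) = 0" using add[OF B[of 0] B[of 0]] by simp
    then show ?case by simp
  next
    case (Suc k)
    let ?e = "\<lambda>i\<in>{..<n}. if i = k then w k else \<zero>\<^bsub>E\<^esub>"
    have k: "k < n" using Suc by simp
    have e: "?e \<in> {..<n} \<rightarrow>\<^sub>E carrier E" using wc[OF k] by auto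
    have "B (Suc k) = (\<lambda>j\<in>{..<n}. B k j \<oplus>\<^bsub>E\<^esub> ?e j)"
      using wc wc[OF k] by (auto simp: B_def fun_eq_iff less_Suc_eq)
    then have "\<psi> (B (Suc k)) = \<psi> (B k) + \<psi> ?e"
      by (rule trans[OF arg_cong[where f=\<psi>] add[OF B[of k] e]])
    moreover have "\<psi> (B k) = (\<Sum>j<k. \<psi> (\<lambda>i\<in>{..<n}. if i = j then w j else \<zero>\<^bsub>E\<^esub>))"
      by (rule Suc.IH) (use Suc.prems in simp)
    ultimately show ?case by (simp only: sum.lessThan_Suc)
  qed
  have "B n = w" using w by (auto simp: B_def fun_eq_iff PiE_def extensional_def)
  with main[OF order_refl] show ?thesis by (simp only:)
qed

section \<open>Duality between the projective norm and step functions\<close>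

context conjugate_exponents
begin

text \<open>The difference is a density of the zero charge. Uniqueness will turn the linearity of
  \<nu> in y into linearity of the extended operator.\<close>

lemma has_density_unique:
  assumes "f \<in> Lq_fun p' M" "g \<in> Lq_fun p' M" "has_density M \<nu> f" "has_density M \<nu> g"
  shows "AE x in M. f x = g x"
proof -
  have "has_density M (\<lambda>A. 1 * \<nu> A + (-1) * \<nu> A) (\<lambda>x. 1 * f x + (-1) * g x)"
    by (rule has_density_lincomb[OF assms(3) set_integrable[OF assms(1)] assms(4) set_integrable[OF assms(2)]])
  then have d: "has_density M (\<lambda>A. 0) (\<lambda>x. f x - g x)" by simp
  have L: "(\<lambda>x. f x - g x) \<in> Lq_fun p' M" by (rule Lq_fun_diff(1)[OF p' assms(1,2)])
  have "AE x in M. f x - g x = 0"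
    by (rule has_density_zero[OF s(2) _ d set_integrable[OF L]]) (use L s in auto)
  then show ?thesis by simp
qed

lemma sint_rep:
  assumes f: "f \<in> Lq_fun p' M" and [measurable]: "A \<in> sets M"
  shows "sint M A (rep (cls p' M f)) = sint M A f"
proof (rule integral_cong_AE)
  have [measurable]: "f \<in> borel_measurable M" "rep (cls p' M f) \<in> borel_measurable M"
    using f rep_cls(1)[OF f] by measurable
  show "(\<lambda>x. indicator A x * rep (cls p' M f) x) \<in> borel_measurable M"
    "(\<lambda>x. indicator A x * f x) \<in> borel_measurable M" by measurable
  show "AE x in M. indicator A x * rep (cls p' M f) x = indicator A x * f x"
    using rep_cls(2)[OF f] by eventually_elim simp
qed

lemma sint_rep_add:
  assumes "F \<in> carrier (Lq p' M)" "G \<in> carrier (Lq p' M)" and A: "A \<in> fmeasurable M"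
  shows "sint M A (rep (F \<oplus>\<^bsub>Lq p' M\<^esub> G)) = sint M A (rep F) + sint M A (rep G)"
proof -
  obtain f g where fg: "f \<in> Lq_fun p' M" "F = cls p' M f" "g \<in> Lq_fun p' M" "G = cls p' M g"
    using Lq_carrierE assms by metis
  have Am: "A \<in> sets M" using A by auto
  have e: "F \<oplus>\<^bsub>Lq p' M\<^esub> G = cls p' M (\<lambda>x. f x + g x)" unfolding fg(2,4) by (rule Lq_add[OF p' fg(1,3)])
  have "sint M A (rep (F \<oplus>\<^bsub>Lq p' M\<^esub> G)) = sint M A (\<lambda>x. f x + g x)"
    unfolding e by (rule sint_rep[OF Lq_fun_add(1)[OF p' fg(1,3)] Am])
  also have "\<dots> = sint M A f + sint M A g" using sint_lincomb[OF fg(1,3) A, of 1 1] by simp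
  finally show ?thesis unfolding fg(2,4) sint_rep[OF fg(1) Am] sint_rep[OF fg(3) Am] .
qed

lemma sint_rep_smult:
  assumes "F \<in> carrier (Lq p' M)" and A: "A \<in> sets M"
  shows "sint M A (rep (c \<odot>\<^bsub>Lq p' M\<^esub> F)) = c * sint M A (rep F)"
proof -
  obtain f where f: "f \<in> Lq_fun p' M" "F = cls p' M f" using assms by (elim Lq_carrierE)
  have e: "c \<odot>\<^bsub>Lq p' M\<^esub> F = cls p' M (\<lambda>x. c * f x)" unfolding f(2) by (rule Lq_smult[OF p' f(1)])
  have "sint M A (rep (c \<odot>\<^bsub>Lq p' M\<^esub> F)) = sint M A (\<lambda>x. c * f x)"
    unfolding e by (rule sint_rep[OF Lq_fun_scale(1)[OF p' f(1)] A])
  also have "\<dots> = c * sint M A f" by (simp add: mult.left_commute)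
  finally show ?thesis unfolding f(2) sint_rep[OF f(1) A] .
qed

lemma proj_space_Lq: "1 \<le> n \<Longrightarrow> proj_space (Lq p' M) p n"
  using normed_space_Lq[OF p'] p by (simp add: proj_space_def proj_space_axioms_def)

text \<open>On an elementary tensor this is Hoelder's inequality for a step function whose
  coefficients come from the first factor; additivity then makes the pairing a functional of norm at
  most 1 on the projective tensor product. Division by a weight 0 gives 0, so null sets contribute
  nothing.\<close>

lemma step_pairing_le_proj_norm:
  assumes P: "fpartition M m A" and w: "w \<in> {..<m} \<rightarrow>\<^sub>E carrier (Lq p' M)"
  shows "(\<Sum>k<m. sint M (A k) (rep (w k)) / wt p M (A k)) \<le> proj_norm p m (Lq p' M) w"
proof -
  have m: "1 \<le> m" "disjoint_family_on A {..<m}" "\<And>k. k < m \<Longrightarrow> A k \<in> fmeasurable M"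
    using P by (auto simp: fpartition_def)
  interpret proj_space "Lq p' M" p m by (rule proj_space_Lq[OF m(1)])
  show ?thesis
  proof (rule proj_norm_ge[OF w])
    fix K a x assume r: "proj_rep m (Lq p' M) w K a x"
    then have x: "x l \<in> carrier (Lq p' M)" if "l < K" for l using that by (auto simp: proj_rep_def)
    have "sint M (A k) (rep (w k)) = (\<Sum>l<K. a l k * sint M (A k) (rep (x l)))" if k: "k < m" for k
    proof -
      have "w k = (\<Oplus>\<^bsub>Lq p' M\<^esub>l\<in>{..<K}. a l k \<odot>\<^bsub>Lq p' M\<^esub> x l)" using r k by (simp add: proj_rep_def)
      then have "sint M (A k) (rep (w k)) = (\<Sum>l<K. sint M (A k) (rep (a l k \<odot>\<^bsub>Lq p' M\<^esub> x l)))"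
        using additive_finsum[of "\<lambda>F. sint M (A k) (rep F)" "{..<K}" "\<lambda>l. a l k \<odot>\<^bsub>Lq p' M\<^esub> x l"]
          sint_rep_add[OF _ _ m(3)[OF k]] x by simp
      also have "\<dots> = (\<Sum>l<K. a l k * sint M (A k) (rep (x l)))"
        using x m(3)[OF k] by (intro sum.cong refl sint_rep_smult) auto
      finally show ?thesis .
    qed
    then have "(\<Sum>k<m. sint M (A k) (rep (w k)) / wt p M (A k)) =
        (\<Sum>k<m. \<Sum>l<K. a l k / wt p M (A k) * sint M (A k) (rep (x l)))"
      by (simp add: sum_divide_distrib)
    also have "\<dots> = (\<Sum>l<K. \<Sum>k<m. a l k / wt p M (A k) * sint M (A k) (rep (x l)))" by (rule sum.swap)
    also have "\<dots> \<le> (\<Sum>l<K. nrm (lp p m) (a l) * nrm (Lq p' M) (x l))"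
    proof (rule sum_mono)
      fix l assume l: "l \<in> {..<K}"
      then have xL: "rep (x l) \<in> Lq_fun p' M" using rep_carrier(1)[OF x] by simp
      have "(\<Sum>k<m. a l k / wt p M (A k) * sint M (A k) (rep (x l))) \<le>
          nrm (lp p m) (\<lambda>k. wt p M (A k) * (a l k / wt p M (A k))) * Lq_norm p' M (rep (x l))"
        using Holder_step[OF p pp xL m, of "\<lambda>k. a l k / wt p M (A k)"] by linarith
      also have "\<dots> \<le> nrm (lp p m) (a l) * nrm (Lq p' M) (x l)"
        unfolding nrm_Lq using Lq_norm_nonneg[OF xL] by (intro mult_right_mono lp_norm_mono[OF p m(1)]) auto
      finally show "(\<Sum>k<m. a l k / wt p M (A k) * sint M (A k) (rep (x l))) \<le> nrm (lp p m) (a l) * nrm (Lq p' M) (x l)" .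
    qed
    finally show "(\<Sum>k<m. sint M (A k) (rep (w k)) / wt p M (A k)) \<le> proj_sum p m (Lq p' M) K a x"
      by (simp add: proj_sum_def)
  qed
qed

text \<open>A norming functional for the projective norm is an operator from \<open>\<ell>\<^sup>p\<^sub>n\<close> to the dual of
  \<open>L\<^sup>p\<^sup>'(\<mu>)\<close>; averaging over a finite partition makes it a contraction into step functions.\<close>

lemma proj_norm_norming:
  assumes n: "1 \<le> n" and f: "\<And>j. j < n \<Longrightarrow> f j \<in> Lq_fun p' M" and e: "0 < e"
  obtains m A t where "fpartition M m A"
    "\<And>a. nrm (lp p m) (\<lambda>k. \<Sum>j<n. t k j * a j) \<le> nrm (lp p n) a"
    "proj_norm p n (Lq p' M) (\<lambda>j\<in>{..<n}. cls p' M (f j)) \<le>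
      (\<Sum>j<n. \<Sum>k<m. t k j / wt p M (A k) * sint M (A k) (f j)) + e"
proof -
  interpret proj_space "Lq p' M" p n by (rule proj_space_Lq[OF n])
  interpret T: normed_space "tensor_space n (max_mn p (Lq p' M))" by (rule normed_space_proj)
  let ?L = "Lq p' M"
  define W where "W = (\<lambda>j\<in>{..<n}. cls p' M (f j))"
  have W: "W \<in> carrier (tensor_space n (max_mn p ?L))" using f by (auto simp: W_def cls_in_carrier)
  obtain \<psi> where "\<And>y. y \<in> carrier (tensor_space n (max_mn p ?L)) \<Longrightarrow> \<psi> y \<le> nrm (tensor_space n (max_mn p ?L)) y"
    "\<And>y z. y \<in> carrier (tensor_space n (max_mn p ?L)) \<Longrightarrow> z \<in> carrier (tensor_space n (max_mn p ?L)) \<Longrightarrow>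
      \<psi> (y \<oplus>\<^bsub>tensor_space n (max_mn p ?L)\<^esub> z) = \<psi> y + \<psi> z"
    "\<And>c y. y \<in> carrier (tensor_space n (max_mn p ?L)) \<Longrightarrow> \<psi> (c \<odot>\<^bsub>tensor_space n (max_mn p ?L)\<^esub> y) = c * \<psi> y"
    "\<psi> W = nrm (tensor_space n (max_mn p ?L)) W"
    by (rule sublinear_support[OF T.module_axioms T.sublinear_nrm W]) blast
  then have \<psi>: "\<And>y. y \<in> {..<n} \<rightarrow>\<^sub>E carrier ?L \<Longrightarrow> \<psi> y \<le> proj_norm p n ?L y"
    "\<And>y z. y \<in> {..<n} \<rightarrow>\<^sub>E carrier ?L \<Longrightarrow> z \<in> {..<n} \<rightarrow>\<^sub>E carrier ?L \<Longrightarrow>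
      \<psi> (\<lambda>j\<in>{..<n}. y j \<oplus>\<^bsub>?L\<^esub> z j) = \<psi> y + \<psi> z"
    "\<And>c y. y \<in> {..<n} \<rightarrow>\<^sub>E carrier ?L \<Longrightarrow> \<psi> (\<lambda>j\<in>{..<n}. c \<odot>\<^bsub>?L\<^esub> y j) = c * \<psi> y"
    "\<psi> W = proj_norm p n ?L W"
    by simp_all
  define inj where "inj j F = (\<lambda>i\<in>{..<n}. if i = j then F else \<zero>\<^bsub>?L\<^esub>)" for j and F :: "('a \<Rightarrow> real) set"
  have injc: "inj j F \<in> {..<n} \<rightarrow>\<^sub>E carrier ?L" if "F \<in> carrier ?L" for j F using that by (auto simp: inj_def)
  \<comment> \<open>The restriction of \<psi> to the j-th coordinate as a functional on functions;
    passing through classes makes it blind to null sets.\<close>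
  define \<Theta> where "\<Theta> j h = \<psi> (inj j (cls p' M h))" for j h
  have \<Theta>_add: "\<Theta> j (\<lambda>x. g x + h x) = \<Theta> j g + \<Theta> j h" if gh: "g \<in> Lq_fun p' M" "h \<in> Lq_fun p' M" for j g h
  proof -
    have c: "cls p' M g \<in> carrier ?L" "cls p' M h \<in> carrier ?L" using gh by (auto intro: cls_in_carrier)
    have "inj j (cls p' M (\<lambda>x. g x + h x)) = (\<lambda>i\<in>{..<n}. inj j (cls p' M g) i \<oplus>\<^bsub>?L\<^esub> inj j (cls p' M h) i)"
      using c unfolding Lq_add[OF p' gh, symmetric] by (auto simp: inj_def fun_eq_iff)
    then show ?thesis
      unfolding \<Theta>_def by (rule trans[OF arg_cong[where f=\<psi>] \<psi>(2)[OF injc[OF c(1)] injc[OF c(2)]]])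
  qed
  have \<Theta>_sm: "\<Theta> j (\<lambda>x. c * h x) = c * \<Theta> j h" if h: "h \<in> Lq_fun p' M" for j c h
  proof -
    have hc: "cls p' M h \<in> carrier ?L" using h by (rule cls_in_carrier)
    have "inj j (cls p' M (\<lambda>x. c * h x)) = (\<lambda>i\<in>{..<n}. c \<odot>\<^bsub>?L\<^esub> inj j (cls p' M h) i)"
      using hc unfolding Lq_smult[OF p' h, symmetric] by (auto simp: inj_def fun_eq_iff sm_simps)
    then show ?thesis
      unfolding \<Theta>_def by (rule trans[OF arg_cong[where f=\<psi>] \<psi>(3)[OF injc[OF hc]]])
  qed
  have \<Theta>_le: "\<Theta> j h \<le> Lq_norm p' M h" if h: "h \<in> Lq_fun p' M" and j: "j < n" for j h
  proof -
    have hc: "cls p' M h \<in> carrier ?L" using h by (rule cls_in_carrier)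
    have "\<Theta> j h \<le> (\<Sum>i<n. nrm ?L (inj j (cls p' M h) i))"
      unfolding \<Theta>_def by (rule order_trans[OF \<psi>(1)[OF injc[OF hc]] proj_norm_le_sum[OF injc[OF hc]]])
    also have "\<dots> = nrm ?L (cls p' M h)"
      using j by (subst sum.remove[of _ j]) (auto simp: inj_def nrm_zero intro!: sum.neutral)
    finally show ?thesis by (simp add: nrm_Lq_cls[OF h])
  qed
  have \<psi>_sum: "\<psi> (\<lambda>j\<in>{..<n}. a j \<odot>\<^bsub>?L\<^esub> cls p' M (h j)) = (\<Sum>j<n. a j * \<Theta> j (h j))"
    if h: "\<And>j. j < n \<Longrightarrow> h j \<in> Lq_fun p' M" for a h
  proof -
    have c: "(\<lambda>j\<in>{..<n}. a j \<odot>\<^bsub>?L\<^esub> cls p' M (h j)) \<in> {..<n} \<rightarrow>\<^sub>E carrier ?L"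
      using h by (auto intro: cls_in_carrier)
    have "\<psi> (\<lambda>j\<in>{..<n}. a j \<odot>\<^bsub>?L\<^esub> cls p' M (h j)) =
        (\<Sum>j<n. \<psi> (\<lambda>i\<in>{..<n}. if i = j then (\<lambda>j\<in>{..<n}. a j \<odot>\<^bsub>?L\<^esub> cls p' M (h j)) j else \<zero>\<^bsub>?L\<^esub>))"
      by (rule sum_slices_tensor[OF module_axioms \<psi>(2) c])
    also have "\<dots> = (\<Sum>j<n. a j * \<Theta> j (h j))"
    proof (rule sum.cong[OF refl])
      fix j assume "j \<in> {..<n}"
      then have j: "j < n" by simp
      have "(\<lambda>i\<in>{..<n}. if i = j then (\<lambda>j\<in>{..<n}. a j \<odot>\<^bsub>?L\<^esub> cls p' M (h j)) j else \<zero>\<^bsub>?L\<^esub>) =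
          inj j (cls p' M (\<lambda>x. a j * h j x))"
        using j unfolding Lq_smult[OF p' h[OF j], symmetric] by (auto simp: inj_def fun_eq_iff)
      then show "\<psi> (\<lambda>i\<in>{..<n}. if i = j then (\<lambda>j\<in>{..<n}. a j \<odot>\<^bsub>?L\<^esub> cls p' M (h j)) j else \<zero>\<^bsub>?L\<^esub>) = a j * \<Theta> j (h j)"
        using \<Theta>_sm[OF h[OF j], of j "a j"] by (simp add: \<Theta>_def)
    qed
    finally show ?thesis .
  qed
  \<comment> \<open>Each of the n coordinates loses \<epsilon> twice, once in the functional and
    once in the pairing; together this is e.\<close>
  define \<epsilon> where "\<epsilon> = e / (2 * real n)"
  have \<epsilon>: "0 < \<epsilon>" "real n * \<epsilon> + real n * \<epsilon> = e" using e n by (auto simp: \<epsilon>_def field_simps)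
  have "\<exists>g. simple_function M g \<and> g \<in> Lq_fun p' M \<and> Lq_norm p' M (\<lambda>x. f j x - g x) \<le> \<epsilon>" if "j < n" for j
    using Lq_simple_approx[OF s(2) f[OF that, unfolded s(1)] \<epsilon>(1)] unfolding s(1) by metis
  then obtain g where g: "\<And>j. j < n \<Longrightarrow> simple_function M (g j)" "\<And>j. j < n \<Longrightarrow> g j \<in> Lq_fun p' M"
    "\<And>j. j < n \<Longrightarrow> Lq_norm p' M (\<lambda>x. f j x - g j x) \<le> \<epsilon>" by metis
  obtain m A c where P: "fpartition M m A"
    and c: "\<And>j x. j < n \<Longrightarrow> x \<in> space M \<Longrightarrow> g j x = (\<Sum>k<m. c j k * indicator (A k) x)"
    by (rule simple_functions_common_partition[OF s(2), of n M g]) (use g s in auto)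
  have m: "1 \<le> m" "disjoint_family_on A {..<m}" "\<And>k. k < m \<Longrightarrow> A k \<in> fmeasurable M"
    using P by (auto simp: fpartition_def)
  let ?w = "\<lambda>k. wt p M (A k)" and ?w' = "\<lambda>k. wt p' M (A k)"
  have ind: "indicator (A k) \<in> Lq_fun p' M" if "k < m" for k
    using step_function_norm(1)[OF p', of 1 "\<lambda>_. A k" M "\<lambda>_. 1"] m(3)[OF that] by (auto simp: disjoint_family_on_def)
  have \<Theta>_step: "\<Theta> j (\<lambda>x. \<Sum>k<m. d k * indicator (A k) x) = (\<Sum>k<m. d k * \<Theta> j (indicator (A k)))" for j d
  proof -
    have "l \<le> m \<Longrightarrow> (\<lambda>x. \<Sum>k<l. d k * indicator (A k) x) \<in> Lq_fun p' M \<and>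
        \<Theta> j (\<lambda>x. \<Sum>k<l. d k * indicator (A k) x) = (\<Sum>k<l. d k * \<Theta> j (indicator (A k)))" for l
    proof (induction l)
      case 0
      have "\<Theta> j (\<lambda>x. 0 * (0::real)) = 0 * \<Theta> j (\<lambda>x. 0)" by (rule \<Theta>_sm[OF Lq_fun_zero])
      then show ?case using Lq_fun_zero by simp
    next
      case (Suc l)
      then have l: "l < m" by simp
      have i: "(\<lambda>x. d l * indicator (A l) x) \<in> Lq_fun p' M" by (rule Lq_fun_scale(1)[OF p' ind[OF l]])
      have "(\<lambda>x. \<Sum>k<Suc l. d k * indicator (A k) x) =
          (\<lambda>x. (\<Sum>k<l. d k * indicator (A k) x) + d l * indicator (A l) x)" by (simp only: sum.lessThan_Suc)
      then show ?case
        using Lq_fun_add(1)[OF p' _ i] \<Theta>_add[OF _ i, of _ j] \<Theta>_sm[OF ind[OF l], of j "d l"] Suc l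
        by (simp del: sum_mult_indicator)
    qed
    then show ?thesis by blast
  qed
  \<comment> \<open>The functionals are evaluated on indicators normalised in
    \<open>L\<^sup>p\<^sup>'\<close>. The weight for p' enters here and the weight for p in the
    pairing; their product is the measure.\<close>
  define t where "t k j = \<Theta> j (indicator (A k)) / ?w' k" for k j
  have \<Theta>_ind: "\<Theta> j (indicator (A k)) = ?w' k * t k j" if "k < m" for j k
  proof (cases "?w' k = 0")
    case True
    then have "A k \<in> null_sets M"
      using m(3)[OF that] by (auto simp: wt_eq_0 null_sets_def measure_def enn2real_eq_0_iff fmeasurable_def)
    then have "AE x in M. indicator (A k) x = (0::real)" by (rule AE_not_in[THEN eventually_mono]) auto
    then have "cls p' M (indicator (A k)) = cls p' M (\<lambda>x. 0 * indicator (A k) x)"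
      using ind[OF that] Lq_fun_zero[of p' M] by (simp add: cls_eq_iff)
    then have "\<Theta> j (indicator (A k)) = \<Theta> j (\<lambda>x. 0 * indicator (A k) x)" by (simp add: \<Theta>_def)
    also have "\<dots> = 0" using \<Theta>_sm[OF ind[OF that], of j 0] by simp
    finally show ?thesis using True by simp
  qed (simp add: t_def)
  \<comment> \<open>The norm is tested with a vector b of \<open>lp p' m\<close>, which corresponds
    to a step function h in the unit ball of \<open>L\<^sup>p\<^sup>'\<close>. The result is \<psi>
    at a \<otimes> h, and \<psi> is dominated by the cross norm.\<close>
  have tc: "nrm (lp p m) (\<lambda>k. \<Sum>j<n. t k j * a j) \<le> nrm (lp p n) a" for a
  proof -
    obtain b where b: "nrm (lp p' m) b \<le> 1"
      "(\<Sum>k<m. (\<Sum>j<n. t k j * a j) * b k) = nrm (lp p m) (\<lambda>k. \<Sum>j<n. t k j * a j)"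
      by (rule lp_norming[OF p pp m(1)])
    define h where "h x = (\<Sum>k<m. (b k / ?w' k) * indicator (A k) x)" for x
    have h: "h \<in> Lq_fun p' M" "Lq_norm p' M h \<le> 1"
    proof -
      show "h \<in> Lq_fun p' M" unfolding h_def by (rule step_function_norm(1)[OF p' m])
      have "Lq_norm p' M h = nrm (lp p' m) (\<lambda>k. ?w' k * (b k / ?w' k))"
        unfolding h_def by (rule step_function_norm(2)[OF p' m])
      also have "\<dots> \<le> nrm (lp p' m) b" by (rule lp_norm_mono[OF p' m(1)]) simp
      finally show "Lq_norm p' M h \<le> 1" using b(1) by simp
    qed
    have "nrm (lp p m) (\<lambda>k. \<Sum>j<n. t k j * a j) = (\<Sum>k<m. \<Sum>j<n. a j * ((b k / ?w' k) * \<Theta> j (indicator (A k))))"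
      unfolding b(2)[symmetric] sum_distrib_right by (intro sum.cong refl) (simp add: t_def)
    also have "\<dots> = (\<Sum>j<n. \<Sum>k<m. a j * ((b k / ?w' k) * \<Theta> j (indicator (A k))))" by (rule sum.swap)
    also have "\<dots> = (\<Sum>j<n. a j * \<Theta> j h)"
      unfolding h_def[abs_def] \<Theta>_step by (simp add: sum_distrib_left)
    also have "\<dots> = \<psi> (elem_tensor n ?L a (cls p' M h))"
      unfolding elem_tensor_def by (rule \<psi>_sum[OF h(1), symmetric])
    also have "\<dots> \<le> proj_norm p n ?L (elem_tensor n ?L a (cls p' M h))"
      using cls_in_carrier[OF h(1)] by (intro \<psi>(1)) (auto simp: elem_tensor_def)
    also have "\<dots> = nrm (lp p n) a * Lq_norm p' M h"
      using proj_norm_elem[OF cls_in_carrier[OF h(1)]] by (simp add: nrm_Lq_cls[OF h(1)])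
    also have "\<dots> \<le> nrm (lp p n) a * 1" using h(2) lp_norm_nonneg[OF p n] by (intro mult_left_mono)
    finally show ?thesis by simp
  qed
  \<comment> \<open>Column j is the image of the j-th unit vector under the contraction; the bound
    controls the error made in the pairing.\<close>
  have col: "nrm (lp p m) (\<lambda>k. t k j) \<le> 1" if j: "j < n" for j
  proof -
    have "(\<lambda>k. \<Sum>i<n. t k i * (if i = j then 1 else 0)) = (\<lambda>k. t k j)"
      using j by (intro ext, subst sum.remove[of _ j]) auto
    then have "nrm (lp p m) (\<lambda>k. t k j) \<le> nrm (lp p n) (\<lambda>i. if i = j then 1 else 0)"
      using tc[of "\<lambda>i. if i = j then 1 else 0"] by simp
    also have "\<dots> \<le> (\<Sum>i<n. \<bar>if i = j then 1 else 0\<bar>)" by (rule lp_norm_sum_le[OF p n])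
    also have "\<dots> = 1" using j by (subst sum.remove[of _ j]) auto
    finally show ?thesis .
  qed
  have sg: "sint M (A k) (g j) = c j k * measure M (A k)" if k: "k < m" and j: "j < n" for k j
  proof -
    have "sint M (A k) (g j) = (\<integral>x. c j k * indicator (A k) x \<partial>M)"
    proof (rule Bochner_Integration.integral_cong[OF refl])
      fix x assume x: "x \<in> space M"
      show "indicator (A k) x * g j x = c j k * indicator (A k) x"
        using c[OF j x] sum_indicator_disjoint[OF m(2) k, of x "c j"] by (cases "x \<in> A k") auto
    qed
    then show ?thesis using m(3)[OF k] by simp
  qed
  have fj: "\<Theta> j (f j) \<le> (\<Sum>k<m. t k j / ?w k * sint M (A k) (f j)) + (\<epsilon> + \<epsilon>)" if j: "j < n" for j
  proof -
    note fg = Lq_fun_diff(1)[OF p' f[OF j] g(2)[OF j]] and gf = Lq_fun_diff(1)[OF p' g(2)[OF j] f[OF j]]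
    have "\<Theta> j (f j) = \<Theta> j (\<lambda>x. g j x + (f j x - g j x))" by simp
    also have "\<dots> = \<Theta> j (g j) + \<Theta> j (\<lambda>x. f j x - g j x)" by (rule \<Theta>_add[OF g(2)[OF j] fg])
    also have "\<Theta> j (\<lambda>x. f j x - g j x) \<le> \<epsilon>" using \<Theta>_le[OF fg j] g(3)[OF j] by simp
    also have "\<Theta> j (g j) = \<Theta> j (\<lambda>x. \<Sum>k<m. c j k * indicator (A k) x)"
    proof -
      have "cls p' M (g j) = cls p' M (\<lambda>x. \<Sum>k<m. c j k * indicator (A k) x)"
        using g(2)[OF j] step_function_norm(1)[OF p' m] c[OF j] by (subst cls_eq_iff) (auto simp del: sum_mult_indicator)
      then show ?thesis by (simp add: \<Theta>_def del: sum_mult_indicator)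
    qed
    also have "\<dots> = (\<Sum>k<m. c j k * \<Theta> j (indicator (A k)))" by (rule \<Theta>_step)
    also have "\<dots> = (\<Sum>k<m. t k j / ?w k * sint M (A k) (g j))"
    proof (rule sum.cong[OF refl])
      fix k assume "k \<in> {..<m}"
      then have k: "k < m" by simp
      show "c j k * \<Theta> j (indicator (A k)) = t k j / ?w k * sint M (A k) (g j)"
      proof (cases "?w k = 0")
        case True
        then have "?w' k = 0" by (simp add: wt_eq_0)
        then show ?thesis using True \<Theta>_ind[OF k] by simp
      next
        case False
        then show ?thesis unfolding sg[OF k j] wt_mult[OF p pp, symmetric] \<Theta>_ind[OF k] by simp
      qed
    qed
    also have "\<dots> = (\<Sum>k<m. t k j / ?w k * sint M (A k) (f j)) + (\<Sum>k<m. t k j / ?w k * sint M (A k) (\<lambda>x. g j x - f j x))"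
      unfolding sum.distrib[symmetric]
    proof (rule sum.cong[OF refl])
      fix k assume "k \<in> {..<m}"
      then have k: "A k \<in> fmeasurable M" using m(3) by simp
      show "t k j / ?w k * sint M (A k) (g j) =
          t k j / ?w k * sint M (A k) (f j) + t k j / ?w k * sint M (A k) (\<lambda>x. g j x - f j x)"
        unfolding sint_diff[OF g(2)[OF j] f[OF j] k] unfolding right_diff_distrib by simp
    qed
    also have "(\<Sum>k<m. t k j / ?w k * sint M (A k) (\<lambda>x. g j x - f j x)) \<le> 1 * \<epsilon>"
    proof -
      have "\<bar>\<Sum>k<m. t k j / ?w k * sint M (A k) (\<lambda>x. g j x - f j x)\<bar> \<le>
          nrm (lp p m) (\<lambda>k. ?w k * (t k j / ?w k)) * Lq_norm p' M (\<lambda>x. g j x - f j x)"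
        by (rule Holder_step[OF p pp gf m])
      also have "\<dots> \<le> 1 * \<epsilon>"
      proof (rule mult_mono)
        show "nrm (lp p m) (\<lambda>k. ?w k * (t k j / ?w k)) \<le> 1"
          by (rule order_trans[OF lp_norm_mono[OF p m(1)] col[OF j]]) simp
        show "Lq_norm p' M (\<lambda>x. g j x - f j x) \<le> \<epsilon>"
          using Lq_fun_scale(2)[OF p' fg, of "-1"] g(3)[OF j] by simp
      qed (use Lq_norm_nonneg[OF gf] in auto)
      finally show ?thesis by simp
    qed
    finally show ?thesis by simp
  qed
  show thesis
  proof (rule that[OF P tc])
    have "W = (\<lambda>j\<in>{..<n}. 1 \<odot>\<^bsub>?L\<^esub> cls p' M (f j))" using f by (auto simp: W_def fun_eq_iff Lq_smult[OF p'])
    then have "\<psi> W = \<psi> (\<lambda>j\<in>{..<n}. 1 \<odot>\<^bsub>?L\<^esub> cls p' M (f j))" by (rule arg_cong)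
    also have "\<dots> = (\<Sum>j<n. 1 * \<Theta> j (f j))" by (rule \<psi>_sum[OF f])
    finally have "proj_norm p n ?L W = (\<Sum>j<n. 1 * \<Theta> j (f j))" unfolding \<psi>(4) .
    also have "\<dots> \<le> (\<Sum>j<n. (\<Sum>k<m. t k j / ?w k * sint M (A k) (f j)) + (\<epsilon> + \<epsilon>))"
      using fj by (intro sum_mono) simp
    also have "\<dots> = (\<Sum>j<n. \<Sum>k<m. t k j / ?w k * sint M (A k) (f j)) + e"
      using \<epsilon>(2) by (simp add: sum.distrib mult_ac)
    finally show "proj_norm p n ?L (\<lambda>j\<in>{..<n}. cls p' M (f j)) \<le>
      (\<Sum>j<n. \<Sum>k<m. t k j / ?w k * sint M (A k) (f j)) + e" unfolding W_def .
  qed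
qed

end

section \<open>Extension of a single component\<close>

text \<open>One summand of the direct sum: u stands for a component of the given map, and C for a
  constant that will be common to all components.\<close>

locale extension_problem = simple_functions p Y M
  for p :: ennreal and Y :: "'y mnspace" (structure) and M :: "'a measure" +
  fixes p' :: ennreal and S :: "'y set" and u :: "'y \<Rightarrow> ('a \<Rightarrow> real) set" and C :: real
  assumes pp: "1 / p + 1 / p' = 1"
    and S: "submodule S real_ring Y"
    and u: "linear_map (Y\<lparr>carrier := S\<rparr>) (Lq p' M) u"
    and C: "0 \<le> C"
    and bound: "\<And>n w. 1 \<le> n \<Longrightarrow> w \<in> {..<n} \<rightarrow>\<^sub>E S \<Longrightarrow>
      proj_norm p n (Lq p' M) (\<lambda>j\<in>{..<n}. u (w j)) \<le> C * mnrm Y n w"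
begin

definition extension :: "('y \<Rightarrow> ('a \<Rightarrow> real) set) \<Rightarrow> bool" where
  "extension v \<longleftrightarrow> linear_map Y (Lq p' M) v \<and> (\<forall>x\<in>S. v x = u x) \<and>
     (\<forall>n\<ge>1. \<forall>w\<in>{..<n} \<rightarrow>\<^sub>E carrier Y. proj_norm p n (Lq p' M) (\<lambda>j\<in>{..<n}. v (w j)) \<le> C * mnrm Y n w)"

lemma S_closed:
  "x \<in> S \<Longrightarrow> x \<in> carrier Y" "\<zero> \<in> S" "x \<in> S \<Longrightarrow> y \<in> S \<Longrightarrow> x \<oplus> y \<in> S" "x \<in> S \<Longrightarrow> c \<odot> x \<in> S"
proof -
  interpret S: submodule S real_ring Y by (rule S)
  show "x \<in> S \<Longrightarrow> x \<in> carrier Y" using S.subset by auto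
  show "\<zero> \<in> S" using S.one_closed by simp
  show "x \<in> S \<Longrightarrow> y \<in> S \<Longrightarrow> x \<oplus> y \<in> S" using S.m_closed by simp
  show "x \<in> S \<Longrightarrow> c \<odot> x \<in> S" using S.smult_closed by simp
qed

lemma p': "1 \<le> p'"
  by (rule conjugate_exponent_ge_1[OF p pp])

lemma u_simps:
  "x \<in> S \<Longrightarrow> u x \<in> carrier (Lq p' M)"
  "x \<in> S \<Longrightarrow> y \<in> S \<Longrightarrow> u (x \<oplus> y) = u x \<oplus>\<^bsub>Lq p' M\<^esub> u y"
  "x \<in> S \<Longrightarrow> u (c \<odot> x) = c \<odot>\<^bsub>Lq p' M\<^esub> u x"
  using u by (auto simp: linear_map_def)

lemma rep_u_add:
  assumes "x \<in> S" "y \<in> S" shows "AE t in M. rep (u (x \<oplus> y)) t = rep (u x) t + rep (u y) t"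
proof -
  note r = rep_carrier[OF u_simps(1)]
  have "cls p' M (rep (u (x \<oplus> y))) = u (x \<oplus> y)" by (rule r(2)[OF S_closed(3)[OF assms]])
  also have "\<dots> = u x \<oplus>\<^bsub>Lq p' M\<^esub> u y" by (rule u_simps(2)[OF assms])
  also have "\<dots> = cls p' M (\<lambda>t. rep (u x) t + rep (u y) t)"
    using Lq_add[OF p' r(1)[OF assms(1)] r(1)[OF assms(2)]]
    unfolding r(2)[OF assms(1)] r(2)[OF assms(2)] .
  finally have "cls p' M (rep (u (x \<oplus> y))) = cls p' M (\<lambda>t. rep (u x) t + rep (u y) t)" .
  then show ?thesis
    using r(1)[OF S_closed(3)[OF assms]] Lq_fun_add(1)[OF p' r(1)[OF assms(1)] r(1)[OF assms(2)]]
    by (simp add: cls_eq_iff)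
qed

lemma rep_u_smult:
  assumes "x \<in> S" shows "AE t in M. rep (u (c \<odot> x)) t = c * rep (u x) t"
proof -
  note r = rep_carrier[OF u_simps(1)]
  have "cls p' M (rep (u (c \<odot> x))) = u (c \<odot> x)" by (rule r(2)[OF S_closed(4)[OF assms]])
  also have "\<dots> = c \<odot>\<^bsub>Lq p' M\<^esub> u x" by (rule u_simps(3)[OF assms])
  also have "\<dots> = cls p' M (\<lambda>t. c * rep (u x) t)"
    using Lq_smult[OF p' r(1)[OF assms], of c] unfolding r(2)[OF assms] .
  finally have "cls p' M (rep (u (c \<odot> x))) = cls p' M (\<lambda>t. c * rep (u x) t)" .
  then show ?thesis
    using r(1)[OF S_closed(4)[OF assms]] Lq_fun_scale(1)[OF p' r(1)[OF assms]]
    by (simp add: cls_eq_iff)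
qed

text \<open>For a fixed vector y the multinorm is a cross norm. This is what makes the charge of y
  bounded by C times the norm of y.\<close>

lemma val_elem: "1 \<le> m \<Longrightarrow> y \<in> carrier Y \<Longrightarrow> val m A (\<lambda>k. a k \<odot> y) = nrm (lp p m) (\<lambda>k. wt p M (A k) * a k) * nrm Y y"
proof -
  assume m: "1 \<le> m" and y: "y \<in> carrier Y"
  let ?a = "\<lambda>k\<in>{..<m}. wt p M (A k) * a k"
  have "val m A (\<lambda>k. a k \<odot> y) = mnrm Y m (elem_tensor m Y ?a y)"
    unfolding val_def elem_tensor_def using y by (intro arg_cong[where f="mnrm Y m"] restrict_ext) (auto simp: Y.sm_simps)
  also have "\<dots> = nrm (lp p m) ?a * nrm Y y" by (rule Y.mnrm_elem_tensor[OF m _ y]) simp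
  also have "nrm (lp p m) ?a = nrm (lp p m) (\<lambda>k. wt p M (A k) * a k)" by (rule lp_norm_cong[OF p m]) simp
  finally show ?thesis .
qed

text \<open>The extended charges satisfy the multinorm estimate on every partition. Their densities
  inherit it: the partition is shrunk to where charges and densities nearly agree, the lost pieces
  contribute little by absolute continuity, and shrinking does not increase
  \<open>val\<close>.\<close>

lemma extension_finite_exponent:
  assumes s: "p' = ennreal s" "1 \<le> s"
  shows "\<exists>v. extension v"
proof -
  interpret conjugate_exponents p p' s by unfold_locales (use p pp s in auto)
  let ?L = "Lq p' M"
  note r = rep_carrier[OF u_simps(1)]
  \<comment> \<open>The weights are moved into the vectors, w k being the weight of A k times x k;
    the sum then is the step pairing of the tuple u (w k).\<close>
  have Ubound: "(\<Sum>k<m. sint M (A k) (rep (u (x k)))) \<le> C * val m A x"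
    if P: "fpartition M m A" and x: "\<And>k. k < m \<Longrightarrow> x k \<in> S" for m A x
  proof -
    have m: "1 \<le> m" "disjoint_family_on A {..<m}" "\<And>k. k < m \<Longrightarrow> A k \<in> fmeasurable M"
      using P by (auto simp: fpartition_def)
    define w where "w = (\<lambda>k\<in>{..<m}. wt p M (A k) \<odot> x k)"
    have w: "w \<in> {..<m} \<rightarrow>\<^sub>E S" using x S_closed(4) by (auto simp: w_def)
    have uw: "(\<lambda>k\<in>{..<m}. u (w k)) \<in> {..<m} \<rightarrow>\<^sub>E carrier ?L" using w u_simps(1) by auto
    have "(\<Sum>k<m. sint M (A k) (rep (u (x k)))) = (\<Sum>k<m. sint M (A k) (rep ((\<lambda>k\<in>{..<m}. u (w k)) k)) / wt p M (A k))"
    proof (rule sum.cong[OF refl])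
      fix k assume "k \<in> {..<m}"
      then have k: "k < m" by simp
      have Am: "A k \<in> sets M" using m(3)[OF k] by auto
      have wk: "sint M (A k) (rep ((\<lambda>k\<in>{..<m}. u (w k)) k)) = wt p M (A k) * sint M (A k) (rep (u (x k)))"
        using k sint_rep_smult[OF u_simps(1)[OF x[OF k]] Am] by (simp add: w_def u_simps(3)[OF x[OF k]])
      show "sint M (A k) (rep (u (x k))) = sint M (A k) (rep ((\<lambda>k\<in>{..<m}. u (w k)) k)) / wt p M (A k)"
      proof (cases "wt p M (A k) = 0")
        case True
        then show ?thesis using sint_bound[OF r(1)[OF x[OF k]] m(3)[OF k]] by simp
      next
        case False
        then show ?thesis unfolding wk by simp
      qed
    qed
    also have "\<dots> \<le> proj_norm p m ?L (\<lambda>k\<in>{..<m}. u (w k))" by (rule step_pairing_le_proj_norm[OF P uw])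
    also have "\<dots> \<le> C * mnrm Y m w" by (rule bound[OF m(1) w])
    finally show ?thesis by (simp add: val_def w_def)
  qed
  obtain \<nu> where \<nu>: "\<And>y A B. y \<in> carrier Y \<Longrightarrow> A \<in> fmeasurable M \<Longrightarrow> B \<in> fmeasurable M \<Longrightarrow> A \<inter> B = {} \<Longrightarrow>
      \<nu> y (A \<union> B) = \<nu> y A + \<nu> y B"
    "\<And>x y A. x \<in> carrier Y \<Longrightarrow> y \<in> carrier Y \<Longrightarrow> A \<in> fmeasurable M \<Longrightarrow> \<nu> (x \<oplus> y) A = \<nu> x A + \<nu> y A"
    "\<And>c y A. y \<in> carrier Y \<Longrightarrow> A \<in> fmeasurable M \<Longrightarrow> \<nu> (c \<odot> y) A = c * \<nu> y A"
    "\<And>x A. x \<in> S \<Longrightarrow> A \<in> fmeasurable M \<Longrightarrow> \<nu> x A = sint M A (rep (u x))"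
    "\<And>m A y. fpartition M m A \<Longrightarrow> (\<And>k. k < m \<Longrightarrow> y k \<in> carrier Y) \<Longrightarrow> (\<Sum>k<m. \<nu> (y k) (A k)) \<le> C * val m A y"
  proof (rule vector_measure_extension[OF S C, of "\<lambda>x. rep (u x)"])
    show "rep (u x) \<in> borel_measurable M" if "x \<in> S" for x using r(1)[OF that] by measurable
    show "integrable M (\<lambda>t. indicator A t * rep (u x) t)" if "x \<in> S" "A \<in> fmeasurable M" for x A
      by (rule set_integrable[OF r(1)[OF that(1)] that(2)])
  qed (use rep_u_add rep_u_smult Ubound in blast)+
  have charge: "bounded_charge p M (C * nrm Y y) (\<nu> y)" if y: "y \<in> carrier Y" for y
    unfolding bounded_charge_def
  proof (intro conjI ballI allI impI)
    show "\<nu> y (A \<union> B) = \<nu> y A + \<nu> y B" if "A \<in> fmeasurable M" "B \<in> fmeasurable M" "A \<inter> B = {}" for A B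
      by (rule \<nu>(1)[OF y that])
    fix m A a assume P: "fpartition M m A"
    then have m: "1 \<le> m" "\<And>k. k < m \<Longrightarrow> A k \<in> fmeasurable M" by (auto simp: fpartition_def)
    have "(\<Sum>k<m. a k * \<nu> y (A k)) = (\<Sum>k<m. \<nu> (a k \<odot> y) (A k))"
      using m(2) \<nu>(3)[OF y] by (intro sum.cong) auto
    also have "\<dots> \<le> C * val m A (\<lambda>k. a k \<odot> y)" by (rule \<nu>(5)[OF P]) (use y in simp)
    finally show "(\<Sum>k<m. a k * \<nu> y (A k)) \<le> C * nrm Y y * nrm (lp p m) (\<lambda>k. wt p M (A k) * a k)"
      using val_elem[OF m(1) y] by (simp add: mult_ac)
  qed
  have "\<forall>y\<in>carrier Y. \<exists>f. f \<in> Lq_fun p' M \<and> has_density M (\<nu> y) f"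
    using charge_has_density[OF charge] C Y.nrm_nonneg by (meson mult_nonneg_nonneg)
  then obtain f where f: "\<And>y. y \<in> carrier Y \<Longrightarrow> f y \<in> Lq_fun p' M" "\<And>y. y \<in> carrier Y \<Longrightarrow> has_density M (\<nu> y) (f y)"
    by metis
  define v where "v y = cls p' M (f y)" for y
  have "linear_map Y ?L v"
    unfolding linear_map_def
  proof (intro conjI ballI allI)
    show "v \<in> carrier Y \<rightarrow> carrier ?L" using f(1) by (auto simp: v_def cls_in_carrier)
    show "v (x \<oplus> y) = v x \<oplus>\<^bsub>?L\<^esub> v y" if x: "x \<in> carrier Y" and y: "y \<in> carrier Y" for x y
    proof -
      have "has_density M (\<lambda>A. 1 * \<nu> x A + 1 * \<nu> y A) (\<lambda>t. 1 * f x t + 1 * f y t)"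
        by (rule has_density_lincomb[OF f(2)[OF x] set_integrable[OF f(1)[OF x]] f(2)[OF y] set_integrable[OF f(1)[OF y]]])
      then have "has_density M (\<lambda>A. 1 * \<nu> x A + 1 * \<nu> y A) (\<lambda>t. f x t + f y t)" by simp
      then have "has_density M (\<nu> (x \<oplus> y)) (\<lambda>t. f x t + f y t)"
        by (rule has_density_cong[rotated]) (use \<nu>(2)[OF x y] in simp)
      then have "AE t in M. f (x \<oplus> y) t = f x t + f y t"
        using x y f by (intro has_density_unique[OF _ _ f(2)] Lq_fun_add(1)[OF p']) auto
      then show ?thesis
        using f(1) x y Lq_fun_add(1)[OF p' f(1)[OF x] f(1)[OF y]] by (simp add: v_def Lq_add[OF p'] cls_eq_iff)
    qed
    show "v (c \<odot> y) = c \<odot>\<^bsub>?L\<^esub> v y" if y: "y \<in> carrier Y" for c y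
    proof -
      have "has_density M (\<lambda>A. c * \<nu> y A + 0 * \<nu> y A) (\<lambda>t. c * f y t + 0 * f y t)"
        by (rule has_density_lincomb[OF f(2)[OF y] set_integrable[OF f(1)[OF y]] f(2)[OF y] set_integrable[OF f(1)[OF y]]])
      then have "has_density M (\<lambda>A. c * \<nu> y A + 0 * \<nu> y A) (\<lambda>t. c * f y t)" by simp
      then have "has_density M (\<nu> (c \<odot> y)) (\<lambda>t. c * f y t)"
        by (rule has_density_cong[rotated]) (use \<nu>(3)[OF y] in simp)
      then have "AE t in M. f (c \<odot> y) t = c * f y t"
        using y f by (intro has_density_unique[OF _ _ f(2)] Lq_fun_scale(1)[OF p']) auto
      then show ?thesis
        using f(1) y Lq_fun_scale(1)[OF p' f(1)[OF y]] by (simp add: v_def Lq_smult[OF p'] cls_eq_iff)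
    qed
  qed
  moreover have "v x = u x" if x: "x \<in> S" for x
  proof -
    have hd: "has_density M (\<nu> x) (rep (u x))"
      by (rule has_density_cong[OF _ has_density_self]) (use \<nu>(4)[OF x] in simp)
    have "AE t in M. f x t = rep (u x) t"
      by (rule has_density_unique[OF f(1)[OF S_closed(1)[OF x]] r(1)[OF x] f(2)[OF S_closed(1)[OF x]] hd])
    then have "cls p' M (f x) = cls p' M (rep (u x))"
      using f(1)[OF S_closed(1)[OF x]] r(1)[OF x] by (simp add: cls_eq_iff)
    then show ?thesis using r(2)[OF x] by (simp add: v_def)
  qed
  moreover have "proj_norm p n ?L (\<lambda>j\<in>{..<n}. v (w j)) \<le> C * mnrm Y n w"
    if n: "1 \<le> n" and w: "w \<in> {..<n} \<rightarrow>\<^sub>E carrier Y" for n w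
  proof (rule field_le_epsilon)
    fix e :: real assume e: "0 < e"
    have wc: "w j \<in> carrier Y" if "j < n" for j using w that by auto
    obtain m A t where P: "fpartition M m A"
      and t: "\<And>a. nrm (lp p m) (\<lambda>k. \<Sum>j<n. t k j * a j) \<le> nrm (lp p n) a"
      and le: "proj_norm p n ?L (\<lambda>j\<in>{..<n}. cls p' M (f (w j))) \<le>
        (\<Sum>j<n. \<Sum>k<m. t k j / wt p M (A k) * sint M (A k) (f (w j))) + e"
      by (rule proj_norm_norming[OF n _ e, of "\<lambda>j. f (w j)" M]) (use f(1) wc in blast)+
    have m: "1 \<le> m" "disjoint_family_on A {..<m}" "\<And>k. k < m \<Longrightarrow> A k \<in> fmeasurable M"
      using P by (auto simp: fpartition_def)
    let ?w = "\<lambda>k. wt p M (A k)"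
    \<comment> \<open>The total size of the coefficients converts a uniform error on the sets of the
      partition into an error of the double sum.\<close>
    define T where "T = (\<Sum>j<n. \<Sum>k<m. \<bar>t k j / ?w k\<bar>)"
    have T: "0 \<le> T" by (auto simp: T_def intro!: sum_nonneg)
    define U where "U = (\<Union>k<m. A k)"
    have U: "U \<in> fmeasurable M" unfolding U_def using m(3) by (intro fmeasurable.finite_UN) auto
    define Q where "Q = (\<Sum>j<n. \<Sum>k<m. t k j / ?w k * sint M (A k) (f (w j)))"
    have "Q \<le> C * mnrm Y n w + e'" if e': "0 < e'" for e'
    proof -
      \<comment> \<open>Chosen so that 2 \<eta> T \<le> e', with a denominator that is positive even
        for T = 0.\<close>
      define \<eta> where "\<eta> = e' / (2 * T + 1)"
      have \<eta>: "0 < \<eta>" "2 * \<eta> * T \<le> e'"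
      proof -
        have "0 < 2 * T + 1" using T by simp
        then have "\<eta> * (2 * T + 1) = e'" "0 < \<eta>" using e' by (simp_all add: \<eta>_def)
        then show "0 < \<eta>" "2 * \<eta> * T \<le> e'" by (simp_all add: algebra_simps)
      qed
      have "\<exists>d>0. \<forall>N. N \<in> fmeasurable M \<longrightarrow> N \<subseteq> U \<longrightarrow> measure M N < d \<longrightarrow> \<bar>sint M N (f (w j))\<bar> < \<eta>" if j: "j < n" for j
        using sint_small[OF set_integrable[OF f(1)[OF wc[OF j]] U] _ \<eta>(1)] U by (metis fmeasurableD)
      then obtain d where d: "\<And>j. j < n \<Longrightarrow> 0 < d j"
        "\<And>j N. j < n \<Longrightarrow> N \<in> fmeasurable M \<Longrightarrow> N \<subseteq> U \<Longrightarrow> measure M N < d j \<Longrightarrow> \<bar>sint M N (f (w j))\<bar> < \<eta>"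
        by metis
      \<comment> \<open>Each of the n vectors has its own exceptional set; the division by n keeps
        the measure of their union below every threshold d j.\<close>
      define \<delta> where "\<delta> = Min (insert \<eta> (d ` {..<n})) / real n"
      have \<delta>: "0 < \<delta>" "\<delta> \<le> \<eta>" "\<And>j. j < n \<Longrightarrow> real n * \<delta> \<le> d j"
      proof -
        have p0: "0 < Min (insert \<eta> (d ` {..<n}))" using \<eta>(1) d(1) by (subst Min_gr_iff) auto
        then show "0 < \<delta>" using n by (simp add: \<delta>_def)
        show "real n * \<delta> \<le> d j" if "j < n" for j using that n by (auto simp: \<delta>_def)
        have "\<delta> \<le> real n * \<delta>" using n \<open>0 < \<delta>\<close> by simp
        also have "\<dots> \<le> \<eta>" using n by (auto simp: \<delta>_def)
        finally show "\<delta> \<le> \<eta>" .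
      qed
      have "\<exists>B. B \<in> fmeasurable M \<and> B \<subseteq> U \<and> measure M (U - B) < \<delta> \<and>
          (\<forall>D. D \<in> sets M \<longrightarrow> D \<subseteq> B \<longrightarrow> \<bar>\<nu> (w j) D - sint M D (f (w j))\<bar> < \<delta>)" if j: "j < n" for j
        by (rule has_densityD[OF f(2)[OF wc[OF j]] U \<delta>(1)]) blast
      then obtain B where B: "\<And>j. j < n \<Longrightarrow> B j \<in> fmeasurable M" "\<And>j. j < n \<Longrightarrow> measure M (U - B j) < \<delta>"
        "\<And>j D. j < n \<Longrightarrow> D \<in> sets M \<Longrightarrow> D \<subseteq> B j \<Longrightarrow> \<bar>\<nu> (w j) D - sint M D (f (w j))\<bar> < \<delta>"
        by metis
      \<comment> \<open>The part of A k on which the charge of every w j nearly agrees with its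
        density.\<close>
      define B' where "B' k = A k \<inter> (\<Inter>j<n. B j)" for k
      have Bs: "(\<Inter>j<n. B j) \<in> sets M" using B(1) n by (intro sets.finite_INT) (auto simp: lessThan_empty_iff)
      have B'f: "B' k \<in> fmeasurable M" "A k - B' k \<in> fmeasurable M" if "k < m" for k
      proof -
        have "B' k \<in> sets M" "A k - B' k \<in> sets M" using m(3)[OF that] Bs by (auto simp: B'_def)
        moreover have "B' k \<subseteq> A k" "A k - B' k \<subseteq> A k" by (auto simp: B'_def)
        ultimately show "B' k \<in> fmeasurable M" "A k - B' k \<in> fmeasurable M"
          using fmeasurable_subset[OF m(3)[OF that]] by blast+
      qed
      have P': "fpartition M m B'"
        unfolding fpartition_def
      proof (intro conjI allI impI)
        show "disjoint_family_on B' {..<m}" using m(2) unfolding disjoint_family_on_def B'_def by blast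
      qed (use m B'f in auto)
      have close: "\<bar>sint M (A k) (f (w j)) - \<nu> (w j) (B' k)\<bar> \<le> 2 * \<eta>" if k: "k < m" and j: "j < n" for j k
      proof -
        have "measure M (A k - B' k) \<le> measure M (\<Union>i<n. U - B i)"
          using k m(3) B(1) U B'f(2)[OF k]
          by (intro measure_mono_fmeasurable fmeasurable.finite_UN) (auto simp: B'_def U_def intro: fmeasurable_Diff)
        also have "\<dots> \<le> (\<Sum>i<n. measure M (U - B i))"
          using B(1) U by (intro measure_UNION_le) (auto intro: fmeasurable_Diff)
        also have "\<dots> < (\<Sum>i<n. \<delta>)" using B(2) n by (intro sum_strict_mono) (auto simp: lessThan_empty_iff)
        also have "\<dots> \<le> d j" using \<delta>(3)[OF j] by simp
        finally have "\<bar>sint M (A k - B' k) (f (w j))\<bar> < \<eta>"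
          using k by (intro d(2)[OF j B'f(2)[OF k]]) (auto simp: U_def)
        moreover have "\<bar>\<nu> (w j) (B' k) - sint M (B' k) (f (w j))\<bar> < \<delta>"
          using B'f(1)[OF k] j by (intro B(3)) (auto simp: B'_def)
        moreover have "sint M (A k) (f (w j)) = sint M (B' k) (f (w j)) + sint M (A k - B' k) (f (w j))"
        proof -
          have "sint M (B' k \<union> (A k - B' k)) (f (w j)) = sint M (B' k) (f (w j)) + sint M (A k - B' k) (f (w j))"
            by (rule sint_Un[OF f(1)[OF wc[OF j]] B'f[OF k]]) blast
          moreover have "B' k \<union> (A k - B' k) = A k" by (auto simp: B'_def)
          ultimately show ?thesis by simp
        qed
        ultimately show ?thesis using \<delta>(2) by linarith
      qed
      \<comment> \<open>Linearity of \<nu> in y collects the double sum into a single sum over the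
        partition, to which the domination of \<nu> applies.\<close>
      define z where "z k = (\<Oplus>j\<in>{..<n}. (t k j / ?w k) \<odot> w j)" for k
      have z: "z k \<in> carrier Y" for k using wc by (auto simp: z_def intro!: Y.finsum_in)
      have "Q \<le> (\<Sum>j<n. \<Sum>k<m. t k j / ?w k * \<nu> (w j) (B' k) + \<bar>t k j / ?w k\<bar> * (2 * \<eta>))"
        unfolding Q_def
      proof (intro sum_mono)
        fix j k assume jk: "j \<in> {..<n}" "k \<in> {..<m}"
        have "t k j / ?w k * sint M (A k) (f (w j)) - t k j / ?w k * \<nu> (w j) (B' k) =
            t k j / ?w k * (sint M (A k) (f (w j)) - \<nu> (w j) (B' k))" by (simp add: right_diff_distrib)
        also have "\<dots> \<le> \<bar>t k j / ?w k\<bar> * \<bar>sint M (A k) (f (w j)) - \<nu> (w j) (B' k)\<bar>"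
          by (metis abs_ge_self abs_mult)
        also have "\<dots> \<le> \<bar>t k j / ?w k\<bar> * (2 * \<eta>)" using close jk by (intro mult_left_mono) auto
        finally show "t k j / ?w k * sint M (A k) (f (w j)) \<le>
            t k j / ?w k * \<nu> (w j) (B' k) + \<bar>t k j / ?w k\<bar> * (2 * \<eta>)" by simp
      qed
      also have "\<dots> = (\<Sum>j<n. \<Sum>k<m. t k j / ?w k * \<nu> (w j) (B' k)) + T * (2 * \<eta>)"
        by (simp only: sum.distrib T_def sum_distrib_right)
      finally have q1: "Q \<le> (\<Sum>j<n. \<Sum>k<m. t k j / ?w k * \<nu> (w j) (B' k)) + T * (2 * \<eta>)" .
      have q2: "(\<Sum>j<n. \<Sum>k<m. t k j / ?w k * \<nu> (w j) (B' k)) = (\<Sum>k<m. \<nu> (z k) (B' k))"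
      proof -
        have "\<nu> (z k) (B' k) = (\<Sum>j<n. t k j / ?w k * \<nu> (w j) (B' k))" if k: "k < m" for k
        proof -
          have "\<nu> (z k) (B' k) = (\<Sum>j<n. \<nu> ((t k j / ?w k) \<odot> w j) (B' k))"
            unfolding z_def using \<nu>(2)[OF _ _ B'f(1)[OF k]] wc
            by (intro Y.additive_finsum[where \<phi>="\<lambda>y. \<nu> y (B' k)"]) auto
          also have "\<dots> = (\<Sum>j<n. t k j / ?w k * \<nu> (w j) (B' k))"
            using \<nu>(3)[OF wc B'f(1)[OF k]] by (intro sum.cong) auto
          finally show ?thesis .
        qed
        then show ?thesis by (subst sum.swap) simp
      qed
      have q3: "(\<Sum>k<m. \<nu> (z k) (B' k)) \<le> C * val m B' z" by (rule \<nu>(5)[OF P' z])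
      have "val m B' z \<le> val m A z"
      proof -
        \<comment> \<open>Shrinking is refinement with the identity as index map.\<close>
        have "val m B' (\<lambda>l. if id l < m then z (id l) else \<zero>) \<le> val m A z"
          by (rule val_refine[OF P P']) (use z in \<open>auto simp: B'_def\<close>)
        moreover have "val m B' (\<lambda>l. if id l < m then z (id l) else \<zero>) = val m B' z"
          unfolding val_def by (intro arg_cong[where f="mnrm Y m"] restrict_ext) simp
        ultimately show ?thesis by simp
      qed
      also have "val m A z = mnrm Y m (\<lambda>k\<in>{..<m}. \<Oplus>j\<in>{..<n}. (?w k * (t k j / ?w k)) \<odot> w j)"
        unfolding val_def
      proof (intro arg_cong[where f="mnrm Y m"] restrict_ext)
        fix k
        have "?w k \<odot> z k = (\<Oplus>j\<in>{..<n}. ?w k \<odot> ((t k j / ?w k) \<odot> w j))"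
          unfolding z_def using wc by (intro Y.finsum_sm) auto
        also have "\<dots> = (\<Oplus>j\<in>{..<n}. (?w k * (t k j / ?w k)) \<odot> w j)"
          using wc by (intro Y.finsum_cong') (auto simp: Y.sm_simps)
        finally show "?w k \<odot> z k = (\<Oplus>j\<in>{..<n}. (?w k * (t k j / ?w k)) \<odot> w j)" .
      qed
      also have "\<dots> \<le> mnrm Y n w"
      proof (rule Y.mnrm_contraction[OF p n m(1) _ w])
        fix a
        \<comment> \<open>Weight times quotient is t k j, except for sets of weight 0, where it is
          0; so this matrix inherits the contraction property of t.\<close>
        have "nrm (lp p m) (\<lambda>k. \<Sum>j<n. ?w k * (t k j / ?w k) * a j) \<le> nrm (lp p m) (\<lambda>k. \<Sum>j<n. t k j * a j)"
        proof (rule lp_norm_mono[OF p m(1)])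
          fix k
          show "\<bar>\<Sum>j<n. ?w k * (t k j / ?w k) * a j\<bar> \<le> \<bar>\<Sum>j<n. t k j * a j\<bar>"
            by (cases "?w k = 0") simp_all
        qed
        then show "nrm (lp p m) (\<lambda>k. \<Sum>j<n. ?w k * (t k j / ?w k) * a j) \<le> nrm (lp p n) a" using t[of a] by linarith
      qed
      finally have "C * val m B' z \<le> C * mnrm Y n w" using C by (rule mult_left_mono)
      moreover have "T * (2 * \<eta>) \<le> e'" using \<eta>(2) by (simp add: mult_ac)
      ultimately show ?thesis using q1 q2 q3 by linarith
    qed
    then have "Q \<le> C * mnrm Y n w" by (rule field_le_epsilon)
    then show "proj_norm p n ?L (\<lambda>j\<in>{..<n}. v (w j)) \<le> C * mnrm Y n w + e"
      using le by (simp add: v_def Q_def)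
  qed
  ultimately show ?thesis unfolding extension_def by blast
qed

end

section \<open>The case p = 1: bounded functions and order completeness\<close>

lemma l1_norm: "nrm (lp 1 n) a = (\<Sum>j<n. \<bar>a j\<bar>)"
  by (simp add: lp_def sum_nonneg)

text \<open>With \<open>proj_norm_le_sum\<close> this identifies the projective norm for p = 1 with
  the sum of the coordinate norms, so multinorm estimates reduce to estimates for single
  vectors.\<close>

lemma (in proj_space) sum_le_proj_norm:
  assumes p1: "p = 1" and w: "w \<in> {..<n} \<rightarrow>\<^sub>E carrier E"
  shows "(\<Sum>j<n. nrm E (w j)) \<le> proj_norm p n E w"
proof (rule proj_norm_ge[OF w])
  fix K a x assume "proj_rep n E w K a x"
  then have x: "\<And>k. k < K \<Longrightarrow> x k \<in> carrier E"
    and wj: "\<And>j. j < n \<Longrightarrow> w j = (\<Oplus>k\<in>{..<K}. a k j \<odot> x k)"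
    by (auto simp: proj_rep_def)
  have "(\<Sum>j<n. nrm E (w j)) \<le> (\<Sum>j<n. \<Sum>k<K. \<bar>a k j\<bar> * nrm E (x k))"
  proof (rule sum_mono)
    fix j assume "j \<in> {..<n}"
    then have "nrm E (w j) \<le> (\<Sum>k<K. nrm E (a k j \<odot> x k))"
      using wj x nrm_finsum_le[of "{..<K}" "\<lambda>k. a k j \<odot> x k"] by simp
    also have "\<dots> = (\<Sum>k<K. \<bar>a k j\<bar> * nrm E (x k))" using x by (intro sum.cong) (auto simp: nrm_smult)
    finally show "nrm E (w j) \<le> (\<Sum>k<K. \<bar>a k j\<bar> * nrm E (x k))" .
  qed
  also have "\<dots> = proj_sum p n E K a x"
    unfolding proj_sum_def p1 l1_norm sum_distrib_right by (rule sum.swap)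
  finally show "(\<Sum>j<n. nrm E (w j)) \<le> proj_sum p n E K a x" .
qed

lemma sint_count_space:
  assumes "finite A" "A \<subseteq> S"
  shows "integrable (count_space S) (\<lambda>t. indicator A t * (h t :: real))" "sint (count_space S) A h = sum h A"
proof -
  have f: "finite {t \<in> S. indicator A t * h t \<noteq> 0}"
    by (rule finite_subset[OF _ assms(1)]) (auto simp: indicator_def split: if_splits)
  show "sint (count_space S) A h = sum h A"
    unfolding lebesgue_integral_count_space_finite_support[OF f]
    using assms by (intro sum.mono_neutral_cong_left) (auto simp: indicator_def split: if_splits)
  show "integrable (count_space S) (\<lambda>t. indicator A t * h t)"
    by (rule integrableI_bounded_set[of A _ _ "\<Sum>t\<in>A. \<bar>h t\<bar>"])
      (use assms in \<open>auto simp: emeasure_count_space AE_count_space of_nat_less_top indicator_def intro!: member_le_sum\<close>)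
qed

context extension_problem
begin

text \<open>S itself indexes the family: the functional with index \<gamma> supports the seminorm x
  \<mapsto> \<parallel>u x\<parallel> at \<gamma>. Hence the supremum over the family recovers the
  norm of u x, attained at the index x.\<close>

lemma norming_functionals:
  assumes p1: "p = 1"
  obtains g :: "'y \<Rightarrow> 'y \<Rightarrow> real" where
    "\<And>\<gamma> x. \<gamma> \<in> S \<Longrightarrow> x \<in> S \<Longrightarrow> g \<gamma> x \<le> nrm (Lq p' M) (u x)"
    "\<And>\<gamma> x y. \<gamma> \<in> S \<Longrightarrow> x \<in> S \<Longrightarrow> y \<in> S \<Longrightarrow> g \<gamma> (x \<oplus> y) = g \<gamma> x + g \<gamma> y"
    "\<And>\<gamma> c x. \<gamma> \<in> S \<Longrightarrow> x \<in> S \<Longrightarrow> g \<gamma> (c \<odot> x) = c * g \<gamma> x"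
    "\<And>\<gamma>. \<gamma> \<in> S \<Longrightarrow> g \<gamma> \<gamma> = nrm (Lq p' M) (u \<gamma>)"
proof -
  let ?L = "Lq p' M"
  interpret L: normed_space ?L by (rule normed_space_Lq[OF p'])
  have E: "module real_ring (Y\<lparr>carrier := S\<rparr>)"
    by (rule real_submodule[OF Y.module_axioms]) (use S_closed in auto)
  have q: "sublinear (Y\<lparr>carrier := S\<rparr>) (\<lambda>x. nrm ?L (u x))"
    unfolding sublinear_def using u_simps L.nrm_triangle L.nrm_smult by auto
  have "\<exists>\<phi>. (\<forall>x\<in>S. \<phi> x \<le> nrm ?L (u x)) \<and> (\<forall>x\<in>S. \<forall>y\<in>S. \<phi> (x \<oplus> y) = \<phi> x + \<phi> y) \<and>
      (\<forall>c. \<forall>x\<in>S. \<phi> (c \<odot> x) = c * \<phi> x) \<and> \<phi> \<gamma> = nrm ?L (u \<gamma>)" if \<gamma>: "\<gamma> \<in> S" for \<gamma>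
  proof -
    have "\<gamma> \<in> carrier (Y\<lparr>carrier := S\<rparr>)" using \<gamma> by simp
    then obtain \<phi> where "\<And>y. y \<in> carrier (Y\<lparr>carrier := S\<rparr>) \<Longrightarrow> \<phi> y \<le> nrm ?L (u y)"
      "\<And>y z. y \<in> carrier (Y\<lparr>carrier := S\<rparr>) \<Longrightarrow> z \<in> carrier (Y\<lparr>carrier := S\<rparr>) \<Longrightarrow>
        \<phi> (y \<oplus>\<^bsub>Y\<lparr>carrier := S\<rparr>\<^esub> z) = \<phi> y + \<phi> z"
      "\<And>c y. y \<in> carrier (Y\<lparr>carrier := S\<rparr>) \<Longrightarrow> \<phi> (c \<odot>\<^bsub>Y\<lparr>carrier := S\<rparr>\<^esub> y) = c * \<phi> y"
      "\<phi> \<gamma> = nrm ?L (u \<gamma>)"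
      using sublinear_support[OF E q, of \<gamma> thesis] by blast
    then show ?thesis by (intro exI[of _ \<phi>]) simp
  qed
  then obtain g where g: "\<forall>\<gamma>\<in>S. (\<forall>x\<in>S. g \<gamma> x \<le> nrm ?L (u x)) \<and>
      (\<forall>x\<in>S. \<forall>y\<in>S. g \<gamma> (x \<oplus> y) = g \<gamma> x + g \<gamma> y) \<and>
      (\<forall>c. \<forall>x\<in>S. g \<gamma> (c \<odot> x) = c * g \<gamma> x) \<and> g \<gamma> \<gamma> = nrm ?L (u \<gamma>)"
    by metis
  show thesis by (rule that[of g]) (use g in blast)+
qed

text \<open>Composing \<open>u\<close> with norming functionals embeds its range into \<open>\<ell>\<^sup>\<infinity>(S)\<close>, the dual of \<open>\<ell>\<^sup>1(S)\<close>;
  the extension of the composition gives a seminorm that dominates the norm of \<open>u\<close>.\<close>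

lemma dominating_seminorm:
  assumes p1: "p = 1"
  obtains N where "sublinear Y N" "\<And>y. y \<in> carrier Y \<Longrightarrow> N ((-1) \<odot> y) = N y"
    "\<And>y. y \<in> carrier Y \<Longrightarrow> 0 \<le> N y" "\<And>x. x \<in> S \<Longrightarrow> nrm (Lq p' M) (u x) \<le> N x"
    "\<And>n w. 1 \<le> n \<Longrightarrow> w \<in> {..<n} \<rightarrow>\<^sub>E carrier Y \<Longrightarrow> (\<Sum>j<n. N (w j)) \<le> C * mnrm Y n w"
proof -
  let ?L = "Lq p' M" and ?S = "count_space S"
  interpret L: normed_space ?L by (rule normed_space_Lq[OF p'])
  obtain g where g: "\<And>\<gamma> x. \<gamma> \<in> S \<Longrightarrow> x \<in> S \<Longrightarrow> g \<gamma> x \<le> nrm ?L (u x)"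
    "\<And>\<gamma> x y. \<gamma> \<in> S \<Longrightarrow> x \<in> S \<Longrightarrow> y \<in> S \<Longrightarrow> g \<gamma> (x \<oplus> y) = g \<gamma> x + g \<gamma> y"
    "\<And>\<gamma> c x. \<gamma> \<in> S \<Longrightarrow> x \<in> S \<Longrightarrow> g \<gamma> (c \<odot> x) = c * g \<gamma> x"
    "\<And>\<gamma>. \<gamma> \<in> S \<Longrightarrow> g \<gamma> \<gamma> = nrm ?L (u \<gamma>)"
    by (rule norming_functionals[OF p1]) (rule that)
  interpret c: simple_functions p Y ?S by unfold_locales (rule p)
  \<comment> \<open>For counting measure the sets of finite measure are the finite subsets of S, and
    for p = 1 the weight of such a set is its cardinality.\<close>
  have fm: "A \<in> fmeasurable ?S \<longleftrightarrow> finite A \<and> A \<subseteq> S" for A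
    by (auto simp: fmeasurable_def emeasure_count_space of_nat_less_top split: if_splits)
  have wt: "wt p ?S A = card A" if "finite A" "A \<subseteq> S" for A
    using that by (simp add: wt_def p1 measure_def emeasure_count_space)
  have Ubound: "(\<Sum>k<m. sint ?S (A k) (\<lambda>\<gamma>. g \<gamma> (x k))) \<le> C * c.val m A x"
    if P: "fpartition ?S m A" and x: "\<And>k. k < m \<Longrightarrow> x k \<in> S" for m A x
  proof -
    have A: "1 \<le> m" "\<And>k. k < m \<Longrightarrow> finite (A k)" "\<And>k. k < m \<Longrightarrow> A k \<subseteq> S"
      using P by (auto simp: fpartition_def fm)
    define w where "w = (\<lambda>k\<in>{..<m}. wt p ?S (A k) \<odot> x k)"
    have wS: "w k \<in> S" if "k < m" for k using that x S_closed(4) by (auto simp: w_def)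
    then have w: "w \<in> {..<m} \<rightarrow>\<^sub>E S" by (auto simp: w_def)
    interpret proj_space ?L p m using L.normed_space_axioms p A(1) by (simp add: proj_space_def proj_space_axioms_def)
    have "(\<Sum>k<m. sint ?S (A k) (\<lambda>\<gamma>. g \<gamma> (x k))) \<le> (\<Sum>k<m. nrm ?L ((\<lambda>k\<in>{..<m}. u (w k)) k))"
    proof (rule sum_mono)
      fix k assume "k \<in> {..<m}"
      then have k: "k < m" by simp
      have "sint ?S (A k) (\<lambda>\<gamma>. g \<gamma> (x k)) = (\<Sum>\<gamma>\<in>A k. g \<gamma> (x k))"
        by (rule sint_count_space(2)) (use A k in auto)
      also have "\<dots> \<le> (\<Sum>\<gamma>\<in>A k. nrm ?L (u (x k)))"
        using g(1) A(3)[OF k] x[OF k] by (intro sum_mono) auto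
      also have "\<dots> = nrm ?L (u (w k))"
        using k A x[OF k] u_simps wt by (simp add: w_def L.nrm_smult)
      finally show "sint ?S (A k) (\<lambda>\<gamma>. g \<gamma> (x k)) \<le> nrm ?L ((\<lambda>k\<in>{..<m}. u (w k)) k)" using k by simp
    qed
    also have "\<dots> \<le> proj_norm p m ?L (\<lambda>k\<in>{..<m}. u (w k))"
      by (rule sum_le_proj_norm[OF p1]) (use wS u_simps(1) in auto)
    also have "\<dots> \<le> C * mnrm Y m w" by (rule bound[OF A(1) w])
    finally show ?thesis by (simp add: c.val_def w_def)
  qed
  obtain \<nu> where \<nu>: "\<And>x y A. x \<in> carrier Y \<Longrightarrow> y \<in> carrier Y \<Longrightarrow> A \<in> fmeasurable ?S \<Longrightarrow> \<nu> (x \<oplus> y) A = \<nu> x A + \<nu> y A"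
    "\<And>c y A. y \<in> carrier Y \<Longrightarrow> A \<in> fmeasurable ?S \<Longrightarrow> \<nu> (c \<odot> y) A = c * \<nu> y A"
    "\<And>x A. x \<in> S \<Longrightarrow> A \<in> fmeasurable ?S \<Longrightarrow> \<nu> x A = sint ?S A (\<lambda>\<gamma>. g \<gamma> x)"
    "\<And>m A y. fpartition ?S m A \<Longrightarrow> (\<And>k. k < m \<Longrightarrow> y k \<in> carrier Y) \<Longrightarrow> (\<Sum>k<m. \<nu> (y k) (A k)) \<le> C * c.val m A y"
  proof (rule c.vector_measure_extension[OF S C, of "\<lambda>x \<gamma>. g \<gamma> x"])
    show "integrable ?S (\<lambda>t. indicator A t * g t x)" if "A \<in> fmeasurable ?S" for x A
      by (rule sint_count_space(1)) (use that fm in auto)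
    show "(\<Sum>k<m. sint ?S (A k) (\<lambda>\<gamma>. g \<gamma> (x k))) \<le> C * c.val m A x"
      if "fpartition ?S m A" "\<And>k. k < m \<Longrightarrow> x k \<in> S" for m A x
      by (rule Ubound[OF that])
  qed (use g in \<open>auto simp: AE_count_space\<close>)
  have \<nu>1: "\<nu> (x \<oplus> y) {\<gamma>} = \<nu> x {\<gamma>} + \<nu> y {\<gamma>}" "\<nu> (c \<odot> y) {\<gamma>} = c * \<nu> y {\<gamma>}"
    if "x \<in> carrier Y" "y \<in> carrier Y" "\<gamma> \<in> S" for x y c \<gamma>
    using \<nu>(1,2) that fm by auto
  \<comment> \<open>The points \<gamma> j may coincide, whereas the sets of a partition are
    disjoint. So the distinct points are enumerated by h, and the signed vectors belonging to one
    point are summed into z. The matrix has one entry of modulus at most 1 in each column and is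
    therefore a contraction between \<open>\<ell>\<^sup>1\<close> spaces.\<close>
  have key: "(\<Sum>j<n. \<bar>\<nu> (w j) {\<gamma> j}\<bar>) \<le> C * mnrm Y n w"
    if n: "1 \<le> n" and w: "w \<in> {..<n} \<rightarrow>\<^sub>E carrier Y" and \<gamma>: "\<And>j. j < n \<Longrightarrow> \<gamma> j \<in> S" for n w \<gamma>
  proof -
    have wc: "w j \<in> carrier Y" if "j < n" for j using w that by auto
    obtain h where h: "bij_betw h {0..<card (\<gamma> ` {..<n})} (\<gamma> ` {..<n})"
      using ex_bij_betw_nat_finite[of "\<gamma> ` {..<n}"] by auto
    define m where "m = card (\<gamma> ` {..<n})"
    have h: "bij_betw h {..<m} (\<gamma> ` {..<n})" using h by (simp add: m_def lessThan_atLeast0)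
    have "\<gamma> ` {..<n} \<subseteq> S" using \<gamma> by auto
    then have hS: "h k \<in> S" if "k < m" for k using bij_betwE[OF h] that by blast
    define \<kappa> where "\<kappa> j = inv_into {..<m} h (\<gamma> j)" for j
    have \<kappa>: "\<kappa> j < m" "h (\<kappa> j) = \<gamma> j" if "j < n" for j
    proof -
      have "\<gamma> j \<in> h ` {..<m}" using h that by (auto simp: bij_betw_def)
      then show "\<kappa> j < m" "h (\<kappa> j) = \<gamma> j"
        unfolding \<kappa>_def using inv_into_into[of "\<gamma> j" h "{..<m}"] f_inv_into_f[of "\<gamma> j" h "{..<m}"] by auto
    qed
    have m: "1 \<le> m" using \<kappa>(1)[of 0] n by simp
    define \<epsilon> where "\<epsilon> j = sgn (\<nu> (w j) {\<gamma> j})" for j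
    define t where "t k j = (if k = \<kappa> j then \<epsilon> j else 0)" for k j
    define z where "z k = (\<Oplus>j\<in>{..<n}. t k j \<odot> w j)" for k
    have z: "z k \<in> carrier Y" for k using wc by (auto simp: z_def intro!: Y.finsum_in)
    have P: "fpartition ?S m (\<lambda>k. {h k})"
      using m hS bij_betw_imp_inj_on[OF h] by (auto simp: fpartition_def fm disjoint_family_on_def inj_on_def)
    have "(\<Sum>j<n. \<bar>\<nu> (w j) {\<gamma> j}\<bar>) = (\<Sum>j<n. \<Sum>k<m. t k j * \<nu> (w j) {h k})"
    proof (rule sum.cong[OF refl])
      fix j assume "j \<in> {..<n}"
      then have j: "j < n" by simp
      have "(\<Sum>k<m. t k j * \<nu> (w j) {h k}) = (\<Sum>k<m. if k = \<kappa> j then \<epsilon> j * \<nu> (w j) {h k} else 0)"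
        by (rule sum.cong) (auto simp: t_def)
      also have "\<dots> = \<epsilon> j * \<nu> (w j) {\<gamma> j}" using \<kappa>[OF j] by simp
      finally show "\<bar>\<nu> (w j) {\<gamma> j}\<bar> = (\<Sum>k<m. t k j * \<nu> (w j) {h k})" by (simp add: \<epsilon>_def abs_sgn mult.commute)
    qed
    also have "\<dots> = (\<Sum>k<m. \<nu> (z k) {h k})"
    proof (subst sum.swap, rule sum.cong[OF refl])
      fix k assume "k \<in> {..<m}"
      then have k: "h k \<in> S" using hS by simp
      have "\<nu> (z k) {h k} = (\<Sum>j<n. \<nu> (t k j \<odot> w j) {h k})"
        unfolding z_def using wc \<nu>1(1)[OF _ _ k]
        by (intro Y.additive_finsum[where \<phi>="\<lambda>y. \<nu> y {h k}"]) auto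
      also have "\<dots> = (\<Sum>j<n. t k j * \<nu> (w j) {h k})"
        using \<nu>1(2)[OF wc wc k] by (intro sum.cong) auto
      finally show "(\<Sum>j<n. t k j * \<nu> (w j) {h k}) = \<nu> (z k) {h k}" by simp
    qed
    also have "\<dots> \<le> C * c.val m (\<lambda>k. {h k}) z" by (rule \<nu>(4)[OF P z])
    also have "c.val m (\<lambda>k. {h k}) z = mnrm Y m (\<lambda>k\<in>{..<m}. \<Oplus>j\<in>{..<n}. t k j \<odot> w j)"
      unfolding c.val_def
    proof (intro arg_cong[where f="mnrm Y m"] restrict_ext)
      fix k assume "k \<in> {..<m}"
      then have "wt p ?S {h k} = 1" using wt[of "{h k}"] hS by simp
      then have "wt p ?S {h k} \<odot> z k = z k" using z by (simp add: Y.sm_simps)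
      then show "wt p ?S {h k} \<odot> z k = (\<Oplus>j\<in>{..<n}. t k j \<odot> w j)" by (simp add: z_def)
    qed
    also have "C * \<dots> \<le> C * mnrm Y n w"
    proof (rule mult_left_mono[OF _ C], rule Y.mnrm_contraction[OF p n m _ w])
      fix a
      have "(\<Sum>k<m. \<bar>\<Sum>j<n. t k j * a j\<bar>) \<le> (\<Sum>k<m. \<Sum>j<n. \<bar>t k j * a j\<bar>)" by (intro sum_mono sum_abs)
      also have "\<dots> = (\<Sum>j<n. \<Sum>k<m. \<bar>t k j * a j\<bar>)" by (rule sum.swap)
      also have "\<dots> \<le> (\<Sum>j<n. \<bar>a j\<bar>)"
      proof (rule sum_mono)
        fix j assume j: "j \<in> {..<n}"
        have "(\<Sum>k<m. \<bar>t k j * a j\<bar>) = (\<Sum>k<m. if k = \<kappa> j then \<bar>\<epsilon> j * a j\<bar> else 0)"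
          by (rule sum.cong) (auto simp: t_def)
        also have "\<dots> = \<bar>\<epsilon> j * a j\<bar>" using \<kappa> j by simp
        also have "\<dots> \<le> \<bar>a j\<bar>" by (simp add: \<epsilon>_def abs_mult sgn_if)
        finally show "(\<Sum>k<m. \<bar>t k j * a j\<bar>) \<le> \<bar>a j\<bar>" .
      qed
      finally show "nrm (lp p m) (\<lambda>k. \<Sum>j<n. t k j * a j) \<le> nrm (lp p n) a" by (simp add: p1 l1_norm)
    qed
    finally show ?thesis .
  qed
  \<comment> \<open>The norm of the extended map with values in the bounded functions on S. S
    contains 0, so the supremum is over a nonempty set.\<close>
  define N where "N y = (SUP \<gamma>\<in>S. \<bar>\<nu> y {\<gamma>}\<bar>)" for y
  have bdd: "bdd_above ((\<lambda>\<gamma>. \<bar>\<nu> y {\<gamma>}\<bar>) ` S)" if y: "y \<in> carrier Y" for y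
  proof (rule bdd_aboveI2)
    fix \<gamma> assume "\<gamma> \<in> S"
    then show "\<bar>\<nu> y {\<gamma>}\<bar> \<le> C * mnrm Y 1 (\<lambda>_\<in>{..<1::nat}. y)"
      using key[of 1 "\<lambda>_\<in>{..<1::nat}. y" "\<lambda>_. \<gamma>"] y by simp
  qed
  have N_ge: "\<bar>\<nu> y {\<gamma>}\<bar> \<le> N y" if "y \<in> carrier Y" "\<gamma> \<in> S" for y \<gamma>
    unfolding N_def by (rule cSUP_upper[OF that(2) bdd[OF that(1)]])
  have N_le: "N y \<le> b" if "\<And>\<gamma>. \<gamma> \<in> S \<Longrightarrow> \<bar>\<nu> y {\<gamma>}\<bar> \<le> b" for y b
    unfolding N_def by (rule cSUP_least) (use that S_closed(2) in auto)
  have N_sm: "N (c \<odot> y) \<le> c * N y" if c: "0 < c" and y: "y \<in> carrier Y" for c y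
    using c y N_ge[OF y] \<nu>1(2)[OF y y] by (intro N_le) (simp add: abs_mult)
  show thesis
  proof (rule that[of N])
    show "sublinear Y N"
      unfolding sublinear_def
    proof (intro conjI ballI allI impI)
      fix x y assume xy: "x \<in> carrier Y" "y \<in> carrier Y"
      show "N (x \<oplus> y) \<le> N x + N y"
      proof (rule N_le)
        fix \<gamma> assume \<gamma>: "\<gamma> \<in> S"
        show "\<bar>\<nu> (x \<oplus> y) {\<gamma>}\<bar> \<le> N x + N y"
          using N_ge[OF xy(1) \<gamma>] N_ge[OF xy(2) \<gamma>] \<nu>1(1)[OF xy \<gamma>] by linarith
      qed
    next
      fix c :: real and y assume c: "0 < c" and y: "y \<in> carrier Y"
      have "N ((1 / c) \<odot> (c \<odot> y)) \<le> (1 / c) * N (c \<odot> y)" using c y by (intro N_sm) auto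
      then have "c * N y \<le> N (c \<odot> y)" using c y by (simp add: Y.sm_simps field_simps)
      then show "N (c \<odot> y) = c * N y" using N_sm[OF c y] by simp
    qed
    show "N ((-1) \<odot> y) = N y" if y: "y \<in> carrier Y" for y
      unfolding N_def using \<nu>1(2)[OF y y] by (intro arg_cong[where f=Sup] image_cong) auto
    show "0 \<le> N y" if y: "y \<in> carrier Y" for y using N_ge[OF y S_closed(2)] by linarith
    show "nrm ?L (u x) \<le> N x" if x: "x \<in> S" for x
    proof -
      have "\<nu> x {x} = nrm ?L (u x)" using x \<nu>(3)[OF x] fm g(4) sint_count_space(2)[of "{x}" S] by simp
      then show ?thesis using N_ge[OF S_closed(1)[OF x] x] by linarith
    qed
    show "(\<Sum>j<n. N (w j)) \<le> C * mnrm Y n w" if n: "1 \<le> n" and w: "w \<in> {..<n} \<rightarrow>\<^sub>E carrier Y" for n w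
    proof (rule field_le_epsilon)
      fix e :: real assume e: "0 < e"
      \<comment> \<open>Points that attain the suprema up to e / n reduce the claim to
        \<open>key\<close>.\<close>
      have "\<exists>\<gamma>\<in>S. N (w j) - e / n < \<bar>\<nu> (w j) {\<gamma>}\<bar>" if j: "j < n" for j
      proof (rule ccontr)
        assume "\<not> ?thesis"
        then have "N (w j) \<le> N (w j) - e / n" by (intro N_le) (auto simp: not_less)
        then show False using e n by (simp add: divide_simps split: if_splits)
      qed
      then obtain \<gamma> where \<gamma>: "\<And>j. j < n \<Longrightarrow> \<gamma> j \<in> S" "\<And>j. j < n \<Longrightarrow> N (w j) - e / n < \<bar>\<nu> (w j) {\<gamma> j}\<bar>"
        by metis
      have "(\<Sum>j<n. N (w j)) \<le> (\<Sum>j<n. \<bar>\<nu> (w j) {\<gamma> j}\<bar> + e / n)"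
        using \<gamma>(2) by (intro sum_mono) (fastforce simp: algebra_simps)
      also have "\<dots> = (\<Sum>j<n. \<bar>\<nu> (w j) {\<gamma> j}\<bar>) + e" using n by (simp add: sum.distrib)
      also have "\<dots> \<le> C * mnrm Y n w + e" using key[OF n w \<gamma>(1)] by simp
      finally show "(\<Sum>j<n. N (w j)) \<le> C * mnrm Y n w + e" .
    qed
  qed
qed

text \<open>Projective norms are at most sums of coordinate norms, and the sums of the N (w j) are
  bounded by the multinorm. So it is enough that each value satisfies |v y| \<le> N y almost
  everywhere, which is an order-theoretic domination.\<close>

lemma extension_infinite_exponent:
  assumes p1: "p = 1" and M: "dedekind_complete_measure M"
  shows "\<exists>v. extension v"
proof -
  let ?L = "Lq p' M"
  have top': "p' = top_class.top"
    by (cases rule: conjugate_exponent_cases[OF p pp]) (use p1 in auto)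
  note r = rep_carrier[OF u_simps(1)]
  obtain N where N: "sublinear Y N" "\<And>y. y \<in> carrier Y \<Longrightarrow> N ((-1) \<odot> y) = N y"
    "\<And>y. y \<in> carrier Y \<Longrightarrow> 0 \<le> N y" "\<And>x. x \<in> S \<Longrightarrow> nrm ?L (u x) \<le> N x"
    "\<And>n w. 1 \<le> n \<Longrightarrow> w \<in> {..<n} \<rightarrow>\<^sub>E carrier Y \<Longrightarrow> (\<Sum>j<n. N (w j)) \<le> C * mnrm Y n w"
    by (rule dominating_seminorm[OF p1]) (rule that)
  define G where "G = {(x, f). x \<in> S \<and> f \<in> Lq_fun p' M \<and> cls p' M f = u x}"
  have G: "dominated_graph Y M N G"
    unfolding dominated_graph_def
  proof (intro conjI allI impI)
    have "(\<zero>, rep (u \<zero>)) \<in> G" unfolding G_def using S_closed(2) r[OF S_closed(2)] by simp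
    then show "G \<noteq> {}" by blast
    show "G \<subseteq> carrier Y \<times> borel_measurable M" using S_closed(1) Lq_fun_measurable by (auto simp: G_def)
    show "(x \<oplus> y, \<lambda>t. f t + g t) \<in> G" if "(x, f) \<in> G" "(y, g) \<in> G" for x f y g
      using that S_closed(3) Lq_fun_add(1)[OF p'] Lq_add[OF p', of f M g] u_simps(2) by (auto simp: G_def)
    show "(c \<odot> x, \<lambda>t. c * f t) \<in> G" if "(x, f) \<in> G" for c x f
      using that S_closed(4) Lq_fun_scale(1)[OF p'] Lq_smult[OF p', of f M c] u_simps(3) by (auto simp: G_def)
    show "AE t in M. f t \<le> N x" if "(x, f) \<in> G" for x f
    proof -
      have x: "x \<in> S" "f \<in> Lq_fun p' M" "cls p' M f = u x" using that by (auto simp: G_def)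
      have "AE t in M. \<bar>f t\<bar> \<le> Lq_norm p' M f" using Linf_norm_AE x(2) top' by metis
      moreover have "Lq_norm p' M f \<le> N x" using N(4)[OF x(1)] nrm_Lq_cls[OF x(2)] x(3) by simp
      ultimately show ?thesis by (auto elim!: eventually_mono)
    qed
  qed
  obtain h where h: "\<And>y. y \<in> carrier Y \<Longrightarrow> h y \<in> borel_measurable M"
    "\<And>y. y \<in> carrier Y \<Longrightarrow> AE t in M. h y t \<le> N y"
    "\<And>x y. x \<in> carrier Y \<Longrightarrow> y \<in> carrier Y \<Longrightarrow> AE t in M. h (x \<oplus> y) t = h x t + h y t"
    "\<And>c y. y \<in> carrier Y \<Longrightarrow> AE t in M. h (c \<odot> y) t = c * h y t"
    "\<And>x f. (x, f) \<in> G \<Longrightarrow> AE t in M. h x t = f t"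
    by (rule hahn_banach_AE[OF Y.module_axioms M N(1) G]) (rule that)
  \<comment> \<open>Symmetry of N turns the one-sided domination into a bound for the absolute
    value.\<close>
  have ab: "AE t in M. \<bar>h y t\<bar> \<le> N y" if y: "y \<in> carrier Y" for y
  proof -
    have "(-1) \<odot> y \<in> carrier Y" using y by simp
    from h(2)[OF y] h(2)[OF this] h(4)[OF y, of "-1"] show ?thesis
      unfolding N(2)[OF y] by eventually_elim auto
  qed
  have hL: "h y \<in> Lq_fun p' M" and hn: "nrm ?L (cls p' M (h y)) \<le> N y" if y: "y \<in> carrier Y" for y
  proof -
    show L: "h y \<in> Lq_fun p' M" using h(1)[OF y] ab[OF y] by (auto simp: top' Lq_fun_top)
    have "Lq_norm p' M (h y) \<le> N y" unfolding top' by (rule Linf_norm_le[OF ab[OF y] N(3)[OF y]])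
    then show "nrm ?L (cls p' M (h y)) \<le> N y" by (simp add: nrm_Lq_cls[OF L])
  qed
  define v where "v y = cls p' M (h y)" for y
  have vc: "v y \<in> carrier ?L" if "y \<in> carrier Y" for y using hL[OF that] by (simp add: v_def cls_in_carrier)
  have "linear_map Y ?L v"
    unfolding linear_map_def
  proof (intro conjI ballI allI)
    show "v \<in> carrier Y \<rightarrow> carrier ?L" using vc by simp
    show "v (x \<oplus> y) = v x \<oplus>\<^bsub>?L\<^esub> v y" if x: "x \<in> carrier Y" and y: "y \<in> carrier Y" for x y
      using h(3)[OF x y] hL x y Lq_fun_add(1)[OF p' hL[OF x] hL[OF y]]
      by (simp add: v_def Lq_add[OF p'] cls_eq_iff)
    show "v (c \<odot> y) = c \<odot>\<^bsub>?L\<^esub> v y" if y: "y \<in> carrier Y" for c y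
      using h(4)[OF y] hL y Lq_fun_scale(1)[OF p' hL[OF y]] by (simp add: v_def Lq_smult[OF p'] cls_eq_iff)
  qed
  moreover have "v x = u x" if x: "x \<in> S" for x
  proof -
    have "AE t in M. h x t = rep (u x) t" by (rule h(5)) (use x r in \<open>auto simp: G_def\<close>)
    then have "cls p' M (h x) = cls p' M (rep (u x))" using hL[OF S_closed(1)[OF x]] r(1)[OF x] by (simp add: cls_eq_iff)
    then show ?thesis using r(2)[OF x] by (simp add: v_def)
  qed
  moreover have "proj_norm p n ?L (\<lambda>j\<in>{..<n}. v (w j)) \<le> C * mnrm Y n w"
    if n: "1 \<le> n" and w: "w \<in> {..<n} \<rightarrow>\<^sub>E carrier Y" for n w
  proof -
    interpret proj_space ?L p n using normed_space_Lq[OF p'] p n by (simp add: proj_space_def proj_space_axioms_def)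
    have "proj_norm p n ?L (\<lambda>j\<in>{..<n}. v (w j)) \<le> (\<Sum>j<n. nrm ?L ((\<lambda>j\<in>{..<n}. v (w j)) j))"
      by (rule proj_norm_le_sum) (use vc w in auto)
    also have "\<dots> \<le> (\<Sum>j<n. N (w j))" using hn w by (intro sum_mono) (auto simp: v_def PiE_iff)
    also have "\<dots> \<le> C * mnrm Y n w" by (rule N(5)[OF n w])
    finally show ?thesis .
  qed
  ultimately show ?thesis unfolding extension_def by blast
qed

end

section \<open>Injectivity of the direct sum\<close>

lemma linear_map_tensor_right:
  assumes "linear_map E F u"
  shows "linear_map (tensor_space n E) (tensor_space n F) (tensor_right n u)"
  using assms unfolding linear_map_def
  by (auto simp: tensor_right_def fun_eq_iff PiE_iff Pi_iff)

lemma multi_norm_bound: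
  assumes E: "normed_space (tensor_space n E)" and F: "normed_space (tensor_space n F)"
    and u: "linear_map E F u" and fin: "multi_norm E F u < \<infinity>" and n: "1 \<le> n"
    and w: "w \<in> {..<n} \<rightarrow>\<^sub>E carrier E"
  shows "mnrm F n (\<lambda>j\<in>{..<n}. u (w j)) \<le> enn2real (multi_norm E F u) * mnrm E n w"
proof -
  have wc: "w \<in> carrier (tensor_space n E)" using w by simp
  have nn: "0 \<le> mnrm E n w" using normed_space.nrm_nonneg[OF E wc] by simp
  have "ennreal (mnrm F n (tensor_right n u w)) \<le>
      op_norm (tensor_space n E) (tensor_space n F) (tensor_right n u) * ennreal (mnrm E n w)"
    using normed_space.op_norm_bound[OF E F linear_map_tensor_right[OF u] wc] by simp
  also have "\<dots> \<le> multi_norm E F u * ennreal (mnrm E n w)"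
    unfolding multi_norm_def using n by (intro mult_right_mono SUP_upper) auto
  also have "multi_norm E F u = ennreal (enn2real (multi_norm E F u))" using fin by simp
  finally have "ennreal (mnrm F n (tensor_right n u w)) \<le> ennreal (enn2real (multi_norm E F u) * mnrm E n w)"
    using nn by (simp add: ennreal_mult)
  then show ?thesis using nn by (simp add: ennreal_le_iff tensor_right_def)
qed

lemma multi_norm_le:
  assumes "0 \<le> C" "\<And>n w. 1 \<le> n \<Longrightarrow> w \<in> {..<n} \<rightarrow>\<^sub>E carrier E \<Longrightarrow> mnrm F n (\<lambda>j\<in>{..<n}. u (w j)) \<le> C * mnrm E n w"
  shows "multi_norm E F u \<le> ennreal C"
  unfolding multi_norm_def
proof (intro SUP_least op_norm_le assms(1))
  fix n w assume "n \<in> {1::nat..}" "w \<in> carrier (tensor_space n E)" "nrm (tensor_space n E) w \<le> 1"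
  then have "mnrm F n (\<lambda>j\<in>{..<n}. u (w j)) \<le> C * mnrm E n w" "mnrm E n w \<le> 1"
    using assms(2)[of n w] by auto
  then show "nrm (tensor_space n F) (tensor_right n u w) \<le> C"
    using mult_left_mono[OF \<open>mnrm E n w \<le> 1\<close> assms(1)] by (simp add: tensor_right_def)
qed

lemma (in p_multinormed_space) normed_space_tensor_subspace:
  assumes S: "submodule S real_ring E" and n: "1 \<le> n"
  shows "normed_space (tensor_space n (E\<lparr>carrier := S\<rparr>))"
proof -
  interpret S: submodule S real_ring E by (rule S)
  interpret T: normed_space "tensor_space n E" by (rule mnrm_norm[OF n])
  have "module real_ring (E\<lparr>carrier := S\<rparr>)"
    using S.subset S.one_closed S.m_closed S.smult_closed by (intro real_submodule module_axioms) auto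
  then have m: "module real_ring (tensor_space n (E\<lparr>carrier := S\<rparr>))" by (rule module_tensor_space)
  have c: "w \<in> carrier (tensor_space n E)" if "w \<in> carrier (tensor_space n (E\<lparr>carrier := S\<rparr>))" for w
    using that S.subset by (auto simp: PiE_iff)
  show ?thesis
  proof (intro normed_space.intro m normed_space_axioms.intro)
    fix w assume w: "w \<in> carrier (tensor_space n (E\<lparr>carrier := S\<rparr>))"
    show "0 \<le> nrm (tensor_space n (E\<lparr>carrier := S\<rparr>)) w" using T.nrm_nonneg[OF c[OF w]] by simp
    show "(nrm (tensor_space n (E\<lparr>carrier := S\<rparr>)) w = 0) = (w = \<zero>\<^bsub>tensor_space n (E\<lparr>carrier := S\<rparr>)\<^esub>)"
      using T.nrm_eq_0[OF c[OF w]] by simp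
    show "nrm (tensor_space n (E\<lparr>carrier := S\<rparr>)) (a \<odot>\<^bsub>tensor_space n (E\<lparr>carrier := S\<rparr>)\<^esub> w) =
        \<bar>a\<bar> * nrm (tensor_space n (E\<lparr>carrier := S\<rparr>)) w" for a
      using T.nrm_smult[OF c[OF w], of a] by simp
    fix v assume v: "v \<in> carrier (tensor_space n (E\<lparr>carrier := S\<rparr>))"
    show "nrm (tensor_space n (E\<lparr>carrier := S\<rparr>)) (w \<oplus>\<^bsub>tensor_space n (E\<lparr>carrier := S\<rparr>)\<^esub> v) \<le>
        nrm (tensor_space n (E\<lparr>carrier := S\<rparr>)) w + nrm (tensor_space n (E\<lparr>carrier := S\<rparr>)) v"
      using T.nrm_triangle[OF c[OF w] c[OF v]] by simp
  qed
qed

lemma bdd_above_mnrm_linf: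
  assumes E: "\<And>i. i \<in> I \<Longrightarrow> p_multinormed_space p (E i)" and p: "1 \<le> p" and n: "1 \<le> n"
    and w: "w \<in> {..<n} \<rightarrow>\<^sub>E carrier (linf_sum I E)"
  shows "bdd_above ((\<lambda>i. mnrm (E i) n (\<lambda>j\<in>{..<n}. w j i)) ` I)"
proof (rule bdd_aboveI2)
  fix i assume i: "i \<in> I"
  have wc: "w j \<in> carrier (linf_sum I E)" if "j < n" for j using w that by blast
  have "mnrm (E i) n (\<lambda>j\<in>{..<n}. w j i) \<le> (\<Sum>j<n. nrm (E i) ((\<lambda>j\<in>{..<n}. w j i) j))"
    by (rule p_multinormed_space.mnrm_le_sum[OF E[OF i] p n]) (use wc i in auto)
  also have "\<dots> \<le> (\<Sum>j<n. nrm (linf_sum I E) (w j))"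
    using wc i by (intro sum_mono) (auto intro!: nrm_linf_ge)
  finally show "mnrm (E i) n (\<lambda>j\<in>{..<n}. w j i) \<le> (\<Sum>j<n. nrm (linf_sum I E) (w j))" .
qed

text \<open>Norms and multinorms in the direct sum are suprema over the summands. So the components
  can be extended independently, provided that all extensions obey one constant; it is the multinorm
  of u.\<close>

theorem theorem3p6:
  fixes p p' :: ennreal and I :: "'i set" and \<mu> :: "'i \<Rightarrow> 'a measure"
  assumes "1 \<le> p" and "1 / p + 1 / p' = 1"
    and "p = 1 \<Longrightarrow> \<forall>i\<in>I. dedekind_complete_measure (\<mu> i)"
  shows "c_injective TYPE('y) p 1 (linf_sum I (\<lambda>i. max_mn p (Lq p' (\<mu> i))))"
proof -
  let ?E = "\<lambda>i. max_mn p (Lq p' (\<mu> i))"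
  let ?Z = "linf_sum I ?E"
  have p': "1 \<le> p'" by (rule conjugate_exponent_ge_1[OF assms(1,2)])
  have E: "p_multinormed_space p (?E i)" for i
    by (rule max_mn_p_multinormed[OF banach_space_Lq[OF p'] assms(1)])
  have Z: "p_multinormed_space p ?Z" by (rule linf_sum_p_multinormed[OF assms(1) E])
  interpret Z: p_multinormed_space p ?Z by (rule Z)
  show ?thesis
    unfolding c_injective_def
  proof (intro conjI allI impI Z)
    fix Y :: "'y mnspace" and S u
    assume Y: "p_multinormed_space p Y" and cl: "closed_subspace S Y"
      and mb: "multibounded (Y\<lparr>carrier := S\<rparr>) ?Z u"
    interpret Y: p_multinormed_space p Y by (rule Y)
    interpret Ym: real_module Y by (rule Y.real_module)
    have S: "submodule S real_ring Y" using cl by (simp add: closed_subspace_def)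
    interpret S: submodule S real_ring Y by (rule S)
    have lin: "linear_map (Y\<lparr>carrier := S\<rparr>) ?Z u" and fin: "multi_norm (Y\<lparr>carrier := S\<rparr>) ?Z u < \<infinity>"
      using mb by (auto simp: multibounded_def)
    define C where "C = enn2real (multi_norm (Y\<lparr>carrier := S\<rparr>) ?Z u)"
    have C: "0 \<le> C" by (simp add: C_def)
    have uc: "u x \<in> carrier ?Z" if "x \<in> S" for x using lin that by (auto simp: linear_map_def)
    have mn: "mnrm ?Z n (\<lambda>j\<in>{..<n}. u (w j)) \<le> C * mnrm Y n w"
      if n: "1 \<le> n" and w: "w \<in> {..<n} \<rightarrow>\<^sub>E S" for n w
      using multi_norm_bound[OF Y.normed_space_tensor_subspace[OF S n] Z.mnrm_norm[OF n] lin fin n] w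
      by (simp add: C_def)
    \<comment> \<open>The multinorm of a component is at most that of u, because slices are
      dominated by the supremum.\<close>
    have ep: "extension_problem p Y (\<mu> i) p' S (\<lambda>x. u x i) C" if i: "i \<in> I" for i
    proof (intro extension_problem.intro extension_problem_axioms.intro simple_functions.intro
        simple_functions_axioms.intro Y)
      show "1 \<le> p" "1 / p + 1 / p' = 1" "submodule S real_ring Y" "0 \<le> C" by (fact assms S C)+
      show "linear_map (Y\<lparr>carrier := S\<rparr>) (Lq p' (\<mu> i)) (\<lambda>x. u x i)"
        using lin i by (auto simp: linear_map_def PiE_iff Pi_iff)
      fix n and w :: "nat \<Rightarrow> 'y" assume n: "1 \<le> n" and w: "w \<in> {..<n} \<rightarrow>\<^sub>E S"
      let ?w = "\<lambda>j\<in>{..<n}. u (w j)"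
      have wS: "w j \<in> S" if "j < n" for j using w that by blast
      have "?w \<in> {..<n} \<rightarrow>\<^sub>E carrier ?Z" using uc wS by (intro restrict_PiE_iff[THEN iffD2] ballI) (simp del: linf_sum_simps)
      then have "mnrm (?E i) n (\<lambda>j\<in>{..<n}. ?w j i) \<le> mnrm ?Z n ?w"
        by (intro mnrm_linf_ge bdd_above_mnrm_linf[OF E assms(1) n] i)
      moreover have "(\<lambda>j\<in>{..<n}. ?w j i) = (\<lambda>j\<in>{..<n}. u (w j) i)" by (auto simp: fun_eq_iff)
      ultimately have "proj_norm p n (Lq p' (\<mu> i)) (\<lambda>j\<in>{..<n}. u (w j) i) \<le> mnrm ?Z n ?w"
        by (simp only: max_mn_simps)
      then show "proj_norm p n (Lq p' (\<mu> i)) (\<lambda>j\<in>{..<n}. u (w j) i) \<le> C * mnrm Y n w"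
        using mn[OF n w] by (rule order_trans)
    qed
    have "\<exists>v. extension_problem.extension p Y (\<mu> i) p' S (\<lambda>x. u x i) C v" if i: "i \<in> I" for i
    \<comment> \<open>p = \<infinity> belongs to the finite conjugate exponent 1; only p = 1 leads
      to \<open>L\<^sup>\<infinity>\<close>.\<close>
    proof (cases rule: conjugate_exponent_cases[OF assms(1,2)])
      case 1
      then show ?thesis using extension_problem.extension_infinite_exponent[OF ep[OF i]] assms(3) i by blast
    next
      case 2
      then show ?thesis using extension_problem.extension_finite_exponent[OF ep[OF i], of 1] by simp
    next
      case (3 r s)
      then show ?thesis using extension_problem.extension_finite_exponent[OF ep[OF i], of s] by simp
    qed
    then obtain v where v: "\<And>i. i \<in> I \<Longrightarrow> extension_problem.extension p Y (\<mu> i) p' S (\<lambda>x. u x i) C (v i)"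
      by metis
    have v1: "linear_map Y (Lq p' (\<mu> i)) (v i)" and v2: "\<And>x. x \<in> S \<Longrightarrow> v i x = u x i"
      and v3: "\<And>n w. 1 \<le> n \<Longrightarrow> w \<in> {..<n} \<rightarrow>\<^sub>E carrier Y \<Longrightarrow>
        proj_norm p n (Lq p' (\<mu> i)) (\<lambda>j\<in>{..<n}. v i (w j)) \<le> C * mnrm Y n w" if i: "i \<in> I" for i
      using v[OF i] unfolding extension_problem.extension_def[OF ep[OF i]] by blast+
    define V where "V y = (\<lambda>i\<in>I. v i y)" for y
    have vc: "v i y \<in> carrier (Lq p' (\<mu> i))" if "i \<in> I" "y \<in> carrier Y" for i y
      using v1[OF that(1)] that(2) by (auto simp: linear_map_def)
    \<comment> \<open>A bound that is independent of i puts the values of V into the direct sum; it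
      is the case n = 1 of \<open>v3\<close>.\<close>
    have vb: "nrm (Lq p' (\<mu> i)) (v i y) \<le> C * mnrm Y 1 (\<lambda>_\<in>{..<1::nat}. y)" if i: "i \<in> I" and y: "y \<in> carrier Y" for i y
    proof -
      let ?y = "\<lambda>_\<in>{..<1::nat}. y"
      interpret proj_space "Lq p' (\<mu> i)" p 1
        using normed_space_Lq[OF p'] assms(1) by (simp add: proj_space_def proj_space_axioms_def)
      have "nrm (Lq p' (\<mu> i)) ((\<lambda>j\<in>{..<1::nat}. v i (?y j)) 0) \<le> proj_norm p 1 (Lq p' (\<mu> i)) (\<lambda>j\<in>{..<1}. v i (?y j))"
        by (rule nrm_coord_le_proj_norm) (use vc[OF i y] in auto)
      also have "\<dots> \<le> C * mnrm Y 1 ?y" by (rule v3[OF i order_refl restrict_PiE_iff[THEN iffD2]]) (use y in simp)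
      finally show ?thesis by simp
    qed
    have "linear_map Y ?Z V"
      unfolding linear_map_def
    proof (intro conjI ballI allI)
      show "V \<in> carrier Y \<rightarrow> carrier ?Z"
      proof
        fix y assume y: "y \<in> carrier Y"
        have "bdd_above ((\<lambda>i. nrm (?E i) (V y i)) ` I)"
          by (rule bdd_aboveI2[where M="C * mnrm Y 1 (\<lambda>_\<in>{..<1::nat}. y)"]) (use vb[OF _ y] in \<open>simp add: V_def\<close>)
        then show "V y \<in> carrier ?Z" using vc[OF _ y] by (simp add: V_def)
      qed
    qed (use v1 in \<open>auto simp: V_def linear_map_def fun_eq_iff\<close>)
    moreover have "V x = u x" if x: "x \<in> S" for x
    proof -
      have "(\<lambda>i\<in>I. u x i) = u x" using uc[OF x] by (auto simp: PiE_def intro: extensional_restrict)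
      moreover have "V x = (\<lambda>i\<in>I. u x i)" unfolding V_def using v2[OF _ x] by (intro restrict_ext) simp
      ultimately show ?thesis by simp
    qed
    moreover have "multi_norm Y ?Z V \<le> ennreal 1 * multi_norm (Y\<lparr>carrier := S\<rparr>) ?Z u"
    proof -
      have "multi_norm Y ?Z V \<le> ennreal C"
      proof (rule multi_norm_le[OF C])
        fix n :: nat and w assume n: "1 \<le> n" and w: "w \<in> {..<n} \<rightarrow>\<^sub>E carrier Y"
        have "w \<in> carrier (tensor_space n Y)" using w by simp
        then have "0 \<le> mnrm Y n w" using normed_space.nrm_nonneg[OF Y.mnrm_norm[OF n]] by fastforce
        then show "mnrm ?Z n (\<lambda>j\<in>{..<n}. V (w j)) \<le> C * mnrm Y n w"
        proof (intro mnrm_linf_le mult_nonneg_nonneg C)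
          fix i assume i: "i \<in> I"
          have "(\<lambda>j\<in>{..<n}. (\<lambda>j\<in>{..<n}. V (w j)) j i) = (\<lambda>j\<in>{..<n}. v i (w j))" using i by (auto simp: V_def fun_eq_iff)
          then show "mnrm (?E i) n (\<lambda>j\<in>{..<n}. (\<lambda>j\<in>{..<n}. V (w j)) j i) \<le> C * mnrm Y n w"
            using v3[OF i n w] by simp
        qed
      qed
      also have "\<dots> = ennreal 1 * multi_norm (Y\<lparr>carrier := S\<rparr>) ?Z u" using fin by (simp add: C_def)
      finally show ?thesis .
    qed
    ultimately show "\<exists>v. linear_map Y ?Z v \<and> (\<forall>x\<in>S. v x = u x) \<and>
        multi_norm Y ?Z v \<le> ennreal 1 * multi_norm (Y\<lparr>carrier := S\<rparr>) ?Z u"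
      by blast
  qed
qed

end
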